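(* Let $C$ be a strict $\omega$-category and let $\mathcal N(C)$ be its Street nerve. Then: (i) the simplicial set $\mathcal N(C)$ has the right lifting property with respect to the horn inclusions $\Lambda^i[n+1]\to\Delta[n+1]$ for all $n>0$ and all $0\le i\le n$ if and only if all cells of $C$ of dimension $\ge 1$ are weakly invertible; (ii) the simplicial set $\mathcal N(C)$ has the right lifting property with respect to the horn inclusions $\Lambda^i[n+1]\to\Delta[n+1]$ for all $n>1$ and all $0<i<n$ if and only if all cells of $C$ of dimension $>1$ are weakly invertible.
   Context: **$\omega$-categories.** A (strict) $\omega$-category $C$ has sets $C_n$ of $n$-cells ($n\ge0$), source and target maps $d_k^-,d_k^+:C_n\to C_k$ ($k<n$) satisfying the globular identities, compositions $d*_k c$ of $n$-cells defined for $k<n$ whenever $d_k^+c=d_k^-d$, and units $1^m_c\in C_m$ for $c\in C_n$, $m>n$ (with $1_c:=1_c^{n+1}$), satisfying the usual strict associativity, interchange and unit laws. For an $n$-cell $c$, $c:a\to b$ means $d_{n-1}^-c=a$, $d_{n-1}^+c=b$. **Weakly invertible cells.** An invertibility set is a set $E\subset\coprod_{n>0}C_n$ such that for every $n\ge 0$ and every $(n+1)$-cell $b\in E$ there exist $\tilde b,c,c'\in E$ with $\tilde b\in C_{n+1}$, $c,c'\in C_{n+2}$ and $c:1_{d_n^-b}\to\tilde b*_n b$, $c':1_{d_n^+b}\to b*_n\tilde b$. A cell of positive dimension is weakly invertible if it belongs to some invertibility set. **Orientals and Street nerve.** For $n\ge0$ let $C_\bullet(\Delta[n])$ be the normalized chain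 complex: $C_k(\Delta[n])$ is the free abelian group on the nondegenerate $k$-simplices of $\Delta[n]$, with $\partial_{k}:C_{k+1}\to C_{k}$, $\partial v=\sum_i(-1)^i d_iv$ (degenerate faces counted as $0$), augmentation $e$ sending each vertex to $1$, and $C_k^*(\Delta[n])\subset C_k(\Delta[n])$ the submonoid generated by the nondegenerate simplices. The $n$-th oriental $|\Delta[n]|$ is the $\omega$-category whose $p$-cells are the families $(x_k^\alpha)_{0\le k\le p,\ \alpha\in\{-,+\}}$ with $x_k^\alpha\in C_k^*(\Delta[n])$, $x_p^-=x_p^+$, $\partial_{k-1}(x_k^\alpha)=x_{k-1}^+-x_{k-1}^-$ for $0<k\le p$, and $e(x_0^\pm)=1$. The cell $d_k^\alpha x$ ($k<p$) keeps the entries of index $<k$ and has both entries of index $k$ equal to $x_k^\alpha$; $1^m_x$ is obtained by adding zero entries; and for $d_k^-x=d_k^+y=z$, $x*_ky=x-z+y$ (entrywise, where $z$ is extended by $0$). These form a cosimplicial $\omega$-category, and $\mathcal N(C)_n:=\mathrm{Hom}_{\omega\text{-}\mathrm{cat}}(|\Delta[n]|,C)$. $\Lambda^i[n]\subset\Delta[n]$ is the union of all codimension-one faces except the one opposite to vertex $i$. *)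

theory Defs
  imports "HOL-Library.FuncSet" "HOL-Library.Poly_Mapping"
begin

section \<open>Strict \<open>\<omega>\<close>-categories\<close>

datatype sign = Minus | Plus

text \<open>
  The sets of cells of different dimensions need not be disjoint (in the orientals below they are
  not), so every operation takes the dimension of its argument as a parameter:
  \<open>bd C n k \<alpha> c\<close> is \<open>d\<^sub>k\<^sup>\<alpha> c\<close> for an \<open>n\<close>-cell \<open>c\<close> and \<open>k < n\<close>;
  \<open>cmp C n k d c\<close> is the composite \<open>d *\<^sub>k c\<close> of \<open>n\<close>-cells (\<open>c\<close> first);
  \<open>idn C n m c\<close> is the unit \<open>1\<^sup>m\<^sub>c\<close> on an \<open>n\<close>-cell \<open>c\<close>, for \<open>n < m\<close>.
  Outside these domains the values are irrelevant.
\<close>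

record 'a omega_struct =
  cells :: "nat \<Rightarrow> 'a set"
  bd :: "nat \<Rightarrow> nat \<Rightarrow> sign \<Rightarrow> 'a \<Rightarrow> 'a"
  cmp :: "nat \<Rightarrow> nat \<Rightarrow> 'a \<Rightarrow> 'a \<Rightarrow> 'a"
  idn :: "nat \<Rightarrow> nat \<Rightarrow> 'a \<Rightarrow> 'a"

definition composable :: "('a, 'b) omega_struct_scheme \<Rightarrow> nat \<Rightarrow> nat \<Rightarrow> 'a \<Rightarrow> 'a \<Rightarrow> bool" where
  "composable C n k d c \<longleftrightarrow>
     k < n \<and> d \<in> cells C n \<and> c \<in> cells C n \<and> bd C n k Plus c = bd C n k Minus d"

locale omega_category =
  fixes C :: "('a, 'b) omega_struct_scheme"
  assumes bd_cell: "\<lbrakk>k < n; c \<in> cells C n\<rbrakk> \<Longrightarrow> bd C n k \<alpha> c \<in> cells C k"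
    and globular: "\<lbrakk>j < k; k < n; c \<in> cells C n\<rbrakk> \<Longrightarrow> bd C k j \<alpha> (bd C n k \<beta> c) = bd C n j \<alpha> c"
    and cmp_cell: "composable C n k d c \<Longrightarrow> cmp C n k d c \<in> cells C n"
    and bd_cmp_below:
      "\<lbrakk>composable C n k d c; j < k\<rbrakk> \<Longrightarrow> bd C n j \<alpha> (cmp C n k d c) = bd C n j \<alpha> c"
    and bd_cmp_source: "composable C n k d c \<Longrightarrow> bd C n k Minus (cmp C n k d c) = bd C n k Minus c"
    and bd_cmp_target: "composable C n k d c \<Longrightarrow> bd C n k Plus (cmp C n k d c) = bd C n k Plus d"
    and bd_cmp_above:
      "\<lbrakk>composable C n k d c; k < j; j < n\<rbrakk> \<Longrightarrow>
         bd C n j \<alpha> (cmp C n k d c) = cmp C j k (bd C n j \<alpha> d) (bd C n j \<alpha> c)"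
    and idn_cell: "\<lbrakk>n < m; c \<in> cells C n\<rbrakk> \<Longrightarrow> idn C n m c \<in> cells C m"
    and bd_idn_below: "\<lbrakk>n < m; k < n; c \<in> cells C n\<rbrakk> \<Longrightarrow> bd C m k \<alpha> (idn C n m c) = bd C n k \<alpha> c"
    and bd_idn: "\<lbrakk>n < m; c \<in> cells C n\<rbrakk> \<Longrightarrow> bd C m n \<alpha> (idn C n m c) = c"
    and bd_idn_above:
      "\<lbrakk>n < k; k < m; c \<in> cells C n\<rbrakk> \<Longrightarrow> bd C m k \<alpha> (idn C n m c) = idn C n k c"
    and idn_idn: "\<lbrakk>n < m; m < p; c \<in> cells C n\<rbrakk> \<Longrightarrow> idn C m p (idn C n m c) = idn C n p c"
    and idn_right: "\<lbrakk>k < n; c \<in> cells C n\<rbrakk> \<Longrightarrow> cmp C n k c (idn C k n (bd C n k Minus c)) = c"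
    and idn_left: "\<lbrakk>k < n; c \<in> cells C n\<rbrakk> \<Longrightarrow> cmp C n k (idn C k n (bd C n k Plus c)) c = c"
    and idn_cmp:
      "\<lbrakk>composable C n k d c; n < m\<rbrakk> \<Longrightarrow>
         idn C n m (cmp C n k d c) = cmp C m k (idn C n m d) (idn C n m c)"
    and assoc:
      "\<lbrakk>composable C n k d c; composable C n k e d\<rbrakk> \<Longrightarrow>
         cmp C n k e (cmp C n k d c) = cmp C n k (cmp C n k e d) c"
    and interchange:
      "\<lbrakk>j < k; composable C n k d c; composable C n k d' c';
        composable C n j d' d; composable C n j c' c\<rbrakk> \<Longrightarrow>
         cmp C n j (cmp C n k d' c') (cmp C n k d c) = cmp C n k (cmp C n j d' d) (cmp C n j c' c)"

text \<open>
  A functor is a family of maps on \<open>n\<close>-cells, extensional (\<open>undefined\<close> off the cells), so that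
  equality of functors is equality of HOL functions.
\<close>

definition omega_functors ::
  "('a, 'x) omega_struct_scheme \<Rightarrow> ('b, 'y) omega_struct_scheme \<Rightarrow> (nat \<Rightarrow> 'a \<Rightarrow> 'b) set" where
  "omega_functors C D = {F.
     (\<forall>n. F n \<in> cells C n \<rightarrow>\<^sub>E cells D n) \<and>
     (\<forall>n k \<alpha> c. k < n \<and> c \<in> cells C n \<longrightarrow> F k (bd C n k \<alpha> c) = bd D n k \<alpha> (F n c)) \<and>
     (\<forall>n k d c. composable C n k d c \<longrightarrow> F n (cmp C n k d c) = cmp D n k (F n d) (F n c)) \<and>
     (\<forall>n m c. n < m \<and> c \<in> cells C n \<longrightarrow> F m (idn C n m c) = idn D n m (F n c))}"


section \<open>Weakly invertible cells\<close>

text \<open>\<open>cell_from_to C n c a b\<close> is the relation \<open>c : a \<rightarrow> b\<close> for an \<open>(n+1)\<close>-cell \<open>c\<close>.\<close>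

definition cell_from_to :: "('a, 'x) omega_struct_scheme \<Rightarrow> nat \<Rightarrow> 'a \<Rightarrow> 'a \<Rightarrow> 'a \<Rightarrow> bool" where
  "cell_from_to C n c a b \<longleftrightarrow>
     c \<in> cells C (n + 1) \<and> bd C (n + 1) n Minus c = a \<and> bd C (n + 1) n Plus c = b"

text \<open>
  A subset of the disjoint union of the sets of cells is a set of pairs (dimension, cell). The
  composability conditions are part of the meaning of the composites in the types of \<open>c\<close>, \<open>c'\<close>.
\<close>

definition invertibility_set :: "('a, 'x) omega_struct_scheme \<Rightarrow> (nat \<times> 'a) set \<Rightarrow> bool" where
  "invertibility_set C E \<longleftrightarrow>
     E \<subseteq> (SIGMA n : {0<..}. cells C n) \<and>
     (\<forall>n b. (n + 1, b) \<in> E \<longrightarrow>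
        (\<exists>b' c c'. (n + 1, b') \<in> E \<and> (n + 2, c) \<in> E \<and> (n + 2, c') \<in> E \<and>
           composable C (n + 1) n b' b \<and> composable C (n + 1) n b b' \<and>
           cell_from_to C (n + 1) c
             (idn C n (n + 1) (bd C (n + 1) n Minus b)) (cmp C (n + 1) n b' b) \<and>
           cell_from_to C (n + 1) c'
             (idn C n (n + 1) (bd C (n + 1) n Plus b)) (cmp C (n + 1) n b b')))"

definition weakly_invertible :: "('a, 'x) omega_struct_scheme \<Rightarrow> nat \<Rightarrow> 'a \<Rightarrow> bool" where
  "weakly_invertible C n c \<longleftrightarrow> (\<exists>E. invertibility_set C E \<and> (n, c) \<in> E)"


section \<open>Simplicial sets\<close>

text \<open>The morphisms \<open>[m] \<rightarrow> [n]\<close> of the simplex category, as extensional functions.\<close>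

definition ord_maps :: "nat \<Rightarrow> nat \<Rightarrow> (nat \<Rightarrow> nat) set" where
  "ord_maps m n = {\<theta> \<in> {..m} \<rightarrow>\<^sub>E {..n}. mono_on {..m} \<theta>}"

text \<open>\<open>act X m n \<theta>\<close> is the map \<open>X\<^sub>n \<rightarrow> X\<^sub>m\<close> induced by \<open>\<theta> : [m] \<rightarrow> [n]\<close>.\<close>

record 'x sset_struct =
  simplices :: "nat \<Rightarrow> 'x set"
  act :: "nat \<Rightarrow> nat \<Rightarrow> (nat \<Rightarrow> nat) \<Rightarrow> 'x \<Rightarrow> 'x"

locale simplicial_set =
  fixes X :: "('x, 'a) sset_struct_scheme"
  assumes act_simplex: "\<lbrakk>\<theta> \<in> ord_maps m n; x \<in> simplices X n\<rbrakk> \<Longrightarrow> act X m n \<theta> x \<in> simplices X m"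
    and act_id: "x \<in> simplices X n \<Longrightarrow> act X n n (restrict id {..n}) x = x"
    and act_compose:
      "\<lbrakk>\<theta> \<in> ord_maps l m; \<eta> \<in> ord_maps m n; x \<in> simplices X n\<rbrakk> \<Longrightarrow>
         act X l n (compose {..l} \<eta> \<theta>) x = act X l m \<theta> (act X m n \<eta> x)"

definition simplicial_maps ::
  "('x, 'a) sset_struct_scheme \<Rightarrow> ('y, 'b) sset_struct_scheme \<Rightarrow> (nat \<Rightarrow> 'x \<Rightarrow> 'y) set" where
  "simplicial_maps X Y = {f.
     (\<forall>n. f n \<in> simplices X n \<rightarrow>\<^sub>E simplices Y n) \<and>
     (\<forall>m n \<theta> x. \<theta> \<in> ord_maps m n \<and> x \<in> simplices X n \<longrightarrow>
        f m (act X m n \<theta> x) = act Y m n \<theta> (f n x))}"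

text \<open>
  The right lifting property of \<open>X\<close> (that is, of \<open>X \<rightarrow> \<Delta>[0]\<close>) with respect to the inclusion of a
  simplicial subset \<open>A\<close> of \<open>B\<close>.
\<close>

definition has_rlp ::
  "('x, 'a) sset_struct_scheme \<Rightarrow> ('y, 'b) sset_struct_scheme \<Rightarrow> ('y, 'c) sset_struct_scheme \<Rightarrow> bool"
  where
  "has_rlp X A B \<longleftrightarrow>
     (\<forall>f \<in> simplicial_maps A X. \<exists>g \<in> simplicial_maps B X. \<forall>n. \<forall>a \<in> simplices A n. g n a = f n a)"

definition std_simplex :: "nat \<Rightarrow> (nat \<Rightarrow> nat) sset_struct" where
  "std_simplex n =
     \<lparr>simplices = (\<lambda>m. ord_maps m n), act = (\<lambda>l m \<theta> x. compose {..l} x \<theta>)\<rparr>"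

text \<open>The \<open>m\<close>-simplices of the codimension-one face of \<open>\<Delta>[n]\<close> opposite to the vertex \<open>j\<close>.\<close>

definition opposite_face :: "nat \<Rightarrow> nat \<Rightarrow> nat \<Rightarrow> (nat \<Rightarrow> nat) set" where
  "opposite_face n j m = {x \<in> simplices (std_simplex n) m. j \<notin> x ` {..m}}"

definition horn :: "nat \<Rightarrow> nat \<Rightarrow> (nat \<Rightarrow> nat) sset_struct" where
  "horn n i = std_simplex n \<lparr>simplices := (\<lambda>m. \<Union>j \<in> {..n} - {i}. opposite_face n j m)\<rparr>"

lemma compose_ord_maps:
  "\<lbrakk>\<theta> \<in> ord_maps l m; \<eta> \<in> ord_maps m n\<rbrakk> \<Longrightarrow> compose {..l} \<eta> \<theta> \<in> ord_maps l n"
  by (auto simp: ord_maps_def compose_def mono_on_def Pi_iff PiE_iff)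

lemma simplicial_set_std_simplex: "simplicial_set (std_simplex n)"
  by unfold_locales
    (auto simp: std_simplex_def compose_ord_maps,
     auto simp: ord_maps_def compose_def fun_eq_iff PiE_iff extensional_def)

lemma simplicial_set_horn: "simplicial_set (horn n i)"
proof -
  interpret simplicial_set "std_simplex n" by (rule simplicial_set_std_simplex)
  have a: "act (horn n i) = act (std_simplex n)" by (simp add: horn_def)
  have b: "x \<in> simplices (std_simplex n) m" if "x \<in> simplices (horn n i) m" for x m
    using that by (auto simp: horn_def opposite_face_def)
  have c: "act (std_simplex n) l m \<theta> x \<in> simplices (horn n i) l"
    if "\<theta> \<in> ord_maps l m" "x \<in> simplices (horn n i) m" for l m \<theta> x
    using that act_simplex by (auto simp: horn_def opposite_face_def)
      (fastforce simp: std_simplex_def compose_def ord_maps_def)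
  show ?thesis
    by (intro simplicial_set.intro; unfold a; blast intro: c dest: b act_id act_compose)
qed


section \<open>Normalized chains\<close>

text \<open>\<open>coface k i : [k] \<rightarrow> [k+1]\<close> omits \<open>i\<close>; \<open>codegeneracy k i : [k+1] \<rightarrow> [k]\<close> repeats \<open>i\<close>.\<close>

definition coface :: "nat \<Rightarrow> nat \<Rightarrow> nat \<Rightarrow> nat" where
  "coface k i = (\<lambda>j \<in> {..k}. if j < i then j else j + 1)"

definition codegeneracy :: "nat \<Rightarrow> nat \<Rightarrow> nat \<Rightarrow> nat" where
  "codegeneracy k i = (\<lambda>j \<in> {..k + 1}. if j \<le> i then j else j - 1)"

definition degenerate :: "('x, 'a) sset_struct_scheme \<Rightarrow> nat \<Rightarrow> 'x \<Rightarrow> bool" where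
  "degenerate X k x \<longleftrightarrow>
     (\<exists>l i y. k = l + 1 \<and> i \<le> l \<and> y \<in> simplices X l \<and> x = act X (l + 1) l (codegeneracy l i) y)"

text \<open>The class in \<open>C\<^sub>k(X)\<close> of a \<open>k\<close>-simplex: degenerate simplices count as \<open>0\<close>.\<close>

definition simplex_chain :: "('x, 'a) sset_struct_scheme \<Rightarrow> nat \<Rightarrow> 'x \<Rightarrow> 'x \<Rightarrow>\<^sub>0 int" where
  "simplex_chain X k x = (if degenerate X k x then 0 else frag_of x)"

text \<open>\<open>boundary X k : C\<^bsub>k+1\<^esub>(X) \<rightarrow> C\<^sub>k(X)\<close>\<close>

definition boundary :: "('x, 'a) sset_struct_scheme \<Rightarrow> nat \<Rightarrow> ('x \<Rightarrow>\<^sub>0 int) \<Rightarrow> ('x \<Rightarrow>\<^sub>0 int)" where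
  "boundary X k = frag_extend (\<lambda>v.
     \<Sum>i \<le> k + 1. frag_cmul ((-1) ^ i) (simplex_chain X k (act X k (k + 1) (coface k i) v)))"

definition augmentation :: "('x \<Rightarrow>\<^sub>0 int) \<Rightarrow> int" where
  "augmentation c = (\<Sum>v \<in> Poly_Mapping.keys c. Poly_Mapping.lookup c v)"

text \<open>The submonoid \<open>C\<^sub>k\<^sup>*(X)\<close>.\<close>

inductive_set pos_chains :: "('x, 'a) sset_struct_scheme \<Rightarrow> nat \<Rightarrow> ('x \<Rightarrow>\<^sub>0 int) set"
  for X :: "('x, 'a) sset_struct_scheme" and k :: nat where
  zero: "0 \<in> pos_chains X k"
| gen: "\<lbrakk>v \<in> simplices X k; \<not> degenerate X k v\<rbrakk> \<Longrightarrow> frag_of v \<in> pos_chains X k"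
| add: "\<lbrakk>a \<in> pos_chains X k; b \<in> pos_chains X k\<rbrakk> \<Longrightarrow> a + b \<in> pos_chains X k"

text \<open>The map \<open>C\<^sub>k(X) \<rightarrow> C\<^sub>k(Y)\<close> induced by a simplicial map \<open>f : X \<rightarrow> Y\<close>.\<close>

definition chain_map ::
  "('y, 'b) sset_struct_scheme \<Rightarrow> (nat \<Rightarrow> 'x \<Rightarrow> 'y) \<Rightarrow> nat \<Rightarrow> ('x \<Rightarrow>\<^sub>0 int) \<Rightarrow> ('y \<Rightarrow>\<^sub>0 int)" where
  "chain_map Y f k = frag_extend (\<lambda>v. simplex_chain Y k (f k v))"


section \<open>Orientals and the Street nerve\<close>

type_synonym oriental_cell = "nat \<Rightarrow> sign \<Rightarrow> (nat \<Rightarrow> nat) \<Rightarrow>\<^sub>0 int"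

text \<open>
  A \<open>p\<close>-cell is a family indexed by \<open>k \<le> p\<close>; it is represented by its extension by \<open>0\<close> to all \<open>k\<close>.
  Hence a \<open>p\<close>-cell and its units are the same function, and units are the identity on functions.
\<close>

definition oriental_cells :: "nat \<Rightarrow> nat \<Rightarrow> oriental_cell set" where
  "oriental_cells n p = {x.
     (\<forall>k \<alpha>. k \<le> p \<longrightarrow> x k \<alpha> \<in> pos_chains (std_simplex n) k) \<and>
     (\<forall>k \<alpha>. p < k \<longrightarrow> x k \<alpha> = 0) \<and>
     x p Minus = x p Plus \<and>
     (\<forall>k \<alpha>. k < p \<longrightarrow> boundary (std_simplex n) k (x (k + 1) \<alpha>) = x k Plus - x k Minus) \<and>
     (\<forall>\<alpha>. augmentation (x 0 \<alpha>) = 1)}"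

definition oriental_bd :: "nat \<Rightarrow> sign \<Rightarrow> oriental_cell \<Rightarrow> oriental_cell" where
  "oriental_bd k \<alpha> x = (\<lambda>l \<beta>. if l < k then x l \<beta> else if l = k then x k \<alpha> else 0)"

definition oriental :: "nat \<Rightarrow> oriental_cell omega_struct" where
  "oriental n =
     \<lparr>cells = oriental_cells n,
      bd = (\<lambda>p k \<alpha> x. oriental_bd k \<alpha> x),
      cmp = (\<lambda>p k x y. \<lambda>l \<beta>. x l \<beta> - oriental_bd k Minus x l \<beta> + y l \<beta>),
      idn = (\<lambda>p m x. x)\<rparr>"

text \<open>The functor \<open>|\<Delta>[m]| \<rightarrow> |\<Delta>[n]|\<close> induced by \<open>\<theta> : [m] \<rightarrow> [n]\<close>.\<close>

definition oriental_map ::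
  "nat \<Rightarrow> nat \<Rightarrow> (nat \<Rightarrow> nat) \<Rightarrow> nat \<Rightarrow> oriental_cell \<Rightarrow> oriental_cell" where
  "oriental_map m n \<theta> p = (\<lambda>x \<in> cells (oriental m) p. \<lambda>k \<alpha>.
     chain_map (std_simplex n) (\<lambda>l v. compose {..l} \<theta> v) k (x k \<alpha>))"

definition street_nerve ::
  "('a, 'x) omega_struct_scheme \<Rightarrow> (nat \<Rightarrow> oriental_cell \<Rightarrow> 'a) sset_struct" where
  "street_nerve C =
     \<lparr>simplices = (\<lambda>n. omega_functors (oriental n) C),
      act = (\<lambda>m n \<theta> F p. compose (cells (oriental m) p) (F p) (oriental_map m n \<theta> p))\<rparr>"

end

theory Submission
  imports Defs
begin

text \<open>
  A basis of simplices with a total order compatible with sources and targets makes the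
  \<open>\<omega>\<close>-category of cells of a subcomplex of a simplex free: a functor defined up to dimension \<open>p\<close>
  extends to dimension \<open>p + 1\<close> by any values on the atoms that have the right boundaries. Maps from
  a horn to the nerve are therefore functors on the cells supported by that horn.

  Suppose that the cells of \<open>C\<close> of dimension greater than \<open>m\<close> are weakly invertible. Then equations
  \<open>u *\<^sub>k x \<rightarrow> y\<close> with \<open>k \<ge> m\<close> and parallel data can be solved up to a higher cell. One of the two
  boundaries of the top simplex is a composite in which the missing face occurs once, as a whiskered atom;
  solving for that atom yields the value on the face, and the remaining higher cell is the value on the
  top simplex. If \<open>m = 1\<close>, the horn is inner, so that the missing face has the same first and last vertex as
  the simplex and no whiskering along a vertex occurs.

  Conversely, labelling the simplices of a horn by a cell \<open>b\<close> and by units turns a filler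
  into a one-sided weak inverse of \<open>b\<close>; an inverse of the inverse shows that it is two-sided.
\<close>

section \<open>Solving equations up to a higher cell\<close>

text \<open>Weak inverses come without triangle identities, so no formula undoes a whiskering. All
  that is ever asserted is the existence of a cell between two composites (\<open>arr\<close>), and
  equations are moved to lower codimension until a factor can be divided off directly. Another
  obstacle shapes the free extension: a cell has many decompositions into whiskered atoms, and its
  value must not depend on the choice. The order \<open>key\<close> singles out one decomposition,
  and any other is brought to it by exchanging neighbours, each exchange being an instance of
  interchange. The order comes from parity: deleting a vertex in an even position gives a piece of
  the target, in an odd position a piece of the source, and the digits of the key record just this.
  The parity of the horn index decides which side of the top simplex contains the missing face, and
  whether the labelled face stands before or after it. So inverses first appear on one side only and
  fillers in one direction only; the symmetry of \<open>arr\<close> and the dual category absorb the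
  difference.\<close>

definition up :: "('a, 'x) omega_struct_scheme \<Rightarrow> nat \<Rightarrow> nat \<Rightarrow> 'a \<Rightarrow> 'a" where
  "up C n m c = (if n = m then c else idn C n m c)"

text \<open>Only the existence of a cell is recorded, so no coherence has to be carried along. The
  relation is a preorder in every dimension and becomes symmetric where cells are
  invertible.\<close>

definition arr :: "('a, 'x) omega_struct_scheme \<Rightarrow> nat \<Rightarrow> 'a \<Rightarrow> 'a \<Rightarrow> bool" where
  "arr C q f g \<longleftrightarrow>
     (\<exists>y \<in> cells C (Suc q). bd C (Suc q) q Minus y = f \<and> bd C (Suc q) q Plus y = g)"

definition parallel :: "('a, 'x) omega_struct_scheme \<Rightarrow> nat \<Rightarrow> 'a \<Rightarrow> 'a \<Rightarrow> bool" where
  "parallel C q f g \<longleftrightarrow>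
     f \<in> cells C q \<and> g \<in> cells C q \<and> (\<forall>k<q. \<forall>\<alpha>. bd C q k \<alpha> f = bd C q k \<alpha> g)"

text \<open>Weak invertibility is coinductive, but if it holds for all cells above a dimension it
  unfolds just once: the comparison cells lie above that dimension too and need no separate witness.
  \<open>weakly_invertible_iff\<close> makes this precise.\<close>

definition has_inverses :: "('a, 'x) omega_struct_scheme \<Rightarrow> nat \<Rightarrow> bool" where
  "has_inverses C m \<longleftrightarrow>
     (\<forall>n\<ge>m. \<forall>b \<in> cells C (Suc n). \<exists>b'. composable C (Suc n) n b' b \<and> composable C (Suc n) n b b' \<and>
        arr C (Suc n) (idn C n (Suc n) (bd C (Suc n) n Minus b)) (cmp C (Suc n) n b' b) \<and>
        arr C (Suc n) (idn C n (Suc n) (bd C (Suc n) n Plus b)) (cmp C (Suc n) n b b'))"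

section \<open>Reversal of all cells\<close>

fun opp :: "sign \<Rightarrow> sign" where
  "opp Minus = Plus" | "opp Plus = Minus"

lemma opp_opp [simp]: "opp (opp \<alpha>) = \<alpha>"
  by (cases \<alpha>) auto

text \<open>Cells of all positive dimensions are reversed at once, so that statements about left
  factors yield those about right factors. \<open>arr\<close> is reversed as well, which
  \<open>arr_sym\<close> repairs.\<close>

definition dual :: "'a omega_struct \<Rightarrow> 'a omega_struct" where
  "dual C = \<lparr>cells = cells C, bd = (\<lambda>n k \<alpha>. bd C n k (opp \<alpha>)), cmp = (\<lambda>n k d c. cmp C n k c d),
             idn = idn C\<rparr>"

lemma dual_simps [simp]:
  "cells (dual C) = cells C" "bd (dual C) n k \<alpha> = bd C n k (opp \<alpha>)"
  "cmp (dual C) n k d c = cmp C n k c d" "idn (dual C) = idn C" "up (dual C) = up C"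
  by (auto simp: dual_def up_def fun_eq_iff)

lemma composable_dual [simp]: "composable (dual C) n k d c \<longleftrightarrow> composable C n k c d"
  by (auto simp: composable_def)

lemma arr_dual [simp]: "arr (dual C) q f g \<longleftrightarrow> arr C q g f"
  by (auto simp: arr_def)

lemma parallel_dual [simp]: "parallel (dual C) q f g \<longleftrightarrow> parallel C q f g"
  unfolding parallel_def dual_simps by (metis opp_opp)

lemma omega_category_dual:
  fixes C :: "'a omega_struct"
  assumes "omega_category C"
  shows "omega_category (dual C)"
proof -
  interpret omega_category C by fact
  \<comment> \<open>\<open>bd_cmp_below\<close> refers to the boundary of \<open>c\<close>; in the
    dual the other factor \<open>d\<close> is in that place.\<close>
  have below: "bd C n j \<alpha> d = bd C n j \<alpha> c" if "composable C n k d c" "j < k" for n k d c j \<alpha>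
    using that globular[of j k n c \<alpha> Plus] globular[of j k n d \<alpha> Minus] by (auto simp: composable_def)
  show ?thesis
    by unfold_locales
      (auto simp: bd_cell globular cmp_cell bd_cmp_below bd_cmp_source bd_cmp_target bd_cmp_above below
        idn_cell bd_idn_below bd_idn bd_idn_above idn_idn idn_left idn_right idn_cmp assoc
        intro: interchange)
qed

section \<open>Units, and calculus with \<open>arr\<close>\<close>

context omega_category
begin

lemma up_same [simp]: "up C n n c = c"
  by (simp add: up_def)

lemma up_Suc: "up C n (Suc n) c = idn C n (Suc n) c"
  by (simp add: up_def)

lemma up_cell: "n \<le> m \<Longrightarrow> c \<in> cells C n \<Longrightarrow> up C n m c \<in> cells C m"
  by (auto simp: up_def idn_cell)

lemma bd_up_below: "n \<le> m \<Longrightarrow> k < n \<Longrightarrow> c \<in> cells C n \<Longrightarrow> bd C m k \<alpha> (up C n m c) = bd C n k \<alpha> c"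
  by (auto simp: up_def bd_idn_below)

lemma bd_up_above: "n \<le> k \<Longrightarrow> k < m \<Longrightarrow> c \<in> cells C n \<Longrightarrow> bd C m k \<alpha> (up C n m c) = up C n k c"
  by (auto simp: up_def bd_idn bd_idn_above)

lemma up_up: "n \<le> m \<Longrightarrow> m \<le> p \<Longrightarrow> c \<in> cells C n \<Longrightarrow> up C m p (up C n m c) = up C n p c"
  by (auto simp: up_def idn_idn)

lemma composable_up: "composable C n k d c \<Longrightarrow> n \<le> m \<Longrightarrow> composable C m k (up C n m d) (up C n m c)"
  by (auto simp: composable_def up_cell bd_up_below)

lemma up_cmp:
  "composable C n k d c \<Longrightarrow> n \<le> m \<Longrightarrow> up C n m (cmp C n k d c) = cmp C m k (up C n m d) (up C n m c)"
  by (auto simp: up_def idn_cmp)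

lemma unit_right: "k < n \<Longrightarrow> c \<in> cells C n \<Longrightarrow> cmp C n k c (up C k n (bd C n k Minus c)) = c"
  by (simp add: up_def idn_right)

lemma unit_left: "k < n \<Longrightarrow> c \<in> cells C n \<Longrightarrow> cmp C n k (up C k n (bd C n k Plus c)) c = c"
  by (simp add: up_def idn_left)

lemma composable_unit_left: "k < n \<Longrightarrow> c \<in> cells C n \<Longrightarrow> composable C n k (up C k n (bd C n k Plus c)) c"
  by (auto simp: composable_def up_cell bd_cell bd_up_above)

lemma arr_refl: "f \<in> cells C q \<Longrightarrow> arr C q f f"
  unfolding arr_def by (intro bexI[of _ "idn C q (Suc q) f"]) (auto simp: bd_idn idn_cell)

lemma arr_trans:
  assumes "arr C q f g" "arr C q g h"
  shows "arr C q f h"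
proof -
  obtain y z where *: "y \<in> cells C (Suc q)" "bd C (Suc q) q Minus y = f" "bd C (Suc q) q Plus y = g"
    "z \<in> cells C (Suc q)" "bd C (Suc q) q Minus z = g" "bd C (Suc q) q Plus z = h"
    using assms by (auto simp: arr_def)
  then have "composable C (Suc q) q z y" by (auto simp: composable_def)
  with * show ?thesis
    unfolding arr_def
    by (intro bexI[of _ "cmp C (Suc q) q z y"]) (auto simp: bd_cmp_source bd_cmp_target cmp_cell)
qed

lemma arr_cmp:
  assumes "arr C q f f'" "arr C q g g'" "composable C q k g f"
  shows "arr C q (cmp C q k g f) (cmp C q k g' f')"
proof -
  obtain y z where *: "y \<in> cells C (Suc q)" "bd C (Suc q) q Minus y = f" "bd C (Suc q) q Plus y = f'"
    "z \<in> cells C (Suc q)" "bd C (Suc q) q Minus z = g" "bd C (Suc q) q Plus z = g'"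
    using assms by (auto simp: arr_def)
  have k: "k < q" using assms by (auto simp: composable_def)
  have "bd C (Suc q) k Plus y = bd C q k Plus f" "bd C (Suc q) k Minus z = bd C q k Minus g"
    using * k globular[of k q "Suc q" y Plus Minus] globular[of k q "Suc q" z Minus Minus] by auto
  with * k assms(3) have "composable C (Suc q) k z y" by (auto simp: composable_def)
  with * k show ?thesis
    unfolding arr_def
    by (intro bexI[of _ "cmp C (Suc q) k z y"]) (auto simp: bd_cmp_above cmp_cell)
qed

lemma has_inversesE:
  assumes "has_inverses C m" "m \<le> n" "b \<in> cells C (Suc n)"
  obtains b' where "composable C (Suc n) n b' b" "composable C (Suc n) n b b'"
    "arr C (Suc n) (idn C n (Suc n) (bd C (Suc n) n Minus b)) (cmp C (Suc n) n b' b)"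
    "arr C (Suc n) (idn C n (Suc n) (bd C (Suc n) n Plus b)) (cmp C (Suc n) n b b')"
  using assms unfolding has_inverses_def by blast

text \<open>Composability of \<open>y'\<close> with \<open>y\<close> on both sides fixes the two
  ends of \<open>y'\<close>, so the inverse itself is the reversed cell.\<close>

lemma arr_sym:
  assumes "has_inverses C m" "m \<le> n" "arr C n f g"
  shows "arr C n g f"
proof -
  obtain y where y: "y \<in> cells C (Suc n)" "bd C (Suc n) n Minus y = f" "bd C (Suc n) n Plus y = g"
    using assms by (auto simp: arr_def)
  obtain y' where y': "composable C (Suc n) n y' y" "composable C (Suc n) n y y'"
    using has_inversesE[OF assms(1,2) y(1)] by metis
  with y have "y' \<in> cells C (Suc n)" "bd C (Suc n) n Minus y' = g" "bd C (Suc n) n Plus y' = f"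
    by (auto simp: composable_def)
  then show ?thesis by (auto simp: arr_def)
qed

text \<open>Dualising exchanges the two invertibility conditions and reverses their comparison
  cells, which \<open>arr_sym\<close> one dimension higher turns back.\<close>

lemma has_inverses_dual:
  fixes D :: "'a omega_struct"
  assumes "omega_category D" "has_inverses D m"
  shows "has_inverses (dual D) m"
proof -
  interpret D: omega_category D by fact
  show ?thesis
    unfolding has_inverses_def
  proof (intro allI impI ballI)
    fix n b
    assume n: "m \<le> n" and b: "b \<in> cells (dual D) (Suc n)"
    have "b \<in> cells D (Suc n)" using b by simp
    with D.has_inversesE[OF assms(2) n, of b] obtain b' where
      "composable D (Suc n) n b' b" "composable D (Suc n) n b b'"
      "arr D (Suc n) (idn D n (Suc n) (bd D (Suc n) n Minus b)) (cmp D (Suc n) n b' b)"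
      "arr D (Suc n) (idn D n (Suc n) (bd D (Suc n) n Plus b)) (cmp D (Suc n) n b b')"
      by metis
    then show "\<exists>b'. composable (dual D) (Suc n) n b' b \<and> composable (dual D) (Suc n) n b b' \<and>
      arr (dual D) (Suc n) (idn (dual D) n (Suc n) (bd (dual D) (Suc n) n Minus b)) (cmp (dual D) (Suc n) n b' b) \<and>
      arr (dual D) (Suc n) (idn (dual D) n (Suc n) (bd (dual D) (Suc n) n Plus b)) (cmp (dual D) (Suc n) n b b')"
      using D.arr_sym[OF assms(2), of "Suc n"] n by (intro exI[of _ b']) auto
  qed
qed

text \<open>Both sides are \<open>c *\<^sub>k x\<close>, by interchange.\<close>

lemma naturality_square:
  fixes k q x c a U
  defines "e \<equiv> \<lambda>\<alpha>. cmp C (k+2) k c (up C (k+1) (k+2) (bd C q (k+1) \<alpha> x))"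
  assumes c: "c \<in> cells C (k+2)" "bd C (k+2) (k+1) Minus c = up C k (k+1) a"
      "bd C (k+2) (k+1) Plus c = U"
    and x: "k+2 \<le> q" "x \<in> cells C q" "bd C q k Plus x = a"
  shows "e \<alpha> \<in> cells C (k+2)"
    and "composable C q k (up C (k+1) q U) x"
    and "composable C q (k+1) (cmp C q k (up C (k+1) q U) x) (up C (k+2) q (e Minus))"
    and "composable C q (k+1) (up C (k+2) q (e Plus)) x"
    and "cmp C q (k+1) (cmp C q k (up C (k+1) q U) x) (up C (k+2) q (e Minus)) =
         cmp C q (k+1) (up C (k+2) q (e Plus)) x"
proof -
  let ?K = "k+1"
  have a: "a \<in> cells C k" using x bd_cell[of k q x Plus] by auto
  have kq: "k < q" "?K < q" "?K \<le> q" using x by auto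
  have U: "U \<in> cells C ?K" using c bd_cell[of ?K "k+2" c Plus] by auto
  have ck: "bd C (k+2) k \<alpha> c = a" for \<alpha>
    using globular[of k ?K "k+2" c \<alpha> Minus] c a by (simp add: bd_up_above)
  have Uk: "bd C ?K k \<alpha> U = a" for \<alpha>
    using globular[of k ?K "k+2" c \<alpha> Plus] c ck by simp
  have bx: "bd C q ?K \<alpha> x \<in> cells C ?K" for \<alpha> using x bd_cell by auto
  have bxk: "bd C ?K k Plus (bd C q ?K \<alpha> x) = a" for \<alpha>
    using globular[of k ?K q x Plus \<alpha>] x by simp
  have ce: "composable C (k+2) k c (up C ?K (k+2) (bd C q ?K \<alpha> x))" for \<alpha>
    using c ck bx bxk by (auto simp: composable_def up_cell bd_up_below)
  show e: "e \<alpha> \<in> cells C (k+2)" for \<alpha> unfolding e_def by (rule cmp_cell[OF ce])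
  let ?c = "up C (k+2) q c" and ?U = "up C ?K q U" and ?a = "up C k q a"
  let ?x = "\<lambda>\<alpha>. up C ?K q (bd C q ?K \<alpha> x)"
  have ue: "up C (k+2) q (e \<alpha>) = cmp C q k ?c (?x \<alpha>)" for \<alpha>
    unfolding e_def using up_cmp[OF ce x(1)] bx x by (simp add: up_up)
  have cc: "?c \<in> cells C q" "?U \<in> cells C q" "?a \<in> cells C q" "?x \<alpha> \<in> cells C q" for \<alpha>
    using c U a bx x by (auto intro!: up_cell)
  have cb: "bd C q ?K Minus ?c = up C k ?K a" "bd C q ?K Plus ?c = U" "bd C q k \<alpha> ?c = a"
    "bd C q k \<alpha> ?U = a" "bd C q ?K \<alpha> ?U = U" "bd C q ?K \<alpha> ?a = up C k ?K a" "bd C q k \<alpha> ?a = a"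
    "bd C q ?K \<alpha> (?x \<beta>) = bd C q ?K \<beta> x" "bd C q k \<alpha> (?x \<beta>) = bd C q k \<alpha> x" for \<alpha> \<beta>
    using c U a bx x ck Uk kq by (auto simp: bd_up_below bd_up_above globular)
  show Ux: "composable C q k ?U x" using cc cb x kq by (auto simp: composable_def)
  have ax: "composable C q k ?a x" using cc cb x kq by (auto simp: composable_def)
  have c1: "composable C q ?K ?c ?a" "composable C q ?K (?x Plus) x" "composable C q k ?c (?x Plus)"
    "composable C q ?K ?U ?c" "composable C q ?K x (?x Minus)" "composable C q k ?c (?x Minus)"
    using cc cb x kq by (auto simp: composable_def)
  have unit: "cmp C q ?K ?c ?a = ?c" "cmp C q ?K (?x Plus) x = x" "cmp C q ?K ?U ?c = ?c"
    "cmp C q ?K x (?x Minus) = x" "cmp C q k ?a x = x"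
    using unit_right[of ?K q ?c] unit_left[of ?K q x] unit_left[of ?K q ?c] unit_right[of ?K q x]
      unit_left[of k q x] cc cb x kq a by (auto simp: up_up)
  \<comment> \<open>Padding \<open>c\<close> by its source unit and \<open>x\<close> by its target
    unit along \<open>k+1\<close> gives one side; padding \<open>c\<close> by its target unit and
    \<open>x\<close> by its source unit gives the other.\<close>
  have "cmp C q k ?c x = cmp C q ?K (cmp C q k ?c (?x Plus)) (cmp C q k ?a x)"
    using interchange[of k ?K q "?x Plus" x ?c ?a] c1 ax unit by simp
  then have A: "cmp C q k ?c x = cmp C q ?K (up C (k+2) q (e Plus)) x" by (simp only: ue unit)
  have "cmp C q k ?c x = cmp C q ?K (cmp C q k ?U x) (cmp C q k ?c (?x Minus))"
    using interchange[of k ?K q x "?x Minus" ?U ?c] c1 Ux unit by simp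
  then show "cmp C q ?K (cmp C q k ?U x) (up C (k+2) q (e Minus)) = cmp C q ?K (up C (k+2) q (e Plus)) x"
    using A by (simp only: ue)
  have "bd C q ?K Plus (up C (k+2) q (e Minus)) = cmp C ?K k U (bd C q ?K Minus x)"
    "bd C q ?K Minus (cmp C q k ?U x) = cmp C ?K k U (bd C q ?K Minus x)"
    unfolding ue using c1 Ux kq cb by (auto simp: bd_cmp_above)
  then show "composable C q ?K (cmp C q k ?U x) (up C (k+2) q (e Minus))"
    using Ux e x kq by (auto simp: composable_def cmp_cell up_cell)
  have "bd C q ?K Minus (up C (k+2) q (e Plus)) = cmp C ?K k (up C k ?K a) (bd C q ?K Plus x)"
    unfolding ue using c1 kq cb by (auto simp: bd_cmp_above)
  also have "\<dots> = bd C q ?K Plus x" using unit_left[of k ?K "bd C q ?K Plus x"] bx bxk by simp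
  finally show "composable C q ?K (up C (k+2) q (e Plus)) x"
    using e x kq by (auto simp: composable_def up_cell)
qed

end

text \<open>Left cancellation of invertible cells: descends along \<open>c *\<^sub>k x\<close> to a lower codimension.\<close>

lemma (in omega_category) arr_cancel_left:
  assumes inv: "has_inverses C m" and "m \<le> k" "u \<in> cells C (k+1)" "k < q" "parallel C q f g"
    and "composable C q k (up C (k+1) q u) f"
    and "arr C q (cmp C q k (up C (k+1) q u) f) (cmp C q k (up C (k+1) q u) g)"
  shows "arr C q f g"
  using assms(2-)
proof (induction "q - k" arbitrary: k u rule: less_induct)
  case less
  let ?K = "k+1"
  have u: "u \<in> cells C (Suc k)" using less.prems by simp
  obtain u' where u': "composable C (Suc k) k u' u"
    "arr C (Suc k) (idn C k (Suc k) (bd C (Suc k) k Minus u)) (cmp C (Suc k) k u' u)"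
    using has_inversesE[OF inv _ u] less.prems(1) by blast
  define a where "a = bd C (Suc k) k Minus u"
  define U where "U = cmp C (Suc k) k u' u"
  \<comment> \<open>\<open>c\<close> connects the unit on \<open>a\<close> with
    \<open>U = u' u\<close>. Multiplying by \<open>u'\<close> reduces the cancellation of
    \<open>u\<close> to that of \<open>U\<close>.\<close>
  obtain c where c: "c \<in> cells C (k+2)" "bd C (k+2) (k+1) Minus c = up C k (k+1) a"
      "bd C (k+2) (k+1) Plus c = U"
    using u'(2) unfolding arr_def a_def U_def by (auto simp: up_Suc)
  have fg: "f \<in> cells C q" "g \<in> cells C q" "\<And>j \<alpha>. j < q \<Longrightarrow> bd C q j \<alpha> f = bd C q j \<alpha> g"
    using less.prems by (auto simp: parallel_def)
  have fa: "bd C q k Plus f = a"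
    using less.prems u by (auto simp: composable_def a_def bd_up_below)
  have ga: "bd C q k Plus g = a" using fa fg less.prems by auto
  let ?u = "up C ?K q u" and ?u' = "up C ?K q u'"
  have uu: "composable C q k ?u' ?u" using composable_up[OF u'(1), of q] less.prems by simp
  have ug: "composable C q k ?u g" using less.prems fg by (auto simp: composable_def)
  have Uf: "cmp C q k (up C ?K q U) h = cmp C q k ?u' (cmp C q k ?u h)"
    if "composable C q k ?u h" for h
    using up_cmp[OF u'(1), of q] assoc[OF that uu] less.prems by (simp add: U_def)
  have c2: "composable C q k ?u' (cmp C q k ?u f)"
    using uu less.prems(5) by (auto simp: composable_def bd_cmp_target cmp_cell)
  have uc: "?u' \<in> cells C q" using c2 by (auto simp: composable_def)
  have w: "arr C q (cmp C q k (up C ?K q U) f) (cmp C q k (up C ?K q U) g)"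
    using arr_cmp[OF less.prems(6) arr_refl[OF uc] c2] Uf less.prems(5) ug by simp
  show ?case
  proof (cases "q = ?K")
    case True
    \<comment> \<open>In codimension one \<open>c\<close> has just the dimension that is needed to
      whisker it by \<open>h\<close> into a cell from \<open>h\<close> to
      \<open>U *\<^sub>k h\<close>.\<close>
    have unit: "arr C q h (cmp C q k (up C ?K q U) h)" if h: "h \<in> cells C q" "bd C q k Plus h = a" for h
    proof -
      have hc: "arr C q (up C k q a) U" using c True by (auto simp: arr_def)
      have "composable C q k (up C k q a) h"
        using composable_unit_left[of k q h] h less.prems by auto
      from arr_cmp[OF arr_refl[OF h(1)] hc this] show ?thesis
        using unit_left[of k q h] h True by simp
    qed
    have mq: "m \<le> q" using True less.prems by simp
    show ?thesis
      using unit[OF fg(1) fa] w arr_sym[OF inv mq unit[OF fg(2) ga]] arr_trans by blast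
  next
    case False
    \<comment> \<open>In higher codimension \<open>naturality_square\<close> trades the factor
      \<open>U\<close> along \<open>k\<close> for the factor \<open>e Plus\<close> along
      \<open>k+1\<close>, at the price of \<open>e Minus\<close> on the right. Since
      \<open>f\<close> and \<open>g\<close> are parallel, both give the same
      \<open>e\<close>.\<close>
    with less.prems have q: "k+2 \<le> q" by auto
    define e where "e \<alpha> = cmp C (k+2) k c (up C ?K (k+2) (bd C q ?K \<alpha> f))" for \<alpha>
    have eg: "e \<alpha> = cmp C (k+2) k c (up C ?K (k+2) (bd C q ?K \<alpha> g))" for \<alpha>
      using fg(3)[of ?K] q by (auto simp: e_def)
    note nf = naturality_square[OF c q fg(1) fa, folded e_def]
    note ng = naturality_square[OF c q fg(2) ga, folded eg]
    have em: "up C (k+2) q (e Minus) \<in> cells C q" using nf(1) q by (auto intro: up_cell)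
    have A: "arr C q (cmp C q ?K (up C (k+2) q (e Plus)) f) (cmp C q ?K (up C (k+2) q (e Plus)) g)"
      using arr_cmp[OF arr_refl[OF em] w nf(3)] nf(5) ng(5) by simp
    show ?thesis
      using less.hyps[of ?K "e Plus"] q less.prems(1,4) nf(1)[of Plus] nf(4) A by simp
  qed
qed

lemma arr_cancel_right:
  fixes C :: "'a omega_struct"
  assumes C: "omega_category C" and inv: "has_inverses C m" and "m \<le> k" "u \<in> cells C (k+1)" "k < q"
    and "parallel C q f g" "composable C q k f (up C (k+1) q u)"
    and "arr C q (cmp C q k f (up C (k+1) q u)) (cmp C q k g (up C (k+1) q u))"
  shows "arr C q f g"
proof -
  interpret omega_category C by fact
  have "arr (dual C) q f g"
    by (rule omega_category.arr_cancel_left[OF omega_category_dual[OF C] has_inverses_dual[OF C inv] assms(3)])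
      (use assms arr_sym[OF inv, of q] in auto)
  then show ?thesis using arr_sym[OF inv, of q] assms by simp
qed

lemma (in omega_category) parallelI:
  assumes "x \<in> cells C (Suc q)" "w \<in> cells C (Suc q)" "\<And>\<alpha>. bd C (Suc q) q \<alpha> x = bd C (Suc q) q \<alpha> w"
  shows "parallel C (Suc q) x w"
  unfolding parallel_def
proof (intro conjI allI impI)
  fix k \<alpha> assume "k < Suc q"
  then consider "k = q" | "k < q" by linarith
  then show "bd C (Suc q) k \<alpha> x = bd C (Suc q) k \<alpha> w"
    using assms globular[of k q "Suc q" x \<alpha> Minus] globular[of k q "Suc q" w \<alpha> Minus] by cases auto
qed (use assms in auto)

text \<open>The solution is \<open>u' *\<^sub>n w\<close>; the comparison cell from the unit to
  \<open>u *\<^sub>n u'\<close>, whiskered by \<open>w\<close> and reversed, shows that it solves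
  the equation.\<close>

lemma (in omega_category) divide_codim1:
  assumes inv: "has_inverses C m" and m: "m \<le> n" and u: "u \<in> cells C (Suc n)"
    and w: "w \<in> cells C (Suc n)" "bd C (Suc n) n Plus w = bd C (Suc n) n Plus u"
  shows "\<exists>x. composable C (Suc n) n u x \<and> bd C (Suc n) n Minus x = bd C (Suc n) n Minus w \<and>
    arr C (Suc n) (cmp C (Suc n) n u x) w"
proof -
  obtain u' where u': "composable C (Suc n) n u' u" "composable C (Suc n) n u u'"
    "arr C (Suc n) (idn C n (Suc n) (bd C (Suc n) n Plus u)) (cmp C (Suc n) n u u')"
    using has_inversesE[OF inv m u] by metis
  have c1: "composable C (Suc n) n u' w" using u' w by (auto simp: composable_def)
  have c2: "composable C (Suc n) n u (cmp C (Suc n) n u' w)"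
    using c1 u' by (auto simp: composable_def bd_cmp_target cmp_cell)
  have "arr C (Suc n) (cmp C (Suc n) n (idn C n (Suc n) (bd C (Suc n) n Plus u)) w)
    (cmp C (Suc n) n (cmp C (Suc n) n u u') w)"
    by (rule arr_cmp[OF arr_refl[OF w(1)] u'(3)])
      (use composable_unit_left[OF _ w(1), of n] w in \<open>auto simp: up_Suc\<close>)
  then have "arr C (Suc n) w (cmp C (Suc n) n u (cmp C (Suc n) n u' w))"
    using unit_left[OF _ w(1), of n] w assoc[OF c1 u'(2)] by (simp add: up_Suc)
  then show ?thesis
    using c1 c2 arr_sym[OF inv, of "Suc n"] m by (intro exI[of _ "cmp C (Suc n) n u' w"]) (auto simp: bd_cmp_source)
qed

text \<open>
  The solution is found for \<open>c *\<^sub>k x\<close>, in lower codimension; cancelling the whiskers afterwards avoids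
  any triangle identity for the chosen inverse.
\<close>

lemma divide_left:
  fixes C :: "'a omega_struct"
  assumes C: "omega_category C" and inv: "has_inverses C m"
    and "m \<le> k" "u \<in> cells C (k+1)" "k < q" "parallel C q f g" "composable C q k (up C (k+1) q u) f"
    and "w \<in> cells C (Suc q)" "bd C (Suc q) q Minus w = cmp C q k (up C (k+1) q u) f"
    and "bd C (Suc q) q Plus w = cmp C q k (up C (k+1) q u) g"
  shows "\<exists>x \<in> cells C (Suc q). bd C (Suc q) q Minus x = f \<and> bd C (Suc q) q Plus x = g \<and>
    composable C (Suc q) k (up C (k+1) (Suc q) u) x \<and>
    arr C (Suc q) (cmp C (Suc q) k (up C (k+1) (Suc q) u) x) w"
  using assms(3-)
proof (induction "q - k" arbitrary: k u w rule: less_induct)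
  case less
  interpret omega_category C by fact
  let ?K = "k+1"
  have u: "u \<in> cells C (Suc k)" using less.prems by simp
  obtain u' where u': "composable C (Suc k) k u' u"
    "arr C (Suc k) (idn C k (Suc k) (bd C (Suc k) k Minus u)) (cmp C (Suc k) k u' u)"
    using has_inversesE[OF inv _ u] less.prems(1) by blast
  define a where "a = bd C (Suc k) k Minus u"
  define U where "U = cmp C (Suc k) k u' u"
  obtain c where c: "c \<in> cells C (k+2)" "bd C (k+2) (k+1) Minus c = up C k (k+1) a"
      "bd C (k+2) (k+1) Plus c = U"
    using u'(2) unfolding arr_def a_def U_def by (auto simp: up_Suc)
  have fg: "f \<in> cells C q" "g \<in> cells C q" "\<And>j \<alpha>. j < q \<Longrightarrow> bd C q j \<alpha> f = bd C q j \<alpha> g"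
    using less.prems by (auto simp: parallel_def)
  have fa: "bd C q k Plus f = a"
    using less.prems u by (auto simp: composable_def a_def bd_up_below)
  have ga: "bd C q k Plus g = a" using fa fg less.prems by auto
  have a: "a \<in> cells C k" using bd_cell u by (auto simp: a_def)
  have kq: "k < q" by fact
  have u'c: "u' \<in> cells C ?K" using u'(1) by (auto simp: composable_def)
  have Uc: "U \<in> cells C ?K" using cmp_cell[OF u'(1)] by (simp add: U_def)
  let ?u = "\<lambda>r. up C ?K r u" and ?u' = "\<lambda>r. up C ?K r u'"
  have uu: "composable C r k (?u' r) (?u r)" if "k < r" for r
    using composable_up[OF u'(1), of r] that by simp
  have ug: "composable C q k (?u q) g" using less.prems fg by (auto simp: composable_def)
  have Uh: "cmp C r k (up C ?K r U) h = cmp C r k (?u' r) (cmp C r k (?u r) h)"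
    if "composable C r k (?u r) h" "k < r" for h r
    using up_cmp[OF u'(1), of r] assoc[OF that(1) uu[OF that(2)]] that by (simp add: U_def)
  have uS: "bd C (Suc q) q \<alpha> (?u (Suc q)) = ?u q" "bd C (Suc q) q \<alpha> (?u' (Suc q)) = ?u' q" for \<alpha>
    using kq less.prems(2) u'c by (auto simp: bd_up_above)
  have "bd C (Suc q) k Minus w = bd C q k Minus (cmp C q k (?u q) f)"
    using globular[of k q "Suc q" w Minus Minus] less.prems kq by simp
  have "bd C (Suc q) k Plus w = bd C q k Plus (cmp C q k (?u q) f)"
    using globular[of k q "Suc q" w Plus Minus] less.prems kq by simp
  also have "\<dots> = bd C q k Plus (?u q)" using less.prems by (simp add: bd_cmp_target)
  also have "\<dots> = bd C q k Minus (?u' q)" using uu[OF kq] by (simp add: composable_def)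
  also have "\<dots> = bd C (Suc q) k Minus (?u' (Suc q))" using u'c kq by (simp add: bd_up_below)
  finally have u'w: "composable C (Suc q) k (?u' (Suc q)) w"
    using u'c kq less.prems by (auto simp: composable_def up_cell)
  \<comment> \<open>\<open>v\<close> is the right-hand side of the equation for
    \<open>U = u' u\<close>; the factor \<open>u'\<close> is cancelled at the very end.\<close>
  define v where "v = cmp C (Suc q) k (?u' (Suc q)) w"
  have v: "v \<in> cells C (Suc q)" unfolding v_def by (rule cmp_cell[OF u'w])
  have vb: "bd C (Suc q) q Minus v = cmp C q k (up C ?K q U) f"
    "bd C (Suc q) q Plus v = cmp C q k (up C ?K q U) g"
    unfolding v_def using u'w kq less.prems uS Uh[OF less.prems(5) kq] Uh[OF ug kq]
    by (auto simp: bd_cmp_above)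
  \<comment> \<open>The \<open>(k+1)\<close>-boundaries that a solution must have. For
    \<open>q = k+1\<close> they are \<open>f\<close> and \<open>g\<close> themselves, otherwise they
    are boundaries common to \<open>f\<close> and \<open>g\<close>.\<close>
  define b where "b \<alpha> = (if q = ?K then if \<alpha> = Minus then f else g else bd C q ?K \<alpha> f)" for \<alpha>
  have b: "b \<alpha> \<in> cells C ?K" "bd C ?K k Plus (b \<alpha>) = a" for \<alpha>
    using fg fa ga kq by (auto simp: b_def bd_cell globular)
  have bx: "bd C (Suc q) ?K \<alpha> x = b \<alpha>"
    if "x \<in> cells C (Suc q)" "bd C (Suc q) q Minus x = f" "bd C (Suc q) q Plus x = g" for x \<alpha>
    using that globular[of ?K q "Suc q" x \<alpha> Minus] kq by (cases \<alpha>) (auto simp: b_def)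
  define e where "e \<alpha> = cmp C (k+2) k c (up C ?K (k+2) (b \<alpha>))" for \<alpha>
  have ck: "bd C (k+2) k \<alpha> c = a" for \<alpha>
    using globular[of k ?K "k+2" c \<alpha> Minus] c a by (simp add: bd_up_above)
  have ce: "composable C (k+2) k c (up C ?K (k+2) (b \<alpha>))" for \<alpha>
    using c b ck by (auto simp: composable_def up_cell bd_up_below)
  have e: "e \<alpha> \<in> cells C (k+2)" for \<alpha> unfolding e_def by (rule cmp_cell[OF ce])
  have eb: "bd C (k+2) ?K Minus (e \<alpha>) = b \<alpha>" "bd C (k+2) ?K Plus (e \<alpha>) = cmp C ?K k U (b \<alpha>)" for \<alpha>
    unfolding e_def using bd_cmp_above[OF ce] c b unit_left[of k ?K "b \<alpha>"] bd_up_above[of ?K ?K "k+2"]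
    by auto
  let ?e = "\<lambda>\<alpha>. up C (k+2) (Suc q) (e \<alpha>)"
  have ec: "?e \<alpha> \<in> cells C (Suc q)" for \<alpha> using e kq by (auto intro: up_cell)
  have Ub: "composable C ?K k U (b \<alpha>)" for \<alpha>
    using Uc b bd_cmp_source[OF u'(1)] by (auto simp: composable_def U_def a_def)
  have Uhq: "bd C q ?K \<alpha> (cmp C q k (up C ?K q U) h) = cmp C ?K k U (bd C q ?K \<alpha> h)"
    if "composable C q k (up C ?K q U) h" "?K < q" for h \<alpha>
    using that Uc bd_cmp_above[OF that(1), of ?K \<alpha>] bd_up_above[of ?K ?K q U] by simp
  have Uf: "composable C q k (up C ?K q U) f"
    using Uc fg fa kq bd_cmp_source[OF u'(1)] by (auto simp: composable_def U_def a_def up_cell bd_up_below)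
  have "bd C (Suc q) ?K Minus v = cmp C ?K k U (b Minus)"
  proof (cases "q = ?K")
    case True then show ?thesis using vb Uc by (simp add: b_def)
  next
    case False
    then have "?K < q" using kq by simp
    then show ?thesis using vb v globular[of ?K q "Suc q" v Minus Minus] Uhq[OF Uf] by (simp add: b_def)
  qed
  then have ve: "composable C (Suc q) ?K v (?e Minus)"
    using v ec kq e eb by (cases "q = ?K") (auto simp: composable_def bd_up_below)
  \<comment> \<open>Composing with \<open>e Minus\<close> turns the equation with left side
    \<open>U *\<^sub>k x\<close> into one with left side
    \<open>e Plus *\<^sub>k\<^sub>+\<^sub>1 x\<close>, so that \<open>q - k\<close> drops by
    one.\<close>
  define w' where "w' = cmp C (Suc q) ?K v (?e Minus)"
  have w': "w' \<in> cells C (Suc q)" unfolding w'_def by (rule cmp_cell[OF ve])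
  have "\<exists>x \<in> cells C (Suc q). bd C (Suc q) q Minus x = f \<and> bd C (Suc q) q Plus x = g \<and>
    arr C (Suc q) (cmp C (Suc q) ?K (?e Plus) x) w'"
  proof (cases "q = ?K")
    case True
    have m: "m \<le> ?K" "e Plus \<in> cells C (Suc ?K)" "w' \<in> cells C (Suc ?K)"
      "bd C (Suc ?K) ?K Plus w' = bd C (Suc ?K) ?K Plus (e Plus)"
      using True less.prems(1) e w' bd_cmp_target[OF ve] vb eb Uc by (auto simp: w'_def b_def)
    from divide_codim1[OF inv this] obtain x where
      x: "composable C (Suc ?K) ?K (e Plus) x" "bd C (Suc ?K) ?K Minus x = bd C (Suc ?K) ?K Minus w'"
      "arr C (Suc ?K) (cmp C (Suc ?K) ?K (e Plus) x) w'" by blast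
    show ?thesis
      using x True bd_cmp_source[OF ve] eb e by (intro bexI[of _ x]) (auto simp: composable_def w'_def b_def)
  next
    case False
    then have q: "k+2 \<le> q" using kq by simp
    have be: "b \<alpha> = bd C q ?K \<alpha> f" "b \<alpha> = bd C q ?K \<alpha> g" for \<alpha>
      using False fg(3)[of ?K] q by (auto simp: b_def)
    note nf = naturality_square[OF c q fg(1) fa, folded be, folded e_def]
    note ng = naturality_square[OF c q fg(2) ga, folded be, folded e_def]
    have eq: "bd C (Suc q) q \<alpha> (?e \<beta>) = up C (k+2) q (e \<beta>)" for \<alpha> \<beta>
      using e q by (simp add: bd_up_above)
    have "bd C (Suc q) q Minus w' = cmp C q ?K (up C (k+2) q (e Plus)) f"
      "bd C (Suc q) q Plus w' = cmp C q ?K (up C (k+2) q (e Plus)) g"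
      unfolding w'_def using bd_cmp_above[OF ve, of q] q vb eq nf(5) ng(5) by auto
    moreover have "q - ?K < q - k" using kq by simp
    ultimately show ?thesis
      using less.hyps[of ?K "e Plus" w'] q less.prems(1,4) e nf(4) w' by auto
  qed
  then obtain x where x: "x \<in> cells C (Suc q)" "bd C (Suc q) q Minus x = f" "bd C (Suc q) q Plus x = g"
    "arr C (Suc q) (cmp C (Suc q) ?K (?e Plus) x) w'" by blast
  have xk: "bd C (Suc q) k Plus x = a" using globular[of k q "Suc q" x Plus Minus] x fa kq by simp
  have "k+2 \<le> Suc q" using kq by simp
  note nx = naturality_square[OF c this x(1) xk, unfolded bx[OF x(1-3)], folded e_def]
  have ux: "composable C (Suc q) k (?u (Suc q)) x"
    using less.prems(2) x xk kq by (auto simp: composable_def up_cell bd_up_below a_def)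
  have uxb: "bd C (Suc q) q Minus (cmp C (Suc q) k (?u (Suc q)) x) = cmp C q k (?u q) f"
    "bd C (Suc q) q Plus (cmp C (Suc q) k (?u (Suc q)) x) = cmp C q k (?u q) g"
    using bd_cmp_above[OF ux, of q] kq uS x by auto
  have "bd C (Suc q) q Minus (cmp C (Suc q) k (up C ?K (Suc q) U) x) = cmp C q k (up C ?K q U) f"
    "bd C (Suc q) q Plus (cmp C (Suc q) k (up C ?K (Suc q) U) x) = cmp C q k (up C ?K q U) g"
    using bd_cmp_above[OF nx(2), of q] kq x Uc by (auto simp: bd_up_above)
  then have "bd C (Suc q) q \<alpha> (cmp C (Suc q) k (up C ?K (Suc q) U) x) = bd C (Suc q) q \<alpha> v" for \<alpha>
    using vb by (cases \<alpha>) auto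
  then have par: "parallel C (Suc q) (cmp C (Suc q) k (up C ?K (Suc q) U) x) v"
    using v nx(2) by (intro parallelI) (auto simp: cmp_cell)
  \<comment> \<open>The whiskers are undone: first \<open>e Minus\<close> is cancelled on the right,
    then \<open>u'\<close> on the left.\<close>
  have "arr C (Suc q) (cmp C (Suc q) k (up C ?K (Suc q) U) x) v"
  proof (rule arr_cancel_right[OF C inv _ _ _ par])
    show "arr C (Suc q) (cmp C (Suc q) ?K (cmp C (Suc q) k (up C ?K (Suc q) U) x) (up C (?K+1) (Suc q) (e Minus)))
      (cmp C (Suc q) ?K v (up C (?K+1) (Suc q) (e Minus)))"
      using x(4) nx(5) by (simp add: w'_def)
  qed (use less.prems(1) e[of Minus] kq nx(3) in auto)
  then have A: "arr C (Suc q) (cmp C (Suc q) k (?u' (Suc q)) (cmp C (Suc q) k (?u (Suc q)) x))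
    (cmp C (Suc q) k (?u' (Suc q)) w)"
    using Uh[OF ux] kq by (simp add: v_def)
  have "bd C (Suc q) q \<alpha> (cmp C (Suc q) k (?u (Suc q)) x) = bd C (Suc q) q \<alpha> w" for \<alpha>
    using uxb less.prems by (cases \<alpha>) auto
  then have par: "parallel C (Suc q) (cmp C (Suc q) k (?u (Suc q)) x) w"
    using less.prems ux by (intro parallelI) (auto simp: cmp_cell)
  have "composable C (Suc q) k (?u' (Suc q)) (cmp C (Suc q) k (?u (Suc q)) x)"
    using uu[of "Suc q"] kq ux by (auto simp: composable_def cmp_cell bd_cmp_target)
  then have "arr C (Suc q) (cmp C (Suc q) k (?u (Suc q)) x) w"
    using arr_cancel_left[OF inv less.prems(1) u'c _ par _ A] kq by simp
  then show ?case using x ux by blast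
qed

lemma divide_right:
  fixes C :: "'a omega_struct"
  assumes C: "omega_category C" and inv: "has_inverses C m"
    and "m \<le> k" "u \<in> cells C (k+1)" "k < q" "parallel C q f g" "composable C q k f (up C (k+1) q u)"
    and "w \<in> cells C (Suc q)" "bd C (Suc q) q Minus w = cmp C q k f (up C (k+1) q u)"
    and "bd C (Suc q) q Plus w = cmp C q k g (up C (k+1) q u)"
  shows "\<exists>x \<in> cells C (Suc q). bd C (Suc q) q Minus x = f \<and> bd C (Suc q) q Plus x = g \<and>
    composable C (Suc q) k x (up C (k+1) (Suc q) u) \<and>
    arr C (Suc q) (cmp C (Suc q) k x (up C (k+1) (Suc q) u)) w"
proof -
  interpret omega_category C by fact
  \<comment> \<open>In the dual the ends \<open>f\<close> and \<open>g\<close> of the unknown are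
    exchanged, and the final cell comes out reversed.\<close>
  have "parallel (dual C) q g f" using assms(6) by (auto simp: parallel_def)
  moreover have "composable C q k g (up C (k+1) q u)"
    using assms(5-7) by (auto simp: composable_def parallel_def)
  ultimately have "\<exists>x \<in> cells (dual C) (Suc q). bd (dual C) (Suc q) q Minus x = g \<and>
    bd (dual C) (Suc q) q Plus x = f \<and> composable (dual C) (Suc q) k (up (dual C) (k+1) (Suc q) u) x \<and>
    arr (dual C) (Suc q) (cmp (dual C) (Suc q) k (up (dual C) (k+1) (Suc q) u) x) w"
    by (intro divide_left[OF omega_category_dual[OF C] has_inverses_dual[OF C inv] assms(3) _ assms(5)])
      (use assms in simp_all)
  then obtain x where "x \<in> cells C (Suc q)" "bd C (Suc q) q Minus x = f" "bd C (Suc q) q Plus x = g"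
    "composable C (Suc q) k x (up C (k+1) (Suc q) u)"
    "arr C (Suc q) w (cmp C (Suc q) k x (up C (k+1) (Suc q) u))"
    unfolding composable_dual arr_dual dual_simps opp.simps by blast
  moreover from this have "arr C (Suc q) (cmp C (Suc q) k x (up C (k+1) (Suc q) u)) w"
    using arr_sym[OF inv, of "Suc q"] assms(3,5) by auto
  ultimately show ?thesis by blast
qed

lemma divide_codim1_right:
  fixes C :: "'a omega_struct"
  assumes C: "omega_category C" and inv: "has_inverses C m" and m: "m \<le> n" and u: "u \<in> cells C (Suc n)"
    and w: "w \<in> cells C (Suc n)" "bd C (Suc n) n Minus w = bd C (Suc n) n Minus u"
  shows "\<exists>x. composable C (Suc n) n x u \<and> bd C (Suc n) n Plus x = bd C (Suc n) n Plus w \<and>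
    arr C (Suc n) (cmp C (Suc n) n x u) w"
proof -
  interpret omega_category C by fact
  obtain x where "composable C (Suc n) n x u" "bd C (Suc n) n Plus x = bd C (Suc n) n Plus w"
    "arr C (Suc n) w (cmp C (Suc n) n x u)"
    using omega_category.divide_codim1[OF omega_category_dual[OF C] has_inverses_dual[OF C inv] m, of u w] u w
    unfolding composable_dual arr_dual dual_simps opp.simps by blast
  moreover from this have "arr C (Suc n) (cmp C (Suc n) n x u) w"
    using arr_sym[OF inv, of "Suc n"] m by simp
  ultimately show ?thesis by blast
qed

text \<open>
  If \<open>b'\<close> is a left inverse of \<open>b\<close> and \<open>b''\<close> one of \<open>b'\<close>, then \<open>b \<rightarrow> b'' b' b \<rightarrow> b''\<close>, so that \<open>b'\<close> is also a
  right inverse of \<open>b\<close>.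
\<close>

lemma (in omega_category) two_sided_inverse:
  assumes sym: "\<And>f g. arr C (Suc n) f g \<Longrightarrow> arr C (Suc n) g f"
    and left: "\<And>b. b \<in> cells C (Suc n) \<Longrightarrow> \<exists>b'. composable C (Suc n) n b' b \<and> composable C (Suc n) n b b' \<and>
      arr C (Suc n) (idn C n (Suc n) (bd C (Suc n) n Minus b)) (cmp C (Suc n) n b' b)"
    and b: "b \<in> cells C (Suc n)"
  shows "\<exists>b'. composable C (Suc n) n b' b \<and> composable C (Suc n) n b b' \<and>
      arr C (Suc n) (idn C n (Suc n) (bd C (Suc n) n Minus b)) (cmp C (Suc n) n b' b) \<and>
      arr C (Suc n) (idn C n (Suc n) (bd C (Suc n) n Plus b)) (cmp C (Suc n) n b b')"
proof -
  let ?m = "cmp C (Suc n) n" and ?i = "idn C n (Suc n)"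
  obtain b' where b': "composable C (Suc n) n b' b" "composable C (Suc n) n b b'"
      "arr C (Suc n) (?i (bd C (Suc n) n Minus b)) (?m b' b)"
    using left[OF b] by blast
  have "b' \<in> cells C (Suc n)" using b' by (auto simp: composable_def)
  then obtain b'' where b'': "composable C (Suc n) n b'' b'" "composable C (Suc n) n b' b''"
      "arr C (Suc n) (?i (bd C (Suc n) n Minus b')) (?m b'' b')"
    using left by blast
  have cells: "b' \<in> cells C (Suc n)" "b'' \<in> cells C (Suc n)" using b' b'' by (auto simp: composable_def)
  have bds: "bd C (Suc n) n Plus b = bd C (Suc n) n Minus b'" "bd C (Suc n) n Plus b' = bd C (Suc n) n Minus b"
    "bd C (Suc n) n Minus b'' = bd C (Suc n) n Minus b" "bd C (Suc n) n Plus b'' = bd C (Suc n) n Plus b"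
    using b' b'' by (auto simp: composable_def)
  have "arr C (Suc n) (?m (?i (bd C (Suc n) n Plus b)) b) (?m (?m b'' b') b)"
    by (rule arr_cmp[OF arr_refl[OF b]])
      (use b'' bds composable_unit_left[OF _ b, of n] in \<open>auto simp: up_Suc\<close>)
  then have 1: "arr C (Suc n) b (?m b'' (?m b' b))"
    using unit_left[OF _ b, of n] assoc[OF b'(1) b''(1)] by (simp add: up_Suc)
  have "arr C (Suc n) (?m b'' (?m b' b)) (?m b'' (?i (bd C (Suc n) n Minus b)))"
    by (rule arr_cmp[OF sym[OF b'(3)] arr_refl[OF cells(2)]])
      (use b' cells bds in \<open>auto simp: composable_def cmp_cell bd_cmp_target\<close>)
  then have 2: "arr C (Suc n) (?m b'' (?m b' b)) b''"
    using unit_right[OF _ cells(2), of n] bds by (simp add: up_Suc)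
  have "arr C (Suc n) b'' b" using sym arr_trans[OF 1 2] by blast
  from arr_cmp[OF arr_refl[OF cells(1)] this b''(1)]
  have "arr C (Suc n) (?i (bd C (Suc n) n Plus b)) (?m b b')"
    using b''(3) bds arr_trans by metis
  with b' show ?thesis by blast
qed

section \<open>Cells of a chain complex with an ordered basis\<close>

lemma not_Minus [simp]: "\<alpha> \<noteq> Minus \<longleftrightarrow> \<alpha> = Plus"
  by (cases \<alpha>) auto

type_synonym chain = "(nat \<Rightarrow> nat) \<Rightarrow>\<^sub>0 int"

abbreviation cf :: "chain \<Rightarrow> (nat \<Rightarrow> nat) \<Rightarrow> int" where "cf \<equiv> Poly_Mapping.lookup"
abbreviation supp :: "chain \<Rightarrow> (nat \<Rightarrow> nat) set" where "supp \<equiv> Poly_Mapping.keys"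

section \<open>Positive chains and augmentation\<close>

definition pos :: "(nat \<Rightarrow> nat) set \<Rightarrow> chain \<Rightarrow> bool" where
  "pos S c \<longleftrightarrow> supp c \<subseteq> S \<and> (\<forall>b. 0 \<le> cf c b)"

definition positive_part :: "chain \<Rightarrow> chain" where
  "positive_part c = Poly_Mapping.map (\<lambda>v. max v 0) c"

definition chain_filter :: "((nat \<Rightarrow> nat) \<Rightarrow> bool) \<Rightarrow> chain \<Rightarrow> chain" where
  "chain_filter P c = Poly_Mapping.mapp (\<lambda>b v. if P b then v else 0) c"

lemma cf_positive_part: "cf (positive_part c) b = max (cf c b) 0"
  by (auto simp: positive_part_def Poly_Mapping.map.rep_eq when_def)

lemma cf_chain_filter: "cf (chain_filter P c) b = (if P b then cf c b else 0)"
  by (auto simp: chain_filter_def Poly_Mapping.lookup_mapp when_def in_keys_iff)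

lemma chain_eqI: "(\<And>b. cf c b = cf c' b) \<Longrightarrow> c = c'"
  by (rule poly_mapping_eqI) simp

lemmas cf_simps = Poly_Mapping.lookup_add Poly_Mapping.lookup_minus Poly_Mapping.lookup_uminus
  cf_positive_part cf_chain_filter

lemma positive_part_diff: "positive_part c - positive_part (- c) = c"
  by (rule chain_eqI) (auto simp: cf_simps)

lemma pos_iff: "pos S c \<longleftrightarrow> (\<forall>b. 0 \<le> cf c b \<and> (cf c b \<noteq> 0 \<longrightarrow> b \<in> S))"
  by (auto simp: pos_def in_keys_iff)

lemma pos_0 [simp]: "pos S 0" by (simp add: pos_iff)

lemma pos_add: "pos S a \<Longrightarrow> pos S b \<Longrightarrow> pos S (a + b)"
  unfolding pos_iff cf_simps by (metis add.right_neutral add_nonneg_nonneg)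

lemma pos_nonneg: "pos S c \<Longrightarrow> 0 \<le> cf c b" by (auto simp: pos_def)

lemma pos_supp: "pos S c \<Longrightarrow> supp c \<subseteq> S" by (auto simp: pos_def)

lemma pos_frag_of [simp]: "pos S (frag_of b) \<longleftrightarrow> b \<in> S" by (auto simp: pos_iff)

lemma pos_filter: "pos S c \<Longrightarrow> pos S (chain_filter P c)" by (auto simp: pos_iff cf_simps)

lemma pos_filter_diff: "pos S c \<Longrightarrow> pos S (c - chain_filter P c)" by (auto simp: pos_iff cf_simps)

lemma pos_positive_part: "supp c \<subseteq> S \<Longrightarrow> pos S (positive_part c)"
  by (auto simp: pos_iff cf_simps in_keys_iff max_def split: if_splits)

lemma pos_diffI:
  assumes "pos S a" "pos S b" "\<And>e. cf b e \<le> cf a e"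
  shows "pos S (a - b)"
  using assms unfolding pos_iff cf_simps by (metis diff_self diff_ge_0_iff_ge le_antisym)

lemma pos_eq_0: "pos S c \<Longrightarrow> pos S (- c) \<Longrightarrow> c = 0"
  by (rule chain_eqI) (auto simp: pos_iff cf_simps intro: antisym)

lemma augmentation_superset:
  "finite S \<Longrightarrow> supp c \<subseteq> S \<Longrightarrow> augmentation c = (\<Sum>v\<in>S. cf c v)"
  unfolding augmentation_def by (intro sum.mono_neutral_left) (auto simp: in_keys_iff)

lemma augmentation_add: "augmentation (a + b :: chain) = augmentation a + augmentation b"
  using Poly_Mapping.keys_add[of a b]
  by (simp add: augmentation_superset[of "supp a \<union> supp b"] cf_simps sum.distrib)

lemma augmentation_0 [simp]: "augmentation 0 = 0" by (simp add: augmentation_def)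

lemma augmentation_minus: "augmentation (- a :: chain) = - augmentation a"
  using augmentation_add[of a "-a"] by simp

lemma augmentation_diff: "augmentation (a - b :: chain) = augmentation a - augmentation b"
  using augmentation_add[of a "-b"] by (simp add: augmentation_minus)

lemma augmentation_frag_of [simp]: "augmentation (frag_of a) = 1"
  by (simp add: augmentation_def)

lemma augmentation_nonneg: "pos S c \<Longrightarrow> 0 \<le> augmentation c"
  unfolding augmentation_def by (intro sum_nonneg) (auto simp: pos_iff)

lemma augmentation_eq_0: "pos S c \<Longrightarrow> augmentation c = 0 \<Longrightarrow> c = 0"
  unfolding augmentation_def by (subst (asm) sum_nonneg_eq_0_iff) (auto simp: pos_iff in_keys_iff intro: chain_eqI)

lemma augmentation_1:
  assumes c: "pos S c" and 1: "augmentation c = 1"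
  obtains v where "v \<in> S" "c = frag_of v"
proof -
  have "supp c \<noteq> {}" using 1 by (intro notI) (simp add: augmentation_def)
  then obtain v where v: "v \<in> supp c" by blast
  then have "v \<in> S" "1 \<le> cf c v" using c by (auto simp: pos_iff in_keys_iff order.order_iff_strict)
  then have p: "pos S (c - frag_of v)" using c by (intro pos_diffI) (auto simp: pos_iff)
  then have "c - frag_of v = 0" using augmentation_eq_0[OF p] 1 by (simp add: augmentation_diff)
  then show ?thesis using that[of v] \<open>v \<in> S\<close> by simp
qed

section \<open>Composition of families of chains\<close>

definition kcomp :: "nat \<Rightarrow> oriental_cell \<Rightarrow> oriental_cell \<Rightarrow> bool" where
  "kcomp k x y \<longleftrightarrow> oriental_bd k Plus y = oriental_bd k Minus x"

text \<open>The composite \<open>x - z + y\<close> without subtraction, with a choice of the entry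
  in each degree up to \<open>k\<close>. In this form associativity holds for all families,
  composable or not.\<close>

definition kc :: "nat \<Rightarrow> oriental_cell \<Rightarrow> oriental_cell \<Rightarrow> oriental_cell" where
  "kc k x y = (\<lambda>l \<alpha>. if l < k then y l \<alpha> else if l = k then if \<alpha> = Minus then y l \<alpha> else x l \<alpha>
     else x l \<alpha> + y l \<alpha>)"

lemma kcomp_iff: "kcomp k x y \<longleftrightarrow> (\<forall>l<k. y l = x l) \<and> y k Plus = x k Minus"
proof
  assume *: "kcomp k x y"
  have "y l \<alpha> = x l \<alpha>" if "l < k" for l \<alpha>
    using that fun_cong[OF fun_cong[OF *[unfolded kcomp_def], of l], of \<alpha>] by (simp add: oriental_bd_def)
  moreover have "y k Plus = x k Minus"
    using fun_cong[OF fun_cong[OF *[unfolded kcomp_def], of k], of Plus] by (simp add: oriental_bd_def)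
  ultimately show "(\<forall>l<k. y l = x l) \<and> y k Plus = x k Minus" by auto
qed (auto simp: kcomp_def oriental_bd_def fun_eq_iff)

lemma kc_eq: "kcomp k x y \<Longrightarrow> (\<lambda>l \<beta>. x l \<beta> - oriental_bd k Minus x l \<beta> + y l \<beta>) = kc k x y"
proof (intro ext)
  fix l \<beta> assume "kcomp k x y"
  then show "x l \<beta> - oriental_bd k Minus x l \<beta> + y l \<beta> = kc k x y l \<beta>"
    unfolding kcomp_iff by (cases \<beta>) (auto simp: kc_def oriental_bd_def)
qed

lemma obd_obd [simp]: "j < k \<Longrightarrow> oriental_bd j \<alpha> (oriental_bd k \<beta> x) = oriental_bd j \<alpha> x"
  by (auto simp: oriental_bd_def fun_eq_iff)

lemma obd_obd_same [simp]: "oriental_bd k \<alpha> (oriental_bd k \<beta> x) = oriental_bd k \<beta> x"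
  by (auto simp: oriental_bd_def fun_eq_iff)

lemma kc_simps:
  "l < k \<Longrightarrow> kc k x y l = y l" "kc k x y k Minus = y k Minus" "kc k x y k Plus = x k Plus"
  "k < l \<Longrightarrow> kc k x y l \<alpha> = x l \<alpha> + y l \<alpha>"
  by (auto simp: kc_def)

lemma kc_assoc: "kc k x (kc k y z) = kc k (kc k x y) z"
  by (auto simp: kc_def fun_eq_iff)

lemma kcomp_kc_right: "kcomp k y z \<Longrightarrow> kcomp k x (kc k y z) \<longleftrightarrow> kcomp k x y"
  by (auto simp: kcomp_iff kc_simps)

lemma kcomp_kc_left: "kcomp k x y \<Longrightarrow> kcomp k (kc k x y) z \<longleftrightarrow> kcomp k y z"
  by (auto simp: kcomp_iff kc_simps)

lemma obd_kc:
  "j < k \<Longrightarrow> kcomp k x y \<Longrightarrow> oriental_bd j \<alpha> (kc k x y) = oriental_bd j \<alpha> x"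
  "j < k \<Longrightarrow> kcomp k x y \<Longrightarrow> oriental_bd j \<alpha> (kc k x y) = oriental_bd j \<alpha> y"
  "kcomp k x y \<Longrightarrow> oriental_bd k Minus (kc k x y) = oriental_bd k Minus y"
  "kcomp k x y \<Longrightarrow> oriental_bd k Plus (kc k x y) = oriental_bd k Plus x"
  "k < j \<Longrightarrow> oriental_bd j \<alpha> (kc k x y) = kc k (oriental_bd j \<alpha> x) (oriental_bd j \<alpha> y)"
  by (auto simp: oriental_bd_def kcomp_iff kc_def fun_eq_iff)

lemma kcomp_obd: "k < j \<Longrightarrow> kcomp k (oriental_bd j \<alpha> x) (oriental_bd j \<beta> y) \<longleftrightarrow> kcomp k x y"
  by (auto simp: kcomp_def)

lemma kcomp_obd_left: "k < j \<Longrightarrow> kcomp k (oriental_bd j \<alpha> x) y \<longleftrightarrow> kcomp k x y"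
  by (auto simp: kcomp_def)

lemma kcomp_obd_right: "k < j \<Longrightarrow> kcomp k x (oriental_bd j \<beta> y) \<longleftrightarrow> kcomp k x y"
  by (auto simp: kcomp_def)

lemma kc_interchange:
  assumes "j < k" "kcomp k x' x" "kcomp k y' y" "kcomp j x y"
  shows "kc j (kc k x' x) (kc k y' y) = kc k (kc j x' y') (kc j x y)"
proof (intro ext)
  fix l \<alpha>
  have e: "\<And>l. l < k \<Longrightarrow> x l = x' l" "\<And>l. l < k \<Longrightarrow> y l = y' l" "\<And>l. l < j \<Longrightarrow> y l = x l"
    "x k Plus = x' k Minus" "y k Plus = y' k Minus" "y j Plus = x j Minus"
    using assms by (auto simp: kcomp_iff)
  consider "l < j" | "l = j" | "j < l" "l < k" | "l = k" | "k < l" by linarith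
  then show "kc j (kc k x' x) (kc k y' y) l \<alpha> = kc k (kc j x' y') (kc j x y) l \<alpha>"
    using \<open>j < k\<close> by cases (simp_all add: kc_def e algebra_simps)
qed

text \<open>The boundary condition is imposed in every degree; in degree \<open>p\<close> it says
  that the two top entries agree (\<open>cl_top\<close>). The basis is a parameter because the horn
  is treated like the simplex.\<close>

definition cx_cells :: "(nat \<Rightarrow> (nat \<Rightarrow> nat) set) \<Rightarrow> (nat \<Rightarrow> chain \<Rightarrow> chain) \<Rightarrow> nat \<Rightarrow> oriental_cell set" where
  "cx_cells B del p = {x. (\<forall>k \<alpha>. pos (B k) (x k \<alpha>)) \<and> (\<forall>k \<alpha>. p < k \<longrightarrow> x k \<alpha> = 0) \<and>
     (\<forall>k \<alpha>. del k (x (Suc k) \<alpha>) = x k Plus - x k Minus) \<and> (\<forall>\<alpha>. augmentation (x 0 \<alpha>) = 1)}"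

text \<open>Steiner's atom of a basis element: going down from \<open>a\<close>, the next target is
  the positive part of the boundary of the target, the next source the negative part of the boundary
  of the source. The recursion is on the codegree \<open>r = p - l\<close>.\<close>

primrec atom_aux :: "(nat \<Rightarrow> chain \<Rightarrow> chain) \<Rightarrow> nat \<Rightarrow> (nat \<Rightarrow> nat) \<Rightarrow> nat \<Rightarrow> sign \<Rightarrow> chain" where
  "atom_aux del p a 0 = (\<lambda>\<alpha>. frag_of a)"
| "atom_aux del p a (Suc r) = (\<lambda>\<alpha>. let c = del (p - Suc r) (atom_aux del p a r \<alpha>) in
     if \<alpha> = Plus then positive_part c else positive_part (- c))"

definition atom :: "(nat \<Rightarrow> chain \<Rightarrow> chain) \<Rightarrow> nat \<Rightarrow> (nat \<Rightarrow> nat) \<Rightarrow> oriental_cell" where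
  "atom del p a = (\<lambda>l \<alpha>. if l \<le> p then atom_aux del p a (p - l) \<alpha> else 0)"

lemma atom_top [simp]: "atom del p a p \<alpha> = frag_of a"
  by (simp add: atom_def)

lemma atom_above [simp]: "p < l \<Longrightarrow> atom del p a l \<alpha> = 0"
  by (simp add: atom_def)

lemma atom_step:
  assumes "l < p"
  shows "atom del p a l Plus = positive_part (del l (atom del p a (Suc l) Plus))"
    and "atom del p a l Minus = positive_part (- del l (atom del p a (Suc l) Minus))"
proof -
  have "p - l = Suc (p - Suc l)" "p - Suc (p - Suc l) = l" using assms by auto
  then show "atom del p a l Plus = positive_part (del l (atom del p a (Suc l) Plus))"
    "atom del p a l Minus = positive_part (- del l (atom del p a (Suc l) Minus))"
    using assms by (auto simp: atom_def Let_def)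
qed

locale directed_complex =
  fixes B :: "nat \<Rightarrow> (nat \<Rightarrow> nat) set" and del :: "nat \<Rightarrow> chain \<Rightarrow> chain"
  assumes del_ext: "del k c = frag_extend (\<lambda>b. del k (frag_of b)) c"
    and del_supp: "supp c \<subseteq> B (Suc k) \<Longrightarrow> supp (del k c) \<subseteq> B k"
    and del_del: "supp c \<subseteq> B (Suc (Suc k)) \<Longrightarrow> del k (del (Suc k) c) = 0"
begin

abbreviation "cl \<equiv> cx_cells B del"
abbreviation "at \<equiv> atom del"

lemma del_add: "del k (a + b) = del k a + del k b"
  by (subst (1 2 3) del_ext) (rule frag_extend_add)

lemma del_0 [simp]: "del k 0 = 0"
  using del_add[of k 0 0] by simp

lemma del_minus: "del k (- a) = - del k a"
  using del_add[of k a "-a"] by (simp add: eq_neg_iff_add_eq_0 add.commute)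

lemma del_diff: "del k (a - b) = del k a - del k b"
  using del_add[of k a "-b"] by (simp add: del_minus)

lemma cf_del: "cf (del k c) e = (\<Sum>a\<in>supp c. cf c a * cf (del k (frag_of a)) e)"
  by (subst del_ext) (simp add: frag_extend_def Poly_Mapping.lookup_sum)

lemma at_facts:
  assumes a: "a \<in> B p"
  shows "pos (B l) (at p a l \<alpha>)" "del l (at p a (Suc l) \<alpha>) = at p a l Plus - at p a l Minus"
proof -
  have *: "l + r = p \<Longrightarrow> (\<forall>l'\<ge>l. \<forall>\<alpha>. pos (B l') (at p a l' \<alpha>)) \<and>
      (\<forall>l'\<ge>l. \<forall>\<alpha>. del l' (at p a (Suc l') \<alpha>) = at p a l' Plus - at p a l' Minus)" for r l
  proof (induction r arbitrary: l)
    case 0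
    have "del l' (at p a (Suc l') \<alpha>) = at p a l' Plus - at p a l' Minus \<and> pos (B l') (at p a l' \<alpha>)"
      if "p \<le> l'" for l' \<alpha>
      using that a by (cases "l' = p") auto
    with 0 show ?case by auto
  next
    case (Suc r)
    then have IH: "\<And>l' \<alpha>. Suc l \<le> l' \<Longrightarrow> pos (B l') (at p a l' \<alpha>)"
      "\<And>l' \<alpha>. Suc l \<le> l' \<Longrightarrow> del l' (at p a (Suc l') \<alpha>) = at p a l' Plus - at p a l' Minus"
      using Suc.IH[of "Suc l"] by auto
    have lp: "l < p" using Suc by auto
    note st = atom_step[OF lp, of del a]
    have s: "supp (del l (at p a (Suc l) \<alpha>)) \<subseteq> B l" for \<alpha> using IH(1) del_supp pos_supp by blast
    have pos: "pos (B l) (at p a l \<alpha>)" for \<alpha>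
      using s[of \<alpha>] st by (cases \<alpha>) (simp_all add: pos_positive_part)
    \<comment> \<open>As the boundary of a boundary vanishes, target and source in degree
      \<open>l+1\<close> have the same boundary; the entries in degree \<open>l\<close> are the two
      parts of this one chain.\<close>
    have "del l (at p a (Suc l) Plus - at p a (Suc l) Minus) = del l (del (Suc l) (at p a (Suc (Suc l)) Plus))"
      using IH(2)[of "Suc l" Plus] by simp
    also have "\<dots> = 0" using IH(1)[of "Suc (Suc l)" Plus] del_del pos_supp by auto
    finally have "del l (at p a (Suc l) Plus) = del l (at p a (Suc l) Minus)" by (simp add: del_diff)
    then have d: "del l (at p a (Suc l) \<alpha>) = at p a l Plus - at p a l Minus" for \<alpha>
      using positive_part_diff[of "del l (at p a (Suc l) Plus)"] st by (cases \<alpha>) auto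
    have "l' = l \<or> Suc l \<le> l'" if "l \<le> l'" for l' using that by auto
    with pos d IH show ?case by metis
  qed
  have "(\<forall>\<alpha>. pos (B l) (at p a l \<alpha>)) \<and> (\<forall>\<alpha>. del l (at p a (Suc l) \<alpha>) = at p a l Plus - at p a l Minus)"
  proof (cases "l \<le> p")
    case True
    then show ?thesis using *[of l "p - l"] by auto
  qed auto
  then show "pos (B l) (at p a l \<alpha>)" "del l (at p a (Suc l) \<alpha>) = at p a l Plus - at p a l Minus" by auto
qed

end

text \<open>
  The key linearises the relation "\<open>e\<close> is in the source of \<open>a\<close>, or \<open>a\<close> is in the target of \<open>e\<close>"; its
  existence says that the basis is strongly loop-free in the sense of Steiner.
\<close>

locale steiner_complex = directed_complex B del for B del +
  fixes key :: "nat \<Rightarrow> (nat \<Rightarrow> nat) \<Rightarrow> int"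
  assumes aug_del: "supp c \<subseteq> B (Suc 0) \<Longrightarrow> augmentation (del 0 c) = 0"
    and key_target: "a \<in> B (Suc k) \<Longrightarrow> 0 < cf (del k (frag_of a)) e \<Longrightarrow> key (Suc k) a < key k e"
    and key_source: "a \<in> B (Suc k) \<Longrightarrow> cf (del k (frag_of a)) e < 0 \<Longrightarrow> key k e < key (Suc k) a"
    and key_inj: "inj_on (key k) (B k)"
    and unital: "a \<in> B p \<Longrightarrow> augmentation (atom del p a 0 \<alpha>) = 1"
begin

text \<open>Some element of \<open>c\<close> must have \<open>e\<close> in its source, and so a
  larger key than \<open>e\<close>. Together with \<open>del_posD\<close> this is how the order
  enters every positivity argument.\<close>

lemma del_negD:
  assumes "pos (B (Suc k)) c" "cf (del k c) e < 0"
  obtains a where "a \<in> supp c" "key k e < key (Suc k) a"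
proof -
  have "\<exists>a\<in>supp c. cf c a * cf (del k (frag_of a)) e < 0"
  proof (rule ccontr)
    assume "\<not> ?thesis"
    then have "0 \<le> cf (del k c) e" unfolding cf_del[of k c e] by (intro sum_nonneg) (auto simp: not_less)
    with assms(2) show False by simp
  qed
  then obtain a where a: "a \<in> supp c" "cf c a * cf (del k (frag_of a)) e < 0" by blast
  then have "cf (del k (frag_of a)) e < 0" using pos_nonneg[OF assms(1), of a]
    by (simp add: mult_less_0_iff)
  then show ?thesis using that a pos_supp[OF assms(1)] key_source by blast
qed

lemma del_posD:
  assumes "pos (B (Suc k)) c" "0 < cf (del k c) e"
  obtains a where "a \<in> supp c" "key (Suc k) a < key k e"
proof -
  have "\<exists>a\<in>supp c. 0 < cf c a * cf (del k (frag_of a)) e"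
  proof (rule ccontr)
    assume "\<not> ?thesis"
    then have "cf (del k c) e \<le> 0" unfolding cf_del[of k c e] by (intro sum_nonpos) (auto simp: not_less)
    with assms(2) show False by simp
  qed
  then obtain a where a: "a \<in> supp c" "0 < cf c a * cf (del k (frag_of a)) e" by blast
  then have "0 < cf (del k (frag_of a)) e" using pos_nonneg[OF assms(1), of a]
    by (simp add: zero_less_mult_iff)
  then show ?thesis using that a pos_supp[OF assms(1)] key_target by blast
qed

lemma clD:
  assumes "x \<in> cl p"
  shows "pos (B k) (x k \<alpha>)" "p < k \<Longrightarrow> x k \<alpha> = 0" "del k (x (Suc k) \<alpha>) = x k Plus - x k Minus"
    "augmentation (x 0 \<alpha>) = 1"
  using assms by (auto simp: cx_cells_def)

lemma cl_top: "x \<in> cl p \<Longrightarrow> p \<le> k \<Longrightarrow> x k \<alpha> = x k \<beta>"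
  using clD(3)[of x p k Plus] clD(2)[of x p "Suc k" Plus] by (cases \<alpha>; cases \<beta>) auto

lemma clI:
  assumes "\<And>k \<alpha>. pos (B k) (x k \<alpha>)" "\<And>k \<alpha>. p < k \<Longrightarrow> x k \<alpha> = 0"
    "\<And>k \<alpha>. del k (x (Suc k) \<alpha>) = x k Plus - x k Minus" "\<And>\<alpha>. augmentation (x 0 \<alpha>) = 1"
  shows "x \<in> cl p"
  using assms by (auto simp: cx_cells_def)

lemma cl_mono: "x \<in> cl p \<Longrightarrow> p \<le> q \<Longrightarrow> x \<in> cl q"
  by (auto simp: cx_cells_def)

lemma cl_lower: "x \<in> cl p \<Longrightarrow> (\<And>k \<alpha>. q < k \<Longrightarrow> x k \<alpha> = 0) \<Longrightarrow> x \<in> cl q"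
  by (auto simp: cx_cells_def)

lemma obd_cl:
  assumes "x \<in> cl p"
  shows "oriental_bd k \<alpha> x \<in> cl k"
proof (rule clI)
  show "del l (oriental_bd k \<alpha> x (Suc l) \<beta>) = oriental_bd k \<alpha> x l Plus - oriental_bd k \<alpha> x l Minus" for l \<beta>
    using clD(3)[OF assms, of l] by (cases "Suc l = k") (auto simp: oriental_bd_def)
qed (use clD[OF assms] in \<open>auto simp: oriental_bd_def\<close>)

lemma obd_id: "x \<in> cl p \<Longrightarrow> p \<le> k \<Longrightarrow> oriental_bd k \<alpha> x = x"
  using clD(2) cl_top by (auto simp: oriental_bd_def fun_eq_iff)

lemma kc_cl:
  assumes x: "x \<in> cl p" and y: "y \<in> cl p" and c: "kcomp k x y"
  shows "kc k x y \<in> cl p"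
proof (rule clI)
  show "pos (B l) (kc k x y l \<alpha>)" for l \<alpha>
    using clD(1)[OF x] clD(1)[OF y] by (auto simp: kc_def intro: pos_add)
  show "kc k x y l \<alpha> = 0" if "p < l" for l \<alpha>
    using clD(2)[OF x that] clD(2)[OF y that] by (auto simp: kc_def)
  show "augmentation (kc k x y 0 \<alpha>) = 1" for \<alpha>
    using clD(4)[OF x] clD(4)[OF y] by (auto simp: kc_def)
  show "del l (kc k x y (Suc l) \<alpha>) = kc k x y l Plus - kc k x y l Minus" for l \<alpha>
    using clD(3)[OF x, of l] clD(3)[OF y, of l] c
    by (auto simp: kc_def kcomp_iff del_add)
qed

lemma kc_unit_right: "x \<in> cl p \<Longrightarrow> kc k x (oriental_bd k Minus x) = x"
  and kc_unit_left: "x \<in> cl p \<Longrightarrow> kc k (oriental_bd k Plus x) x = x"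
  by (auto simp: kc_def oriental_bd_def fun_eq_iff)

lemma kcomp_unit: "kcomp k x (oriental_bd k Minus x)" "kcomp k (oriental_bd k Plus x) x"
  by (auto simp: kcomp_def)

text \<open>\<open>low\<close> and \<open>high\<close> are the factors of a decomposition of \<open>x\<close> along \<open>*\<^sub>k\<close>.\<close>

definition low :: "nat \<Rightarrow> oriental_cell \<Rightarrow> oriental_cell \<Rightarrow> chain \<Rightarrow> oriental_cell" where
  "low k x A M = (\<lambda>l \<alpha>. if l < k then x l \<alpha> else if l = k then if \<alpha> = Minus then x k Minus else M else A l \<alpha>)"

definition high :: "nat \<Rightarrow> oriental_cell \<Rightarrow> oriental_cell \<Rightarrow> chain \<Rightarrow> oriental_cell" where
  "high k x A M = (\<lambda>l \<alpha>. if l < k then x l \<alpha> else if l = k then if \<alpha> = Minus then M else x k Plus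
     else x l \<alpha> - A l \<alpha>)"

text \<open>\<open>A\<close> is the part of \<open>x\<close> above degree \<open>k\<close> that goes
  into the first factor, and \<open>M\<close> is the boundary between the factors. The identities
  for the factors follow from those for \<open>x\<close>; the substantial condition in each
  application is that \<open>M\<close> is positive.\<close>

lemma split_at:
  assumes x: "x \<in> cl p"
    and A: "\<And>l \<alpha>. k < l \<Longrightarrow> pos (B l) (A l \<alpha>)" "\<And>l \<alpha>. k < l \<Longrightarrow> pos (B l) (x l \<alpha> - A l \<alpha>)"
      "\<And>l \<alpha>. k < l \<Longrightarrow> del l (A (Suc l) \<alpha>) = A l Plus - A l Minus"
    and M: "\<And>\<alpha>. del k (A (Suc k) \<alpha>) = M - x k Minus" "pos (B k) M"
  shows "low k x A M \<in> cl p" "high k x A M \<in> cl p" "kcomp k (high k x A M) (low k x A M)"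
    "kc k (high k x A M) (low k x A M) = x"
proof -
  have A0: "A l \<alpha> = 0" if "k < l" "p < l" for l \<alpha>
  proof -
    have "pos (B l) (- A l \<alpha>)" using A(2)[OF that(1), of \<alpha>] clD(2)[OF x that(2)] by simp
    then show ?thesis using pos_eq_0[OF A(1)[OF that(1)]] by blast
  qed
  have M': "M = x k Minus + del k (A (Suc k) Plus)" using M(1) by (simp add: algebra_simps)
  have Ms: "supp (A (Suc k) Plus) \<subseteq> B (Suc k)" using A(1)[of "Suc k"] by (auto dest: pos_supp)
  have dM: "del l M = del l (x k Minus)" if "k = Suc l" for l
    using del_del[of "A (Suc k) Plus" l] Ms that by (simp add: M' del_add)
  have aM: "augmentation M = 1" if "k = 0"
    using aug_del[of "A (Suc k) Plus"] Ms that clD(4)[OF x] by (simp add: M' augmentation_add)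
  show "low k x A M \<in> cl p"
  proof (rule clI)
    show "pos (B l) (low k x A M l \<alpha>)" for l \<alpha> using clD(1)[OF x] A(1) M(2) by (auto simp: low_def)
    show "low k x A M l \<alpha> = 0" if "p < l" for l \<alpha>
      using clD(2)[OF x that] A0 that M(1)[of \<alpha>] A0[of "Suc k"] by (auto simp: low_def)
    show "augmentation (low k x A M 0 \<alpha>) = 1" for \<alpha> using clD(4)[OF x] aM by (auto simp: low_def)
    show "del l (low k x A M (Suc l) \<alpha>) = low k x A M l Plus - low k x A M l Minus" for l \<alpha>
      using clD(3)[OF x, of l] A(3) M(1) dM by (cases "Suc l = k") (auto simp: low_def)
  qed
  show "high k x A M \<in> cl p"
  proof (rule clI)
    show "pos (B l) (high k x A M l \<alpha>)" for l \<alpha> using clD(1)[OF x] A(2) M(2) by (auto simp: high_def)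
    show "high k x A M l \<alpha> = 0" if "p < l" for l \<alpha>
      using clD(2)[OF x that] A0 that M(1)[of \<alpha>] A0[of "Suc k"] by (auto simp: high_def)
    show "augmentation (high k x A M 0 \<alpha>) = 1" for \<alpha> using clD(4)[OF x] aM by (auto simp: high_def)
    show "del l (high k x A M (Suc l) \<alpha>) = high k x A M l Plus - high k x A M l Minus" for l \<alpha>
      using clD(3)[OF x, of l] A(3) M(1) dM by (cases "Suc l = k") (auto simp: high_def del_diff)
  qed
  show "kcomp k (high k x A M) (low k x A M)" by (auto simp: kcomp_iff low_def high_def)
  show "kc k (high k x A M) (low k x A M) = x"
    by (auto simp: kc_def low_def high_def fun_eq_iff)
qed

text \<open>A coefficient of \<open>X + D\<close> can be negative only where \<open>D\<close> is
  negative. There \<open>D'\<close> is not positive, so the coefficient of the full sum would be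
  negative too.\<close>

lemma pos_middle:
  assumes "pos S X" "pos S (X + D + D')" "\<And>e. cf D e < 0 \<Longrightarrow> 0 < cf D' e \<Longrightarrow> False"
    "supp D \<subseteq> S"
  shows "pos S (X + D)"
  unfolding pos_iff
proof (intro allI conjI impI)
  fix e
  have *: "0 \<le> cf X e" "0 \<le> cf X e + cf D e + cf D' e" using assms(1,2) by (auto simp: pos_iff cf_simps)
  show "0 \<le> cf (X + D) e"
    using * assms(3)[of e] unfolding cf_simps by (cases "cf D e < 0"; cases "0 < cf D' e") auto
  show "e \<in> S" if "cf (X + D) e \<noteq> 0"
  proof (cases "cf X e = 0")
    case True
    then have "e \<in> supp D" using that by (simp add: cf_simps in_keys_iff)
    then show ?thesis using assms(4) by blast
  qed (use assms(1) in \<open>auto simp: pos_iff\<close>)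
qed

text \<open>The part \<open>D\<close> can be performed first if it consumes nothing that the rest
  produces.\<close>

lemma pos_del_middle:
  assumes "x \<in> cl p" "pos (B (Suc k)) D" "pos (B (Suc k)) (x (Suc k) Plus - D)"
    and "\<And>e. cf (del k D) e < 0 \<Longrightarrow> 0 < cf (del k (x (Suc k) Plus - D)) e \<Longrightarrow> False"
  shows "pos (B k) (x k Minus + del k D)"
proof (rule pos_middle[where D' = "del k (x (Suc k) Plus - D)"])
  have "x k Minus + del k D + del k (x (Suc k) Plus - D) = x k Plus"
    using clD(3)[OF assms(1), of k Plus] by (simp add: del_diff)
  then show "pos (B k) (x k Minus + del k D + del k (x (Suc k) Plus - D))"
    using clD(1)[OF assms(1)] by simp
qed (use assms clD(1)[OF assms(1)] del_supp pos_supp in auto)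

end

section \<open>Whiskered atoms\<close>

context steiner_complex
begin

lemma at_cl: "a \<in> B p \<Longrightarrow> at p a \<in> cl p"
  by (rule clI) (auto simp: at_facts unital)

text \<open>Both entries are parts of the same chain, one positive and one negative.\<close>

lemma at_disjoint:
  assumes "a \<in> B p" "l < p"
  shows "cf (at p a l Plus) e = 0 \<or> cf (at p a l Minus) e = 0"
proof -
  have "del l (at p a (Suc l) Plus) = del l (at p a (Suc l) Minus)"
    using at_facts[OF assms(1)] by simp
  then show ?thesis using atom_step[OF assms(2), of del a] by (auto simp: cf_simps max_def)
qed

text \<open>The inequalities of the locale relate adjacent degrees. They chain downwards, since each
  element of a target lies in the boundary of some element of the target one degree higher, and
  likewise for sources.\<close>

lemma at_key:
  assumes a: "a \<in> B p" and "l < p"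
  shows "cf (at p a l Plus) e \<noteq> 0 \<Longrightarrow> key p a < key l e"
    and "cf (at p a l Minus) e \<noteq> 0 \<Longrightarrow> key l e < key p a"
proof -
  have "l < p \<Longrightarrow> (cf (at p a l Plus) e \<noteq> 0 \<longrightarrow> key p a < key l e) \<and>
    (cf (at p a l Minus) e \<noteq> 0 \<longrightarrow> key l e < key p a)" for l e
  proof (induction "p - l" arbitrary: l e)
    case (Suc r)
    have IH: "cf (at p a (Suc l) Plus) c \<noteq> 0 \<Longrightarrow> key p a \<le> key (Suc l) c"
      "cf (at p a (Suc l) Minus) c \<noteq> 0 \<Longrightarrow> key (Suc l) c \<le> key p a" for c
      using Suc.hyps(1)[of "Suc l" c] Suc.hyps(2) Suc.prems
      by (cases "Suc l = p"; force split: if_splits)+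
    have pos: "pos (B (Suc l)) (at p a (Suc l) \<alpha>)" for \<alpha> using at_facts[OF a] by blast
    note st = atom_step[OF Suc.prems, of del a]
    show ?case
    proof (intro conjI impI)
      assume "cf (at p a l Plus) e \<noteq> 0"
      then have "0 < cf (del l (at p a (Suc l) Plus)) e" using st by (auto simp: cf_simps max_def split: if_splits)
      then obtain c where "c \<in> supp (at p a (Suc l) Plus)" "key (Suc l) c < key l e"
        using del_posD[OF pos] by blast
      then show "key p a < key l e" using IH(1)[of c] by (auto simp: in_keys_iff)
    next
      assume "cf (at p a l Minus) e \<noteq> 0"
      then have "cf (del l (at p a (Suc l) Minus)) e < 0" using st by (auto simp: cf_simps max_def split: if_splits)
      then obtain c where "c \<in> supp (at p a (Suc l) Minus)" "key l e < key (Suc l) c"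
        using del_negD[OF pos] by blast
      then show "key l e < key p a" using IH(2)[of c] by (auto simp: in_keys_iff)
    qed
  qed auto
  then show "cf (at p a l Plus) e \<noteq> 0 \<Longrightarrow> key p a < key l e"
    "cf (at p a l Minus) e \<noteq> 0 \<Longrightarrow> key l e < key p a" using assms by auto
qed

text \<open>
  The \<open>p\<close>-cells obtained from the atom of \<open>a\<close> by whiskering with cells of dimension less than \<open>j\<close>.
\<close>

definition whiskered :: "nat \<Rightarrow> (nat \<Rightarrow> nat) \<Rightarrow> nat \<Rightarrow> oriental_cell set" where
  "whiskered p a j = {x \<in> cl p. \<forall>l\<ge>j. x l = at p a l}"

lemma whiskered_cl: "x \<in> whiskered p a j \<Longrightarrow> x \<in> cl p"
  by (simp add: whiskered_def)

lemma at_whiskered: "a \<in> B p \<Longrightarrow> at p a \<in> whiskered p a j"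
  by (simp add: whiskered_def at_cl)

lemma whiskered_all: "x \<in> whiskered p a p \<longleftrightarrow> x \<in> cl p \<and> x p Plus = frag_of a"
proof
  assume x: "x \<in> cl p \<and> x p Plus = frag_of a"
  then have "x p \<alpha> = frag_of a" for \<alpha> using cl_top[of x p p \<alpha> Plus] by simp
  then have "x l \<alpha> = at p a l \<alpha>" if "p \<le> l" for l \<alpha>
    using x clD(2)[of x p l] that by (cases "l = p") auto
  then show "x \<in> whiskered p a p" using x by (auto simp: whiskered_def)
qed (auto simp: whiskered_def)

text \<open>In degree \<open>k\<close> the whiskers add the same chain to source and target. It is
  positive because at each element either the source or the target of the atom has coefficient
  zero.\<close>

lemma whiskered_rest:
  assumes x: "x \<in> whiskered p a (Suc k)" and a: "a \<in> B p" and k: "k < p"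
  shows "x k Plus - at p a k Plus = x k Minus - at p a k Minus"
    and "pos (B k) (x k Minus - at p a k Minus)"
proof -
  note xc = whiskered_cl[OF x]
  have "x (Suc k) Plus = at p a (Suc k) Plus" using x by (simp add: whiskered_def)
  then have "x k Plus - x k Minus = at p a k Plus - at p a k Minus"
    using clD(3)[OF xc, of k Plus] at_facts(2)[OF a, of k Plus] by simp
  then show *: "x k Plus - at p a k Plus = x k Minus - at p a k Minus"
    by (simp add: algebra_simps)
  show "pos (B k) (x k Minus - at p a k Minus)"
  proof (rule pos_diffI)
    fix e
    have "cf (x k Plus) e - cf (at p a k Plus) e = cf (x k Minus) e - cf (at p a k Minus) e"
      using arg_cong[OF *, of "\<lambda>c. cf c e"] by (simp add: cf_simps)
    then show "cf (at p a k Minus) e \<le> cf (x k Minus) e"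
      using at_disjoint[OF a k, of e] clD(1)[OF xc, of k] by (auto simp: pos_iff) (metis diff_0_right diff_ge_0_iff_ge)
  qed (use clD(1)[OF xc] at_facts(1)[OF a] in auto)
qed

text \<open>The additional chain in degree 0 is positive of augmentation 0, hence zero: the first
  whiskers that matter are edges.\<close>

lemma whiskered_1:
  assumes x: "x \<in> whiskered p a (Suc 0)" and a: "a \<in> B p" and p: "0 < p"
  shows "x = at p a"
proof -
  note r = whiskered_rest[OF x a p]
  have "augmentation (x 0 Minus - at p a 0 Minus) = 0"
    using clD(4)[OF whiskered_cl[OF x]] unital[OF a] by (simp add: augmentation_diff)
  then have "x 0 Minus - at p a 0 Minus = 0" using augmentation_eq_0[OF r(2)] by blast
  then have "x 0 \<alpha> = at p a 0 \<alpha>" for \<alpha> using r(1) by (cases \<alpha>) auto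
  then have "x l = at p a l" for l using x by (cases l) (auto simp: whiskered_def fun_eq_iff)
  then show ?thesis by auto
qed

text \<open>The only entry of \<open>w\<close> that is not visible in the composite is its target in
  degree \<open>k\<close>, and this is the source plus the boundary of the entry in degree
  \<open>k + 1\<close>.\<close>

lemma kc_cancel:
  assumes cl: "h \<in> cl p" "w \<in> cl p" "h' \<in> cl p" "w' \<in> cl p"
    and "kcomp k h w" "kcomp k h' w'" and eq: "kc k h w = kc k h' w'"
    and above: "\<And>l. k < l \<Longrightarrow> w l = w' l"
  shows "h = h'" "w = w'"
proof -
  have e: "kc k h w l \<alpha> = kc k h' w' l \<alpha>" for l \<alpha> using eq by simp
  have wP: "w k Plus = w' k Plus"
    using clD(3)[OF cl(2), of k Plus] clD(3)[OF cl(4), of k Plus] above[of "Suc k"] e[of k Minus]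
    by (simp add: kc_simps)
  show "w = w'"
  proof (intro ext)
    fix l \<alpha>
    consider "l < k" | "l = k" | "k < l" by linarith
    then show "w l \<alpha> = w' l \<alpha>"
      using e[of l \<alpha>] e[of k Minus] wP above by cases (cases \<alpha>; auto simp: kc_def)+
  qed
  moreover show "h = h'"
  proof (intro ext)
    fix l \<alpha>
    consider "l < k" | "l = k" | "k < l" by linarith
    then show "h l \<alpha> = h' l \<alpha>"
      using e[of l \<alpha>] wP above assms(5,6) \<open>w = w'\<close>
      by cases (cases \<alpha>; auto simp: kc_def kcomp_iff)+
  qed
qed

lemma cl_zero_top: "x \<in> cl (Suc k) \<Longrightarrow> x (Suc k) Plus = 0 \<Longrightarrow> x \<in> cl k"
  using cl_top[of x "Suc k" "Suc k"] clD(2)[of x "Suc k"]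
  by (intro cl_lower[of x "Suc k" k]) (auto, metis Suc_lessI)

text \<open>\<open>whisker_form p a k u y v\<close>: the normal form \<open>u *\<^sub>k y *\<^sub>k v\<close> of a whiskered atom.\<close>

definition whisker_form :: "nat \<Rightarrow> (nat \<Rightarrow> nat) \<Rightarrow> nat \<Rightarrow> oriental_cell \<Rightarrow> oriental_cell \<Rightarrow> oriental_cell \<Rightarrow> bool"
  where "whisker_form p a k u y v \<longleftrightarrow> u \<in> cl (Suc k) \<and> y \<in> whiskered p a (Suc k) \<and> v \<in> cl (Suc k) \<and>
    kcomp k u y \<and> kcomp k y v \<and> (\<forall>c \<in> supp (u (Suc k) Plus). key p a < key (Suc k) c) \<and>
    (\<forall>c \<in> supp (v (Suc k) Plus). key (Suc k) c \<le> key p a)"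

text \<open>The chain \<open>Q\<close> that accompanies the atom in degree \<open>k + 1\<close> is
  divided by key: elements with key at most that of \<open>a\<close> go into \<open>v\<close>,
  before the atom, the others into \<open>u\<close>, after it.\<close>

lemma whisker_form_exists:
  assumes x: "x \<in> whiskered p a (Suc (Suc k))" and a: "a \<in> B p" and k: "Suc k < p"
  obtains u y v where "whisker_form p a k u y v" "x = kc k u (kc k y v)"
proof -
  let ?low = "\<lambda>c. key (Suc k) c \<le> key p a"
  note xc = whiskered_cl[OF x]
  have xl: "x l = at p a l" if "Suc k < l" for l using x that by (simp add: whiskered_def)
  define Q where "Q = x (Suc k) Minus - at p a (Suc k) Minus"
  have Q: "pos (B (Suc k)) Q" "x (Suc k) \<alpha> = Q + at p a (Suc k) \<alpha>" for \<alpha>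
    using whiskered_rest[OF x a k] by (cases \<alpha>; auto simp: Q_def algebra_simps)+
  define V where "V = chain_filter ?low Q"
  define M where "M = x k Minus + del k V"
  have Vp: "pos (B (Suc k)) V" "pos (B (Suc k)) (Q - V)"
    unfolding V_def using Q(1) by (auto intro: pos_filter pos_filter_diff)
  have Vkey: "\<And>c. c \<in> supp V \<Longrightarrow> ?low c" "\<And>c. c \<in> supp (Q - V) \<Longrightarrow> \<not> ?low c"
    by (auto simp: V_def in_keys_iff cf_simps split: if_splits)
  have atp: "pos (B l) (at p a l \<alpha>)" for l \<alpha> using at_facts[OF a] by auto
  have QV: "x (Suc k) \<alpha> - V = (Q - V) + at p a (Suc k) \<alpha>" for \<alpha> using Q(2) by simp
  have atd: "del k (at p a (Suc k) \<alpha>) = at p a k Plus - at p a k Minus" for \<alpha> using at_facts[OF a] by simp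
  \<comment> \<open>What \<open>V\<close> consumes has key below that of \<open>a\<close>, while the
    rest of \<open>Q\<close> and the atom produce only elements with larger keys.\<close>
  have M: "pos (B k) M" unfolding M_def
  proof (rule pos_del_middle[OF xc Vp(1)])
    show "pos (B (Suc k)) (x (Suc k) Plus - V)" unfolding QV using Vp(2) atp by (rule pos_add)
    fix e assume "cf (del k V) e < 0"
    then obtain c where "c \<in> supp V" "key k e < key (Suc k) c" using del_negD[OF Vp(1)] by blast
    then have e: "key k e < key p a" using Vkey(1)[of c] by simp
    assume "0 < cf (del k (x (Suc k) Plus - V)) e"
    then have "0 < cf (del k (Q - V)) e \<or> 0 < cf (at p a k Plus) e - cf (at p a k Minus) e"
      unfolding QV del_add atd by (auto simp: cf_simps)
    then show False
    proof
      assume "0 < cf (del k (Q - V)) e"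
      then obtain c where "c \<in> supp (Q - V)" "key (Suc k) c < key k e" using del_posD[OF Vp(2)] by blast
      then show False using Vkey(2)[of c] e by simp
    next
      assume "0 < cf (at p a k Plus) e - cf (at p a k Minus) e"
      then have "cf (at p a k Plus) e \<noteq> 0" using pos_nonneg[OF atp, of k Minus e] by auto
      then show False using at_key(1)[OF a, of k e] k e by simp
    qed
  qed
  define A where "A = (\<lambda>l (\<alpha>::sign). if l = Suc k then V else 0)"
  define v where "v = low k x A M"
  define x' where "x' = high k x A M"
  have "pos (B l) (A l \<alpha>)" "pos (B l) (x l \<alpha> - A l \<alpha>)" "del l (A (Suc l) \<alpha>) = A l Plus - A l Minus"
    if "k < l" for l \<alpha>
    using Vp(1) pos_add[OF Vp(2) atp[of "Suc k" \<alpha>], folded QV] clD(1)[OF xc] that by (auto simp: A_def)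
  moreover have "del k (A (Suc k) \<alpha>) = M - x k Minus" for \<alpha> by (simp add: A_def M_def)
  ultimately have sp: "v \<in> cl p" "x' \<in> cl p" "kcomp k x' v" "kc k x' v = x"
    using split_at[OF xc, of k A M] M unfolding v_def x'_def by blast+
  \<comment> \<open>The boundary directly after the atom; what remains above it is \<open>u\<close>,
    with top chain \<open>Q - V\<close>.\<close>
  define M' where "M' = M + del k (at p a (Suc k) Plus)"
  have x'k: "x' (Suc k) \<alpha> = (Q - V) + at p a (Suc k) \<alpha>" "x' k Minus = M" for \<alpha>
    using Q(2) by (auto simp: x'_def high_def A_def)
  have x'l: "x' l = at p a l" if "Suc k < l" for l
    using xl[OF that] that by (auto simp: x'_def high_def A_def fun_eq_iff)
  have M': "pos (B k) M'" unfolding M'_def x'k(2)[symmetric]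
  proof (rule pos_del_middle[OF sp(2)])
    fix e assume "cf (del k (at p a (Suc k) Plus)) e < 0"
    then have "cf (at p a k Minus) e \<noteq> 0" using pos_nonneg[OF atp, of k Plus e] by (auto simp: atd cf_simps)
    then have e: "key k e < key p a" using at_key(2)[OF a, of k e] k by simp
    assume "0 < cf (del k (x' (Suc k) Plus - at p a (Suc k) Plus)) e"
    then have "0 < cf (del k (Q - V)) e" by (simp add: x'k)
    then obtain c where "c \<in> supp (Q - V)" "key (Suc k) c < key k e" using del_posD[OF Vp(2)] by blast
    then show False using Vkey(2)[of c] e by simp
  qed (use Vp atp x'k in auto)
  define y where "y = low k x' (at p a) M'"
  define u where "u = high k x' (at p a) M'"
  have c1: "pos (B l) (at p a l \<alpha>)" for l \<alpha> by (rule atp)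
  have c2: "pos (B l) (x' l \<alpha> - at p a l \<alpha>)" if "k < l" for l \<alpha>
    using Vp(2) x'k(1) x'l that by (cases "l = Suc k") auto
  have c3: "del l (at p a (Suc l) \<alpha>) = at p a l Plus - at p a l Minus" for l \<alpha>
    using at_facts(2)[OF a] by blast
  have c4: "del k (at p a (Suc k) \<alpha>) = M' - x' k Minus" for \<alpha> by (simp add: M'_def atd x'k)
  note sp' = split_at[OF sp(2) c1 c2 c3 c4 M', folded y_def u_def]
  have u: "u (Suc k) \<alpha> = Q - V" for \<alpha> by (simp add: u_def high_def x'k)
  have "u \<in> cl (Suc k)" by (rule cl_lower[OF sp'(2)]) (use x'l in \<open>auto simp: u_def high_def\<close>)
  moreover have "v \<in> cl (Suc k)" by (rule cl_lower[OF sp(1)]) (auto simp: v_def low_def A_def)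
  moreover have "y \<in> whiskered p a (Suc k)"
    using sp'(1) by (auto simp: whiskered_def y_def low_def fun_eq_iff)
  moreover have "kcomp k y v" using sp(3) sp'(3,4) kcomp_kc_left by metis
  moreover have "x = kc k u (kc k y v)" using sp(4) sp'(4) kc_assoc by metis
  moreover have "v (Suc k) Plus = V" by (simp add: v_def low_def A_def)
  ultimately show ?thesis
    using that[of u y v] sp'(3) Vkey u by (auto simp: whisker_form_def not_le)
qed

text \<open>The keys separate the top chains of \<open>u\<close> and \<open>v\<close>, so that of
  \<open>v\<close> is recovered from the sum by filtering. Cancellation does the rest.\<close>

lemma whisker_form_unique:
  assumes f: "whisker_form p a k u y v" and f': "whisker_form p a k u' y' v'"
    and k: "Suc k < p" and eq: "kc k u (kc k y v) = kc k u' (kc k y' v')"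
  shows "u = u'" "y = y'" "v = v'"
proof -
  note F = f[unfolded whisker_form_def whiskered_def] f'[unfolded whisker_form_def whiskered_def]
  have c: "u \<in> cl p" "y \<in> cl p" "v \<in> cl p" "u' \<in> cl p" "y' \<in> cl p" "v' \<in> cl p"
    using F k by (auto intro: cl_mono)
  have kk: "kcomp k u (kc k y v)" "kcomp k u' (kc k y' v')" "kcomp k u y" "kcomp k y v"
    "kcomp k u' y'" "kcomp k y' v'" "kcomp k (kc k u y) v" "kcomp k (kc k u' y') v'"
    using F by (auto simp: kcomp_kc_right kcomp_kc_left)
  let ?K = "Suc k"
  have "u ?K Plus + (y ?K Plus + v ?K Plus) = u' ?K Plus + (y' ?K Plus + v' ?K Plus)"
    using fun_cong[OF fun_cong[OF eq], of ?K Plus] by (simp add: kc_simps)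
  then have uv: "u ?K Plus + v ?K Plus = u' ?K Plus + v' ?K Plus"
    using F by (auto simp: algebra_simps)
  have *: "chain_filter (\<lambda>c. key ?K c \<le> key p a) (u ?K Plus + v ?K Plus) = v ?K Plus"
    if "whisker_form p a k u y v" for u y v
  proof (rule chain_eqI)
    fix c
    show "cf (chain_filter (\<lambda>c. key ?K c \<le> key p a) (u ?K Plus + v ?K Plus)) c = cf (v ?K Plus) c"
    proof -
      have "cf (u ?K Plus) c \<noteq> 0 \<Longrightarrow> key p a < key ?K c" "cf (v ?K Plus) c \<noteq> 0 \<Longrightarrow> key ?K c \<le> key p a"
        using that by (auto simp: whisker_form_def in_keys_iff)
      then show ?thesis
        by (cases "cf (u ?K Plus) c = 0"; cases "cf (v ?K Plus) c = 0") (auto simp: cf_simps)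
    qed
  qed
  have vK: "v ?K Plus = v' ?K Plus" using *[OF f] *[OF f'] uv by simp
  have above: "v l = v' l" if "k < l" for l
  proof (cases "l = ?K")
    case True
    have "v \<in> cl ?K" "v' \<in> cl ?K" using F by blast+
    then have "v ?K \<alpha> = v' ?K \<alpha>" for \<alpha>
      using vK cl_top[of v ?K ?K \<alpha> Plus] cl_top[of v' ?K ?K \<alpha> Plus] by simp
    then show ?thesis using True by auto
  next
    case False
    then show ?thesis using F clD(2)[of v ?K l] clD(2)[of v' ?K l] that by (auto simp: fun_eq_iff)
  qed
  have eq2: "kc k (kc k u y) v = kc k (kc k u' y') v'" using eq by (simp add: kc_assoc)
  have cc: "kc k u y \<in> cl p" "kc k u' y' \<in> cl p" using kc_cl c kk by auto
  note r = kc_cancel[OF cc(1) c(3) cc(2) c(6) kk(7,8) eq2 above]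
  show "v = v'" using r by simp
  have yl: "y l = y' l" if "k < l" for l using F that by auto
  show "u = u'" "y = y'" using kc_cancel[OF c(1,2,4,5) kk(3,5) r(1) yl] by auto
qed

text \<open>A cell can be cut at any threshold \<open>t\<close>: elements with small keys consume
  nothing that elements with larger keys produce.\<close>

lemma top_split:
  assumes x: "x \<in> cl (Suc k)"
  obtains h w where "h \<in> cl (Suc k)" "w \<in> cl (Suc k)" "kcomp k h w" "x = kc k h w"
    "\<forall>c \<in> supp (h (Suc k) Plus). t < key (Suc k) c" "\<forall>c \<in> supp (w (Suc k) Plus). key (Suc k) c \<le> t"
proof -
  let ?P = "\<lambda>c. key (Suc k) c \<le> t"
  define A where "A = (\<lambda>l \<alpha>. if l = Suc k then chain_filter ?P (x l \<alpha>) else 0)"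
  define D where "D = chain_filter ?P (x (Suc k) Plus)"
  define M where "M = x k Minus + del k D"
  have top: "x (Suc k) \<alpha> = x (Suc k) Plus" for \<alpha> using cl_top[OF x, of "Suc k"] by simp
  have p: "pos (B (Suc k)) D" "pos (B (Suc k)) (x (Suc k) Plus - D)"
    using clD(1)[OF x] by (auto simp: D_def intro: pos_filter pos_filter_diff)
  have M: "pos (B k) M" unfolding M_def
  proof (rule pos_del_middle[OF x p])
    fix e assume "cf (del k D) e < 0" "0 < cf (del k (x (Suc k) Plus - D)) e"
    then obtain c c' where "c \<in> supp D" "key k e < key (Suc k) c"
      "c' \<in> supp (x (Suc k) Plus - D)" "key (Suc k) c' < key k e"
      using del_negD[OF p(1)] del_posD[OF p(2)] by metis
    then show False by (auto simp: D_def in_keys_iff cf_simps split: if_splits)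
  qed
  have c: "pos (B l) (A l \<alpha>)" "pos (B l) (x l \<alpha> - A l \<alpha>)" if "k < l" for l \<alpha>
    using clD(1)[OF x] that by (auto simp: A_def intro: pos_filter pos_filter_diff)
  have d: "del l (A (Suc l) \<alpha>) = A l Plus - A l Minus" if "k < l" for l \<alpha>
    using top[of Minus] that by (auto simp: A_def)
  have e: "del k (A (Suc k) \<alpha>) = M - x k Minus" for \<alpha> using top[of \<alpha>] by (simp add: A_def M_def D_def)
  note sp = split_at[OF x c d e M]
  have "\<forall>c \<in> supp (high k x A M (Suc k) Plus). t < key (Suc k) c"
    "\<forall>c \<in> supp (low k x A M (Suc k) Plus). key (Suc k) c \<le> t"
    by (auto simp: high_def low_def A_def in_keys_iff cf_simps split: if_splits)
  then show ?thesis using that[OF sp(2,1,3) sp(4)[symmetric]] by blast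
qed

end

section \<open>Extending a functor by one dimension\<close>

text \<open>Only the dimensions up to \<open>p\<close> are constrained, so that a functor can be
  built dimension by dimension and restricted without a change of type.\<close>

definition partial_functor ::
  "(nat \<Rightarrow> (nat \<Rightarrow> nat) set) \<Rightarrow> (nat \<Rightarrow> chain \<Rightarrow> chain) \<Rightarrow> 'a omega_struct \<Rightarrow> nat \<Rightarrow>
    (nat \<Rightarrow> oriental_cell \<Rightarrow> 'a) \<Rightarrow> bool" where
  "partial_functor B del C p G \<longleftrightarrow>
     (\<forall>q\<le>p. \<forall>x \<in> cx_cells B del q. G q x \<in> cells C q) \<and>
     (\<forall>q\<le>p. \<forall>k<q. \<forall>\<alpha>. \<forall>x \<in> cx_cells B del q. G k (oriental_bd k \<alpha> x) = bd C q k \<alpha> (G q x)) \<and>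
     (\<forall>q\<le>p. \<forall>k<q. \<forall>x \<in> cx_cells B del q. \<forall>y \<in> cx_cells B del q. kcomp k x y \<longrightarrow>
        G q (kc k x y) = cmp C q k (G q x) (G q y)) \<and>
     (\<forall>q\<le>p. \<forall>r<q. \<forall>x \<in> cx_cells B del r. G q x = idn C r q (G r x))"

lemma partial_functorD:
  assumes "partial_functor B del C p G" "q \<le> p"
  shows "x \<in> cx_cells B del q \<Longrightarrow> G q x \<in> cells C q"
    and "k < q \<Longrightarrow> x \<in> cx_cells B del q \<Longrightarrow> G k (oriental_bd k \<alpha> x) = bd C q k \<alpha> (G q x)"
    and "k < q \<Longrightarrow> x \<in> cx_cells B del q \<Longrightarrow> y \<in> cx_cells B del q \<Longrightarrow> kcomp k x y \<Longrightarrow>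
      G q (kc k x y) = cmp C q k (G q x) (G q y)"
    and "r < q \<Longrightarrow> x \<in> cx_cells B del r \<Longrightarrow> G q x = idn C r q (G r x)"
  using assms by (auto simp: partial_functor_def)

locale extension = steiner_complex B del key + C: omega_category C
  for B del key and C :: "'a omega_struct" +
  fixes p :: nat and G :: "nat \<Rightarrow> oriental_cell \<Rightarrow> 'a"
  assumes G: "partial_functor B del C p G"
begin

abbreviation "m \<equiv> cmp C (Suc p)"

definition "E u = idn C p (Suc p) (G p u)"

text \<open>A candidate value for \<open>x\<close>. Prescribing the boundary in codimension one is
  enough, since the lower ones follow by globularity (\<open>ok_bd\<close>).\<close>

definition ok :: "oriental_cell \<Rightarrow> 'a \<Rightarrow> bool" where
  "ok x w \<longleftrightarrow> x \<in> cl (Suc p) \<and> w \<in> cells C (Suc p) \<and> (\<forall>\<alpha>. bd C (Suc p) p \<alpha> w = G p (oriental_bd p \<alpha> x))"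

lemma okD: "ok x w \<Longrightarrow> x \<in> cl (Suc p)" "ok x w \<Longrightarrow> w \<in> cells C (Suc p)"
  by (auto simp: ok_def)

lemma ok_E: "u \<in> cl p \<Longrightarrow> ok u (E u)"
  using partial_functorD(1)[OF G, of p u]
  by (auto simp: ok_def E_def C.idn_cell C.bd_idn obd_id intro: cl_mono)

lemma ok_bd:
  assumes "ok x w" "k \<le> p"
  shows "bd C (Suc p) k \<alpha> w = G k (oriental_bd k \<alpha> x)"
proof (cases "k = p")
  case False
  then have k: "k < p" using assms by simp
  then have "bd C (Suc p) k \<alpha> w = bd C p k \<alpha> (bd C (Suc p) p Minus w)"
    using C.globular[of k p "Suc p" w \<alpha> Minus] assms by (auto simp: ok_def)
  also have "\<dots> = G k (oriental_bd k \<alpha> (oriental_bd p Minus x))"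
    using partial_functorD(2)[OF G order_refl k, of "oriental_bd p Minus x"] assms
    by (auto simp: ok_def obd_cl)
  finally show ?thesis using k by simp
qed (use assms in \<open>auto simp: ok_def\<close>)

lemma ok_composable: "ok x w \<Longrightarrow> ok y v \<Longrightarrow> kcomp k x y \<Longrightarrow> k \<le> p \<Longrightarrow> composable C (Suc p) k w v"
  using ok_bd[of x w k Minus] ok_bd[of y v k Plus] by (auto simp: composable_def okD kcomp_def)

lemma ok_kc:
  assumes x: "ok x w" and y: "ok y v" and c: "kcomp k x y" and k: "k \<le> p"
  shows "ok (kc k x y) (m k w v)"
proof -
  note cc = ok_composable[OF assms]
  have "bd C (Suc p) p \<alpha> (m k w v) = G p (oriental_bd p \<alpha> (kc k x y))" for \<alpha>
  proof (cases "k = p")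
    case True
    then show ?thesis
      using cc c ok_bd[OF x, of p \<alpha>] ok_bd[OF y, of p \<alpha>]
      by (cases \<alpha>) (auto simp: C.bd_cmp_source C.bd_cmp_target obd_kc)
  next
    case False
    then have k: "k < p" using k by simp
    then show ?thesis
      using C.bd_cmp_above[OF cc k, of \<alpha>] ok_bd[OF x, of p] ok_bd[OF y, of p] c
        partial_functorD(3)[OF G order_refl k, of "oriental_bd p \<alpha> x" "oriental_bd p \<alpha> y"]
        obd_cl[OF okD(1)[OF x]] obd_cl[OF okD(1)[OF y]]
      by (auto simp: obd_kc kcomp_obd)
  qed
  then show ?thesis using cc C.cmp_cell x y c by (auto simp: ok_def kc_cl)
qed

lemma E_low:
  assumes "u \<in> cl k" "k \<le> p"
  shows "E u = up C k (Suc p) (G k u)"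
proof (cases "k = p")
  case False
  then show ?thesis
    using partial_functorD(4)[OF G order_refl, of k u] partial_functorD(1)[OF G, of k u] assms
    by (auto simp: E_def up_def C.idn_idn)
qed (simp add: E_def up_def)

lemma E_unit_right:
  assumes "ok x w" "k \<le> p"
  shows "m k w (E (oriental_bd k Minus x)) = w"
  using C.unit_right[of k "Suc p" w] ok_bd[OF assms] E_low[OF obd_cl[of x "Suc p" k Minus]] assms
  by (auto simp: ok_def)

lemma E_unit_left:
  assumes "ok x w" "k \<le> p"
  shows "m k (E (oriental_bd k Plus x)) w = w"
  using C.unit_left[of k "Suc p" w] ok_bd[OF assms] E_low[OF obd_cl[of x "Suc p" k Plus]] assms
  by (auto simp: ok_def)

lemma E_kc:
  assumes "u \<in> cl p" "v \<in> cl p" "kcomp k u v" "k < p"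
  shows "E (kc k u v) = m k (E u) (E v)"
proof -
  have "composable C p k (G p u) (G p v)"
    using assms partial_functorD(1,2)[OF G order_refl] by (auto simp: composable_def kcomp_def) metis
  then show ?thesis
    using partial_functorD(3)[OF G order_refl, of k u v] assms by (simp add: E_def C.idn_cmp)
qed

lemma ok_assoc:
  assumes "ok x w" "ok y v" "ok z t" "kcomp k x y" "kcomp k y z" "k \<le> p"
  shows "m k w (m k v t) = m k (m k w v) t"
  by (rule C.assoc) (use assms in \<open>auto intro: ok_composable\<close>)

lemma kcomp_lower: "j < k \<Longrightarrow> kcomp k x' x \<Longrightarrow> kcomp k y' y \<Longrightarrow> kcomp j x y \<longleftrightarrow> kcomp j x' y'"
  unfolding kcomp_def by (metis obd_obd)

lemma ok_interchange:
  assumes "ok x' X'" "ok x X" "ok y' Y'" "ok y Y" "j < k" "k \<le> p" "kcomp k x' x" "kcomp k y' y" "kcomp j x y"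
  shows "m j (m k X' X) (m k Y' Y) = m k (m j X' Y') (m j X Y)"
  by (rule C.interchange) (use assms kcomp_lower[of j k x' x y' y] in \<open>auto intro: ok_composable\<close>)

text \<open>The whiskers have dimension \<open>k + 1\<close>, the least one in which composition
  along \<open>*\<^sub>k\<close> is not trivial. Thicker whiskers are reduced to these in
  \<open>HH_kc\<close>.\<close>

definition compatible :: "oriental_cell set \<Rightarrow> nat \<Rightarrow> (oriental_cell \<Rightarrow> 'a) \<Rightarrow> bool" where
  "compatible S k F \<longleftrightarrow> (\<forall>x \<in> S. \<forall>u \<in> cl (Suc k).
     (kcomp k u x \<longrightarrow> F (kc k u x) = m k (E u) (F x)) \<and> (kcomp k x u \<longrightarrow> F (kc k x u) = m k (F x) (E u)))"

lemma compatibleD: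
  assumes "compatible S k F" "x \<in> S" "u \<in> cl (Suc k)"
  shows "kcomp k u x \<Longrightarrow> F (kc k u x) = m k (E u) (F x)" "kcomp k x u \<Longrightarrow> F (kc k x u) = m k (F x) (E u)"
  using assms by (auto simp: compatible_def)

text \<open>Two cells that meet only along \<open>*\<^sub>j\<close> can be performed in either order
  along \<open>*\<^sub>k\<close>: by interchange with units both orders are the composite
  \<open>y1 *\<^sub>j s1\<close>. The next lemma is the same identity for values.\<close>

lemma exchange_chains:
  assumes "j < k" "kcomp k hs y1" "kcomp k s1 ly" "kcomp j y1 s1" "kcomp j hs s1" "kcomp j y1 ly"
    and "hs = oriental_bd k Plus y1" "ly = oriental_bd k Minus s1"
    and cl: "y1 \<in> cl q" "s1 \<in> cl q"
  shows "kc k (kc j hs s1) (kc j y1 ly) = kc j y1 s1"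
    and "kc j y1 s1 = kc k (kc j y1 (oriental_bd k Plus s1)) (kc j (oriental_bd k Minus y1) s1)"
    and "kcomp k (kc j y1 (oriental_bd k Plus s1)) (kc j (oriental_bd k Minus y1) s1)"
proof -
  have "kc j (kc k hs y1) (kc k s1 ly) = kc k (kc j hs s1) (kc j y1 ly)"
    by (rule kc_interchange) (use assms in auto)
  then show "kc k (kc j hs s1) (kc j y1 ly) = kc j y1 s1"
    using assms kc_unit_left[OF cl(1), of k] kc_unit_right[OF cl(2), of k] by simp
  have "kc j (kc k y1 (oriental_bd k Minus y1)) (kc k (oriental_bd k Plus s1) s1) =
    kc k (kc j y1 (oriental_bd k Plus s1)) (kc j (oriental_bd k Minus y1) s1)"
    by (rule kc_interchange) (use assms in \<open>auto simp: kcomp_unit kcomp_obd_left\<close>)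
  then show "kc j y1 s1 = kc k (kc j y1 (oriental_bd k Plus s1)) (kc j (oriental_bd k Minus y1) s1)"
    by (simp add: kc_unit_left[OF cl(2)] kc_unit_right[OF cl(1)])
  show "kcomp k (kc j y1 (oriental_bd k Plus s1)) (kc j (oriental_bd k Minus y1) s1)"
    using assms by (simp add: kcomp_def obd_kc)
qed

lemma exchange_values:
  assumes j: "j < k" "k \<le> p" and c: "kcomp j y1 s1" "kcomp j hs s1" "kcomp j y1 ly"
    and hs: "hs = oriental_bd k Plus y1" and ly: "ly = oriental_bd k Minus s1"
    and Y: "ok y1 Y" and S: "ok s1 S"
  shows "m k (m j (E hs) S) (m j Y (E ly)) =
    m k (m j Y (E (oriental_bd k Plus s1))) (m j (E (oriental_bd k Minus y1)) S)"
proof -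
  have cl: "oriental_bd k \<alpha> x \<in> cl p" if "ok x w" for \<alpha> x w
    using obd_cl[of x "Suc p" k] cl_mono[of _ k p] j that by (auto simp: okD)
  note okE = ok_E[OF cl]
  have "m j (m k (E hs) Y) (m k S (E ly)) = m k (m j (E hs) S) (m j Y (E ly))"
    by (rule ok_interchange[where x'=hs and x=y1 and y'=s1 and y=ly])
      (use c j Y S okE[OF Y] okE[OF S] in \<open>auto simp: hs ly kcomp_unit kcomp_obd_left\<close>)
  moreover have "m j (m k Y (E (oriental_bd k Minus y1))) (m k (E (oriental_bd k Plus s1)) S) =
    m k (m j Y (E (oriental_bd k Plus s1))) (m j (E (oriental_bd k Minus y1)) S)"
    by (rule ok_interchange[where x'=y1 and x="oriental_bd k Minus y1" and y'="oriental_bd k Plus s1" and y=s1])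
      (use c j Y S okE[OF Y] okE[OF S] in \<open>auto simp: kcomp_unit kcomp_obd_left\<close>)
  ultimately show ?thesis
    using j E_unit_left[OF Y] E_unit_left[OF S] E_unit_right[OF Y] E_unit_right[OF S] by (simp add: hs ly)
qed

text \<open>
  Cells \<open>s\<close> with small keys can be moved past a whiskered atom: cutting the common boundary \<open>w\<close> at the
  key of the atom separates the part touched by \<open>s\<close> from the part touched by the atom, so the
  composite along \<open>*\<^sub>k\<close> is also a composite along \<open>*\<^sub>k\<^sub>-\<^sub>1\<close>.
\<close>

lemma split_low:
  assumes a: "a \<in> B q" and k: "Suc j < q"
    and y: "y \<in> whiskered q a (Suc (Suc j))" and s: "s \<in> cl (Suc (Suc j))" and c: "kcomp (Suc j) s y"
    and keys: "\<forall>c \<in> supp (s (Suc (Suc j)) Plus). key (Suc (Suc j)) c \<le> key q a"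
  obtains hs s1 y1 ly where "s = kc j hs s1" "y = kc j y1 ly" "kcomp j hs s1" "kcomp j y1 ly" "kcomp j y1 s1"
    "hs = oriental_bd (Suc j) Plus y1" "ly = oriental_bd (Suc j) Minus s1"
    "y1 \<in> whiskered q a (Suc (Suc j))" "s1 \<in> cl (Suc (Suc j))" "s1 (Suc (Suc j)) = s (Suc (Suc j))"
proof -
  let ?k = "Suc j"
  have yc: "y \<in> cl q" by (rule whiskered_cl[OF y])
  define w where "w = y ?k Plus"
  have sw: "s ?k Minus = w" "\<And>l. l < ?k \<Longrightarrow> y l = s l" using c by (auto simp: kcomp_iff w_def)
  define S where "S = s (Suc ?k) Plus"
  have sS: "s (Suc ?k) \<alpha> = S" for \<alpha> using cl_top[OF s, of "Suc ?k"] by (simp add: S_def)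
  have Sp: "pos (B (Suc ?k)) S" using clD(1)[OF s] by (simp add: S_def)
  define wl where "wl = chain_filter (\<lambda>e. key ?k e \<le> key q a) w"
  have wp: "pos (B ?k) w" using clD(1)[OF yc] by (simp add: w_def)
  have wlp: "pos (B ?k) wl" "pos (B ?k) (w - wl)"
    unfolding wl_def using wp by (auto intro: pos_filter pos_filter_diff)
  define M where "M = y j Minus + del j wl"
  have bw: "oriental_bd ?k Plus y \<in> cl ?k" "oriental_bd ?k Plus y ?k Plus = w" "oriental_bd ?k Plus y j Minus = y j Minus"
    using obd_cl[OF yc] by (auto simp: oriental_bd_def w_def)
  have M: "pos (B j) M"
    unfolding M_def bw(3)[symmetric]
  proof (rule pos_del_middle[OF bw(1) wlp(1)], unfold bw(2))
    fix e assume "cf (del j wl) e < 0" "0 < cf (del j (w - wl)) e"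
    then obtain c c' where "c \<in> supp wl" "key j e < key ?k c" "c' \<in> supp (w - wl)" "key ?k c' < key j e"
      using del_negD[OF wlp(1)] del_posD[OF wlp(2)] by metis
    then show False by (auto simp: wl_def in_keys_iff cf_simps split: if_splits)
  qed (rule wlp(2))
  have sP: "s ?k Plus = w + del ?k S" using clD(3)[OF s, of ?k Plus] sw by (simp add: S_def)
  \<comment> \<open>\<open>s\<close> consumes only low elements: each of them has a key below that
    of some element of \<open>S\<close>, hence below that of \<open>a\<close>.\<close>
  have wS: "pos (B ?k) (wl + del ?k S)"
    unfolding pos_iff
  proof (intro allI conjI impI)
    fix e
    have *: "0 \<le> cf (w + del ?k S) e" using clD(1)[OF s, of ?k Plus] by (simp add: sP pos_nonneg)
    show "0 \<le> cf (wl + del ?k S) e"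
    proof (cases "key ?k e \<le> key q a")
      case True
      then show ?thesis using * by (simp add: wl_def cf_simps)
    next
      case False
      have "\<not> cf (del ?k S) e < 0"
      proof
        assume "cf (del ?k S) e < 0"
        then obtain c where "c \<in> supp S" "key ?k e < key (Suc ?k) c" using del_negD[OF Sp] by blast
        then show False using keys False by (auto simp: S_def)
      qed
      then show ?thesis using pos_nonneg[OF wlp(1), of e] by (simp add: cf_simps)
    qed
    assume "cf (wl + del ?k S) e \<noteq> 0"
    then have "e \<in> supp wl \<or> e \<in> supp (del ?k S)" by (auto simp: in_keys_iff cf_simps)
    then show "e \<in> B ?k" using pos_supp[OF wlp(1)] del_supp[OF pos_supp[OF Sp]] by blast
  qed
  \<comment> \<open>The action of \<open>s\<close> goes entirely into \<open>s1\<close>, on the low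
    half \<open>wl\<close>; on the high half \<open>hs\<close> is a unit.\<close>
  define A where "A = (\<lambda>l \<alpha>. if l = ?k then if \<alpha> = Minus then wl else wl + del ?k S else s l \<alpha>)"
  have c1: "pos (B l) (A l \<alpha>)" for l \<alpha> using wlp wS clD(1)[OF s] by (auto simp: A_def)
  have c2: "pos (B l) (s l \<alpha> - A l \<alpha>)" for l \<alpha> using wlp sP sw by (cases \<alpha>) (auto simp: A_def)
  have c3: "del l (A (Suc l) \<alpha>) = A l Plus - A l Minus" if "j < l" for l \<alpha>
    using that clD(3)[OF s, of l] clD(3)[OF s, of ?k Plus] sS by (auto simp: A_def)
  have dd: "del j (del ?k S) = 0" using del_del pos_supp[OF Sp] by blast
  have c4: "del j (A ?k \<alpha>) = M - s j Minus" for \<alpha> using sw(2)[of j] dd by (auto simp: A_def M_def del_add)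
  define s1 hs where "s1 = low j s A M" and "hs = high j s A M"
  note sp = split_at[OF s c1 c2 c3 c4 M, folded s1_def hs_def]
  define A' where "A' = (\<lambda>l (\<alpha>::sign). if l = ?k then wl else 0)"
  \<comment> \<open>The atom produces only elements with keys above its own, so the low part of
    \<open>w\<close> was already present in the source of \<open>y\<close>.\<close>
  have yM: "pos (B ?k) (y ?k Minus - wl)"
  proof (rule pos_diffI[OF clD(1)[OF yc] wlp(1)])
    fix e
    have d: "cf (y ?k Plus) e - cf (y ?k Minus) e = cf (at q a ?k Plus) e - cf (at q a ?k Minus) e"
      using arg_cong[OF whiskered_rest(1)[OF y a k], of "\<lambda>c. cf c e"] by (simp add: cf_simps)
    note n = pos_nonneg[OF at_facts(1)[OF a], of ?k Minus e] pos_nonneg[OF clD(1)[OF yc], of ?k Minus e]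
    show "cf wl e \<le> cf (y ?k Minus) e"
    proof (cases "key ?k e \<le> key q a")
      case True
      then have "cf (at q a ?k Plus) e = 0" using at_key(1)[OF a k, of e] by auto
      then show ?thesis using d n True by (simp add: wl_def w_def cf_simps)
    qed (use n in \<open>simp add: wl_def cf_simps\<close>)
  qed
  have d1: "pos (B l) (A' l \<alpha>)" for l \<alpha> using wlp by (auto simp: A'_def)
  have d2: "pos (B l) (y l \<alpha> - A' l \<alpha>)" for l \<alpha>
    using wlp yM clD(1)[OF yc] by (cases \<alpha>) (auto simp: A'_def w_def)
  have d3: "del l (A' (Suc l) \<alpha>) = A' l Plus - A' l Minus" if "j < l" for l \<alpha> using that by (simp add: A'_def)
  have d4: "del j (A' ?k \<alpha>) = M - y j Minus" for \<alpha> by (simp add: A'_def M_def)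
  define ly y1 where "ly = low j y A' M" and "y1 = high j y A' M"
  note sp' = split_at[OF yc d1 d2 d3 d4 M, folded ly_def y1_def]
  have hy: "hs = oriental_bd ?k Plus y1"
  proof (intro ext)
    fix l \<alpha>
    consider "l < j" | "l = j" | "l = ?k" | "?k < l" by linarith
    then show "hs l \<alpha> = oriental_bd ?k Plus y1 l \<alpha>"
      using sw(2)[of l] sw(1) sP
      by cases (cases \<alpha>; simp add: hs_def high_def y1_def oriental_bd_def A_def A'_def w_def[symmetric])+
  qed
  have ls: "ly = oriental_bd ?k Minus s1"
  proof (intro ext)
    fix l \<alpha>
    consider "l < j" | "l = j" | "l = ?k" | "?k < l" by linarith
    then show "ly l \<alpha> = oriental_bd ?k Minus s1 l \<alpha>"
      using sw(2)[of l] sw(1)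
      by cases (cases \<alpha>; simp add: ly_def low_def s1_def oriental_bd_def A_def A'_def w_def[symmetric])+
  qed
  have ys: "kcomp j y1 s1"
    using sw by (auto simp: kcomp_iff y1_def s1_def high_def low_def)
  have "y1 \<in> whiskered q a (Suc ?k)"
    using sp'(2) y by (auto simp: whiskered_def y1_def high_def A'_def fun_eq_iff)
  moreover have "s1 (Suc ?k) = s (Suc ?k)" by (auto simp: s1_def low_def A_def)
  ultimately show ?thesis
    using that[of hs s1 y1 ly] sp sp' hy ls ys by auto
qed

text \<open>The mirror image of \<open>split_low\<close>: now \<open>s\<close> comes before the atom
  and has the larger keys, so the low half of the common boundary belongs to the atom and the high
  half to \<open>s\<close>.\<close>

lemma split_high:
  assumes a: "a \<in> B q" and k: "Suc j < q"
    and y: "y \<in> whiskered q a (Suc (Suc j))" and s: "s \<in> cl (Suc (Suc j))" and c: "kcomp (Suc j) y s"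
    and keys: "\<forall>c \<in> supp (s (Suc (Suc j)) Plus). key q a < key (Suc (Suc j)) c"
  obtains hy s1 y1 ls where "s = kc j s1 ls" "y = kc j hy y1" "kcomp j s1 ls" "kcomp j hy y1" "kcomp j s1 y1"
    "hy = oriental_bd (Suc j) Plus s1" "ls = oriental_bd (Suc j) Minus y1"
    "y1 \<in> whiskered q a (Suc (Suc j))" "s1 \<in> cl (Suc (Suc j))" "s1 (Suc (Suc j)) = s (Suc (Suc j))"
proof -
  let ?k = "Suc j"
  have yc: "y \<in> cl q" by (rule whiskered_cl[OF y])
  define w where "w = y ?k Minus"
  have sw: "s ?k Plus = w" "\<And>l. l < ?k \<Longrightarrow> y l = s l" using c by (auto simp: kcomp_iff w_def)
  define S where "S = s (Suc ?k) Plus"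
  have sS: "s (Suc ?k) \<alpha> = S" for \<alpha> using cl_top[OF s, of "Suc ?k"] by (simp add: S_def)
  have Sp: "pos (B (Suc ?k)) S" using clD(1)[OF s] by (simp add: S_def)
  define wl where "wl = chain_filter (\<lambda>e. key ?k e \<le> key q a) w"
  have wp: "pos (B ?k) w" using clD(1)[OF yc] by (simp add: w_def)
  have wlp: "pos (B ?k) wl" "pos (B ?k) (w - wl)"
    unfolding wl_def using wp by (auto intro: pos_filter pos_filter_diff)
  define M where "M = y j Minus + del j wl"
  have bw: "oriental_bd ?k Minus y \<in> cl ?k" "oriental_bd ?k Minus y ?k Plus = w" "oriental_bd ?k Minus y j Minus = y j Minus"
    using obd_cl[OF yc] by (auto simp: oriental_bd_def w_def)
  have M: "pos (B j) M"
    unfolding M_def bw(3)[symmetric]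
  proof (rule pos_del_middle[OF bw(1) wlp(1)], unfold bw(2))
    fix e assume "cf (del j wl) e < 0" "0 < cf (del j (w - wl)) e"
    then obtain c c' where "c \<in> supp wl" "key j e < key ?k c" "c' \<in> supp (w - wl)" "key ?k c' < key j e"
      using del_negD[OF wlp(1)] del_posD[OF wlp(2)] by metis
    then show False by (auto simp: wl_def in_keys_iff cf_simps split: if_splits)
  qed (rule wlp(2))
  have sM: "s ?k Minus = w - del ?k S" using clD(3)[OF s, of ?k Plus] sw by (simp add: S_def algebra_simps)
  \<comment> \<open>Elements of \<open>S\<close> have keys above that of \<open>a\<close> and
    produce only elements with still larger keys, so the low part of \<open>w\<close> was present
    before \<open>s\<close>.\<close>
  have sMl: "pos (B ?k) (s ?k Minus - wl)"
  proof (rule pos_diffI[OF clD(1)[OF s] wlp(1)])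
    fix e
    have n: "0 \<le> cf (s ?k Minus) e" using clD(1)[OF s] by (rule pos_nonneg)
    show "cf wl e \<le> cf (s ?k Minus) e"
    proof (cases "key ?k e \<le> key q a")
      case True
      have "\<not> 0 < cf (del ?k S) e"
      proof
        assume "0 < cf (del ?k S) e"
        then obtain c where "c \<in> supp S" "key (Suc ?k) c < key ?k e" using del_posD[OF Sp] by blast
        then show False using keys True by (auto simp: S_def)
      qed
      then show ?thesis using True by (simp add: wl_def sM cf_simps)
    qed (use n in \<open>simp add: wl_def cf_simps\<close>)
  qed
  define A where "A = (\<lambda>l (\<alpha>::sign). if l = ?k then wl else 0)"
  have c1: "pos (B l) (A l \<alpha>)" for l \<alpha> using wlp by (auto simp: A_def)
  have c2: "pos (B l) (s l \<alpha> - A l \<alpha>)" for l \<alpha>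
    using wlp sMl sw clD(1)[OF s] by (cases \<alpha>) (auto simp: A_def)
  have c3: "del l (A (Suc l) \<alpha>) = A l Plus - A l Minus" if "j < l" for l \<alpha> using that by (simp add: A_def)
  have c4: "del j (A ?k \<alpha>) = M - s j Minus" for \<alpha> using sw(2)[of j] by (simp add: A_def M_def)
  define ls s1 where "ls = low j s A M" and "s1 = high j s A M"
  note sp = split_at[OF s c1 c2 c3 c4 M, folded s1_def ls_def]
  define A' where "A' = (\<lambda>l \<alpha>. if l = ?k then if \<alpha> = Minus then wl
    else wl - at q a ?k Minus + at q a ?k Plus else y l \<alpha>)"
  have d: "y ?k Plus = w - at q a ?k Minus + at q a ?k Plus"
    using whiskered_rest(1)[OF y a k] by (simp add: w_def algebra_simps)
  \<comment> \<open>The atom consumes only elements with keys below its own, and these are all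
    low.\<close>
  have yM: "pos (B ?k) (wl - at q a ?k Minus + at q a ?k Plus)"
    unfolding pos_iff
  proof (intro allI conjI impI)
    fix e
    note n = pos_nonneg[OF clD(1)[OF yc], of ?k Plus e] pos_nonneg[OF at_facts(1)[OF a], of ?k Plus e]
    show "0 \<le> cf (wl - at q a ?k Minus + at q a ?k Plus) e"
    proof (cases "key ?k e \<le> key q a")
      case True
      then show ?thesis using n(1) unfolding d by (simp add: wl_def cf_simps)
    next
      case False
      then have "cf (at q a ?k Minus) e = 0" using at_key(2)[OF a k, of e] by auto
      then show ?thesis using n False by (simp add: wl_def cf_simps)
    qed
    assume "cf (wl - at q a ?k Minus + at q a ?k Plus) e \<noteq> 0"
    then have "e \<in> supp wl \<or> e \<in> supp (at q a ?k Minus) \<or> e \<in> supp (at q a ?k Plus)"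
      by (auto simp: in_keys_iff cf_simps)
    then show "e \<in> B ?k" using pos_supp[OF wlp(1)] pos_supp[OF at_facts(1)[OF a]] by blast
  qed
  have yl: "y l = at q a l" if "?k < l" for l using y that by (auto simp: whiskered_def)
  have d1: "pos (B l) (A' l \<alpha>)" for l \<alpha> using wlp yM clD(1)[OF yc] by (auto simp: A'_def)
  have d2: "pos (B l) (y l \<alpha> - A' l \<alpha>)" for l \<alpha>
    using wlp d by (cases \<alpha>) (auto simp: A'_def w_def algebra_simps)
  have d3: "del l (A' (Suc l) \<alpha>) = A' l Plus - A' l Minus" if "j < l" for l \<alpha>
    using that clD(3)[OF yc] d by (auto simp: A'_def w_def)
  have dd: "del j (at q a ?k Plus) = del j (at q a ?k Minus)" using at_facts(2)[OF a] by simp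
  have d4: "del j (A' ?k \<alpha>) = M - y j Minus" for \<alpha> using dd by (simp add: A'_def M_def del_add del_diff)
  define y1 hy where "y1 = low j y A' M" and "hy = high j y A' M"
  note sp' = split_at[OF yc d1 d2 d3 d4 M, folded y1_def hy_def]
  have hs: "hy = oriental_bd ?k Plus s1"
  proof (intro ext)
    fix l \<alpha>
    consider "l < j" | "l = j" | "l = ?k" | "?k < l" by linarith
    then show "hy l \<alpha> = oriental_bd ?k Plus s1 l \<alpha>"
      using sw(2)[of l] sw(1) d
      by cases (cases \<alpha>; simp add: hy_def high_def s1_def oriental_bd_def A_def A'_def w_def[symmetric])+
  qed
  have ly: "ls = oriental_bd ?k Minus y1"
  proof (intro ext)
    fix l \<alpha>
    consider "l < j" | "l = j" | "l = ?k" | "?k < l" by linarith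
    then show "ls l \<alpha> = oriental_bd ?k Minus y1 l \<alpha>"
      using sw(2)[of l] sw(1)
      by cases (cases \<alpha>; simp add: ls_def low_def y1_def oriental_bd_def A_def A'_def w_def[symmetric])+
  qed
  have ys: "kcomp j s1 y1"
    using sw by (auto simp: kcomp_iff y1_def s1_def high_def low_def)
  have "y1 \<in> whiskered q a (Suc ?k)"
    using sp'(1) y by (auto simp: whiskered_def y1_def low_def A'_def fun_eq_iff)
  moreover have "s1 (Suc ?k) = s (Suc ?k)" by (auto simp: s1_def high_def A_def)
  ultimately show ?thesis
    using that[of s1 ls hy y1] sp sp' hs ly ys by auto
qed

end

section \<open>Edges: the bottom case of the exchange\<close>

context steiner_complex
begin

text \<open>Unitality of an edge says that both parts of its boundary have augmentation 1, so
  neither is zero.\<close>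

lemma edge_ends:
  assumes "c \<in> B (Suc 0)"
  shows "\<exists>e. cf (del 0 (frag_of c)) e < 0" "\<exists>e. 0 < cf (del 0 (frag_of c)) e"
proof -
  have *: "\<exists>e. 0 < cf d e" if "augmentation (positive_part d) = 1" for d
  proof (rule ccontr)
    assume "\<not> ?thesis"
    then have "positive_part d = 0" by (intro chain_eqI) (simp add: cf_simps not_less max_def)
    with that show False by simp
  qed
  show "\<exists>e. cf (del 0 (frag_of c)) e < 0"
    using *[of "- del 0 (frag_of c)"] unital[OF assms, of Minus] atom_step(2)[of 0 "Suc 0" del c]
    by (auto simp: cf_simps)
  show "\<exists>e. 0 < cf (del 0 (frag_of c)) e"
    using *[of "del 0 (frag_of c)"] unital[OF assms, of Plus] atom_step(1)[of 0 "Suc 0" del c]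
    by (auto simp: cf_simps)
qed

text \<open>The source of an edge with minimal key is not cancelled by the target of another edge.\<close>

lemma del0_source:
  assumes S: "pos (B (Suc 0)) S" and "S \<noteq> 0"
  obtains c e where "c \<in> supp S" "cf (del 0 S) e < 0" "key 0 e < key (Suc 0) c"
proof -
  have fin: "finite (supp S)" "supp S \<noteq> {}" using assms by auto
  obtain c where c: "c \<in> supp S" "\<And>c'. c' \<in> supp S \<Longrightarrow> key (Suc 0) c \<le> key (Suc 0) c'"
    using ex_min_if_finite[of "key (Suc 0) ` supp S"] fin by (auto simp: not_less)
  have cB: "c \<in> B (Suc 0)" using c(1) pos_supp[OF S] by blast
  then obtain e where e: "cf (del 0 (frag_of c)) e < 0" using edge_ends by blast
  have ke: "key 0 e < key (Suc 0) c" using key_source[OF cB e] .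
  have "cf (del 0 S) e = cf S c * cf (del 0 (frag_of c)) e + (\<Sum>a\<in>supp S - {c}. cf S a * cf (del 0 (frag_of a)) e)"
    by (subst cf_del) (rule sum.remove[OF fin(1) c(1)])
  moreover have "(\<Sum>a\<in>supp S - {c}. cf S a * cf (del 0 (frag_of a)) e) \<le> 0"
  proof (rule sum_nonpos)
    fix a assume a: "a \<in> supp S - {c}"
    then have "a \<in> B (Suc 0)" using pos_supp[OF S] by blast
    then have "\<not> 0 < cf (del 0 (frag_of a)) e" using key_target[of a 0 e] ke c(2)[of a] a by auto
    then show "cf S a * cf (del 0 (frag_of a)) e \<le> 0"
      using pos_nonneg[OF S, of a] by (simp add: mult_nonneg_nonpos)
  qed
  moreover have "cf S c * cf (del 0 (frag_of c)) e < 0"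
    using e c(1) pos_nonneg[OF S, of c] by (intro mult_pos_neg) (auto simp: in_keys_iff order.order_iff_strict)
  ultimately show ?thesis using that[OF c(1) _ ke] by simp
qed

lemma del0_target:
  assumes S: "pos (B (Suc 0)) S" and "S \<noteq> 0"
  obtains c e where "c \<in> supp S" "0 < cf (del 0 S) e" "key (Suc 0) c < key 0 e"
proof -
  have fin: "finite (supp S)" "supp S \<noteq> {}" using assms by auto
  obtain c where c: "c \<in> supp S" "\<And>c'. c' \<in> supp S \<Longrightarrow> key (Suc 0) c' \<le> key (Suc 0) c"
    using ex_min_if_finite[of "(\<lambda>c. - key (Suc 0) c) ` supp S"] fin by (auto simp: not_less)
  have cB: "c \<in> B (Suc 0)" using c(1) pos_supp[OF S] by blast
  then obtain e where e: "0 < cf (del 0 (frag_of c)) e" using edge_ends by blast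
  have ke: "key (Suc 0) c < key 0 e" using key_target[OF cB e] .
  have "cf (del 0 S) e = cf S c * cf (del 0 (frag_of c)) e + (\<Sum>a\<in>supp S - {c}. cf S a * cf (del 0 (frag_of a)) e)"
    by (subst cf_del) (rule sum.remove[OF fin(1) c(1)])
  moreover have "0 \<le> (\<Sum>a\<in>supp S - {c}. cf S a * cf (del 0 (frag_of a)) e)"
  proof (rule sum_nonneg)
    fix a assume a: "a \<in> supp S - {c}"
    then have "a \<in> B (Suc 0)" using pos_supp[OF S] by blast
    then have "\<not> cf (del 0 (frag_of a)) e < 0" using key_source[of a 0 e] ke c(2)[of a] a by auto
    then show "0 \<le> cf S a * cf (del 0 (frag_of a)) e"
      using pos_nonneg[OF S, of a] by simp
  qed
  moreover have "0 < cf S c * cf (del 0 (frag_of c)) e"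
    using e c(1) pos_nonneg[OF S, of c] by (intro mult_pos_pos) (auto simp: in_keys_iff order.order_iff_strict)
  ultimately show ?thesis using that[OF c(1) _ ke] by simp
qed

text \<open>Here the common boundary is the end of the atom and cannot be cut. If \<open>s\<close>
  had edges, one would start at that end, whose key exceeds that of \<open>a\<close>; but its key
  lies below that of the edge, which is at most that of \<open>a\<close>.\<close>

lemma no_edge_low:
  assumes a: "a \<in> B q" "0 < q" and y: "y \<in> whiskered q a (Suc 0)" and s: "s \<in> cl (Suc 0)" "kcomp 0 s y"
    and keys: "\<forall>c \<in> supp (s (Suc 0) Plus). key (Suc 0) c \<le> key q a"
  shows "s \<in> cl 0"
proof (rule cl_zero_top[OF s(1)], rule ccontr)
  assume "s (Suc 0) Plus \<noteq> 0"
  then obtain c e where ce: "c \<in> supp (s (Suc 0) Plus)" "cf (del 0 (s (Suc 0) Plus)) e < 0" "key 0 e < key (Suc 0) c"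
    using del0_source[OF clD(1)[OF s(1)]] by metis
  then have "cf (s 0 Plus) e < cf (s 0 Minus) e" using clD(3)[OF s(1), of 0 Plus] by (simp add: cf_simps)
  moreover have "0 \<le> cf (s 0 Plus) e" by (rule pos_nonneg[OF clD(1)[OF s(1)]])
  moreover have "s 0 Minus = at q a 0 Plus" using s(2) whiskered_1[OF y a] by (auto simp: kcomp_iff)
  ultimately have "key q a < key 0 e" using at_key(1)[OF a, of e] by auto
  then show False using ce keys by force
qed

lemma no_edge_high:
  assumes a: "a \<in> B q" "0 < q" and y: "y \<in> whiskered q a (Suc 0)" and s: "s \<in> cl (Suc 0)" "kcomp 0 y s"
    and keys: "\<forall>c \<in> supp (s (Suc 0) Plus). key q a < key (Suc 0) c"
  shows "s \<in> cl 0"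
proof (rule cl_zero_top[OF s(1)], rule ccontr)
  assume "s (Suc 0) Plus \<noteq> 0"
  then obtain c e where ce: "c \<in> supp (s (Suc 0) Plus)" "0 < cf (del 0 (s (Suc 0) Plus)) e" "key (Suc 0) c < key 0 e"
    using del0_target[OF clD(1)[OF s(1)]] by metis
  then have "cf (s 0 Minus) e < cf (s 0 Plus) e" using clD(3)[OF s(1), of 0 Plus] by (simp add: cf_simps)
  moreover have "0 \<le> cf (s 0 Minus) e" by (rule pos_nonneg[OF clD(1)[OF s(1)]])
  moreover have "s 0 Plus = at q a 0 Minus" using s(2) whiskered_1[OF y a] by (auto simp: kcomp_iff)
  ultimately have "key 0 e < key q a" using at_key(2)[OF a, of e] by auto
  then show False using ce keys by force
qed

lemma whiskered_kc:
  assumes "x \<in> whiskered q a (Suc j)" "u \<in> cl j" "j \<le> q" "k < j"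
  shows "kcomp k u x \<Longrightarrow> kc k u x \<in> whiskered q a (Suc j)" "kcomp k x u \<Longrightarrow> kc k x u \<in> whiskered q a (Suc j)"
proof -
  have "u \<in> cl q" using assms cl_mono by blast
  moreover have "u l \<alpha> = 0" if "Suc j \<le> l" for l \<alpha> using clD(2)[OF assms(2)] that by simp
  ultimately show "kcomp k u x \<Longrightarrow> kc k u x \<in> whiskered q a (Suc j)"
    "kcomp k x u \<Longrightarrow> kc k x u \<in> whiskered q a (Suc j)"
    using assms by (auto simp: whiskered_def kc_cl fun_eq_iff kc_simps)
qed

end

section \<open>Moving whiskers past an atom\<close>

context extension
begin

lemma compatible_E: "S \<subseteq> cl p \<Longrightarrow> j < p \<Longrightarrow> compatible S j E"
  unfolding compatible_def using cl_mono[of _ "Suc j" p] by (auto intro!: E_kc)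

text \<open>\<open>T\<close> and \<open>F\<close> are kept general because the moved cell may be a
  whisker, with \<open>F = E\<close>, or itself a whiskered atom, with \<open>F = HH b\<close> in
  \<open>elem_exchange\<close>. Fixing the top chain in \<open>T\<close> is harmless, as the
  exchange does not change it.\<close>

lemma exchange_low:
  assumes a: "a \<in> B (Suc p)" and k: "Suc j \<le> p"
    and H: "\<And>x. x \<in> whiskered (Suc p) a (Suc (Suc j)) \<Longrightarrow> ok x (H x)"
      "compatible (whiskered (Suc p) a (Suc (Suc j))) j H"
    and y: "y \<in> whiskered (Suc p) a (Suc (Suc j))" and s: "s \<in> cl (Suc (Suc j))" and c: "kcomp (Suc j) s y"
    and keys: "\<forall>c \<in> supp (s (Suc (Suc j)) Plus). key (Suc (Suc j)) c \<le> key (Suc p) a"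
    and T: "T = {s' \<in> cl (Suc (Suc j)). s' (Suc (Suc j)) = s (Suc (Suc j))}"
    and F: "\<And>s'. s' \<in> T \<Longrightarrow> ok s' (F s')" "compatible T j F"
  shows "\<exists>y' \<in> whiskered (Suc p) a (Suc (Suc j)). \<exists>s' \<in> T. kcomp (Suc j) y' s' \<and>
    kc (Suc j) s y = kc (Suc j) y' s' \<and> m (Suc j) (F s) (H y) = m (Suc j) (H y') (F s')"
proof -
  have k': "Suc j < Suc p" using k by simp
  from split_low[OF a k' y s c keys] obtain hs s1 y1 ly where
    sp: "s = kc j hs s1" "y = kc j y1 ly" "kcomp j hs s1" "kcomp j y1 ly" "kcomp j y1 s1"
    "hs = oriental_bd (Suc j) Plus y1" "ly = oriental_bd (Suc j) Minus s1"
    "y1 \<in> whiskered (Suc p) a (Suc (Suc j))" "s1 \<in> cl (Suc (Suc j))" "s1 (Suc (Suc j)) = s (Suc (Suc j))"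
    by metis
  have s1T: "s1 \<in> T" using sp T by auto
  have cl: "y1 \<in> cl (Suc p)" "s1 \<in> cl (Suc p)" using sp k cl_mono by (auto simp: whiskered_def)
  let ?y' = "kc j y1 (oriental_bd (Suc j) Plus s1)" and ?s' = "kc j (oriental_bd (Suc j) Minus y1) s1"
  have b: "oriental_bd (Suc j) Plus s1 \<in> cl (Suc j)" "oriental_bd (Suc j) Minus y1 \<in> cl (Suc j)"
    "hs \<in> cl (Suc j)" "ly \<in> cl (Suc j)"
    unfolding sp(6,7) using obd_cl[OF cl(1)] obd_cl[OF cl(2)] by auto
  have kk: "kcomp j y1 (oriental_bd (Suc j) Plus s1)" "kcomp j (oriental_bd (Suc j) Minus y1) s1"
    using sp(5) by (auto simp: kcomp_obd_left kcomp_obd_right)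
  have hk: "kcomp (Suc j) hs y1" "kcomp (Suc j) s1 ly" unfolding sp(6,7) by (auto simp: kcomp_unit)
  note ch = exchange_chains[OF lessI hk sp(5,3,4,6,7) cl]
  have "?y' \<in> whiskered (Suc p) a (Suc (Suc j))" using whiskered_kc[OF sp(8) b(1)] kk k by auto
  moreover have "?s' \<in> T"
    unfolding T using kc_cl[OF cl_mono[OF b(2)] sp(9) kk(2)] sp(10) clD(2)[OF b(2)]
    by (auto simp: kc_simps fun_eq_iff)
  moreover have "m (Suc j) (F s) (H y) = m (Suc j) (H ?y') (F ?s')"
    using exchange_values[OF lessI k sp(5,3,4,6,7) H(1)[OF sp(8)] F(1)[OF s1T]]
      compatibleD(1)[OF F(2) s1T b(3) sp(3)] compatibleD(2)[OF H(2) sp(8) b(4) sp(4)]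
      compatibleD(2)[OF H(2) sp(8) b(1) kk(1)] compatibleD(1)[OF F(2) s1T b(2) kk(2)]
    by (simp add: sp(1,2)[symmetric])
  ultimately show ?thesis using ch sp(1,2) by (metis (no_types, lifting))
qed

lemma exchange_high:
  assumes a: "a \<in> B (Suc p)" and k: "Suc (Suc j) \<le> p"
    and H: "\<And>x. x \<in> whiskered (Suc p) a (Suc (Suc j)) \<Longrightarrow> ok x (H x)"
      "compatible (whiskered (Suc p) a (Suc (Suc j))) j H"
    and y: "y \<in> whiskered (Suc p) a (Suc (Suc j))" and s: "s \<in> cl (Suc (Suc j))" and c: "kcomp (Suc j) y s"
    and keys: "\<forall>c \<in> supp (s (Suc (Suc j)) Plus). key (Suc p) a < key (Suc (Suc j)) c"
  shows "\<exists>y' \<in> whiskered (Suc p) a (Suc (Suc j)). \<exists>s' \<in> cl (Suc (Suc j)). s' (Suc (Suc j)) = s (Suc (Suc j)) \<and>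
    kcomp (Suc j) s' y' \<and> kc (Suc j) y s = kc (Suc j) s' y' \<and>
    m (Suc j) (H y) (E s) = m (Suc j) (E s') (H y')"
proof -
  have k': "Suc j < Suc p" "Suc j \<le> p" "j < p" using k by auto
  from split_high[OF a k'(1) y s c keys] obtain hy s1 y1 ls where
    sp: "s = kc j s1 ls" "y = kc j hy y1" "kcomp j s1 ls" "kcomp j hy y1" "kcomp j s1 y1"
    "hy = oriental_bd (Suc j) Plus s1" "ls = oriental_bd (Suc j) Minus y1"
    "y1 \<in> whiskered (Suc p) a (Suc (Suc j))" "s1 \<in> cl (Suc (Suc j))" "s1 (Suc (Suc j)) = s (Suc (Suc j))"
    by metis
  have cl: "s1 \<in> cl (Suc p)" "y1 \<in> cl (Suc p)" "s1 \<in> cl p" using sp k cl_mono by (auto simp: whiskered_def)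
  let ?s' = "kc j s1 (oriental_bd (Suc j) Plus y1)" and ?y' = "kc j (oriental_bd (Suc j) Minus s1) y1"
  have b: "oriental_bd (Suc j) Plus y1 \<in> cl (Suc j)" "oriental_bd (Suc j) Minus s1 \<in> cl (Suc j)"
    "hy \<in> cl (Suc j)" "ls \<in> cl (Suc j)"
    unfolding sp(6,7) using obd_cl[OF cl(1)] obd_cl[OF cl(2)] by auto
  have bp: "x \<in> cl (Suc j) \<Longrightarrow> x \<in> cl p" for x using k'(2) cl_mono by blast
  have kk: "kcomp j s1 (oriental_bd (Suc j) Plus y1)" "kcomp j (oriental_bd (Suc j) Minus s1) y1"
    using sp(5) by (auto simp: kcomp_obd_left kcomp_obd_right)
  have hk: "kcomp (Suc j) hy s1" "kcomp (Suc j) y1 ls" unfolding sp(6,7) by (auto simp: kcomp_unit)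
  note ch = exchange_chains[OF lessI hk sp(5,4,3,6,7) cl(1,2)]
  have "?y' \<in> whiskered (Suc p) a (Suc (Suc j))" using whiskered_kc[OF sp(8) b(2)] kk k by auto
  moreover have "?s' \<in> cl (Suc (Suc j))" "?s' (Suc (Suc j)) = s (Suc (Suc j))"
    using kc_cl[OF sp(9) cl_mono[OF b(1)] kk(1)] sp(10) clD(2)[OF b(1)]
    by (auto simp: kc_simps fun_eq_iff)
  moreover have "m (Suc j) (H y) (E s) = m (Suc j) (E ?s') (H ?y')"
    using exchange_values[OF lessI k'(2) sp(5,4,3,6,7) ok_E[OF cl(3)] H(1)[OF sp(8)]]
      compatibleD(1)[OF H(2) sp(8) b(3) sp(4)] compatibleD(1)[OF H(2) sp(8) b(2) kk(2)]
      E_kc[OF cl(3) bp[OF b(4)] sp(3) k'(3)] E_kc[OF cl(3) bp[OF b(1)] kk(1) k'(3)]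
    by (simp add: sp(1,2)[symmetric])
  ultimately show ?thesis using ch sp(1,2) by (metis (no_types, lifting))
qed

text \<open>The induction hypothesis for the valuation of a single atom. Whiskers of dimension
  \<open>k + 1\<close> stay within \<open>whiskered (Suc p) a j\<close> when
  \<open>k + 1 < j\<close>, whence the bound.\<close>

definition good :: "(nat \<Rightarrow> nat) \<Rightarrow> 'a \<Rightarrow> nat \<Rightarrow> (oriental_cell \<Rightarrow> 'a) \<Rightarrow> bool" where
  "good a g j H \<longleftrightarrow> H (at (Suc p) a) = g \<and> (\<forall>x \<in> whiskered (Suc p) a j. ok x (H x)) \<and>
     (\<forall>k. Suc (Suc k) \<le> j \<longrightarrow> compatible (whiskered (Suc p) a j) k H)"

lemma goodD:
  assumes "good a g j H"
  shows "H (at (Suc p) a) = g" "x \<in> whiskered (Suc p) a j \<Longrightarrow> ok x (H x)"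
    "Suc (Suc k) \<le> j \<Longrightarrow> compatible (whiskered (Suc p) a j) k H"
  using assms by (auto simp: good_def)

text \<open>For \<open>k = 0\<close> there is no lower dimension in which to exchange. There the
  whisker is a unit, and moving it replaces the unit at the target by the unit at the
  source.\<close>

lemma move_low:
  assumes a: "a \<in> B (Suc p)" and k: "Suc k \<le> p" and H: "good a g (Suc k) H"
    and y: "y \<in> whiskered (Suc p) a (Suc k)" and s: "s \<in> cl (Suc k)" and c: "kcomp k s y"
    and keys: "\<forall>c \<in> supp (s (Suc k) Plus). key (Suc k) c \<le> key (Suc p) a"
  obtains y' s' where "y' \<in> whiskered (Suc p) a (Suc k)" "s' \<in> cl (Suc k)" "s' (Suc k) = s (Suc k)"
    "kcomp k y' s'" "kc k s y = kc k y' s'" "m k (E s) (H y) = m k (H y') (E s')"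
proof (cases k)
  case 0
  have s0: "s \<in> cl 0" using no_edge_low[OF a, of y s] y s c keys 0 by simp
  then have e: "s = oriental_bd 0 Plus y" using c obd_id[of s 0 0 Minus] 0 by (simp add: kcomp_def)
  have y0: "oriental_bd 0 Minus y \<in> cl 0" using obd_cl[OF whiskered_cl[OF y]] by blast
  have "oriental_bd 0 Minus y (Suc k) = s (Suc k)"
    using clD(2)[OF s0] clD(2)[OF y0] by (auto simp: fun_eq_iff)
  then show ?thesis
    using that[of y "oriental_bd 0 Minus y"] y 0 e cl_mono[OF y0, of "Suc 0"]
      kc_unit_left[OF whiskered_cl[OF y], of 0] kc_unit_right[OF whiskered_cl[OF y], of 0] kcomp_unit
      E_unit_left[OF goodD(2)[OF H y], of 0] E_unit_right[OF goodD(2)[OF H y], of 0] by simp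
next
  case (Suc j)
  let ?T = "{s' \<in> cl (Suc (Suc j)). s' (Suc (Suc j)) = s (Suc (Suc j))}"
  have "?T \<subseteq> cl p" using cl_mono k Suc by blast
  then have T: "compatible ?T j E" "\<And>s'. s' \<in> ?T \<Longrightarrow> ok s' (E s')"
    using compatible_E k Suc ok_E by auto
  note A = assms[unfolded Suc]
  from exchange_low[OF A(1) Suc_leD[OF A(2)] goodD(2)[OF A(3)] goodD(3)[OF A(3) order_refl] A(4-7) refl T(2,1)]
  show ?thesis using that unfolding Suc by blast
qed

lemma move_high:
  assumes a: "a \<in> B (Suc p)" and k: "Suc k \<le> p" and H: "good a g (Suc k) H"
    and y: "y \<in> whiskered (Suc p) a (Suc k)" and s: "s \<in> cl (Suc k)" and c: "kcomp k y s"
    and keys: "\<forall>c \<in> supp (s (Suc k) Plus). key (Suc p) a < key (Suc k) c"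
  obtains y' s' where "y' \<in> whiskered (Suc p) a (Suc k)" "s' \<in> cl (Suc k)" "s' (Suc k) = s (Suc k)"
    "kcomp k s' y'" "kc k y s = kc k s' y'" "m k (H y) (E s) = m k (E s') (H y')"
proof (cases k)
  case 0
  have s0: "s \<in> cl 0" using no_edge_high[OF a, of y s] y s c keys 0 by simp
  then have e: "s = oriental_bd 0 Minus y" using c obd_id[of s 0 0 Plus] 0 by (simp add: kcomp_def)
  have y0: "oriental_bd 0 Plus y \<in> cl 0" using obd_cl[OF whiskered_cl[OF y]] by blast
  have "oriental_bd 0 Plus y (Suc k) = s (Suc k)"
    using clD(2)[OF s0] clD(2)[OF y0] by (auto simp: fun_eq_iff)
  then show ?thesis
    using that[of y "oriental_bd 0 Plus y"] y 0 e cl_mono[OF y0, of "Suc 0"]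
      kc_unit_left[OF whiskered_cl[OF y], of 0] kc_unit_right[OF whiskered_cl[OF y], of 0] kcomp_unit
      E_unit_left[OF goodD(2)[OF H y], of 0] E_unit_right[OF goodD(2)[OF H y], of 0] by simp
next
  case (Suc j)
  note A = assms[unfolded Suc]
  from exchange_high[OF A(1,2) goodD(2)[OF A(3)] goodD(3)[OF A(3) order_refl] A(4-7)]
  show ?thesis using that unfolding Suc by blast
qed

end

section \<open>Values on whiskered atoms\<close>

context extension
begin

lemma good_1:
  assumes a: "a \<in> B (Suc p)" and g: "ok (at (Suc p) a) g"
  shows "good a g (Suc 0) (\<lambda>_. g)"
  using whiskered_1[OF _ a] g by (auto simp: good_def)

lemma whisker_form_step:
  assumes f: "whisker_form q a k u y v" and k: "Suc k \<le> q"
  shows "kcomp k u (kc k y v)" "kc k u (kc k y v) \<in> whiskered q a (Suc (Suc k))"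
proof -
  note F = f[unfolded whisker_form_def]
  show c: "kcomp k u (kc k y v)" using F by (auto simp: kcomp_kc_right)
  have cl: "u \<in> cl q" "v \<in> cl q" "y \<in> cl q" using F k cl_mono by (auto simp: whiskered_def)
  have "kc k u (kc k y v) l \<alpha> = at q a l \<alpha>" if "Suc (Suc k) \<le> l" for l \<alpha>
    using F that clD(2)[of u "Suc k" l] clD(2)[of v "Suc k" l] by (auto simp: kc_simps whiskered_def)
  then show "kc k u (kc k y v) \<in> whiskered q a (Suc (Suc k))"
    using kc_cl[OF cl(1) kc_cl[OF cl(3,2)]] F c by (auto simp: whiskered_def)
qed

text \<open>A whisker of dimension at most \<open>k\<close> is its own square along
  \<open>*\<^sub>k\<close>, so by interchange it distributes over the three factors of the normal
  form.\<close>

lemma whisker_form_low: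
  assumes f: "whisker_form (Suc p) a k u y v" and k: "Suc k \<le> p" and j: "j < k" and w: "w \<in> cl (Suc j)"
  shows "kcomp j w (kc k u (kc k y v)) \<Longrightarrow> whisker_form (Suc p) a k (kc j w u) (kc j w y) (kc j w v) \<and>
      kc j w (kc k u (kc k y v)) = kc k (kc j w u) (kc k (kc j w y) (kc j w v)) \<and>
      kcomp j w u \<and> kcomp j w y \<and> kcomp j w v"
    and "kcomp j (kc k u (kc k y v)) w \<Longrightarrow> whisker_form (Suc p) a k (kc j u w) (kc j y w) (kc j v w) \<and>
      kc j (kc k u (kc k y v)) w = kc k (kc j u w) (kc k (kc j y w) (kc j v w)) \<and>
      kcomp j u w \<and> kcomp j y w \<and> kcomp j v w"
proof -
  note F = f[unfolded whisker_form_def]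
  have F': "u \<in> cl (Suc k)" "y \<in> whiskered (Suc p) a (Suc k)" "v \<in> cl (Suc k)" "kcomp k u y" "kcomp k y v"
    using F by auto
  have w': "w \<in> cl k" "w \<in> cl (Suc k)" using w j cl_mono by auto
  have ww: "oriental_bd k \<alpha> w = w" for \<alpha> using obd_id[OF w'(1)] by simp
  have wk: "kcomp k w w" by (simp add: kcomp_def ww)
  have wz: "w (Suc k) \<alpha> = 0" for \<alpha> using clD(2)[OF w'(1)] by simp
  have www: "kc k w w = w" using kc_unit_left[OF w'(2), of k] ww by simp
  have b: "oriental_bd j \<alpha> (kc k u (kc k y v)) = oriental_bd j \<alpha> u"
    "oriental_bd j \<alpha> y = oriental_bd j \<alpha> u" "oriental_bd j \<alpha> v = oriental_bd j \<alpha> u" for \<alpha>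
    using F' j obd_obd[OF j, of \<alpha> Minus u] obd_obd[OF j, of \<alpha> Plus y] obd_obd[OF j, of \<alpha> Minus y] obd_obd[OF j, of \<alpha> Plus v]
    by (auto simp: obd_kc kcomp_kc_right kcomp_def)
  {
    assume "kcomp j w (kc k u (kc k y v))"
    then have c: "kcomp j w u" "kcomp j w y" "kcomp j w v" using b by (auto simp: kcomp_def)
    have c2: "kcomp k (kc j w u) (kc j w y)" "kcomp k (kc j w y) (kc j w v)"
      using F' j by (auto simp: kcomp_def obd_kc ww)
    have e1: "kc j w (kc k y v) = kc k (kc j w y) (kc j w v)"
      using kc_interchange[OF j wk F'(5) c(3)] www by simp
    have "kc j w (kc k u (kc k y v)) = kc k (kc j w u) (kc j w (kc k y v))"
      using kc_interchange[OF j wk _ , of u "kc k y v"] F' www b c by (simp add: kcomp_kc_right kcomp_def obd_kc j)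
    moreover have "whisker_form (Suc p) a k (kc j w u) (kc j w y) (kc j w v)"
      using F c c2 j k w' whiskered_kc(1)[OF F'(2) w'(1) _ j] by (auto simp: whisker_form_def kc_cl kc_simps wz)
    ultimately show "whisker_form (Suc p) a k (kc j w u) (kc j w y) (kc j w v) \<and>
      kc j w (kc k u (kc k y v)) = kc k (kc j w u) (kc k (kc j w y) (kc j w v)) \<and>
      kcomp j w u \<and> kcomp j w y \<and> kcomp j w v" using c e1 by simp
  }
  {
    assume "kcomp j (kc k u (kc k y v)) w"
    then have c: "kcomp j u w" "kcomp j y w" "kcomp j v w" using b by (auto simp: kcomp_def)
    have c2: "kcomp k (kc j u w) (kc j y w)" "kcomp k (kc j y w) (kc j v w)"
      using F' j by (auto simp: kcomp_def obd_kc ww)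
    have e1: "kc j (kc k y v) w = kc k (kc j y w) (kc j v w)"
      using kc_interchange[OF j F'(5) wk c(3)] www by simp
    have "kc j (kc k u (kc k y v)) w = kc k (kc j u w) (kc j (kc k y v) w)"
      using kc_interchange[OF j _ wk, of u "kc k y v"] F' www b c by (simp add: kcomp_kc_right kcomp_def obd_kc j)
    moreover have "whisker_form (Suc p) a k (kc j u w) (kc j y w) (kc j v w)"
      using F c c2 j k w' whiskered_kc(2)[OF F'(2) w'(1) _ j] by (auto simp: whisker_form_def kc_cl kc_simps wz)
    ultimately show "whisker_form (Suc p) a k (kc j u w) (kc j y w) (kc j v w) \<and>
      kc j (kc k u (kc k y v)) w = kc k (kc j u w) (kc k (kc j y w) (kc j v w)) \<and>
      kcomp j u w \<and> kcomp j y w \<and> kcomp j v w" using c e1 by simp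
  }
qed

text \<open>The normal form dictates the value in the next dimension. Whiskering may spoil the
  normal form; restoring it takes exchanges that \<open>H\<close> already respects.\<close>

lemma good_step:
  assumes a: "a \<in> B (Suc p)" and k: "Suc k \<le> p" and H: "good a g (Suc k) H"
  shows "\<exists>H'. good a g (Suc (Suc k)) H'"
proof -
  let ?W = "whiskered (Suc p) a" and ?F = "whisker_form (Suc p) a k"
  have k': "Suc k < Suc p" "k \<le> p" "k < p" using k by auto
  \<comment> \<open>The value is taken from some normal form; uniqueness of the normal form makes
    the choice immaterial.\<close>
  define P where "P x t \<longleftrightarrow> (\<exists>u y v. ?F u y v \<and> x = kc k u (kc k y v) \<and> t = m k (E u) (m k (H y) (E v)))" for x t
  define H' where "H' x = (SOME t. P x t)" for x
  have val: "H' (kc k u (kc k y v)) = m k (E u) (m k (H y) (E v))" if f: "?F u y v" for u y v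
  proof -
    have "P (kc k u (kc k y v)) (H' (kc k u (kc k y v)))" unfolding H'_def
      by (rule someI[of _ "m k (E u) (m k (H y) (E v))"]) (use f P_def in blast)
    then show ?thesis unfolding P_def using whisker_form_unique[OF f _ k'(1)] by metis
  qed
  have cp: "x \<in> cl (Suc k) \<Longrightarrow> x \<in> cl p" for x using k cl_mono by blast
  have oks: "ok u (E u)" "ok y (H y)" "ok v (E v)" "ok (kc k y v) (m k (H y) (E v))"
    "ok (kc k u (kc k y v)) (m k (E u) (m k (H y) (E v)))" if f: "?F u y v" for u y v
  proof -
    note F = f[unfolded whisker_form_def]
    show 1: "ok u (E u)" "ok y (H y)" "ok v (E v)" using F cp ok_E goodD(2)[OF H] by auto
    show 2: "ok (kc k y v) (m k (H y) (E v))" using ok_kc[OF 1(2,3) _ k'(2)] F by blast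
    show "ok (kc k u (kc k y v)) (m k (E u) (m k (H y) (E v)))"
      using ok_kc[OF 1(1) 2 _ k'(2)] whisker_form_step(1)[OF f] k by simp
  qed
  have okH': "ok x (H' x)" if x: "x \<in> ?W (Suc (Suc k))" for x
  proof -
    obtain u y v where "?F u y v" "x = kc k u (kc k y v)" using whisker_form_exists[OF x a k'(1)] .
    then show ?thesis using oks(5) val by simp
  qed
  have atH': "H' (at (Suc p) a) = g"
  proof -
    let ?x = "at (Suc p) a"
    have xc: "?x \<in> cl (Suc p)" using at_cl[OF a] .
    have bc: "oriental_bd k \<alpha> ?x \<in> cl k" for \<alpha> using obd_cl[OF xc] .
    have f: "?F (oriental_bd k Plus ?x) ?x (oriental_bd k Minus ?x)"
      using bc[THEN cl_mono, of "Suc k"] clD(2)[OF bc] at_whiskered[OF a] kcomp_unit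
      by (auto simp: whisker_form_def)
    have "kc k ?x (oriental_bd k Minus ?x) = ?x" "kc k (oriental_bd k Plus ?x) ?x = ?x"
      using kc_unit_right[OF xc] kc_unit_left[OF xc] by auto
    then show ?thesis
      using val[OF f] oks(2)[OF f] E_unit_left[OF oks(2)[OF f] k'(2)] E_unit_right[OF oks(2)[OF f] k'(2)] goodD(1)[OF H]
      by simp
  qed
  have left: "H' (kc k w x) = m k (E w) (H' x)" if x: "x \<in> ?W (Suc (Suc k))" and w: "w \<in> cl (Suc k)" "kcomp k w x" for x w
  proof -
    obtain u y v where f: "?F u y v" "x = kc k u (kc k y v)" using whisker_form_exists[OF x a k'(1)] .
    note F = f(1)[unfolded whisker_form_def]
    have cc: "kcomp k u y" "kcomp k y v" "u \<in> cl (Suc k)" "v \<in> cl (Suc k)" "y \<in> ?W (Suc k)" using F by auto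
    have wu: "kcomp k w u" using w f cc by (simp add: kcomp_kc_right)
    \<comment> \<open>The composite of \<open>w\<close> and \<open>u\<close> may contain keys up to
      that of \<open>a\<close>. It is cut there, and its lower part \<open>s\<close> is moved past
      \<open>y\<close> into \<open>v\<close>.\<close>
    obtain h s where hs: "h \<in> cl (Suc k)" "s \<in> cl (Suc k)" "kcomp k h s" "kc k w u = kc k h s"
      "\<forall>c \<in> supp (h (Suc k) Plus). key (Suc p) a < key (Suc k) c" "\<forall>c \<in> supp (s (Suc k) Plus). key (Suc k) c \<le> key (Suc p) a"
      using top_split[OF kc_cl[OF w(1) cc(3) wu], of "key (Suc p) a"] by metis
    have sy: "kcomp k s y" using cc(1) wu hs(3,4) kcomp_kc_left by metis
    obtain y' s' where ys: "y' \<in> ?W (Suc k)" "s' \<in> cl (Suc k)" "s' (Suc k) = s (Suc k)" "kcomp k y' s'"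
      "kc k s y = kc k y' s'" "m k (E s) (H y) = m k (H y') (E s')"
      using move_low[OF a k H cc(5) hs(2) sy hs(6)] by metis
    have s'v: "kcomp k s' v" using cc(2) sy ys(4,5) kcomp_kc_left by metis
    have hy': "kcomp k h y'" using hs(3) sy ys(4,5) kcomp_kc_right by metis
    have y's'v: "kcomp k y' (kc k s' v)" using ys(4) s'v by (simp add: kcomp_kc_right)
    have f': "?F h y' (kc k s' v)"
      using hs ys cc s'v hy' y's'v F kc_cl[OF ys(2) cc(4) s'v] Poly_Mapping.keys_add[of "s (Suc k) Plus" "v (Suc k) Plus"]
      by (fastforce simp: whisker_form_def kc_simps)
    have e: "kc k w x = kc k h (kc k y' (kc k s' v))"
      by (metis f(2) kc_assoc hs(4) ys(5))
    have o: "ok w (E w)" "ok u (E u)" "ok y (H y)" "ok v (E v)" "ok h (E h)" "ok s (E s)" "ok y' (H y')" "ok s' (E s')"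
      using ok_E[OF cp] w cc hs ys goodD(2)[OF H] by auto
    have "m k (E w) (H' x) = m k (E w) (m k (E u) (m k (H y) (E v)))" using val[OF f(1)] f(2) by simp
    also have "\<dots> = m k (m k (E w) (E u)) (m k (H y) (E v))"
      by (rule ok_assoc[OF o(1,2) oks(4)[OF f(1)] wu _ k'(2)]) (use cc in \<open>simp add: kcomp_kc_right\<close>)
    also have "m k (E w) (E u) = m k (E h) (E s)"
      using E_kc[OF cp[OF w(1)] cp[OF cc(3)] wu k'(3)] E_kc[OF cp[OF hs(1)] cp[OF hs(2)] hs(3) k'(3)] hs(4) by simp
    also have "m k (m k (E h) (E s)) (m k (H y) (E v)) = m k (E h) (m k (E s) (m k (H y) (E v)))"
      by (rule ok_assoc[OF o(5,6) oks(4)[OF f(1)] hs(3) _ k'(2), symmetric]) (use cc sy in \<open>simp add: kcomp_kc_right\<close>)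
    also have "m k (E s) (m k (H y) (E v)) = m k (m k (E s) (H y)) (E v)"
      by (rule ok_assoc[OF o(6,3,4) sy cc(2) k'(2)])
    also have "\<dots> = m k (H y') (m k (E s') (E v))"
      unfolding ys(6) by (rule ok_assoc[OF o(7,8,4) ys(4) s'v k'(2), symmetric])
    also have "m k (E s') (E v) = E (kc k s' v)"
      using E_kc[OF cp[OF ys(2)] cp[OF cc(4)] s'v k'(3)] by simp
    finally show ?thesis using val[OF f'] e by simp
  qed
  have right: "H' (kc k x w) = m k (H' x) (E w)" if x: "x \<in> ?W (Suc (Suc k))" and w: "w \<in> cl (Suc k)" "kcomp k x w" for x w
  proof -
    obtain u y v where f: "?F u y v" "x = kc k u (kc k y v)" using whisker_form_exists[OF x a k'(1)] .
    note F = f(1)[unfolded whisker_form_def]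
    have cc: "kcomp k u y" "kcomp k y v" "u \<in> cl (Suc k)" "v \<in> cl (Suc k)" "y \<in> ?W (Suc k)" using F by auto
    have yv: "kcomp k u (kc k y v)" using cc by (simp add: kcomp_kc_right)
    have vw: "kcomp k v w" using w f cc yv by (simp add: kcomp_kc_left)
    \<comment> \<open>Symmetrically, the part \<open>h\<close> of the composite of \<open>v\<close>
      and \<open>w\<close> with keys above that of \<open>a\<close> is moved past \<open>y\<close>
      into \<open>u\<close>.\<close>
    obtain h s where hs: "h \<in> cl (Suc k)" "s \<in> cl (Suc k)" "kcomp k h s" "kc k v w = kc k h s"
      "\<forall>c \<in> supp (h (Suc k) Plus). key (Suc p) a < key (Suc k) c" "\<forall>c \<in> supp (s (Suc k) Plus). key (Suc k) c \<le> key (Suc p) a"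
      using top_split[OF kc_cl[OF cc(4) w(1) vw], of "key (Suc p) a"] by metis
    have yh: "kcomp k y h" using cc(2) vw hs(3,4) kcomp_kc_right by metis
    obtain y' h' where ys: "y' \<in> ?W (Suc k)" "h' \<in> cl (Suc k)" "h' (Suc k) = h (Suc k)" "kcomp k h' y'"
      "kc k y h = kc k h' y'" "m k (H y) (E h) = m k (E h') (H y')"
      using move_high[OF a k H cc(5) hs(1) yh hs(5)] by metis
    have uh': "kcomp k u h'" using cc(1) yh ys(4,5) kcomp_kc_right by metis
    have y's: "kcomp k y' s" using hs(3) yh ys(4,5) kcomp_kc_left by metis
    have uh'y': "kcomp k (kc k u h') y'" using ys(4) uh' by (simp add: kcomp_kc_left)
    have f': "?F (kc k u h') y' s"
      using hs ys cc uh' y's uh'y' F kc_cl[OF cc(3) ys(2) uh'] Poly_Mapping.keys_add[of "u (Suc k) Plus" "h (Suc k) Plus"]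
      by (fastforce simp: whisker_form_def kc_simps)
    have e: "kc k x w = kc k (kc k u h') (kc k y' s)"
      by (metis f(2) kc_assoc hs(4) ys(5))
    have o: "ok w (E w)" "ok u (E u)" "ok y (H y)" "ok v (E v)" "ok h (E h)" "ok s (E s)" "ok y' (H y')" "ok h' (E h')"
      using ok_E[OF cp] w cc hs ys goodD(2)[OF H] by auto
    have "m k (H' x) (E w) = m k (m k (E u) (m k (H y) (E v))) (E w)" using val[OF f(1)] f(2) by simp
    also have "\<dots> = m k (E u) (m k (m k (H y) (E v)) (E w))"
      by (rule ok_assoc[OF o(2) oks(4)[OF f(1)] o(1) yv _ k'(2), symmetric]) (use vw cc in \<open>simp add: kcomp_kc_left\<close>)
    also have "m k (m k (H y) (E v)) (E w) = m k (H y) (m k (E v) (E w))"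
      by (rule ok_assoc[OF o(3,4,1) cc(2) vw k'(2), symmetric])
    also have "m k (E v) (E w) = m k (E h) (E s)"
      using E_kc[OF cp[OF cc(4)] cp[OF w(1)] vw k'(3)] E_kc[OF cp[OF hs(1)] cp[OF hs(2)] hs(3) k'(3)] hs(4) by simp
    also have "m k (H y) (m k (E h) (E s)) = m k (m k (H y) (E h)) (E s)"
      by (rule ok_assoc[OF o(3,5,6) yh hs(3) k'(2)])
    also have "\<dots> = m k (E h') (m k (H y') (E s))"
      unfolding ys(6) by (rule ok_assoc[OF o(8,7,6) ys(4) y's k'(2), symmetric])
    also have "m k (E u) (m k (E h') (m k (H y') (E s))) = m k (m k (E u) (E h')) (m k (H y') (E s))"
      by (rule ok_assoc[OF o(2,8) ok_kc[OF o(7,6) y's k'(2)] uh' _ k'(2)]) (use ys y's in \<open>simp add: kcomp_kc_right\<close>)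
    also have "m k (E u) (E h') = E (kc k u h')"
      using E_kc[OF cp[OF cc(3)] cp[OF ys(2)] uh' k'(3)] by simp
    finally show ?thesis using val[OF f'] e by simp
  qed
  \<comment> \<open>Whiskers of lower dimension distribute over the normal form, and
    \<open>H\<close> respects them by hypothesis.\<close>
  have lower: "(kcomp j w x \<longrightarrow> H' (kc j w x) = m j (E w) (H' x)) \<and> (kcomp j x w \<longrightarrow> H' (kc j x w) = m j (H' x) (E w))"
    if j: "j < k" and x: "x \<in> ?W (Suc (Suc k))" and w: "w \<in> cl (Suc j)" for j x w
  proof -
    obtain u y v where f: "?F u y v" "x = kc k u (kc k y v)" using whisker_form_exists[OF x a k'(1)] .
    note F = f(1)[unfolded whisker_form_def]
    have cc: "kcomp k u y" "kcomp k y v" "u \<in> cl (Suc k)" "v \<in> cl (Suc k)" "y \<in> ?W (Suc k)" using F by auto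
    note o = oks[OF f(1)]
    have wc: "w \<in> cl k" "w \<in> cl p" using w j k cl_mono by auto
    have ow: "ok w (E w)" using ok_E[OF wc(2)] .
    have ww: "oriental_bd k \<alpha> w = w" for \<alpha> using obd_id[OF wc(1)] by simp
    have wk: "kcomp k w w" by (simp add: kcomp_def ww)
    have www: "m k (E w) (E w) = E w" using E_unit_left[OF ow k'(2)] ww by simp
    have jp: "j < p" using j k by simp
    have cj: "compatible (?W (Suc k)) j H" using goodD(3)[OF H] j by simp
    note c1 = compatibleD[OF cj cc(5) w]
    have yv: "kcomp k u (kc k y v)" using cc by (simp add: kcomp_kc_right)
    show ?thesis
    proof (intro conjI impI)
      assume c: "kcomp j w x"
      from whisker_form_low(1)[OF f(1) k j w c[unfolded f(2)]] have
        n: "?F (kc j w u) (kc j w y) (kc j w v)" "kc j w x = kc k (kc j w u) (kc k (kc j w y) (kc j w v))"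
        "kcomp j w u" "kcomp j w y" "kcomp j w v" using f(2) by auto
      have yvw: "kcomp j w (kc k y v)" using n(5) obd_kc(2)[OF j cc(2), of Plus] by (simp only: kcomp_def)
      have "m j (E w) (m k (H y) (E v)) = m k (m j (E w) (H y)) (m j (E w) (E v))"
        using ok_interchange[OF ow ow o(2,3) j k'(2) wk cc(2) n(5)] www by simp
      moreover have "m j (E w) (m k (E u) (m k (H y) (E v))) = m k (m j (E w) (E u)) (m j (E w) (m k (H y) (E v)))"
        using ok_interchange[OF ow ow o(1,4) j k'(2) wk yv yvw] www by simp
      ultimately show "H' (kc j w x) = m j (E w) (H' x)"
        using val[OF n(1)] val[OF f(1)] c1(1)[OF n(4)] E_kc[OF wc(2) cp[OF cc(3)] n(3) jp]
          E_kc[OF wc(2) cp[OF cc(4)] n(5) jp] n(2) f(2) by simp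
    next
      assume c: "kcomp j x w"
      from whisker_form_low(2)[OF f(1) k j w c[unfolded f(2)]] have
        n: "?F (kc j u w) (kc j y w) (kc j v w)" "kc j x w = kc k (kc j u w) (kc k (kc j y w) (kc j v w))"
        "kcomp j u w" "kcomp j y w" "kcomp j v w" using f(2) by auto
      have yvw: "kcomp j (kc k y v) w" using n(5) obd_kc(2)[OF j cc(2)] by (simp add: kcomp_def)
      have "m j (m k (H y) (E v)) (E w) = m k (m j (H y) (E w)) (m j (E v) (E w))"
        using ok_interchange[OF o(2,3) ow ow j k'(2) cc(2) wk n(5)] www by simp
      moreover have "m j (m k (E u) (m k (H y) (E v))) (E w) = m k (m j (E u) (E w)) (m j (m k (H y) (E v)) (E w))"
        using ok_interchange[OF o(1,4) ow ow j k'(2) yv wk yvw] www by simp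
      ultimately show "H' (kc j x w) = m j (H' x) (E w)"
        using val[OF n(1)] val[OF f(1)] c1(2)[OF n(4)] E_kc[OF cp[OF cc(3)] wc(2) n(3) jp]
          E_kc[OF cp[OF cc(4)] wc(2) n(5) jp] n(2) f(2) by simp
    qed
  qed
  have "compatible (?W (Suc (Suc k))) j H'" if "Suc (Suc j) \<le> Suc (Suc k)" for j
    unfolding compatible_def using left right lower that by (cases "j = k") auto
  then have "good a g (Suc (Suc k)) H'" using atH' okH' by (auto simp: good_def)
  then show ?thesis by blast
qed

lemma good_exists:
  assumes a: "a \<in> B (Suc p)" and g: "ok (at (Suc p) a) g"
  shows "\<exists>H. good a g (Suc p) H"
proof -
  have "k \<le> p \<Longrightarrow> \<exists>H. good a g (Suc k) H" for k
    by (induction k) (use good_1[OF a g] good_step[OF a] in auto)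
  then show ?thesis by blast
qed

end

section \<open>Decomposition of cells into whiskered atoms\<close>

context steiner_complex
begin

text \<open>An element of least key can always be split off first: what it consumes has a smaller
  key than itself, and what the others produce has a larger one.\<close>

lemma take_min:
  assumes x: "x \<in> cl (Suc p)" and nz: "x (Suc p) Plus \<noteq> 0"
  obtains a x0 x' where "a \<in> B (Suc p)" "x0 \<in> whiskered (Suc p) a (Suc p)" "x' \<in> cl (Suc p)" "kcomp p x' x0"
    "x = kc p x' x0" "\<forall>c \<in> supp (x' (Suc p) Plus). key (Suc p) a \<le> key (Suc p) c"
    "x' (Suc p) Plus = x (Suc p) Plus - frag_of a"
proof -
  let ?S = "supp (x (Suc p) Plus)"
  obtain a where a: "a \<in> ?S" "\<And>c. c \<in> ?S \<Longrightarrow> key (Suc p) a \<le> key (Suc p) c"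
    using ex_min_if_finite[of "key (Suc p) ` ?S"] nz by (auto simp: not_less)
  have xp: "pos (B (Suc p)) (x (Suc p) Plus)" by (rule clD(1)[OF x])
  have aB: "a \<in> B (Suc p)" using a(1) pos_supp[OF xp] by blast
  have "1 \<le> cf (x (Suc p) Plus) a"
    using a(1) pos_nonneg[OF xp, of a] by (auto simp: in_keys_iff order.order_iff_strict)
  then have r: "pos (B (Suc p)) (x (Suc p) Plus - frag_of a)"
    using aB pos_nonneg[OF xp] by (intro pos_diffI[OF xp]) auto
  have rs: "supp (x (Suc p) Plus - frag_of a) \<subseteq> ?S"
    using a(1) by (auto simp: in_keys_iff cf_simps split: if_splits)
  define M where "M = x p Minus + del p (frag_of a)"
  have aa: "pos (B (Suc p)) (frag_of a)" using aB by simp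
  have M: "pos (B p) M" unfolding M_def
  proof (rule pos_del_middle[OF x aa r])
    fix e assume "cf (del p (frag_of a)) e < 0"
    then have "key p e < key (Suc p) a" using key_source aB by blast
    moreover assume "0 < cf (del p (x (Suc p) Plus - frag_of a)) e"
    then obtain c where "c \<in> supp (x (Suc p) Plus - frag_of a)" "key (Suc p) c < key p e"
      using del_posD[OF r] by blast
    ultimately show False using a(2)[of c] rs by auto
  qed
  define A where "A = (\<lambda>l (\<alpha>::sign). if l = Suc p then frag_of a else 0)"
  have top: "x (Suc p) \<alpha> = x (Suc p) Plus" for \<alpha> using cl_top[OF x, of "Suc p"] by simp
  have c1: "pos (B l) (A l \<alpha>)" for l \<alpha> using aB by (simp add: A_def)
  have c2: "pos (B l) (x l \<alpha> - A l \<alpha>)" for l \<alpha>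
    using r top[of \<alpha>] clD(1)[OF x, of l \<alpha>] by (cases "l = Suc p") (auto simp: A_def)
  have c3: "del l (A (Suc l) \<alpha>) = A l Plus - A l Minus" if "p < l" for l \<alpha> using that by (auto simp: A_def)
  have c4: "del p (A (Suc p) \<alpha>) = M - x p Minus" for \<alpha> by (simp add: A_def M_def)
  note sp = split_at[OF x c1 c2 c3 c4 M]
  have "low p x A M \<in> whiskered (Suc p) a (Suc p)"
    unfolding whiskered_all using sp(1) by (simp add: low_def A_def)
  moreover have "high p x A M (Suc p) Plus = x (Suc p) Plus - frag_of a" by (simp add: high_def A_def)
  ultimately show ?thesis using that[OF aB _ sp(2,3) sp(4)[symmetric]] a(2) rs by auto
qed

text \<open>Atoms generate: the top chain is taken apart element by element, then the whiskers are
  removed one dimension at a time.\<close>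

lemma cell_induct_top [consumes 1, case_names lower atom compose]:
  assumes x: "x \<in> cl (Suc p)"
    and lower: "\<And>u. u \<in> cl p \<Longrightarrow> Q u"
    and atom: "\<And>a. a \<in> B (Suc p) \<Longrightarrow> Q (at (Suc p) a)"
    and compose: "\<And>k x y. k \<le> p \<Longrightarrow> x \<in> cl (Suc p) \<Longrightarrow> y \<in> cl (Suc p) \<Longrightarrow> kcomp k x y \<Longrightarrow> Q x \<Longrightarrow> Q y \<Longrightarrow>
      Q (kc k x y)"
  shows "Q x"
proof -
  have elem: "j \<le> p \<Longrightarrow> y \<in> whiskered (Suc p) a (Suc j) \<Longrightarrow> Q y" if a: "a \<in> B (Suc p)" for a j y
  proof (induction j arbitrary: y)
    case 0
    then show ?case using whiskered_1[OF _ a] atom[OF a] by auto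
  next
    case (Suc k)
    obtain u z v where f: "whisker_form (Suc p) a k u z v" "y = kc k u (kc k z v)"
      using whisker_form_exists[OF Suc.prems(2) a] Suc.prems(1) by auto
    note F = f(1)[unfolded whisker_form_def]
    have c: "u \<in> cl p" "v \<in> cl p" "u \<in> cl (Suc p)" "v \<in> cl (Suc p)" "z \<in> cl (Suc p)"
      using F Suc.prems(1) cl_mono by (auto simp: whiskered_def)
    have k: "kcomp k u (kc k z v)" using F by (auto simp: kcomp_kc_right)
    have "Q z" using Suc.IH F Suc.prems(1) by auto
    then have "Q (kc k z v)" using compose[of k z v] c F lower Suc.prems(1) by auto
    then show ?case using compose[of k u "kc k z v"] c F lower Suc.prems(1) k kc_cl f(2) by auto
  qed
  \<comment> \<open>The augmentation of the top chain counts its elements with multiplicity.\<close>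
  show ?thesis using x
  proof (induction "nat (augmentation (x (Suc p) Plus))" arbitrary: x rule: less_induct)
    case less
    show ?case
    proof (cases "x (Suc p) Plus = 0")
      case True
      then show ?thesis using lower cl_zero_top less.prems by blast
    next
      case False
      then obtain a x0 x' where s: "a \<in> B (Suc p)" "x0 \<in> whiskered (Suc p) a (Suc p)" "x' \<in> cl (Suc p)"
        "kcomp p x' x0" "x = kc p x' x0" "x' (Suc p) Plus = x (Suc p) Plus - frag_of a"
        using take_min[OF less.prems] by metis
      have "augmentation (x' (Suc p) Plus) = augmentation (x (Suc p) Plus) - 1" using s(6) by (simp add: augmentation_diff)
      moreover have "0 \<le> augmentation (x' (Suc p) Plus)" using augmentation_nonneg[OF clD(1)[OF s(3)]] .
      ultimately have "Q x'" using less.hyps[of x'] s(3) by simp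
      then show ?thesis using compose[of p x' x0] s elem[OF s(1), of p x0] by (auto simp: whiskered_def)
    qed
  qed
qed

end

section \<open>Values on all cells of the next dimension\<close>

locale atom_extension = extension +
  fixes \<gamma>
  assumes ok_\<gamma>: "a \<in> B (Suc p) \<Longrightarrow> ok (at (Suc p) a) (\<gamma> a)"
begin

definition HH :: "(nat \<Rightarrow> nat) \<Rightarrow> oriental_cell \<Rightarrow> 'a" where
  "HH a = (SOME H. good a (\<gamma> a) (Suc p) H)"

abbreviation "elem a \<equiv> whiskered (Suc p) a (Suc p)"

lemma good_HH: "a \<in> B (Suc p) \<Longrightarrow> good a (\<gamma> a) (Suc p) (HH a)"
  unfolding HH_def using good_exists[OF _ ok_\<gamma>] by (rule someI_ex)

lemma elem_kc: "x \<in> elem a \<Longrightarrow> u \<in> cl p \<Longrightarrow> k < p \<Longrightarrow> kcomp k x u \<Longrightarrow> kc k x u \<in> elem a"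
  "x \<in> elem a \<Longrightarrow> u \<in> cl p \<Longrightarrow> k < p \<Longrightarrow> kcomp k u x \<Longrightarrow> kc k u x \<in> elem a"
  using whiskered_kc[of x "Suc p" a p u k] by auto

text \<open>By interchange a whisker of dimension \<open>l + 1\<close> along
  \<open>*\<^sub>k\<close> splits into one of dimension \<open>l\<close> along
  \<open>*\<^sub>k\<close> and one along \<open>*\<^sub>l\<close>; the latter is covered by
  \<open>good\<close>.\<close>

lemma HH_kc:
  assumes a: "a \<in> B (Suc p)" and "k < l" "l \<le> p" and x: "x \<in> elem a" and "u \<in> cl l"
  shows "kcomp k x u \<Longrightarrow> HH a (kc k x u) = m k (HH a x) (E u)"
    and "kcomp k u x \<Longrightarrow> HH a (kc k u x) = m k (E u) (HH a x)"
proof -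
  note g = good_HH[OF a]
  have "(kcomp k x u \<longrightarrow> HH a (kc k x u) = m k (HH a x) (E u)) \<and> (kcomp k u x \<longrightarrow> HH a (kc k u x) = m k (E u) (HH a x))"
    using assms(2-)
  proof (induction l arbitrary: x u)
    case (Suc l)
    show ?case
    proof (cases "l = k")
      case True
      then show ?thesis
        using compatibleD[OF goodD(3)[OF g, of k] Suc.prems(3), of u] Suc.prems by auto
    next
      case False
      then have l: "k < l" "l \<le> p" "l < p" "k < p" using Suc.prems by auto
      note x = Suc.prems(3) and u = Suc.prems(4)
      note IH = Suc.IH[OF l(1,2)]
      have ox: "ok x (HH a x)" using goodD(2)[OF g x] .
      have up: "u \<in> cl p" using u Suc.prems cl_mono by blast
      have ou: "ok u (E u)" using ok_E[OF up] .
      have bu: "oriental_bd l \<alpha> u \<in> cl l" for \<alpha> using obd_cl[OF u] .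
      have bx: "oriental_bd l \<alpha> x \<in> cl l" for \<alpha> using obd_cl[OF whiskered_cl[OF x]] .
      have bp: "z \<in> cl l \<Longrightarrow> z \<in> cl p" for z using l cl_mono by auto
      have bS: "z \<in> cl l \<Longrightarrow> z \<in> cl (Suc l)" for z using cl_mono by auto
      note oks = ok_E[OF bp[OF bu]] ok_E[OF bp[OF bx]]
      note cS = compatibleD[OF goodD(3)[OF g, of l]]
      show ?thesis
      proof (intro conjI impI)
        assume c: "kcomp k x u"
        let ?X = "kc k x (oriental_bd l Plus u)" and ?U = "kc k (oriental_bd l Minus x) u"
        have c': "kcomp k x (oriental_bd l Plus u)" "kcomp k (oriental_bd l Minus x) u"
          using c l by (auto simp: kcomp_obd_left kcomp_obd_right)
        have e: "kc k x u = kc l ?X ?U"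
          using kc_interchange[OF l(1) kcomp_unit(1)[of l x] kcomp_unit(2)[of l u] c'(2)]
          by (simp add: kc_unit_right[OF whiskered_cl[OF x]] kc_unit_left[OF u])
        have X: "?X \<in> elem a" using elem_kc(1)[OF x bp[OF bu] l(4) c'(1)] .
        have U: "?U \<in> cl (Suc l)" using kc_cl[OF bS[OF bx] u c'(2)] .
        have XU: "kcomp l ?X ?U" using c l by (simp add: kcomp_def obd_kc kcomp_obd_left kcomp_obd_right)
        have "HH a (kc k x u) = m l (m k (HH a x) (E (oriental_bd l Plus u))) (m k (E (oriental_bd l Minus x)) (E u))"
          using cS(2)[OF _ X U XU] l e IH[OF x bu] c' E_kc[OF bp[OF bx] up c'(2) l(4)] by simp
        also have "\<dots> = m k (m l (HH a x) (E (oriental_bd l Minus x))) (m l (E (oriental_bd l Plus u)) (E u))"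
          using ok_interchange[OF ox oks(2) oks(1) ou l(1,2) kcomp_unit(1)[of l x] kcomp_unit(2)[of l u] c'(2)] by simp
        finally show "HH a (kc k x u) = m k (HH a x) (E u)"
          using E_unit_right[OF ox l(2)] E_unit_left[OF ou l(2)] by simp
      next
        assume c: "kcomp k u x"
        let ?X = "kc k (oriental_bd l Minus u) x" and ?U = "kc k u (oriental_bd l Plus x)"
        have c': "kcomp k u (oriental_bd l Plus x)" "kcomp k (oriental_bd l Minus u) x"
          using c l by (auto simp: kcomp_obd_left kcomp_obd_right)
        have e: "kc k u x = kc l ?U ?X"
          using kc_interchange[OF l(1) kcomp_unit(1)[of l u] kcomp_unit(2)[of l x] c'(2)]
          by (simp add: kc_unit_left[OF whiskered_cl[OF x]] kc_unit_right[OF u])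
        have X: "?X \<in> elem a" using elem_kc(2)[OF x bp[OF bu] l(4) c'(2)] .
        have U: "?U \<in> cl (Suc l)" using kc_cl[OF u bS[OF bx] c'(1)] .
        have XU: "kcomp l ?U ?X" using c l by (simp add: kcomp_def obd_kc kcomp_obd_left kcomp_obd_right)
        have "HH a (kc k u x) = m l (m k (E u) (E (oriental_bd l Plus x))) (m k (E (oriental_bd l Minus u)) (HH a x))"
          using cS(1)[OF _ X U XU] l e IH[OF x bu] c' E_kc[OF up bp[OF bx] c'(1) l(4)] by simp
        also have "\<dots> = m k (m l (E u) (E (oriental_bd l Minus u))) (m l (E (oriental_bd l Plus x)) (HH a x))"
          using ok_interchange[OF ou oks(1) oks(2) ox l(1,2) kcomp_unit(1)[of l u] kcomp_unit(2)[of l x] c'(2)] by simp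
        finally show "HH a (kc k u x) = m k (E u) (HH a x)"
          using E_unit_left[OF ox l(2)] E_unit_right[OF ou l(2)] by simp
      qed
    qed
  qed simp
  then show "kcomp k x u \<Longrightarrow> HH a (kc k x u) = m k (HH a x) (E u)"
    "kcomp k u x \<Longrightarrow> HH a (kc k u x) = m k (E u) (HH a x)" by auto
qed

text \<open>
  The value of a cell is read off its decomposition into whiskered atoms in increasing order of keys.
\<close>

inductive value_rel :: "oriental_cell \<Rightarrow> 'a \<Rightarrow> bool" where
  unit: "u \<in> cl p \<Longrightarrow> value_rel u (E u)"
| insert: "a \<in> B (Suc p) \<Longrightarrow> x0 \<in> elem a \<Longrightarrow> value_rel x w \<Longrightarrow> kcomp p x x0 \<Longrightarrow>
    \<forall>c \<in> supp (x (Suc p) Plus). key (Suc p) a \<le> key (Suc p) c \<Longrightarrow> value_rel (kc p x x0) (m p w (HH a x0))"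

lemma value_ok: "value_rel x w \<Longrightarrow> ok x w"
proof (induction rule: value_rel.induct)
  case (insert a x0 x w)
  then show ?case using ok_kc[OF insert.IH goodD(2)[OF good_HH]] by blast
qed (rule ok_E)

lemma elem_top: "x0 \<in> elem a \<Longrightarrow> x0 (Suc p) \<alpha> = frag_of a"
  by (simp add: whiskered_def)

lemma value_total: "x \<in> cl (Suc p) \<Longrightarrow> \<exists>w. value_rel x w"
proof (induction "nat (augmentation (x (Suc p) Plus))" arbitrary: x rule: less_induct)
  case less
  show ?case
  proof (cases "x (Suc p) Plus = 0")
    case True
    then show ?thesis using value_rel.unit cl_zero_top less.prems by blast
  next
    case False
    then obtain a x0 x' where s: "a \<in> B (Suc p)" "x0 \<in> elem a" "x' \<in> cl (Suc p)"
      "kcomp p x' x0" "x = kc p x' x0" "\<forall>c \<in> supp (x' (Suc p) Plus). key (Suc p) a \<le> key (Suc p) c"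
      "x' (Suc p) Plus = x (Suc p) Plus - frag_of a"
      using take_min[OF less.prems] by metis
    have "augmentation (x' (Suc p) Plus) = augmentation (x (Suc p) Plus) - 1" using s(7) by (simp add: augmentation_diff)
    moreover have "0 \<le> augmentation (x' (Suc p) Plus)" using augmentation_nonneg[OF clD(1)[OF s(3)]] .
    ultimately obtain w where "value_rel x' w" using less.hyps[of x'] s(3) by auto
    then show ?thesis using value_rel.insert s by blast
  qed
qed

text \<open>In positive dimension this is \<open>exchange_low\<close> with the second whiskered atom
  as the moved cell. For \<open>p = 0\<close> the situation cannot occur, by
  \<open>no_edge_low\<close>.\<close>

lemma elem_exchange:
  assumes a: "a \<in> B (Suc p)" and b: "b \<in> B (Suc p)" and y: "y \<in> elem a" and s: "s \<in> elem b"
    and c: "kcomp p s y" and key: "key (Suc p) b \<le> key (Suc p) a"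
  obtains y' s' where "y' \<in> elem a" "s' \<in> elem b" "kcomp p y' s'" "kc p s y = kc p y' s'"
    "m p (HH b s) (HH a y) = m p (HH a y') (HH b s')"
proof (cases p)
  case 0
  have "s \<in> cl 0" using no_edge_low[OF a, of y s] y s c key elem_top[OF s, of Plus] 0
    by (auto simp: whiskered_def)
  then show ?thesis using clD(2)[of s 0 "Suc 0" Plus] elem_top[OF s, of Plus] 0 by simp
next
  case (Suc j)
  let ?T = "{s' \<in> cl (Suc (Suc j)). s' (Suc (Suc j)) = s (Suc (Suc j))}"
  have T: "?T = elem b"
  proof (intro set_eqI iffI)
    fix x assume "x \<in> ?T"
    then show "x \<in> elem b" using elem_top[OF s, of Plus] Suc by (simp add: whiskered_all)
  next
    fix x assume x: "x \<in> elem b"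
    then show "x \<in> ?T" using elem_top[OF x] elem_top[OF s] whiskered_cl[OF x] Suc by (auto simp: fun_eq_iff)
  qed
  have sT: "s \<in> cl (Suc (Suc j))" using s Suc by (auto simp: whiskered_def)
  have keys: "\<forall>c \<in> supp (s (Suc (Suc j)) Plus). key (Suc (Suc j)) c \<le> key (Suc p) a"
    using key elem_top[OF s, of Plus] Suc by simp
  have jp: "Suc j \<le> p" "Suc (Suc j) \<le> Suc p" using Suc by auto
  from exchange_low[OF a jp(1), of "HH a" y s ?T "HH b"]
  show ?thesis
    using that y c keys sT goodD(2,3)[OF good_HH[OF a]] goodD(2,3)[OF good_HH[OF b]] T Suc by auto
qed

text \<open>Insertion sort: a new first factor whose key is too large is exchanged with its
  neighbour until the keys are in order, and each exchange preserves both the composite and its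
  value.\<close>

lemma value_insert:
  assumes "value_rel x w" "a \<in> B (Suc p)" "x0 \<in> elem a" "kcomp p x x0"
  shows "value_rel (kc p x x0) (m p w (HH a x0))"
  using assms
proof (induction arbitrary: x0 rule: value_rel.induct)
  case (unit u)
  then show ?case
    by (intro value_rel.insert value_rel.unit) (auto simp: clD(2)[OF unit.hyps])
next
  case (insert b b0 x' w')
  note b = insert.hyps(1,2) and a = insert.prems(1,2) and xb = insert.hyps(4)
  show ?case
  proof (cases "key (Suc p) a \<le> key (Suc p) b")
    case True
    have "key (Suc p) a \<le> key (Suc p) c" if "c \<in> supp (kc p x' b0 (Suc p) Plus)" for c
    proof -
      have "c \<in> supp (x' (Suc p) Plus) \<or> c = b"
        using that elem_top[OF b(2)] Poly_Mapping.keys_add[of "x' (Suc p) Plus" "b0 (Suc p) Plus"]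
        by (auto simp: kc_simps)
      then show ?thesis using True insert.hyps(5) by force
    qed
    then show ?thesis
      using value_rel.insert[OF a value_rel.insert[OF b insert.hyps(3,4,5)]] insert.prems(3) by blast
  next
    case False
    have bx: "kcomp p b0 x0" using insert.prems(3) xb by (simp add: kcomp_kc_left)
    obtain y s where ys: "y \<in> elem a" "s \<in> elem b" "kcomp p y s" "kc p b0 x0 = kc p y s"
      "m p (HH b b0) (HH a x0) = m p (HH a y) (HH b s)"
      using elem_exchange[OF a(1) b(1) a(2) b(2) bx] False by (metis linear)
    have x'y: "kcomp p x' y" using xb bx ys(3,4) kcomp_kc_right by metis
    have IH: "value_rel (kc p x' y) (m p w' (HH a y))" using insert.IH[OF a(1) ys(1) x'y] .
    have s: "kcomp p (kc p x' y) s" using ys(3) x'y by (simp add: kcomp_kc_left)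
    have key: "\<forall>c \<in> supp (kc p x' y (Suc p) Plus). key (Suc p) b \<le> key (Suc p) c"
      using insert.hyps(5) elem_top[OF ys(1)] False Poly_Mapping.keys_add[of "x' (Suc p) Plus" "y (Suc p) Plus"]
      by (fastforce simp: kc_simps)
    have "value_rel (kc p (kc p x' y) s) (m p (m p w' (HH a y)) (HH b s))"
      using value_rel.insert[OF b(1) ys(2) IH s key] .
    moreover have "kc p (kc p x' b0) x0 = kc p (kc p x' y) s" using ys(4) kc_assoc by metis
    moreover have "m p (m p w' (HH b b0)) (HH a x0) = m p (m p w' (HH a y)) (HH b s)"
      using ok_assoc[OF value_ok[OF insert.hyps(3)] goodD(2)[OF good_HH[OF b(1)] b(2)] goodD(2)[OF good_HH[OF a(1)] a(2)] xb bx]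
        ok_assoc[OF value_ok[OF insert.hyps(3)] goodD(2)[OF good_HH[OF a(1)] ys(1)] goodD(2)[OF good_HH[OF b(1)] ys(2)] x'y ys(3)]
        ys(5) by simp
    ultimately show ?thesis by simp
  qed
qed

lemma not_lower:
  assumes "x \<in> cl (Suc p)" "x0 \<in> elem a"
  shows "kc p x x0 \<notin> cl p"
proof
  assume "kc p x x0 \<in> cl p"
  then have "x (Suc p) Plus + frag_of a = 0" using clD(2)[of _ p "Suc p" Plus] elem_top[OF assms(2)] by (fastforce simp: kc_simps)
  then have "cf (x (Suc p) Plus + frag_of a) a = cf 0 a" by simp
  then have "cf (x (Suc p) Plus) a + 1 = 0" by (simp add: cf_simps)
  then show False using pos_nonneg[OF clD(1)[OF assms(1)], of "Suc p" Plus a] by simp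
qed

text \<open>Two sorted decompositions split off the same element first, since the least key
  determines it by injectivity; the remaining factors agree by \<open>kc_cancel\<close>.\<close>

lemma value_fun: "value_rel x w \<Longrightarrow> value_rel x w' \<Longrightarrow> w = w'"
proof (induction arbitrary: w' rule: value_rel.induct)
  case (unit u)
  from unit(2,1) show ?case
  proof (cases rule: value_rel.cases)
    case (insert a x0 x w)
    then show ?thesis using not_lower[OF okD(1)[OF value_ok[OF insert(5)]] insert(4)] unit(1) by simp
  qed simp
next
  case (insert a x0 x w)
  note xc = okD(1)[OF value_ok[OF insert.hyps(3)]]
  from insert.prems show ?case
  proof (cases rule: value_rel.cases)
    case unit
    then show ?thesis using not_lower[OF xc insert.hyps(2)] by simp
  next
    case i: (insert b y0 y v)
    note yc = okD(1)[OF value_ok[OF i(5)]]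
    have t: "x (Suc p) Plus + frag_of a = y (Suc p) Plus + frag_of b"
      using fun_cong[OF fun_cong[OF i(1)], of "Suc p" Plus] elem_top[OF insert.hyps(2)] elem_top[OF i(4)]
      by (simp add: kc_simps)
    have "b \<in> supp (x (Suc p) Plus + frag_of a)" unfolding t
      using pos_nonneg[OF clD(1)[OF yc], of "Suc p" Plus b] by (auto simp: in_keys_iff cf_simps)
    then have "b \<in> supp (x (Suc p) Plus) \<or> b = a" by (auto simp: in_keys_iff cf_simps split: if_splits)
    then have 1: "key (Suc p) a \<le> key (Suc p) b" using insert.hyps(5) by auto
    have "a \<in> supp (y (Suc p) Plus + frag_of b)" unfolding t[symmetric]
      using pos_nonneg[OF clD(1)[OF xc], of "Suc p" Plus a] by (auto simp: in_keys_iff cf_simps)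
    then have "a \<in> supp (y (Suc p) Plus) \<or> a = b" by (auto simp: in_keys_iff cf_simps split: if_splits)
    then have "key (Suc p) b \<le> key (Suc p) a" using i(7) by auto
    then have ab: "a = b" using 1 key_inj insert.hyps(1) i(3) by (auto simp: inj_on_def)
    have ab': "x0 l = y0 l" if "p < l" for l using insert.hyps(2) i(4) ab that by (auto simp: whiskered_def)
    from kc_cancel[OF xc whiskered_cl[OF insert.hyps(2)] yc whiskered_cl[OF i(4)] insert.hyps(4) i(6) i(1) ab']
    have "x = y" "x0 = y0" by auto
    then show ?thesis using insert.IH i ab by auto
  qed
qed

definition F :: "oriental_cell \<Rightarrow> 'a" where "F x = (THE w. value_rel x w)"

lemma F_eq: "value_rel x w \<Longrightarrow> F x = w"
  unfolding F_def using value_fun by blast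

lemma value_F: "x \<in> cl (Suc p) \<Longrightarrow> value_rel x (F x)"
  using value_total F_eq by metis

lemma ok_F: "x \<in> cl (Suc p) \<Longrightarrow> ok x (F x)"
  using value_F value_ok by blast

lemma F_E: "u \<in> cl p \<Longrightarrow> F u = E u"
  using F_eq value_rel.unit by blast

lemma F_at:
  assumes a: "a \<in> B (Suc p)"
  shows "F (at (Suc p) a) = \<gamma> a"
proof -
  let ?x = "at (Suc p) a"
  have e: "?x \<in> elem a" by (rule at_whiskered[OF a])
  have c: "?x \<in> cl (Suc p)" by (rule at_cl[OF a])
  have "value_rel (kc p (oriental_bd p Plus ?x) ?x) (m p (E (oriental_bd p Plus ?x)) (HH a ?x))"
    by (rule value_insert[OF value_rel.unit a e]) (use obd_cl[OF c] kcomp_unit in auto)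
  then show ?thesis
    using F_eq kc_unit_left[OF c] E_unit_left[OF goodD(2)[OF good_HH[OF a] e]] goodD(1)[OF good_HH[OF a]] by simp
qed

text \<open>The atoms of the first factor \<open>y\<close> are inserted into the decomposition of
  \<open>x\<close> one at a time.\<close>

lemma value_kc_top:
  assumes "value_rel y v" "value_rel x w" "kcomp p x y"
  shows "value_rel (kc p x y) (m p w v)"
  using assms
proof (induction arbitrary: x w rule: value_rel.induct)
  case (unit u)
  have "u = oriental_bd p Minus x" using unit obd_id[of u p p Plus] by (simp add: kcomp_def)
  then show ?case
    using unit kc_unit_right[OF okD(1)[OF value_ok[OF unit(2)]], of p] E_unit_right[OF value_ok[OF unit(2)], of p] by simp
next
  case (insert a y0 y' v)
  have c: "kcomp p x y'" "kcomp p (kc p x y') y0"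
    using insert.prems insert.hyps(4) by (auto simp: kcomp_kc_right kcomp_kc_left)
  have "value_rel (kc p (kc p x y') y0) (m p (m p w v) (HH a y0))"
    using value_insert[OF insert.IH[OF insert.prems(1) c(1)] insert.hyps(1,2) c(2)] .
  moreover have "m p w (m p v (HH a y0)) = m p (m p w v) (HH a y0)"
    by (rule ok_assoc[OF value_ok[OF insert.prems(1)] value_ok[OF insert.hyps(3)]
        goodD(2)[OF good_HH[OF insert.hyps(1)] insert.hyps(2)] c(1) insert.hyps(4)]) simp
  ultimately show ?case by (simp add: kc_assoc)
qed

text \<open>A whisker of dimension at most \<open>p\<close> is its own square along
  \<open>*\<^sub>p\<close>, so it distributes over the decomposition; \<open>value_insert\<close>
  reassembles the whiskered factors.\<close>

lemma value_whisker:
  assumes "value_rel x w" "u \<in> cl p" "k < p"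
  shows "kcomp k x u \<Longrightarrow> value_rel (kc k x u) (m k w (E u))"
    and "kcomp k u x \<Longrightarrow> value_rel (kc k u x) (m k (E u) w)"
proof -
  have u: "u \<in> cl p" and k: "k < p" by fact+
  have uu: "oriental_bd p \<alpha> u = u" for \<alpha> using obd_id[OF u] by simp
  have kuu: "kcomp p u u" by (simp add: kcomp_def uu)
  have u1: "kc p u u = u" using kc_unit_left[OF u, of p] uu by simp
  have u2: "m p (E u) (E u) = E u" using E_unit_left[OF ok_E[OF u], of p] uu by simp
  have "(kcomp k x u \<longrightarrow> value_rel (kc k x u) (m k w (E u))) \<and> (kcomp k u x \<longrightarrow> value_rel (kc k u x) (m k (E u) w))"
    using assms(1)
  proof (induction rule: value_rel.induct)
    case (unit v)
    have "kcomp k v u \<Longrightarrow> value_rel (kc k v u) (m k (E v) (E u))"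
      using value_rel.unit[OF kc_cl[OF unit u]] E_kc[OF unit u _ k] by metis
    moreover have "kcomp k u v \<Longrightarrow> value_rel (kc k u v) (m k (E u) (E v))"
      using value_rel.unit[OF kc_cl[OF u unit]] E_kc[OF u unit _ k] by metis
    ultimately show ?case by blast
  next
    case (insert a x0 x w)
    note o = value_ok[OF insert.hyps(3)] goodD(2)[OF good_HH[OF insert.hyps(1)] insert.hyps(2)] ok_E[OF u]
    show ?case
    proof (intro conjI impI)
      assume c: "kcomp k (kc p x x0) u"
      then have c': "kcomp k x u" "kcomp k x0 u" using obd_kc(1,2)[OF k insert.hyps(4)] by (auto simp: kcomp_def)
      have e: "kc k (kc p x x0) u = kc p (kc k x u) (kc k x0 u)"
        using kc_interchange[OF k insert.hyps(4) kuu c'(2)] u1 by simp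
      have kk: "kcomp p (kc k x u) (kc k x0 u)" using insert.hyps(4) k by (simp add: kcomp_def obd_kc uu)
      have "value_rel (kc k x u) (m k w (E u))" using insert.IH c' by blast
      from value_insert[OF this insert.hyps(1) elem_kc(1)[OF insert.hyps(2) u k c'(2)] kk]
      show "value_rel (kc k (kc p x x0) u) (m k (m p w (HH a x0)) (E u))"
        using e HH_kc(1)[OF insert.hyps(1) k order_refl insert.hyps(2) u c'(2)]
          ok_interchange[OF o(1,2,3,3) k order_refl insert.hyps(4) kuu c'(2)] u2 by simp
    next
      assume c: "kcomp k u (kc p x x0)"
      then have c': "kcomp k u x" "kcomp k u x0" using obd_kc(1,2)[OF k insert.hyps(4)] by (auto simp: kcomp_def)
      have e: "kc k u (kc p x x0) = kc p (kc k u x) (kc k u x0)"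
        using kc_interchange[OF k kuu insert.hyps(4) c'(2)] u1 by simp
      have kk: "kcomp p (kc k u x) (kc k u x0)" using insert.hyps(4) k by (simp add: kcomp_def obd_kc uu)
      have "value_rel (kc k u x) (m k (E u) w)" using insert.IH c' by blast
      from value_insert[OF this insert.hyps(1) elem_kc(2)[OF insert.hyps(2) u k c'(2)] kk]
      show "value_rel (kc k u (kc p x x0)) (m k (E u) (m p w (HH a x0)))"
        using e HH_kc(2)[OF insert.hyps(1) k order_refl insert.hyps(2) u c'(2)]
          ok_interchange[OF o(3,3,1,2) k order_refl kuu insert.hyps(4) c'(2)] u2 by simp
    qed
  qed
  then show "kcomp k x u \<Longrightarrow> value_rel (kc k x u) (m k w (E u))"
    "kcomp k u x \<Longrightarrow> value_rel (kc k u x) (m k (E u) w)" by auto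
qed

text \<open>For \<open>k < p\<close> interchange turns the composite into one along
  \<open>*\<^sub>p\<close> of two whiskered cells, so the two preceding lemmas suffice.\<close>

lemma F_kc:
  assumes x: "x \<in> cl (Suc p)" and y: "y \<in> cl (Suc p)" and c: "kcomp k x y" and k: "k \<le> p"
  shows "F (kc k x y) = m k (F x) (F y)"
proof (cases "k = p")
  case True
  then show ?thesis using F_eq[OF value_kc_top[OF value_F[OF y] value_F[OF x]]] c by simp
next
  case False
  then have kp: "k < p" using k by simp
  let ?y = "oriental_bd p Plus y" and ?x = "oriental_bd p Minus x"
  have b: "?y \<in> cl p" "?x \<in> cl p" using obd_cl x y by auto
  have c': "kcomp k x ?y" "kcomp k ?x y" using c kp by (auto simp: kcomp_obd_left kcomp_obd_right)
  have e: "kc k x y = kc p (kc k x ?y) (kc k ?x y)"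
    using kc_interchange[OF kp kcomp_unit(1)[of p x] kcomp_unit(2)[of p y] c'(2)]
    by (simp add: kc_unit_right[OF x] kc_unit_left[OF y])
  have kk: "kcomp p (kc k x ?y) (kc k ?x y)" using c kp by (simp add: kcomp_def obd_kc kcomp_obd_left kcomp_obd_right)
  have "F (kc k x y) = m p (m k (F x) (E ?y)) (m k (E ?x) (F y))"
    unfolding e by (rule F_eq[OF value_kc_top[OF value_whisker(2)[OF value_F[OF y] b(2) kp c'(2)]
          value_whisker(1)[OF value_F[OF x] b(1) kp c'(1)] kk]])
  also have "\<dots> = m k (m p (F x) (E ?x)) (m p (E ?y) (F y))"
    using ok_interchange[OF ok_F[OF x] ok_E[OF b(2)] ok_E[OF b(1)] ok_F[OF y] kp order_refl
        kcomp_unit(1)[of p x] kcomp_unit(2)[of p y] c'(2)] by simp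
  finally show ?thesis using E_unit_right[OF ok_F[OF x], of p] E_unit_left[OF ok_F[OF y], of p] by simp
qed

lemma partial_functor_F: "partial_functor B del C (Suc p) (G(Suc p := F))"
  unfolding partial_functor_def
proof (intro conjI allI impI ballI)
  fix q x assume "q \<le> Suc p" "x \<in> cl q"
  then show "(G(Suc p := F)) q x \<in> cells C q"
    using okD(2)[OF ok_F] partial_functorD(1)[OF G] by (cases "q = Suc p") auto
next
  fix q k \<alpha> x assume "q \<le> Suc p" "k < q" "x \<in> cl q"
  then show "(G(Suc p := F)) k (oriental_bd k \<alpha> x) = bd C q k \<alpha> ((G(Suc p := F)) q x)"
    using ok_bd[OF ok_F, of x k \<alpha>] partial_functorD(2)[OF G, of q k x \<alpha>] by (cases "q = Suc p") auto
next
  fix q k x y assume "q \<le> Suc p" "k < q" "x \<in> cl q" "y \<in> cl q" "kcomp k x y"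
  then show "(G(Suc p := F)) q (kc k x y) = cmp C q k ((G(Suc p := F)) q x) ((G(Suc p := F)) q y)"
    using F_kc partial_functorD(3)[OF G] by (cases "q = Suc p") auto
next
  fix q r x assume "q \<le> Suc p" "r < q" "x \<in> cl r"
  then show "(G(Suc p := F)) q x = idn C r q ((G(Suc p := F)) r x)"
    using F_E[OF cl_mono, of x r] E_low[of x r] partial_functorD(4)[OF G, of q r x]
    by (cases "q = Suc p") (auto simp: up_def)
qed

end

section \<open>Functors determined by their values on atoms\<close>

lemma extend_partial_functor:
  fixes C :: "'a omega_struct"
  assumes "steiner_complex B del key" "omega_category C" "partial_functor B del C p G"
    and "\<And>a. a \<in> B (Suc p) \<Longrightarrow> \<gamma> a \<in> cells C (Suc p)"
    and "\<And>a \<alpha>. a \<in> B (Suc p) \<Longrightarrow> bd C (Suc p) p \<alpha> (\<gamma> a) = G p (oriental_bd p \<alpha> (atom del (Suc p) a))"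
  obtains G' where "partial_functor B del C (Suc p) G'" "\<And>q. q \<le> p \<Longrightarrow> G' q = G q"
    "\<And>a. a \<in> B (Suc p) \<Longrightarrow> G' (Suc p) (atom del (Suc p) a) = \<gamma> a"
proof -
  interpret steiner_complex B del key by fact
  interpret C: omega_category C by fact
  interpret extension B del key C p G by unfold_locales fact
  interpret atom_extension B del key C p G \<gamma>
    by unfold_locales (auto simp: ok_def assms(4,5) at_cl)
  show ?thesis using that[of "G(Suc p := F)"] partial_functor_F F_at by auto
qed

context steiner_complex
begin

lemma cl_0: "x \<in> cl 0 \<longleftrightarrow> (\<exists>v \<in> B 0. x = at 0 v)"
proof
  assume x: "x \<in> cl 0"
  obtain v where v: "v \<in> B 0" "x 0 Plus = frag_of v"
    using augmentation_1[OF clD(1)[OF x] clD(4)[OF x]] by metis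
  have "x l \<alpha> = at 0 v l \<alpha>" for l \<alpha>
    using v clD(2)[OF x, of l] cl_top[OF x, of 0 \<alpha> Plus] by (cases l) auto
  then show "\<exists>v \<in> B 0. x = at 0 v" using v by blast
qed (auto simp: at_cl)

lemma base_partial_functor:
  fixes C :: "'a omega_struct"
  assumes "\<And>a. a \<in> B 0 \<Longrightarrow> \<gamma> a \<in> cells C 0"
  obtains G where "partial_functor B del C 0 G" "\<And>a. a \<in> B 0 \<Longrightarrow> G 0 (at 0 a) = \<gamma> a"
proof -
  define G where "G = (\<lambda>(q::nat) x. \<gamma> (THE v. x = at 0 v))"
  have inj: "at 0 v = at 0 v' \<Longrightarrow> v = v'" for v v'
    using atom_top[of del 0 v Plus] atom_top[of del 0 v' Plus] by (metis frag_of_eq)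
  have "G q (at 0 v) = \<gamma> v" for q v
    unfolding G_def by (rule arg_cong[of _ _ \<gamma>], rule the_equality) (auto dest: inj)
  moreover from this have "\<forall>x \<in> cl 0. G 0 x \<in> cells C 0" using assms by (auto simp: cl_0)
  ultimately show ?thesis using that[of G] by (simp add: partial_functor_def)
qed

lemma partial_functor_unique:
  fixes C :: "'a omega_struct"
  assumes G: "partial_functor B del C p G" and G': "partial_functor B del C p G'"
    and at: "\<And>q a. q \<le> p \<Longrightarrow> a \<in> B q \<Longrightarrow> G q (at q a) = G' q (at q a)"
  shows "q \<le> p \<Longrightarrow> x \<in> cl q \<Longrightarrow> G q x = G' q x"
proof (induction q arbitrary: x)
  case 0
  then show ?case using at by (auto simp: cl_0)
next
  case (Suc q)
  from Suc.prems(2) show ?case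
  proof (induction rule: cell_induct_top)
    case (lower u)
    then show ?case
      using Suc.IH[OF _ lower] Suc.prems partial_functorD(4)[OF G, of "Suc q" q u] partial_functorD(4)[OF G', of "Suc q" q u] by simp
  next
    case (atom a)
    then show ?case using at Suc.prems by simp
  next
    case (compose k x y)
    then show ?case
      using Suc.prems partial_functorD(3)[OF G, of "Suc q" k x y] partial_functorD(3)[OF G', of "Suc q" k x y] by simp
  qed
qed

end

section \<open>The chain complex of a simplex\<close>

definition nd :: "nat \<Rightarrow> nat \<Rightarrow> (nat \<Rightarrow> nat) set" where
  "nd n k = {f \<in> {..k} \<rightarrow>\<^sub>E {..n}. strict_mono_on {..k} f}"

definition face :: "nat \<Rightarrow> nat \<Rightarrow> (nat \<Rightarrow> nat) \<Rightarrow> nat \<Rightarrow> nat" where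
  "face k i f = compose {..k} f (coface k i)"

text \<open>The vertex \<open>v\<close> adjoined in front. Every nondegenerate simplex of positive
  dimension is the cone on its face 0 (\<open>nd_cone\<close>), which supports inductions on the
  dimension.\<close>

definition cone :: "nat \<Rightarrow> nat \<Rightarrow> (nat \<Rightarrow> nat) \<Rightarrow> nat \<Rightarrow> nat" where
  "cone k v f = (\<lambda>j \<in> {..Suc k}. if j = 0 then v else f (j - 1))"

abbreviation "vertex v \<equiv> \<lambda>j \<in> {..0::nat}. v :: nat"

lemma ndD:
  assumes "f \<in> nd n k"
  shows "j \<le> k \<Longrightarrow> f j \<le> n" "\<not> j \<le> k \<Longrightarrow> f j = undefined" "i < j \<Longrightarrow> j \<le> k \<Longrightarrow> f i < f j"
  using assms by (auto simp: nd_def PiE_iff extensional_def strict_mono_on_def)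

lemma ndI:
  assumes "\<And>j. j \<le> k \<Longrightarrow> f j \<le> n" "\<And>j. \<not> j \<le> k \<Longrightarrow> f j = undefined" "\<And>j. j < k \<Longrightarrow> f j < f (Suc j)"
  shows "f \<in> nd n k"
proof -
  have "j \<le> k \<Longrightarrow> i < j \<Longrightarrow> f i < f j" for i j
  proof (induction j)
    case (Suc j)
    then show ?case using assms(3)[of j] by (cases "i = j") (auto dest: order.strict_trans)
  qed simp
  then show ?thesis using assms(1,2) by (auto simp: nd_def PiE_iff extensional_def strict_mono_on_def)
qed

lemma nd_le: "f \<in> nd n k \<Longrightarrow> i \<le> j \<Longrightarrow> j \<le> k \<Longrightarrow> f i \<le> f j"
  using ndD(3)[of f n k i j] by (cases "i = j") auto

lemma nd_ge: "f \<in> nd n k \<Longrightarrow> j \<le> k \<Longrightarrow> j \<le> f j"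
proof (induction j)
  case (Suc j)
  then show ?case using ndD(3)[of f n k j "Suc j"] by auto
qed simp

lemma nd_empty: "n < k \<Longrightarrow> nd n k = {}"
  using nd_ge ndD(1) by (metis all_not_in_conv leD le_refl le_trans)

lemma nd_ord_maps: "f \<in> nd n k \<Longrightarrow> f \<in> ord_maps k n"
  by (auto simp: nd_def ord_maps_def strict_mono_on_imp_mono_on)

lemma ord_mapsD:
  assumes "f \<in> ord_maps k n"
  shows "j \<le> k \<Longrightarrow> f j \<le> n" "\<not> j \<le> k \<Longrightarrow> f j = undefined" "i \<le> j \<Longrightarrow> j \<le> k \<Longrightarrow> f i \<le> f j"
  using assms by (auto simp: ord_maps_def PiE_iff extensional_def mono_on_def)

lemma ord_maps_not_nd:
  assumes f: "f \<in> ord_maps k n" and "f \<notin> nd n k"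
  obtains i where "i < k" "f i = f (Suc i)"
proof -
  have "\<exists>i<k. \<not> f i < f (Suc i)" using assms ndI[of k f n] ord_mapsD[OF f] by blast
  then obtain i where "i < k" "f (Suc i) \<le> f i" by (auto simp: not_less)
  then show ?thesis using that ord_mapsD(3)[OF f, of i "Suc i"] by auto
qed

lemma std_simplex_simps [simp]:
  "simplices (std_simplex n) k = ord_maps k n" "act (std_simplex n) l m \<theta> x = compose {..l} x \<theta>"
  by (simp_all add: std_simplex_def)

lemma coface_app: "j \<le> k \<Longrightarrow> coface k i j = (if j < i then j else Suc j)"
  by (simp add: coface_def)

lemma face_app: "j \<le> k \<Longrightarrow> face k i f j = (if j < i then f j else f (Suc j))"
  by (simp add: face_def compose_def coface_app)

lemma face_undefined: "\<not> j \<le> k \<Longrightarrow> face k i f j = undefined"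
  by (simp add: face_def compose_def)

lemma ext_le: "(\<And>j. j \<le> k \<Longrightarrow> f j = g j) \<Longrightarrow> (\<And>j. \<not> j \<le> k \<Longrightarrow> f j = g j) \<Longrightarrow> f = g"
  by (rule ext) blast

lemma codegeneracy_ord_maps: "i \<le> l \<Longrightarrow> codegeneracy l i \<in> ord_maps (Suc l) l"
  by (auto simp: codegeneracy_def ord_maps_def mono_on_def)

lemma degenerate_factor:
  assumes "i < k" "f i = f (Suc i)" "f \<in> ord_maps k n"
  obtains l where "k = Suc l" "f = compose {..k} (face l i f) (codegeneracy l i)" "face l i f \<in> ord_maps l n" "i \<le> l"
proof -
  obtain l where l: "k = Suc l" using assms(1) by (cases k) auto
  have "f = compose {..k} (face l i f) (codegeneracy l i)"
  proof (rule ext_le[of k])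
    fix j assume j: "j \<le> k"
    show "f j = compose {..k} (face l i f) (codegeneracy l i) j"
    proof (cases "j = i")
      case True
      then show ?thesis using assms l by (simp add: compose_def codegeneracy_def face_app)
    next
      case False
      then show ?thesis using assms l j by (cases "j < i") (auto simp: compose_def codegeneracy_def face_app)
    qed
  qed (use ord_mapsD(2)[OF assms(3)] in \<open>auto simp: compose_def\<close>)
  moreover have "face l i f \<in> ord_maps l n"
    using ord_mapsD[OF assms(3)] l
    by (auto simp: ord_maps_def PiE_iff extensional_def mono_on_def face_app face_undefined)
  ultimately show ?thesis using that l assms(1) by auto
qed

lemma degenerate_iff:
  assumes f: "f \<in> ord_maps k n"
  shows "degenerate (std_simplex n) k f \<longleftrightarrow> f \<notin> nd n k"
proof
  assume "degenerate (std_simplex n) k f"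
  then obtain l i y where *: "k = l + 1" "i \<le> l" "f = compose {..l+1} y (codegeneracy l i)"
    by (auto simp: degenerate_def)
  then have "f i = f (Suc i)" by (simp add: compose_def codegeneracy_def)
  then show "f \<notin> nd n k" using ndD(3)[of f n k i "Suc i"] * by auto
next
  assume "f \<notin> nd n k"
  then obtain i where "i < k" "f i = f (Suc i)" using ord_maps_not_nd f by blast
  then obtain l where "k = Suc l" "f = compose {..k} (face l i f) (codegeneracy l i)" "face l i f \<in> ord_maps l n" "i \<le> l"
    using degenerate_factor f by metis
  then show "degenerate (std_simplex n) k f"
    unfolding degenerate_def by (intro exI[of _ l] exI[of _ i] exI[of _ "face l i f"]) simp
qed

lemma simplex_chain_eq: "f \<in> ord_maps k n \<Longrightarrow> simplex_chain (std_simplex n) k f = (if f \<in> nd n k then frag_of f else 0)"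
  by (simp add: simplex_chain_def degenerate_iff)

lemma face_nd: "f \<in> nd n (Suc k) \<Longrightarrow> i \<le> Suc k \<Longrightarrow> face k i f \<in> nd n k"
  using ndD[of f n "Suc k"] by (intro ndI) (auto simp: face_app face_undefined)

abbreviation "bdry n \<equiv> boundary (std_simplex n)"

lemma bdry_frag:
  assumes "f \<in> nd n (Suc k)"
  shows "bdry n k (frag_of f) = (\<Sum>i\<le>Suc k. frag_cmul ((-1)^i) (frag_of (face k i f)))"
  unfolding boundary_def frag_extend_of Suc_eq_plus1[symmetric]
proof (rule sum.cong[OF refl])
  fix i assume "i \<in> {..Suc k}"
  then have "face k i f \<in> nd n k" using face_nd assms by auto
  then show "frag_cmul ((-1)^i) (simplex_chain (std_simplex n) k (act (std_simplex n) k (Suc k) (coface k i) f)) =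
    frag_cmul ((-1)^i) (frag_of (face k i f))"
    using simplex_chain_eq[OF nd_ord_maps] by (simp add: face_def[symmetric])
qed

lemma bdry_ext: "bdry n k c = frag_extend (\<lambda>b. bdry n k (frag_of b)) c"
  by (simp add: boundary_def)

lemma supp_bdry_frag: "f \<in> nd n (Suc k) \<Longrightarrow> supp (bdry n k (frag_of f)) \<subseteq> (\<lambda>i. face k i f) ` {..Suc k}"
  using Poly_Mapping.keys_sum[of "\<lambda>i. frag_cmul ((-1)^i) (frag_of (face k i f))" "{..Suc k}"]
  by (fastforce simp: bdry_frag)

lemma frag_extend_cong: "(\<And>f. f \<in> S \<Longrightarrow> g f = h f) \<Longrightarrow> supp c \<subseteq> S \<Longrightarrow> frag_extend g c = frag_extend h c"
  by (rule frag_extend_eq) blast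

lemma linear_eqI:
  fixes c :: chain
  assumes "supp c \<subseteq> S" "\<And>f. f \<in> S \<Longrightarrow> T (frag_of f) = T' (frag_of f)"
    and "\<And>a b. T (a - b) = T a - (T b :: chain)" "\<And>a b. T' (a - b) = T' a - T' b"
  shows "T c = T' c"
  using assms(1)
proof (induction c rule: frag_induction)
  case zero
  then show ?case using assms(3)[of 0 0] assms(4)[of 0 0] by simp
qed (use assms in auto)

lemma bdry_diff: "bdry n k (a - b) = bdry n k a - bdry n k b"
  by (simp add: boundary_def frag_extend_diff)

lemma bdry_supp:
  assumes "supp c \<subseteq> S" "\<And>f. f \<in> S \<Longrightarrow> f \<in> nd n (Suc k)" "\<And>f i. f \<in> S \<Longrightarrow> i \<le> Suc k \<Longrightarrow> face k i f \<in> S'"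
  shows "supp (bdry n k c) \<subseteq> S'"
proof -
  have "supp (bdry n k c) \<subseteq> (\<Union>f \<in> supp c. supp (bdry n k (frag_of f)))"
    by (subst bdry_ext) (rule keys_frag_extend)
  moreover have "supp (bdry n k (frag_of f)) \<subseteq> S'" if "f \<in> supp c" for f
    using supp_bdry_frag[of f n k] assms that by blast
  ultimately show ?thesis by blast
qed

section \<open>Cones\<close>

definition above :: "nat \<Rightarrow> nat \<Rightarrow> nat \<Rightarrow> (nat \<Rightarrow> nat) set" where
  "above n v k = {f \<in> nd n k. v < f 0}"

definition cone_chain :: "nat \<Rightarrow> nat \<Rightarrow> chain \<Rightarrow> chain" where
  "cone_chain k v c = frag_extend (\<lambda>f. frag_of (cone k v f)) c"

lemma cone_app: "cone k v f 0 = v" "j \<le> k \<Longrightarrow> cone k v f (Suc j) = f j" "Suc k < j \<Longrightarrow> cone k v f j = undefined"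
  by (auto simp: cone_def)

lemma cone_nd: "f \<in> above n v k \<Longrightarrow> cone k v f \<in> nd n (Suc k)"
proof (rule ndI)
  fix j assume f: "f \<in> above n v k"
  have v: "v < n" using ndD(1)[of f n k 0] f by (auto simp: above_def)
  show "cone k v f j \<le> n" if "j \<le> Suc k"
    using that f v ndD(1)[of f n k "j - 1"] by (cases j) (auto simp: cone_app above_def)
  show "cone k v f j = undefined" if "\<not> j \<le> Suc k" using that by (simp add: cone_app)
  show "cone k v f j < cone k v f (Suc j)" if "j < Suc k"
    using that f ndD(3)[of f n k "j - 1" j] by (cases j) (auto simp: cone_app above_def)
qed

lemma nd_cone:
  assumes f: "f \<in> nd n (Suc k)"
  shows "f = cone k (f 0) (face k 0 f)" "face k 0 f \<in> above n (f 0) k"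
proof -
  show "f = cone k (f 0) (face k 0 f)"
  proof (rule ext_le[of "Suc k"])
    fix j assume "j \<le> Suc k"
    then show "f j = cone k (f 0) (face k 0 f) j" by (cases j) (auto simp: cone_app face_app)
  qed (use ndD(2)[OF f] in \<open>auto simp: cone_app\<close>)
  show "face k 0 f \<in> above n (f 0) k"
    using face_nd[OF f] ndD(3)[OF f, of 0 "Suc 0"] by (auto simp: above_def face_app)
qed

lemma face_cone:
  "f \<in> nd n k \<Longrightarrow> face k 0 (cone k v f) = f"
  "i \<le> Suc k \<Longrightarrow> face (Suc k) (Suc i) (cone (Suc k) v f) = cone k v (face k i f)"
  "face 0 (Suc 0) (cone 0 v f) = vertex v"
proof -
  show "f \<in> nd n k \<Longrightarrow> face k 0 (cone k v f) = f"
    by (rule ext_le[of k]) (auto simp: face_app cone_app face_undefined ndD(2))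
  show "face (Suc k) (Suc i) (cone (Suc k) v f) = cone k v (face k i f)" if "i \<le> Suc k"
  proof (rule ext_le[of "Suc k"])
    fix j assume "j \<le> Suc k"
    then show "face (Suc k) (Suc i) (cone (Suc k) v f) j = cone k v (face k i f) j"
      by (cases j) (auto simp: face_app cone_app)
  qed (auto simp: face_undefined cone_app)
  show "face 0 (Suc 0) (cone 0 v f) = vertex v"
    by (rule ext_le[of 0]) (auto simp: face_app cone_app face_undefined)
qed

lemma cone_chain_frag [simp]: "cone_chain k v (frag_of f) = frag_of (cone k v f)"
  by (simp add: cone_chain_def)

lemma cone_chain_diff: "cone_chain k v (a - b) = cone_chain k v a - cone_chain k v b"
  by (simp add: cone_chain_def frag_extend_diff)

lemma cone_chain_sum: "finite I \<Longrightarrow> cone_chain k v (sum g I) = (\<Sum>i\<in>I. cone_chain k v (g i))"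
  by (simp add: cone_chain_def frag_extend_sum)

lemma cone_chain_cmul: "cone_chain k v (frag_cmul a c) = frag_cmul a (cone_chain k v c)"
  by (simp add: cone_chain_def frag_extend_cmul)

lemma face_above: "f \<in> above n v (Suc k) \<Longrightarrow> i \<le> Suc k \<Longrightarrow> face k i f \<in> above n v k"
  using face_nd[of f n k i] ndD(3)[of f n "Suc k" 0 "Suc 0"]
  by (auto simp: above_def face_app intro: order.strict_trans)

text \<open>The usual contracting homotopy: face 0 of a cone is the base, and the other faces are
  the cones on the faces of the base with opposite signs.\<close>

lemma bdry_cone:
  assumes "supp c \<subseteq> above n v (Suc k)"
  shows "bdry n (Suc k) (cone_chain (Suc k) v c) = c - cone_chain k v (bdry n k c)"
  using assms
proof (rule linear_eqI)
  fix f assume f: "f \<in> above n v (Suc k)"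
  then have fn: "f \<in> nd n (Suc k)" by (simp add: above_def)
  have "bdry n (Suc k) (cone_chain (Suc k) v (frag_of f)) =
    frag_of f + (\<Sum>i\<le>Suc k. frag_cmul ((-1)^Suc i) (frag_of (cone k v (face k i f))))"
    unfolding cone_chain_frag bdry_frag[OF cone_nd[OF f]]
    by (subst sum.atMost_Suc_shift) (simp add: face_cone(1)[OF fn] face_cone(2))
  also have "(\<Sum>i\<le>Suc k. frag_cmul ((-1)^Suc i) (frag_of (cone k v (face k i f)))) = - cone_chain k v (bdry n k (frag_of f))"
    unfolding bdry_frag[OF fn] by (simp add: cone_chain_sum cone_chain_cmul sum_negf[symmetric] del: sum.atMost_Suc)
  finally show "bdry n (Suc k) (cone_chain (Suc k) v (frag_of f)) = frag_of f - cone_chain k v (bdry n k (frag_of f))"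
    by simp
qed (simp_all add: cone_chain_diff bdry_diff)

lemma bdry_cone_0:
  assumes "supp c \<subseteq> above n v 0"
  shows "bdry n 0 (cone_chain 0 v c) = c - frag_cmul (augmentation c) (frag_of (vertex v))"
  using assms
proof (rule linear_eqI)
  fix f assume f: "f \<in> above n v 0"
  then have fn: "f \<in> nd n 0" by (simp add: above_def)
  show "bdry n 0 (cone_chain 0 v (frag_of f)) = frag_of f - frag_cmul (augmentation (frag_of f)) (frag_of (vertex v))"
    unfolding cone_chain_frag bdry_frag[OF cone_nd[OF f]] by (simp add: face_cone(1)[OF fn] face_cone(3))
qed (simp_all add: cone_chain_diff bdry_diff augmentation_diff frag_cmul_diff_distrib)

lemma aug_bdry:
  assumes "supp c \<subseteq> nd n (Suc 0)"
  shows "augmentation (bdry n 0 c) = 0"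
  using assms
proof (induction c rule: frag_induction)
  case (one f)
  then show ?case by (simp add: bdry_frag augmentation_diff)
next
  case (diff a b)
  then show ?case by (simp add: bdry_diff augmentation_diff)
qed (simp add: boundary_def)

text \<open>Induction with the cone formula, in place of matching pairs of faces in a double
  sum.\<close>

lemma bdry_bdry:
  assumes "supp c \<subseteq> nd n (Suc (Suc k))"
  shows "bdry n k (bdry n (Suc k) c) = 0"
proof -
  have "bdry n k (bdry n (Suc k) (frag_of f)) = 0" if "f \<in> nd n (Suc (Suc k))" for f
    using that
  proof (induction k arbitrary: f)
    case 0
    note f = nd_cone[OF 0]
    let ?b = "frag_of (face (Suc 0) 0 f)" and ?v = "f 0"
    have b: "supp ?b \<subseteq> above n ?v (Suc 0)" using f by simp
    have b': "supp (bdry n 0 ?b) \<subseteq> above n ?v 0"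
      by (rule bdry_supp[OF b]) (auto simp: above_def[of _ _ "Suc 0"] intro: face_above[unfolded One_nat_def])
    have "bdry n (Suc 0) (frag_of f) = ?b - cone_chain 0 ?v (bdry n 0 ?b)"
      using bdry_cone[OF b] f(1) by simp
    moreover have "augmentation (bdry n 0 ?b) = 0" using f(2) by (intro aug_bdry) (simp add: above_def)
    ultimately show ?case using bdry_cone_0[OF b'] by (simp add: bdry_diff)
  next
    case (Suc k)
    note f = nd_cone[OF Suc.prems]
    let ?b = "frag_of (face (Suc (Suc k)) 0 f)" and ?v = "f 0"
    have b: "supp ?b \<subseteq> above n ?v (Suc (Suc k))" using f by simp
    have b': "supp (bdry n (Suc k) ?b) \<subseteq> above n ?v (Suc k)"
      by (rule bdry_supp[OF b]) (auto simp: above_def[of _ _ "Suc (Suc k)"] intro: face_above)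
    have "bdry n (Suc (Suc k)) (frag_of f) = ?b - cone_chain (Suc k) ?v (bdry n (Suc k) ?b)"
      using bdry_cone[OF b] f(1) by simp
    moreover have "bdry n k (bdry n (Suc k) ?b) = 0" using f(2) by (intro Suc.IH) (simp add: above_def)
    ultimately show ?case using bdry_cone[OF b'] by (simp add: bdry_diff cone_chain_def)
  qed
  then have "bdry n k (bdry n (Suc k) c) = (\<lambda>c. 0) c"
    by (intro linear_eqI[OF assms, where T = "\<lambda>c. bdry n k (bdry n (Suc k) c)" and T' = "\<lambda>c. 0"])
      (simp_all add: bdry_diff)
  then show ?thesis by simp
qed

lemma directed_complex_above: "directed_complex (above n v) (bdry n)"
proof
  show "supp (bdry n k c) \<subseteq> above n v k" if "supp c \<subseteq> above n v (Suc k)" for k c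
    using that by (rule bdry_supp) (auto simp: above_def[of _ _ "Suc k"] intro: face_above)
  show "bdry n k (bdry n (Suc k) c) = 0" if "supp c \<subseteq> above n v (Suc (Suc k))" for k c
    using that by (intro bdry_bdry) (auto simp: above_def)
qed (rule bdry_ext)

lemma directed_complex_nd: "directed_complex (nd n) (bdry n)"
proof
  show "supp (bdry n k c) \<subseteq> nd n k" if "supp c \<subseteq> nd n (Suc k)" for k c
    using that by (rule bdry_supp) (auto intro: face_nd)
qed (rule bdry_ext, rule bdry_bdry)

lemma cf_relabel:
  assumes "inj_on h S" "supp c \<subseteq> S"
  shows "x \<in> S \<Longrightarrow> cf (frag_extend (\<lambda>f. frag_of (h f)) c) (h x) = cf c x"
    and "y \<notin> h ` S \<Longrightarrow> cf (frag_extend (\<lambda>f. frag_of (h f)) c) y = 0"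
proof -
  show "cf (frag_extend (\<lambda>f. frag_of (h f)) c) (h x) = cf c x" if x: "x \<in> S"
  proof -
    have "cf (frag_extend (\<lambda>f. frag_of (h f)) c) (h x) = (\<Sum>f\<in>supp c. cf c f * (if f = x then 1 else 0))"
      unfolding frag_extend_def Poly_Mapping.lookup_sum lookup_frag_cmul lookup_frag_of
      by (rule sum.cong) (use assms x in \<open>auto simp: inj_on_def\<close>)
    then show ?thesis by (simp add: if_distrib[of "\<lambda>z. _ * z"] sum.delta in_keys_iff cong: if_cong)
  qed
  show "cf (frag_extend (\<lambda>f. frag_of (h f)) c) y = 0" if "y \<notin> h ` S"
    unfolding frag_extend_def Poly_Mapping.lookup_sum lookup_frag_cmul lookup_frag_of
    by (rule sum.neutral) (use assms that in auto)
qed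

lemma inj_cone: "inj_on (cone k v) (above n v' k)"
proof (rule inj_onI)
  fix f g assume fg: "f \<in> above n v' k" "g \<in> above n v' k" and "cone k v f = cone k v g"
  then have "f j = g j" if "j \<le> k" for j using that by (metis cone_app(2))
  then show "f = g" using fg by (intro ext_le[of k]) (auto simp: above_def ndD(2))
qed

text \<open>In positive degrees the source of a cone is the cone on the target of its base. Of the
  boundary of that chain the negative terms are the cones on the target one degree lower; nothing
  cancels, as the other terms either avoid \<open>v\<close> or are cones on the source, which is
  disjoint from the target.\<close>

lemma atom_cone:
  assumes b: "b \<in> above n v p" and v: "v \<le> n"
  shows "m \<le> p \<Longrightarrow> atom (bdry n) (Suc p) (cone p v b) (Suc m) Minus = cone_chain m v (atom (bdry n) p b m Plus)"
    and "augmentation (atom (bdry n) p b 0 Plus) = 1 \<Longrightarrow>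
      atom (bdry n) (Suc p) (cone p v b) 0 Minus = frag_of (vertex v) \<and>
      atom (bdry n) (Suc p) (cone p v b) 0 Plus = atom (bdry n) p b 0 Plus"
proof -
  interpret V: directed_complex "above n v" "bdry n" by (rule directed_complex_above)
  interpret N: directed_complex "nd n" "bdry n" by (rule directed_complex_nd)
  let ?a = "N.at (Suc p) (cone p v b)" and ?b = "N.at p b"
  have an: "cone p v b \<in> nd n (Suc p)" by (rule cone_nd[OF b])
  have step: "?a l Plus = positive_part (bdry n l (?a (Suc l) Minus))"
    "?a l Minus = positive_part (- bdry n l (?a (Suc l) Minus))" if "l < Suc p" for l
    using atom_step[OF that, of "bdry n" "cone p v b"]
      trans[OF N.at_facts(2)[OF an, of l Plus] N.at_facts(2)[OF an, of l Minus, symmetric]] by simp_all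
  have bp: "supp (?b l \<alpha>) \<subseteq> above n v l" "pos (above n v l) (?b l \<alpha>)" for l \<alpha>
    using V.at_facts(1)[OF b] pos_supp by auto
  note cc = cf_relabel[OF inj_cone bp(1), folded cone_chain_def]
  have Minus: "?a (Suc m) Minus = cone_chain m v (?b m Plus)" if "m \<le> p" for m
    using that
  proof (induction "p - m" arbitrary: m)
    case 0
    then show ?case by simp
  next
    case (Suc r)
    then have IH: "?a (Suc (Suc m)) Minus = cone_chain (Suc m) v (?b (Suc m) Plus)" by simp
    have m: "m < p" using Suc by simp
    have "bdry n (Suc m) (?a (Suc (Suc m)) Minus) = ?b (Suc m) Plus - cone_chain m v (?b m Plus - ?b m Minus)"
      unfolding IH bdry_cone[OF bp(1)] V.at_facts(2)[OF b] ..
    then have *: "bdry n (Suc m) (?a (Suc (Suc m)) Minus) =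
        ?b (Suc m) Plus - (cone_chain m v (?b m Plus) - cone_chain m v (?b m Minus))"
      by (simp add: cone_chain_diff)
    show ?case unfolding step(2)[OF Suc_less_eq[THEN iffD2, OF m]] *
    proof (rule chain_eqI)
      fix e
      show "cf (positive_part (- (?b (Suc m) Plus - (cone_chain m v (?b m Plus) - cone_chain m v (?b m Minus))))) e =
        cf (cone_chain m v (?b m Plus)) e"
      proof (cases "e \<in> cone m v ` above n v m")
        case True
        then obtain x where x: "x \<in> above n v m" "e = cone m v x" by blast
        have "e \<notin> above n v (Suc m)" using x by (auto simp: above_def cone_app)
        then have "cf (?b (Suc m) Plus) e = 0" using bp(1)[of "Suc m" Plus] by (auto simp: in_keys_iff)
        moreover have "cf (?b m Plus) x = 0 \<or> cf (?b m Minus) x = 0"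
          using atom_step[OF m, of "bdry n" b]
            trans[OF V.at_facts(2)[OF b, of m Plus] V.at_facts(2)[OF b, of m Minus, symmetric]]
          by (auto simp: cf_simps max_def)
        ultimately show ?thesis
          using pos_nonneg[OF bp(2), of m Plus x] pos_nonneg[OF bp(2), of m Minus x] x
          by (auto simp: cf_simps cc)
      next
        case False
        then show ?thesis using pos_nonneg[OF bp(2), of "Suc m" Plus e] by (simp add: cf_simps cc(2))
      qed
    qed
  qed
  then show "m \<le> p \<Longrightarrow> ?a (Suc m) Minus = cone_chain m v (?b m Plus)" .
  assume 1: "augmentation (?b 0 Plus) = 1"
  have d: "bdry n 0 (?a (Suc 0) Minus) = ?b 0 Plus - frag_of (vertex v)"
    using Minus[of 0] bdry_cone_0[OF bp(1)[of 0 Plus]] 1 by simp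
  have vb: "cf (?b 0 Plus) (vertex v) = 0"
    using bp(1)[of 0 Plus] by (auto simp: above_def in_keys_iff)
  have "?a 0 Minus = frag_of (vertex v)"
    unfolding step(2)[OF zero_less_Suc] d
    by (rule chain_eqI) (use vb pos_nonneg[OF bp(2), of 0 Plus] in \<open>auto simp: cf_simps\<close>)
  moreover have "?a 0 Plus = ?b 0 Plus"
    unfolding step(1)[OF zero_less_Suc] d
    by (rule chain_eqI) (use vb pos_nonneg[OF bp(2), of 0 Plus] in \<open>auto simp: cf_simps\<close>)
  ultimately show "?a 0 Minus = frag_of (vertex v) \<and> ?a 0 Plus = ?b 0 Plus" by simp
qed

text \<open>This yields unitality, and later the coincidence of the ends of the simplex with those
  of an inner face.\<close>

lemma atom_ends:
  assumes "a \<in> nd n p"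
  shows "atom (bdry n) p a 0 Minus = frag_of (vertex (a 0))" "atom (bdry n) p a 0 Plus = frag_of (vertex (a p))"
proof -
  have "atom (bdry n) p a 0 Minus = frag_of (vertex (a 0)) \<and> atom (bdry n) p a 0 Plus = frag_of (vertex (a p))"
    using assms
  proof (induction p arbitrary: a)
    case 0
    have "a = vertex (a 0)" by (rule ext_le[of 0]) (use ndD(2)[OF 0] in auto)
    then show ?case by simp
  next
    case (Suc p)
    note c = nd_cone[OF Suc.prems]
    let ?b = "face p 0 a"
    have "?b \<in> nd n p" using c(2) by (simp add: above_def)
    note IH = conjunct2[OF Suc.IH[OF this]]
    have 1: "augmentation (atom (bdry n) p ?b 0 Plus) = 1" unfolding IH by (rule augmentation_frag_of)
    have "a 0 \<le> n" using ndD(1)[OF Suc.prems] by simp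
    moreover have "?b p = a (Suc p)" by (simp add: face_app)
    ultimately show ?case using atom_cone(2)[OF c(2) _ 1, folded c(1)] IH by metis
  qed
  then show "atom (bdry n) p a 0 Minus = frag_of (vertex (a 0))" "atom (bdry n) p a 0 Plus = frag_of (vertex (a p))" by auto
qed

section \<open>The total order on faces\<close>

text \<open>
  The key compares the vertex sets of two faces at the first vertex where they differ; deleting the
  vertex number \<open>i\<close> flips the digits from that vertex on, the first one from \<open>even i\<close> to \<open>odd i\<close>.
\<close>

definition digit :: "nat \<Rightarrow> (nat \<Rightarrow> nat) \<Rightarrow> nat \<Rightarrow> int" where
  "digit k f v = (if even (card {j. j \<le> k \<and> f j \<le> v}) then 1 else 0)"

definition simplex_key :: "nat \<Rightarrow> nat \<Rightarrow> (nat \<Rightarrow> nat) \<Rightarrow> int" where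
  "simplex_key n k f = (\<Sum>v\<le>n. 2 ^ (n - v) * digit k f v)"

text \<open>Comparison of binary numbers by the first digit in which they differ.\<close>

lemma digit_less:
  fixes d d' :: "nat \<Rightarrow> int"
  assumes "\<And>v. v < w \<Longrightarrow> d v = d' v" "d w = 0" "d' w = 1" "w \<le> n"
    and d: "\<And>v. 0 \<le> d v \<and> d v \<le> 1" "\<And>v. 0 \<le> d' v \<and> d' v \<le> 1"
  shows "(\<Sum>v\<le>n. 2 ^ (n - v) * d v) < (\<Sum>v\<le>n. 2 ^ (n - v) * d' v)"
  using \<open>w \<le> n\<close>
proof (induction "n" rule: dec_induct)
  case base
  have "(\<Sum>v<w. 2 ^ (w - v) * d v) = (\<Sum>v<w. 2 ^ (w - v) * d' v)" using assms(1) by (intro sum.cong) auto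
  then show ?case using assms(2,3) by (simp add: lessThan_Suc_atMost[symmetric])
next
  case (step n)
  have *: "(\<Sum>v\<le>Suc n. 2 ^ (Suc n - v) * d v) = 2 * (\<Sum>v\<le>n. 2 ^ (n - v) * d v) + d (Suc n)" for d :: "nat \<Rightarrow> int"
    by (simp add: sum_distrib_left Suc_diff_le mult.assoc)
  show ?case unfolding * using step.IH d[of "Suc n"] by linarith
qed

lemma card_below: "f \<in> nd n k \<Longrightarrow> i \<le> k \<Longrightarrow> card {j. j \<le> k \<and> f j \<le> f i} = Suc i"
proof -
  assume f: "f \<in> nd n k" and i: "i \<le> k"
  have "{j. j \<le> k \<and> f j \<le> f i} = {..i}"
    using nd_le[OF f] ndD(3)[OF f] i by (auto simp: not_less[symmetric])
  then show ?thesis by simp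
qed

lemma key_less:
  assumes "w \<le> n" "\<And>v. v < w \<Longrightarrow> card {j. j \<le> k \<and> f j \<le> v} = card {j. j \<le> l \<and> g j \<le> v}"
    and "odd (card {j. j \<le> k \<and> f j \<le> w})" "even (card {j. j \<le> l \<and> g j \<le> w})"
  shows "simplex_key n k f < simplex_key n l g"
  unfolding simplex_key_def by (rule digit_less[of w]) (use assms in \<open>auto simp: digit_def\<close>)

text \<open>Before \<open>f i\<close> the deletion of vertex number \<open>i\<close> goes unnoticed;
  at \<open>f i\<close> the count drops from \<open>i + 1\<close> to \<open>i\<close>, which flips
  the digit.\<close>

lemma card_face:
  assumes f: "f \<in> nd n (Suc k)" and i: "i \<le> Suc k"
  shows "v < f i \<Longrightarrow> card {j. j \<le> k \<and> face k i f j \<le> v} = card {j. j \<le> Suc k \<and> f j \<le> v}"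
    and "card {j. j \<le> k \<and> face k i f j \<le> f i} = i"
proof -
  show "card {j. j \<le> k \<and> face k i f j \<le> v} = card {j. j \<le> Suc k \<and> f j \<le> v}" if v: "v < f i"
  proof -
    have "j < i" if "j \<le> Suc k" "f j \<le> v" for j
      using nd_le[OF f, of i j] that v by (cases "j < i") auto
    moreover have "j < i" if "j \<le> k" "face k i f j \<le> v" for j
      using nd_le[OF f, of i "Suc j"] that v by (cases "j < i") (auto simp: face_app)
    ultimately have "{j. j \<le> k \<and> face k i f j \<le> v} = {j. j \<le> Suc k \<and> f j \<le> v}"
      using i by (fastforce simp: face_app)
    then show ?thesis by simp
  qed
  have "{j. j \<le> k \<and> face k i f j \<le> f i} = {..<i}"
  proof (intro set_eqI iffI)
    fix j assume "j \<in> {j. j \<le> k \<and> face k i f j \<le> f i}"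
    then show "j \<in> {..<i}" using ndD(3)[OF f, of i "Suc j"] by (cases "j < i") (auto simp: face_app)
  next
    fix j assume "j \<in> {..<i}"
    then show "j \<in> {j. j \<le> k \<and> face k i f j \<le> f i}" using i nd_le[OF f, of j i] by (auto simp: face_app)
  qed
  then show "card {j. j \<le> k \<and> face k i f j \<le> f i} = i" by simp
qed

lemma key_face:
  assumes f: "f \<in> nd n (Suc k)" and i: "i \<le> Suc k"
  shows "even i \<Longrightarrow> simplex_key n (Suc k) f < simplex_key n k (face k i f)"
    and "odd i \<Longrightarrow> simplex_key n k (face k i f) < simplex_key n (Suc k) f"
  using card_face[OF f i] card_below[OF f i] ndD(1)[OF f i]
  by (auto intro!: key_less[of "f i"])

lemma cf_bdry_frag:
  assumes f: "f \<in> nd n (Suc k)"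
  shows "0 < cf (bdry n k (frag_of f)) e \<Longrightarrow> \<exists>i\<le>Suc k. even i \<and> e = face k i f"
    and "cf (bdry n k (frag_of f)) e < 0 \<Longrightarrow> \<exists>i\<le>Suc k. odd i \<and> e = face k i f"
proof -
  have *: "cf (bdry n k (frag_of f)) e = (\<Sum>i\<le>Suc k. (-1)^i * (if e = face k i f then 1 else 0))"
    unfolding bdry_frag[OF f] Poly_Mapping.lookup_sum by simp
  show "\<exists>i\<le>Suc k. even i \<and> e = face k i f" if "0 < cf (bdry n k (frag_of f)) e"
  proof (rule ccontr)
    assume "\<not> ?thesis"
    then have "cf (bdry n k (frag_of f)) e \<le> 0" unfolding * by (intro sum_nonpos) (auto simp: minus_one_power_iff)
    with that show False by simp
  qed
  show "\<exists>i\<le>Suc k. odd i \<and> e = face k i f" if "cf (bdry n k (frag_of f)) e < 0"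
  proof (rule ccontr)
    assume "\<not> ?thesis"
    then have "0 \<le> cf (bdry n k (frag_of f)) e" unfolding * by (intro sum_nonneg) (auto simp: minus_one_power_iff)
    with that show False by simp
  qed
qed

text \<open>At the first index \<open>j\<close> with different vertices, say
  \<open>f j < g j\<close>, the numbers of vertices up to \<open>f j\<close> are
  \<open>j + 1\<close> and \<open>j\<close>, of different parity.\<close>

lemma inj_simplex_key: "inj_on (simplex_key n k) (nd n k)"
proof -
  have *: "simplex_key n k f \<noteq> simplex_key n k g"
    if f: "f \<in> nd n k" and g: "g \<in> nd n k" and j: "j \<le> k" "f j < g j" "\<And>i. i < j \<Longrightarrow> f i = g i" for f g j
  proof -
    have eq: "{i. i \<le> k \<and> f i \<le> v} = {i. i \<le> k \<and> g i \<le> v}" if "v < f j" for v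
    proof -
      have "i < j" if "i \<le> k" "f i \<le> v" for i
        using nd_le[OF f, of j i] that \<open>v < f j\<close> by (cases "i < j") auto
      moreover have "i < j" if "i \<le> k" "g i \<le> v" for i
        using nd_le[OF g, of j i] that \<open>v < f j\<close> j(2) by (cases "i < j") auto
      ultimately show ?thesis using j(3) by (intro set_eqI) (metis mem_Collect_eq)
    qed
    have "{i. i \<le> k \<and> g i \<le> f j} = {..<j}"
    proof (intro set_eqI iffI)
      fix i assume "i \<in> {i. i \<le> k \<and> g i \<le> f j}"
      then show "i \<in> {..<j}" using nd_le[OF g, of j i] j(2) by (cases "i < j") auto
    next
      fix i assume "i \<in> {..<j}"
      then show "i \<in> {i. i \<le> k \<and> g i \<le> f j}" using j ndD(3)[OF f, of i j] by auto
    qed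
    then have "card {i. i \<le> k \<and> g i \<le> f j} = j" by simp
    then show ?thesis
      using key_less[of "f j" n k f k g] key_less[of "f j" n k g k f] card_below[OF f j(1)] ndD(1)[OF f j(1)] eq
      by (cases "even j") auto
  qed
  show ?thesis
  proof (rule inj_onI, rule ccontr)
    fix f g assume fg: "f \<in> nd n k" "g \<in> nd n k" "simplex_key n k f = simplex_key n k g" "f \<noteq> g"
    then have "\<exists>j\<le>k. f j \<noteq> g j" using ext_le[of k f g] ndD(2)[of _ n k] by metis
    then obtain j' where j': "j' \<le> k" "f j' \<noteq> g j'" by blast
    define j where "j = (LEAST j. f j \<noteq> g j)"
    have jk: "j \<le> k" unfolding j_def using Least_le[of "\<lambda>j. f j \<noteq> g j", OF j'(2)] j'(1) by (rule order_trans)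
    have jne: "f j \<noteq> g j" unfolding j_def by (rule LeastI[of "\<lambda>j. f j \<noteq> g j", OF j'(2)])
    have jl: "f i = g i" if "i < j" for i
      using not_less_Least[of i "\<lambda>j. f j \<noteq> g j"] that unfolding j_def by blast
    show False
    proof (cases "f j < g j")
      case True
      show ?thesis using *[OF fg(1,2) jk True jl] fg(3) by blast
    next
      case False
      then have "g j < f j" using jne by simp
      from *[OF fg(2,1) jk this jl[symmetric]] fg(3) show ?thesis by simp
    qed
  qed
qed

lemma steiner_complex_nd: "steiner_complex (nd n) (bdry n) (simplex_key n)"
proof -
  interpret directed_complex "nd n" "bdry n" by (rule directed_complex_nd)
  show ?thesis
  proof
    show "augmentation (bdry n 0 c) = 0" if "supp c \<subseteq> nd n (Suc 0)" for c using aug_bdry that .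
    show "simplex_key n (Suc k) a < simplex_key n k e" if "a \<in> nd n (Suc k)" "0 < cf (bdry n k (frag_of a)) e" for a k e
      using cf_bdry_frag(1)[OF that] key_face(1)[OF that(1)] by auto
    show "simplex_key n k e < simplex_key n (Suc k) a" if "a \<in> nd n (Suc k)" "cf (bdry n k (frag_of a)) e < 0" for a k e
      using cf_bdry_frag(2)[OF that] key_face(2)[OF that(1)] by auto
    show "inj_on (simplex_key n k) (nd n k)" for k by (rule inj_simplex_key)
    show "augmentation (atom (bdry n) p a 0 \<alpha>) = 1" if "a \<in> nd n p" for a p \<alpha>
      using atom_ends[OF that] by (cases \<alpha>) auto
  qed
qed

text \<open>Unitality passes to a subcomplex because an atom is computed from \<open>del\<close>
  alone.\<close>

lemma steiner_complex_sub:
  assumes "steiner_complex B del key" and sub: "\<And>k. B' k \<subseteq> B k"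
    and cl: "\<And>k c. supp c \<subseteq> B' (Suc k) \<Longrightarrow> supp (del k c) \<subseteq> B' k"
  shows "steiner_complex B' del key"
proof -
  interpret steiner_complex B del key by fact
  show ?thesis
  proof
    show "del k c = frag_extend (\<lambda>b. del k (frag_of b)) c" for k c by (rule del_ext)
    show "del k (del (Suc k) c) = 0" if "supp c \<subseteq> B' (Suc (Suc k))" for k c using that sub del_del by blast
    show "augmentation (del 0 c) = 0" if "supp c \<subseteq> B' (Suc 0)" for c using that sub aug_del by blast
    show "inj_on (key k) (B' k)" for k using key_inj sub inj_on_subset by blast
    show "key (Suc k) a < key k e" if "a \<in> B' (Suc k)" "0 < cf (del k (frag_of a)) e" for a k e
      using that sub key_target by blast
    show "key k e < key (Suc k) a" if "a \<in> B' (Suc k)" "cf (del k (frag_of a)) e < 0" for a k e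
      using that sub key_source by blast
    show "augmentation (atom del p a 0 \<alpha>) = 1" if "a \<in> B' p" for a p \<alpha> using that sub unital by blast
  qed (rule cl)
qed

section \<open>Functoriality in the simplex\<close>

definition push :: "nat \<Rightarrow> (nat \<Rightarrow> nat) \<Rightarrow> nat \<Rightarrow> chain \<Rightarrow> chain" where
  "push n \<theta> k c = chain_map (std_simplex n) (\<lambda>l v. compose {..l} \<theta> v) k c"

definition push_cell :: "nat \<Rightarrow> (nat \<Rightarrow> nat) \<Rightarrow> oriental_cell \<Rightarrow> oriental_cell" where
  "push_cell n \<theta> x = (\<lambda>k \<alpha>. push n \<theta> k (x k \<alpha>))"

lemma push_add: "push n \<theta> k (a + b) = push n \<theta> k a + push n \<theta> k b"
  by (simp add: push_def chain_map_def frag_extend_add)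

lemma push_diff: "push n \<theta> k (a - b) = push n \<theta> k a - push n \<theta> k b"
  by (simp add: push_def chain_map_def frag_extend_diff)

lemma push_0 [simp]: "push n \<theta> k 0 = 0"
  by (simp add: push_def chain_map_def)

lemma push_cmul: "push n \<theta> k (frag_cmul a c) = frag_cmul a (push n \<theta> k c)"
  by (simp add: push_def chain_map_def frag_extend_cmul)

lemma push_sum: "finite I \<Longrightarrow> push n \<theta> k (sum g I) = (\<Sum>i\<in>I. push n \<theta> k (g i))"
  by (simp add: push_def chain_map_def frag_extend_sum)

lemma push_frag:
  assumes "\<theta> \<in> ord_maps m n" "f \<in> ord_maps k m"
  shows "push n \<theta> k (frag_of f) = (if compose {..k} \<theta> f \<in> nd n k then frag_of (compose {..k} \<theta> f) else 0)"
  using simplex_chain_eq[OF compose_ord_maps[OF assms(2,1)]] by (simp add: push_def chain_map_def)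

lemma coface_ord_maps: "coface k i \<in> ord_maps k (Suc k)"
  by (auto simp: coface_def ord_maps_def mono_on_def)

lemma compose_assoc_le: "\<theta> \<in> ord_maps l k \<Longrightarrow> compose {..l} \<eta> (compose {..l} f \<theta>) = compose {..l} (compose {..k} \<eta> f) \<theta>"
  by (rule ext_le[of l]) (auto simp: compose_def ord_mapsD(1))

lemma face_compose: "face k i (compose {..Suc k} \<theta> f) = compose {..k} \<theta> (face k i f)"
  unfolding face_def by (rule compose_assoc_le[OF coface_ord_maps, symmetric])

text \<open>If \<open>\<theta>\<close> identifies two successive vertices, the two faces omitting
  one of them have the same image with opposite signs, and the other faces stay degenerate.\<close>

lemma push_bdry:
  assumes th: "\<theta> \<in> ord_maps m n" and c: "supp c \<subseteq> nd m (Suc k)"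
  shows "bdry n k (push n \<theta> (Suc k) c) = push n \<theta> k (bdry m k c)"
proof (rule linear_eqI[OF c, where T = "\<lambda>c. bdry n k (push n \<theta> (Suc k) c)" and T' = "\<lambda>c. push n \<theta> k (bdry m k c)"])
  fix f assume f: "f \<in> nd m (Suc k)"
  let ?f = "compose {..Suc k} \<theta> f"
  have fo: "?f \<in> ord_maps (Suc k) n" using compose_ord_maps[OF nd_ord_maps[OF f] th] .
  have R: "push n \<theta> k (bdry m k (frag_of f)) = (\<Sum>i\<le>Suc k. frag_cmul ((-1)^i) (if face k i ?f \<in> nd n k then frag_of (face k i ?f) else 0))"
    unfolding bdry_frag[OF f] push_sum[OF finite_atMost] push_cmul
    by (rule sum.cong) (use push_frag[OF th nd_ord_maps[OF face_nd[OF f]]] in \<open>auto simp: face_compose\<close>)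
  show "bdry n k (push n \<theta> (Suc k) (frag_of f)) = push n \<theta> k (bdry m k (frag_of f))"
  proof (cases "?f \<in> nd n (Suc k)")
    case True
    then show ?thesis unfolding R using push_frag[OF th nd_ord_maps[OF f]] face_nd[OF True]
      by (simp add: bdry_frag del: sum.atMost_Suc)
  next
    case False
    then obtain j where j: "j < Suc k" "?f j = ?f (Suc j)" using ord_maps_not_nd[OF fo] by metis
    let ?t = "\<lambda>i. frag_cmul ((-1)^i) (if face k i ?f \<in> nd n k then frag_of (face k i ?f) else 0)"
    have "?t i = 0" if "i \<in> {..Suc k} - {j, Suc j}" for i
    proof -
      have "face k i ?f \<notin> nd n k"
      proof
        assume g: "face k i ?f \<in> nd n k"
        show False
        proof (cases "i < j")
          case True
          then obtain j' where "j = Suc j'" by (cases j) auto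
          then show False using True ndD(3)[OF g, of j' j] j by (simp add: face_app)
        next
          case False
          then have "Suc j < i" using that by auto
          then show False using ndD(3)[OF g, of j "Suc j"] that j by (simp add: face_app)
        qed
      qed
      then show ?thesis by simp
    qed
    then have "(\<Sum>i\<le>Suc k. ?t i) = (\<Sum>i\<in>{j, Suc j}. ?t i)"
      using j by (intro sum.mono_neutral_right) auto
    also have "face k (Suc j) ?f = face k j ?f"
      by (rule ext_le[of k]) (use j in \<open>auto simp: face_app face_undefined less_Suc_eq\<close>)
    then have "(\<Sum>i\<in>{j, Suc j}. ?t i) = 0"
      using frag_cmul_distrib[of "(-1)^j" "- ((-1)^j)" "frag_of (face k j ?f)"] by simp
    finally show ?thesis unfolding R using push_frag[OF th nd_ord_maps[OF f]] False by (simp add: boundary_def)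
  qed
qed (simp_all add: push_diff bdry_diff)

lemma push_pos:
  assumes th: "\<theta> \<in> ord_maps m n" and c: "pos (nd m k) c"
    and S: "\<And>f. f \<in> nd m k \<Longrightarrow> compose {..k} \<theta> f \<in> nd n k \<Longrightarrow> compose {..k} \<theta> f \<in> S"
  shows "pos S (push n \<theta> k c)"
proof -
  have e: "push n \<theta> k c = (\<Sum>f\<in>supp c. frag_cmul (cf c f) (push n \<theta> k (frag_of f)))"
    by (simp add: push_def chain_map_def frag_extend_def)
  have "pos S (\<Sum>f\<in>A. frag_cmul (cf c f) (push n \<theta> k (frag_of f)))" if "finite A" "A \<subseteq> supp c" for A
    using that
  proof (induction A rule: finite_induct)
    case (insert f A)
    have f: "f \<in> nd m k" using insert.prems pos_supp[OF c] by auto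
    have "pos S (frag_cmul (cf c f) (push n \<theta> k (frag_of f)))"
      unfolding push_frag[OF th nd_ord_maps[OF f]] using S[OF f] pos_nonneg[OF c, of f] by (auto simp: pos_iff)
    then show ?case using insert by (auto intro: pos_add)
  qed simp
  then show ?thesis unfolding e by simp
qed

lemma vertex_nd: "f \<in> ord_maps 0 n \<longleftrightarrow> f \<in> nd n 0"
proof
  assume "f \<in> ord_maps 0 n"
  then show "f \<in> nd n 0" by (intro ndI) (simp_all add: ord_mapsD)
qed (rule nd_ord_maps)

lemma push_aug:
  assumes th: "\<theta> \<in> ord_maps m n" and c: "supp c \<subseteq> nd m 0"
  shows "augmentation (push n \<theta> 0 c) = augmentation c"
  using c
proof (induction c rule: frag_induction)
  case (one f)
  then show ?case using push_frag[OF th nd_ord_maps[OF one]] compose_ord_maps[OF nd_ord_maps[OF one] th] vertex_nd by simp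
qed (simp_all add: push_diff augmentation_diff)

lemma compose_not_nd:
  assumes f: "f \<in> ord_maps k m" and "f \<notin> nd m k"
  shows "compose {..k} \<theta> f \<notin> nd n k"
proof
  assume g: "compose {..k} \<theta> f \<in> nd n k"
  obtain i where "i < k" "f i = f (Suc i)" using ord_maps_not_nd[OF assms] .
  then show False using ndD(3)[OF g, of i "Suc i"] by (simp add: compose_def)
qed

lemma push_push:
  assumes th: "\<theta> \<in> ord_maps l m" and et: "\<eta> \<in> ord_maps m n" and c: "supp c \<subseteq> nd l k"
  shows "push n \<eta> k (push m \<theta> k c) = push n (compose {..l} \<eta> \<theta>) k c"
proof (rule linear_eqI[OF c, where T = "\<lambda>c. push n \<eta> k (push m \<theta> k c)" and T' = "push n (compose {..l} \<eta> \<theta>) k"])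
  fix f assume f: "f \<in> nd l k"
  have fo: "compose {..k} \<theta> f \<in> ord_maps k m" using compose_ord_maps[OF nd_ord_maps[OF f] th] .
  have e: "compose {..k} (compose {..l} \<eta> \<theta>) f = compose {..k} \<eta> (compose {..k} \<theta> f)"
    by (rule compose_assoc_le[OF nd_ord_maps[OF f], symmetric])
  show "push n \<eta> k (push m \<theta> k (frag_of f)) = push n (compose {..l} \<eta> \<theta>) k (frag_of f)"
    using push_frag[OF th nd_ord_maps[OF f]] push_frag[OF et fo]
      push_frag[OF compose_ord_maps[OF th et] nd_ord_maps[OF f]] compose_not_nd[OF fo]
    by (auto simp: e)
qed (simp_all add: push_diff)

definition oid :: "nat \<Rightarrow> nat \<Rightarrow> nat" where "oid n = restrict id {..n}"

lemma oid_nd: "oid n \<in> nd n n"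
  by (rule ndI) (auto simp: oid_def)

lemma oid_ord_maps: "oid n \<in> ord_maps n n"
  by (rule nd_ord_maps[OF oid_nd])

lemma compose_oid: "f \<in> ord_maps k n \<Longrightarrow> compose {..k} (oid n) f = f" "f \<in> ord_maps k n \<Longrightarrow> compose {..k} f (oid k) = f"
  by (rule ext_le[of k]; auto simp: compose_def oid_def ord_mapsD)+

section \<open>Subcomplexes and the cells they support\<close>

text \<open>The simplicial subsets of the simplex, so that the horn and the whole simplex are
  instances of one argument.\<close>

definition closed_family :: "nat \<Rightarrow> (nat \<Rightarrow> (nat \<Rightarrow> nat) set) \<Rightarrow> bool" where
  "closed_family n Y \<longleftrightarrow> (\<forall>m. Y m \<subseteq> ord_maps m n) \<and>
     (\<forall>l m \<theta> a. \<theta> \<in> ord_maps l m \<longrightarrow> a \<in> Y m \<longrightarrow> compose {..l} a \<theta> \<in> Y l)"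

abbreviation basis :: "nat \<Rightarrow> (nat \<Rightarrow> (nat \<Rightarrow> nat) set) \<Rightarrow> nat \<Rightarrow> (nat \<Rightarrow> nat) set" where
  "basis n Y \<equiv> \<lambda>k. nd n k \<inter> Y k"

lemma closed_familyD:
  assumes "closed_family n Y"
  shows "a \<in> Y m \<Longrightarrow> a \<in> ord_maps m n" "\<theta> \<in> ord_maps l m \<Longrightarrow> a \<in> Y m \<Longrightarrow> compose {..l} a \<theta> \<in> Y l"
  using assms by (auto simp: closed_family_def)

lemma closed_family_all: "closed_family n (\<lambda>m. ord_maps m n)"
  by (simp add: closed_family_def compose_ord_maps)

lemma basis_all: "basis n (\<lambda>m. ord_maps m n) = nd n"
  using nd_ord_maps by (auto simp: fun_eq_iff)

lemma closed_family_horn: "closed_family n (\<lambda>m. simplices (horn n i) m)"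
proof -
  interpret simplicial_set "horn n i" by (rule simplicial_set_horn)
  have "act (horn n i) = act (std_simplex n)" by (simp add: horn_def)
  then show ?thesis using act_simplex
    by (auto simp: closed_family_def) (auto simp: horn_def opposite_face_def)
qed

lemma steiner_complex_basis:
  assumes Y: "closed_family n Y"
  shows "steiner_complex (basis n Y) (bdry n) (simplex_key n)"
proof (rule steiner_complex_sub[OF steiner_complex_nd])
  show "supp (bdry n k c) \<subseteq> basis n Y k" if "supp c \<subseteq> basis n Y (Suc k)" for k c
    by (rule bdry_supp[OF that])
      (use face_nd closed_familyD(2)[OF Y coface_ord_maps] in \<open>auto simp: face_def\<close>)
qed simp

abbreviation ocells :: "nat \<Rightarrow> nat \<Rightarrow> oriental_cell set" where
  "ocells n \<equiv> cx_cells (nd n) (bdry n)"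

lemma push_cell_cells:
  assumes th: "\<theta> \<in> ord_maps m n" and x: "x \<in> ocells m p"
    and S: "\<And>k f. f \<in> nd m k \<Longrightarrow> compose {..k} \<theta> f \<in> nd n k \<Longrightarrow> compose {..k} \<theta> f \<in> B k"
  shows "push_cell n \<theta> x \<in> cx_cells B (bdry n) p"
proof -
  interpret M: steiner_complex "nd m" "bdry m" "simplex_key m" by (rule steiner_complex_nd)
  note D = M.clD[OF x]
  have s: "supp (x k \<alpha>) \<subseteq> nd m k" for k \<alpha> using D(1) pos_supp by blast
  have "pos (B k) (push n \<theta> k (x k \<alpha>))" for k \<alpha> by (rule push_pos[OF th D(1)]) (rule S)
  moreover have "push n \<theta> k (x k \<alpha>) = 0" if "p < k" for k \<alpha> using D(2)[OF that] by simp
  moreover have "bdry n k (push n \<theta> (Suc k) (x (Suc k) \<alpha>)) = push n \<theta> k (x k Plus) - push n \<theta> k (x k Minus)" for k \<alpha>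
    using push_bdry[OF th s] D(3) by (simp add: push_diff)
  moreover have "augmentation (push n \<theta> 0 (x 0 \<alpha>)) = 1" for \<alpha> using push_aug[OF th s] D(4) by simp
  ultimately show ?thesis by (auto simp: cx_cells_def push_cell_def)
qed

lemma push_cell_basis:
  assumes "closed_family n Y" "a \<in> Y m" "x \<in> ocells m p"
  shows "push_cell n a x \<in> cx_cells (basis n Y) (bdry n) p"
  by (rule push_cell_cells[OF closed_familyD(1)[OF assms(1,2)] assms(3)])
    (use closed_familyD(2)[OF assms(1) nd_ord_maps assms(2)] in auto)

lemma push_cell_ocells: "\<theta> \<in> ord_maps m n \<Longrightarrow> x \<in> ocells m p \<Longrightarrow> push_cell n \<theta> x \<in> ocells n p"
  by (rule push_cell_cells)

lemma push_cell_obd: "push_cell n \<theta> (oriental_bd k \<alpha> x) = oriental_bd k \<alpha> (push_cell n \<theta> x)"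
  by (auto simp: push_cell_def oriental_bd_def fun_eq_iff)

lemma push_cell_kc: "push_cell n \<theta> (kc k x y) = kc k (push_cell n \<theta> x) (push_cell n \<theta> y)"
  by (auto simp: push_cell_def kc_def fun_eq_iff push_add)

lemma push_cell_kcomp: "kcomp k x y \<Longrightarrow> kcomp k (push_cell n \<theta> x) (push_cell n \<theta> y)"
  unfolding kcomp_def push_cell_obd[symmetric] by simp

lemma ocells_supp: "x \<in> ocells n p \<Longrightarrow> supp (x k \<alpha>) \<subseteq> nd n k"
  by (auto simp: cx_cells_def pos_def)

lemma push_cell_push_cell:
  assumes "\<theta> \<in> ord_maps l m" "\<eta> \<in> ord_maps m n" "x \<in> ocells l p"
  shows "push_cell n \<eta> (push_cell m \<theta> x) = push_cell n (compose {..l} \<eta> \<theta>) x"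
  using push_push[OF assms(1,2) ocells_supp[OF assms(3)]] by (simp add: push_cell_def)

lemma partial_functor_push:
  assumes G: "partial_functor (basis n Y) (bdry n) C p G" and Y: "closed_family n Y" and a: "a \<in> Y m"
  shows "partial_functor (nd m) (bdry m) C p (\<lambda>q x. G q (push_cell n a x))"
  unfolding partial_functor_def push_cell_obd push_cell_kc
  by (intro conjI allI impI ballI)
    (simp_all add: partial_functorD[OF G] push_cell_basis[OF Y a] push_cell_kcomp)

lemma cx_cells_sub: "(\<And>k. B' k \<subseteq> B k) \<Longrightarrow> cx_cells B' del p \<subseteq> cx_cells B del p"
  unfolding cx_cells_def pos_def by blast

lemma partial_functor_sub:
  assumes G: "partial_functor B del C p G" and "\<And>k. B' k \<subseteq> B k"
  shows "partial_functor B' del C p G"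
proof -
  have "x \<in> cx_cells B del q" if "x \<in> cx_cells B' del q" for x q
    using that cx_cells_sub[of B' B, OF assms(2)] by blast
  then show ?thesis unfolding partial_functor_def
    by (intro conjI allI impI ballI) (simp_all add: partial_functorD[OF G])
qed

lemma partial_functor_mono: "partial_functor B del C p G \<Longrightarrow> q \<le> p \<Longrightarrow> partial_functor B del C q G"
  unfolding partial_functor_def by auto

text \<open>A nondegenerate simplex is injective, so it merely relabels basis elements and commutes
  with positive parts. Every atom is thus the image of the top cell of the oriental of its
  dimension.\<close>

lemma push_atom:
  assumes s: "s \<in> nd m q"
  shows "push_cell m s (atom (bdry q) q (oid q)) = atom (bdry m) q s"
proof -
  have so: "s \<in> ord_maps q m" by (rule nd_ord_maps[OF s])
  interpret Q: steiner_complex "nd q" "bdry q" "simplex_key q" by (rule steiner_complex_nd)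
  let ?a = "Q.at q (oid q)" and ?s = "atom (bdry m) q s"
  have nd: "compose {..k} s f \<in> nd m k" if f: "f \<in> nd q k" for f k
    using ndD[OF f] ndD[OF s] by (intro ndI) (auto simp: compose_def)
  have inj: "inj_on (compose {..k} s) (nd q k)" for k
  proof (rule inj_onI)
    fix f g assume fg: "f \<in> nd q k" "g \<in> nd q k" and e: "compose {..k} s f = compose {..k} s g"
    show "f = g"
    proof (rule ext_le[of k])
      fix j assume j: "j \<le> k"
      then have "s (f j) = s (g j)" using fun_cong[OF e, of j] by (simp add: compose_def)
      then show "f j = g j"
        using ndD(3)[OF s, of "f j" "g j"] ndD(3)[OF s, of "g j" "f j"] ndD(1)[OF fg(1) j] ndD(1)[OF fg(2) j]
        by (metis less_irrefl linorder_neqE_nat)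
    qed (use ndD(2)[OF fg(1)] ndD(2)[OF fg(2)] in auto)
  qed
  have rel: "push m s k c = frag_extend (\<lambda>f. frag_of (compose {..k} s f)) c" if "supp c \<subseteq> nd q k" for k c
    unfolding push_def chain_map_def
    by (rule frag_extend_cong[OF _ that]) (use nd simplex_chain_eq[OF nd_ord_maps[OF nd]] in auto)
  have pp: "push m s k (positive_part c) = positive_part (push m s k c)" if c: "supp c \<subseteq> nd q k" for k c
  proof -
    have c': "supp (positive_part c) \<subseteq> nd q k" using pos_supp[OF pos_positive_part[OF c]] .
    show ?thesis unfolding rel[OF c] rel[OF c']
    proof (rule chain_eqI)
      fix e
      show "cf (frag_extend (\<lambda>f. frag_of (compose {..k} s f)) (positive_part c)) e =
        cf (positive_part (frag_extend (\<lambda>f. frag_of (compose {..k} s f)) c)) e"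
        using cf_relabel[OF inj c] cf_relabel[OF inj c']
        by (cases "e \<in> compose {..k} s ` nd q k") (auto simp: cf_simps)
    qed
  qed
  have as: "supp (?a k \<alpha>) \<subseteq> nd q k" for k \<alpha> using Q.at_facts(1)[OF oid_nd] pos_supp by blast
  have ds: "supp (bdry q k (?a (Suc k) \<alpha>)) \<subseteq> nd q k" for k \<alpha> using Q.del_supp as by blast
  have *: "l + r = q \<Longrightarrow> push m s l (?a l \<alpha>) = ?s l \<alpha>" for r l \<alpha>
  proof (induction r arbitrary: l \<alpha>)
    case 0
    then show ?case using push_frag[OF so nd_ord_maps[OF oid_nd]] compose_oid(2)[OF so] s by simp
  next
    case (Suc r)
    have lq: "l < q" using Suc.prems by simp
    have IH: "push m s (Suc l) (?a (Suc l) \<alpha>) = ?s (Suc l) \<alpha>" for \<alpha> using Suc by simp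
    have b: "push m s l (bdry q l (?a (Suc l) \<alpha>)) = bdry m l (?s (Suc l) \<alpha>)" for \<alpha>
      by (simp only: push_bdry[OF so as, symmetric] IH)
    have b': "push m s l (- bdry q l (?a (Suc l) \<alpha>)) = - bdry m l (?s (Suc l) \<alpha>)" for \<alpha>
      using b[of \<alpha>] push_diff[of m s l 0] by simp
    show ?case
      using atom_step[OF lq, of "bdry q" "oid q"] atom_step[OF lq, of "bdry m" s] pp ds b b' by (cases \<alpha>) auto
  qed
  have "push m s l (?a l \<alpha>) = ?s l \<alpha>" for l \<alpha>
    using *[of l "q - l"] by (cases "l \<le> q") auto
  then show ?thesis by (simp add: push_cell_def)
qed

section \<open>The nerve\<close>

lemma pos_chains_eq: "pos_chains (std_simplex n) k = {c. pos (nd n k) c}"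
proof (intro set_eqI iffI; simp)
  fix c assume "c \<in> pos_chains (std_simplex n) k"
  then show "pos (nd n k) c"
    by induction (use degenerate_iff in \<open>auto intro: pos_add\<close>)
next
  fix c assume c: "pos (nd n k) c"
  have "frag_cmul (int j) (frag_of f) \<in> pos_chains (std_simplex n) k" if "f \<in> nd n k" for f j
  proof (induction j)
    case (Suc j)
    have "frag_of f \<in> pos_chains (std_simplex n) k"
      using that degenerate_iff[OF nd_ord_maps[OF that]] nd_ord_maps[OF that] by (intro pos_chains.gen) auto
    then show ?case using Suc by (simp add: frag_cmul_distrib pos_chains.add)
  qed (simp add: pos_chains.zero)
  then have *: "frag_cmul (cf c f) (frag_of f) \<in> pos_chains (std_simplex n) k" if "f \<in> supp c" for f
    using that pos_supp[OF c] pos_nonneg[OF c, of f] by (metis nat_0_le subsetD)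
  have "(\<Sum>f\<in>A. frag_cmul (cf c f) (frag_of f)) \<in> pos_chains (std_simplex n) k" if "finite A" "A \<subseteq> supp c" for A
    using that by (induction A rule: finite_induct) (auto intro: pos_chains.zero pos_chains.add *)
  from this[of "supp c"] show "c \<in> pos_chains (std_simplex n) k"
    using frag_expansion[of c] by (simp add: frag_extend_def)
qed

lemma cells_oriental: "cells (oriental n) p = ocells n p"
proof -
  interpret N: steiner_complex "nd n" "bdry n" "simplex_key n" by (rule steiner_complex_nd)
  have "x \<in> oriental_cells n p \<longleftrightarrow> x \<in> ocells n p" for x
  proof
    assume x: "x \<in> oriental_cells n p"
    then have p: "\<And>k \<alpha>. k \<le> p \<Longrightarrow> pos (nd n k) (x k \<alpha>)" "\<And>k \<alpha>. p < k \<Longrightarrow> x k \<alpha> = 0" "x p Minus = x p Plus"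
      "\<And>k \<alpha>. k < p \<Longrightarrow> bdry n k (x (Suc k) \<alpha>) = x k Plus - x k Minus" "\<And>\<alpha>. augmentation (x 0 \<alpha>) = 1"
      by (auto simp: oriental_cells_def pos_chains_eq)
    \<comment> \<open>In degree \<open>p\<close> this encodes the agreement of the two top entries;
      above it both sides vanish.\<close>
    have "bdry n k (x (Suc k) \<alpha>) = x k Plus - x k Minus" for k \<alpha>
    proof -
      consider "k < p" | "k = p" | "p < k" by linarith
      then show ?thesis
      proof cases
        case 1
        then show ?thesis by (rule p(4))
      qed (simp_all add: p(2,3) boundary_def)
    qed
    moreover have "pos (nd n k) (x k \<alpha>)" for k \<alpha> using p(1,2) by (cases "k \<le> p") auto
    ultimately show "x \<in> ocells n p" using p by (auto simp: cx_cells_def)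
  next
    assume x: "x \<in> ocells n p"
    then show "x \<in> oriental_cells n p"
      using N.clD[OF x] N.cl_top[OF x order_refl, of Minus Plus] by (auto simp: oriental_cells_def pos_chains_eq)
  qed
  then show ?thesis by (auto simp: oriental_def)
qed

lemma oriental_simps: "bd (oriental n) p k \<alpha> x = oriental_bd k \<alpha> x" "idn (oriental n) p q x = x"
  "composable (oriental n) p k x y \<longleftrightarrow> k < p \<and> x \<in> ocells n p \<and> y \<in> ocells n p \<and> kcomp k x y"
  "kcomp k x y \<Longrightarrow> cmp (oriental n) p k x y = kc k x y"
proof -
  show "composable (oriental n) p k x y \<longleftrightarrow> k < p \<and> x \<in> ocells n p \<and> y \<in> ocells n p \<and> kcomp k x y"
    unfolding composable_def cells_oriental kcomp_def by (simp add: oriental_def)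
  show "kcomp k x y \<Longrightarrow> cmp (oriental n) p k x y = kc k x y"
    using kc_eq by (simp add: oriental_def)
qed (simp_all add: oriental_def)

lemma omega_functors_iff:
  "F \<in> omega_functors (oriental n) C \<longleftrightarrow>
    (\<forall>p. F p \<in> extensional (ocells n p)) \<and> (\<forall>p. partial_functor (nd n) (bdry n) C p F)"
proof
  assume F: "F \<in> omega_functors (oriental n) C"
  note F = F[unfolded omega_functors_def mem_Collect_eq cells_oriental oriental_simps(1-3)]
  note F1 = F[THEN conjunct1, rule_format] and F2 = F[THEN conjunct2, THEN conjunct1, rule_format]
    and F3 = F[THEN conjunct2, THEN conjunct2, THEN conjunct1, rule_format]
    and F4 = F[THEN conjunct2, THEN conjunct2, THEN conjunct2, rule_format]
  have "partial_functor (nd n) (bdry n) C p F" for p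
    unfolding partial_functor_def
  proof (intro conjI allI impI ballI)
    show "F q x \<in> cells C q" if "x \<in> ocells n q" for q x using F1 that by (auto simp: PiE_iff)
    show "F k (oriental_bd k \<alpha> x) = bd C q k \<alpha> (F q x)" if "k < q" "x \<in> ocells n q" for q k \<alpha> x
      using F2 that by blast
    show "F q (kc k x y) = cmp C q k (F q x) (F q y)"
      if "k < q" "x \<in> ocells n q" "y \<in> ocells n q" "kcomp k x y" for q k x y
      using F3[of k q x y] that oriental_simps(4)[OF that(4)] by simp
    show "F q x = idn C r q (F r x)" if "r < q" "x \<in> ocells n r" for q r x
      using F4[of r q x] that by (simp add: oriental_simps)
  qed
  then show "(\<forall>p. F p \<in> extensional (ocells n p)) \<and> (\<forall>p. partial_functor (nd n) (bdry n) C p F)"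
    using F1 by (auto simp: PiE_iff)
next
  assume F: "(\<forall>p. F p \<in> extensional (ocells n p)) \<and> (\<forall>p. partial_functor (nd n) (bdry n) C p F)"
  then have D: "partial_functor (nd n) (bdry n) C p F" for p by blast
  show "F \<in> omega_functors (oriental n) C"
    unfolding omega_functors_def mem_Collect_eq cells_oriental oriental_simps(1-3)
    using F partial_functorD[OF D order_refl] by (auto simp: PiE_iff oriental_simps)
qed

lemma nerve_simplices: "simplices (street_nerve C) n = omega_functors (oriental n) C"
  by (simp add: street_nerve_def)

lemma nerve_act: "x \<in> ocells m p \<Longrightarrow> act (street_nerve C) m n \<theta> F p x = F p (push_cell n \<theta> x)"
  by (simp add: street_nerve_def compose_def cells_oriental oriental_map_def push_cell_def push_def)

text \<open>A functor \<open>G\<close> on the cells supported by \<open>Y\<close>, read as a map to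
  the nerve: the simplex \<open>a\<close> goes to the functor that first pushes cells forward along
  \<open>a\<close>. The restrictions provide the required extensionality.\<close>

definition nerve_map :: "nat \<Rightarrow> (nat \<Rightarrow> (nat \<Rightarrow> nat) set) \<Rightarrow> (nat \<Rightarrow> oriental_cell \<Rightarrow> 'a) \<Rightarrow>
    nat \<Rightarrow> (nat \<Rightarrow> nat) \<Rightarrow> nat \<Rightarrow> oriental_cell \<Rightarrow> 'a" where
  "nerve_map n Y G m = (\<lambda>a \<in> Y m. \<lambda>p. \<lambda>x \<in> ocells m p. G p (push_cell n a x))"

lemma nerve_map_simplicial:
  fixes X :: "(nat \<Rightarrow> nat) sset_struct"
  assumes Y: "closed_family n Y" and X: "simplices X = Y" "\<And>l m \<theta> a. act X l m \<theta> a = compose {..l} a \<theta>"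
    and G: "\<And>p. partial_functor (basis n Y) (bdry n) C p G"
  shows "nerve_map n Y G \<in> simplicial_maps X (street_nerve C)"
  unfolding simplicial_maps_def mem_Collect_eq X nerve_simplices
proof (intro conjI allI impI)
  fix m
  show "nerve_map n Y G m \<in> Y m \<rightarrow>\<^sub>E omega_functors (oriental m) C"
  proof (rule PiE_I)
    fix a assume a: "a \<in> Y m"
    have P: "partial_functor (nd m) (bdry m) C p (\<lambda>q x. G q (push_cell n a x))" for p
      by (rule partial_functor_push[OF G Y a])
    interpret M: steiner_complex "nd m" "bdry m" "simplex_key m" by (rule steiner_complex_nd)
    have "partial_functor (nd m) (bdry m) C p (nerve_map n Y G m a)" for p
      unfolding partial_functor_def nerve_map_def
      using partial_functorD[OF P order_refl] M.kc_cl M.obd_cl M.cl_mono a by (auto simp: less_imp_le)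
    then show "nerve_map n Y G m a \<in> omega_functors (oriental m) C"
      using a by (auto simp: omega_functors_iff nerve_map_def)
  qed (simp add: nerve_map_def)
next
  fix l m \<theta> a assume *: "\<theta> \<in> ord_maps l m \<and> a \<in> Y m"
  then have c: "compose {..l} a \<theta> \<in> Y l" using closed_familyD(2)[OF Y] by blast
  have ao: "a \<in> ord_maps m n" using * closed_familyD(1)[OF Y] by blast
  show "nerve_map n Y G l (compose {..l} a \<theta>) = act (street_nerve C) l m \<theta> (nerve_map n Y G m a)"
  proof (intro ext)
    fix p x
    show "nerve_map n Y G l (compose {..l} a \<theta>) p x = act (street_nerve C) l m \<theta> (nerve_map n Y G m a) p x"
    proof (cases "x \<in> ocells l p")
      case True
      then show ?thesis
        using push_cell_ocells[of \<theta> l m x p] push_cell_push_cell[of \<theta> l m a n x p] * c ao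
        by (simp add: nerve_map_def nerve_act[OF True])
    next
      case False
      then show ?thesis using c by (simp add: nerve_map_def street_nerve_def compose_def cells_oriental)
    qed
  qed
qed

abbreviation top_cell :: "nat \<Rightarrow> oriental_cell" where "top_cell q \<equiv> atom (bdry q) q (oid q)"

lemma simplicial_mapsD:
  fixes X :: "(nat \<Rightarrow> nat) sset_struct"
  assumes f: "f \<in> simplicial_maps X (street_nerve C)" and X: "simplices X = Y" "\<And>l m \<theta> a. act X l m \<theta> a = compose {..l} a \<theta>"
    and a: "a \<in> Y m"
  shows "f m a p \<in> extensional (ocells m p)" "partial_functor (nd m) (bdry m) C p (f m a)"
    "\<theta> \<in> ord_maps l m \<Longrightarrow> x \<in> ocells l p \<Longrightarrow> f l (compose {..l} a \<theta>) p x = f m a p (push_cell m \<theta> x)"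
proof -
  have "f m a \<in> omega_functors (oriental m) C"
    using f a by (auto simp: simplicial_maps_def X nerve_simplices)
  then show "f m a p \<in> extensional (ocells m p)" "partial_functor (nd m) (bdry m) C p (f m a)"
    by (auto simp: omega_functors_iff)
  assume "\<theta> \<in> ord_maps l m" "x \<in> ocells l p"
  then show "f l (compose {..l} a \<theta>) p x = f m a p (push_cell m \<theta> x)"
    using f a nerve_act[of x l p C m \<theta> "f m a"] by (auto simp: simplicial_maps_def X)
qed

text \<open>Since atoms generate, it is enough to compare atoms. Those of nondegenerate simplices
  agree by hypothesis, and degenerate simplices are reduced to a lower dimension.\<close>

lemma simplicial_map_determined:
  fixes X :: "(nat \<Rightarrow> nat) sset_struct" and C :: "'a omega_struct"
  assumes Y: "closed_family n Y" and X: "simplices X = Y" "\<And>l m \<theta> a. act X l m \<theta> a = compose {..l} a \<theta>"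
    and f: "f \<in> simplicial_maps X (street_nerve C)"
    and G: "partial_functor (basis n Y) (bdry n) C p G"
    and at: "\<And>q r. q \<le> p \<Longrightarrow> r \<in> basis n Y q \<Longrightarrow> G q (atom (bdry n) q r) = f q r q (top_cell q)"
  shows "q \<le> p \<Longrightarrow> a \<in> Y m \<Longrightarrow> x \<in> ocells m q \<Longrightarrow> f m a q x = G q (push_cell n a x)"
proof (induction q arbitrary: m a x rule: less_induct)
  case (less q)
  interpret M: steiner_complex "nd m" "bdry m" "simplex_key m" by (rule steiner_complex_nd)
  interpret Q: steiner_complex "nd q" "bdry q" "simplex_key q" by (rule steiner_complex_nd)
  note fm = simplicial_mapsD[OF f X]
  have ao: "a \<in> ord_maps m n" using less.prems closed_familyD(1)[OF Y] by blast
  have t: "top_cell q \<in> ocells q q" by (rule Q.at_cl[OF oid_nd])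
  have atom: "f m a q (atom (bdry m) q s) = G q (push_cell n a (atom (bdry m) q s))" if s: "s \<in> nd m q" for s
  proof -
    let ?r = "compose {..q} a s"
    have so: "s \<in> ord_maps q m" by (rule nd_ord_maps[OF s])
    have rY: "?r \<in> Y q" using closed_familyD(2)[OF Y so less.prems(2)] .
    have ro: "?r \<in> ord_maps q n" using rY closed_familyD(1)[OF Y] by blast
    have L: "f m a q (atom (bdry m) q s) = f q ?r q (top_cell q)"
      using fm(3)[OF less.prems(2) so t] push_atom[OF s] by simp
    have R: "push_cell n a (atom (bdry m) q s) = push_cell n ?r (top_cell q)"
      using push_cell_push_cell[OF so ao t] push_atom[OF s] by simp
    show ?thesis
    proof (cases "?r \<in> nd n q")
      case True
      then show ?thesis using at[of q ?r] less.prems(1) rY push_atom[OF True] by (simp add: L R)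
    next
      case False
      then obtain i where i: "i < q" "?r i = ?r (Suc i)" using ord_maps_not_nd[OF ro] by metis
      obtain l where l: "q = Suc l" "?r = compose {..q} (face l i ?r) (codegeneracy l i)" "face l i ?r \<in> ord_maps l n" "i \<le> l"
        using degenerate_factor[OF i ro] .
      let ?c = "codegeneracy l i" and ?r' = "face l i ?r"
      have c: "?c \<in> ord_maps q l" using codegeneracy_ord_maps l by simp
      have r'Y: "?r' \<in> Y l" unfolding face_def using closed_familyD(2)[OF Y coface_ord_maps] rY l(1) by simp
      \<comment> \<open>Pushed along the degeneracy the top cell loses its top chain, because an
        \<open>l\<close>-simplex has no nondegenerate face of dimension \<open>l + 1\<close>. It
        becomes a unit on an \<open>l\<close>-cell.\<close>
      let ?u = "push_cell l ?c (top_cell q)"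
      interpret L: steiner_complex "nd l" "bdry l" "simplex_key l" by (rule steiner_complex_nd)
      have uq: "?u \<in> ocells l q" using push_cell_ocells[OF c t] .
      have "?u q Plus = 0" using L.clD(1)[OF uq, of q Plus] nd_empty[of l q] l(1) by (auto simp: pos_def)
      then have u: "?u \<in> ocells l l" using L.cl_zero_top uq l(1) by simp
      have "f q ?r q (top_cell q) = f l ?r' q ?u"
        using fm(3)[OF r'Y c t] l(2) by simp
      also have "\<dots> = idn C l q (f l ?r' l ?u)"
        using partial_functorD(4)[OF fm(2)[OF r'Y, of q] order_refl _ u] l(1) by simp
      also have "f l ?r' l ?u = G l (push_cell n ?r' ?u)" using less.IH[OF _ _ r'Y u] less.prems(1) l(1) by simp
      also have "idn C l q \<dots> = G q (push_cell n ?r' ?u)"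
        using partial_functorD(4)[OF G less.prems(1) _ push_cell_basis[OF Y r'Y u]] l(1) by simp
      also have "push_cell n ?r' ?u = push_cell n ?r (top_cell q)"
        using push_cell_push_cell[OF c l(3) t] l(2) by simp
      finally show ?thesis by (simp add: L R)
    qed
  qed
  show ?case
  proof (cases q)
    case 0
    then show ?thesis using atom less.prems(3) by (auto simp: M.cl_0)
  next
    case (Suc p')
    have "x \<in> ocells m (Suc p')" using less.prems(3) Suc by simp
    then show ?thesis
    proof (induction rule: M.cell_induct_top)
      case (lower u)
      have "f m a q u = idn C p' q (f m a p' u)"
        using partial_functorD(4)[OF fm(2)[OF less.prems(2), of q] order_refl _ lower] Suc by simp
      also have "\<dots> = idn C p' q (G p' (push_cell n a u))" using less.IH[OF _ _ less.prems(2) lower] less.prems(1) Suc by simp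
      also have "\<dots> = G q (push_cell n a u)"
        using partial_functorD(4)[OF G less.prems(1) _ push_cell_basis[OF Y less.prems(2) lower]] Suc by simp
      finally show ?case .
    next
      case (atom s)
      then show ?case using \<open>\<And>s. s \<in> nd m q \<Longrightarrow> _\<close> Suc by simp
    next
      case (compose k x y)
      have "f m a q (kc k x y) = cmp C q k (f m a q x) (f m a q y)"
        using partial_functorD(3)[OF fm(2)[OF less.prems(2), of q] order_refl] compose Suc by simp
      also have "\<dots> = G q (push_cell n a (kc k x y))"
        using partial_functorD(3)[OF G less.prems(1), of k "push_cell n a x" "push_cell n a y"] compose Suc
          push_cell_basis[OF Y less.prems(2)] push_cell_kcomp push_cell_kc by simp
      finally show ?case .
    qed
  qed
qed

lemma horn_act: "act (horn n i) l m \<theta> a = compose {..l} a \<theta>"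
  by (simp add: horn_def)

lemma has_rlp_hornI:
  fixes C :: "'a omega_struct"
  assumes fill: "\<And>f. f \<in> simplicial_maps (horn n i) (street_nerve C) \<Longrightarrow>
    \<exists>G. (\<forall>p. partial_functor (nd n) (bdry n) C p G) \<and>
      (\<forall>q. \<forall>r \<in> basis n (simplices (horn n i)) q. G q (atom (bdry n) q r) = f q r q (top_cell q))"
  shows "has_rlp (street_nerve C) (horn n i) (std_simplex n)"
  unfolding has_rlp_def
proof
  fix f assume f: "f \<in> simplicial_maps (horn n i) (street_nerve C)"
  let ?Y = "simplices (horn n i)" and ?Z = "\<lambda>m. ord_maps m n"
  obtain G where G: "\<And>p. partial_functor (nd n) (bdry n) C p G"
    "\<And>q r. r \<in> basis n ?Y q \<Longrightarrow> G q (atom (bdry n) q r) = f q r q (top_cell q)"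
    using fill[OF f] by blast
  have Y: "closed_family n ?Y" using closed_family_horn .
  have "nerve_map n ?Z G \<in> simplicial_maps (std_simplex n) (street_nerve C)"
    by (rule nerve_map_simplicial[OF closed_family_all])
      (use G(1) basis_all[of n] in \<open>auto simp: std_simplex_def\<close>)
  moreover have "nerve_map n ?Z G m a = f m a" if a: "a \<in> ?Y m" for m a
  proof (intro ext)
    fix p x
    have ao: "a \<in> ord_maps m n" using a closed_familyD(1)[OF Y] by blast
    have GY: "partial_functor (basis n ?Y) (bdry n) C p G" by (rule partial_functor_sub[OF G(1)]) simp
    show "nerve_map n ?Z G m a p x = f m a p x"
    proof (cases "x \<in> ocells m p")
      case True
      then show ?thesis
        using simplicial_map_determined[OF Y refl horn_act f GY G(2) order_refl a True] ao by (simp add: nerve_map_def)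
    next
      case False
      then show ?thesis using simplicial_mapsD(1)[OF f refl horn_act a, of p] ao
        by (simp add: nerve_map_def extensional_def)
    qed
  qed
  ultimately show "\<exists>g\<in>simplicial_maps (std_simplex n) (street_nerve C). \<forall>n'. \<forall>a\<in>?Y n'. g n' a = f n' a" by blast
qed

text \<open>The extension is read off from the filler at the identity simplex; by uniqueness its
  agreement with \<open>G\<close> has to be seen on atoms only.\<close>

lemma has_rlp_hornD:
  fixes C :: "'a omega_struct"
  assumes rlp: "has_rlp (street_nerve C) (horn n i) (std_simplex n)"
    and G: "\<And>p. partial_functor (basis n (simplices (horn n i))) (bdry n) C p G"
  shows "\<exists>G'. (\<forall>p. partial_functor (nd n) (bdry n) C p G') \<and>
    (\<forall>p. \<forall>x \<in> cx_cells (basis n (simplices (horn n i))) (bdry n) p. G' p x = G p x)"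
proof -
  let ?Y = "simplices (horn n i)" and ?Z = "\<lambda>m. ord_maps m n"
  have Y: "closed_family n ?Y" using closed_family_horn .
  interpret H: steiner_complex "basis n ?Y" "bdry n" "simplex_key n" by (rule steiner_complex_basis[OF Y])
  let ?f = "nerve_map n ?Y G"
  have "?f \<in> simplicial_maps (horn n i) (street_nerve C)"
    by (rule nerve_map_simplicial[OF Y refl horn_act G])
  then obtain g where g: "g \<in> simplicial_maps (std_simplex n) (street_nerve C)" "\<And>m a. a \<in> ?Y m \<Longrightarrow> g m a = ?f m a"
    using rlp unfolding has_rlp_def by blast
  have X: "simplices (std_simplex n) = ?Z" by (simp add: std_simplex_def)
  note gm = simplicial_mapsD[OF g(1) X std_simplex_simps(2) oid_ord_maps]
  have at: "g n (oid n) q (H.at q r) = G q (H.at q r)" if r: "r \<in> basis n ?Y q" for q r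
  proof -
    interpret Q: steiner_complex "nd q" "bdry q" "simplex_key q" by (rule steiner_complex_nd)
    have t: "top_cell q \<in> ocells q q" by (rule Q.at_cl[OF oid_nd])
    have rn: "r \<in> nd n q" "r \<in> ?Y q" using r by auto
    have "g n (oid n) q (H.at q r) = g q r q (top_cell q)"
      using gm(3)[OF nd_ord_maps[OF rn(1)] t] compose_oid(1)[OF nd_ord_maps[OF rn(1)]] push_atom[OF rn(1)] by simp
    then show ?thesis using g(2)[OF rn(2)] rn(2) t push_atom[OF rn(1)] by (simp add: nerve_map_def)
  qed
  have "g n (oid n) p x = G p x" if "x \<in> H.cl p" for p x
    by (rule H.partial_functor_unique[OF partial_functor_sub[OF gm(2)] G at order_refl that]) auto
  then show ?thesis using gm(2) by blast
qed

section \<open>Lifting implies invertibility\<close>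

text \<open>
  Two families of functionals \<open>\<sigma>\<close>, \<open>\<tau>\<close> count the simplices labelled by the sources and by the targets
  of a fixed cell \<open>b\<close>; they form a map from the complex to that of the globe of dimension \<open>d\<close>.
\<close>

locale labelling = steiner_complex B del key + C: omega_category C
  for B del key and C :: "'a omega_struct" +
  fixes d :: nat and b :: 'a and \<sigma> \<tau> :: "nat \<Rightarrow> chain \<Rightarrow> int"
  assumes b: "b \<in> cells C d"
    and lin: "\<sigma> k (x + y) = \<sigma> k x + \<sigma> k y" "\<tau> k (x + y) = \<tau> k x + \<tau> k y"
    and nonneg: "pos (B k) c \<Longrightarrow> 0 \<le> \<sigma> k c" "pos (B k) c \<Longrightarrow> 0 \<le> \<tau> k c"
    and bd_\<sigma>: "supp c \<subseteq> B (Suc k) \<Longrightarrow> \<sigma> k (del k c) = - (\<sigma> (Suc k) c + \<tau> (Suc k) c)"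
    and bd_\<tau>: "supp c \<subseteq> B (Suc k) \<Longrightarrow> \<tau> k (del k c) = \<sigma> (Suc k) c + \<tau> (Suc k) c"
    and total_0: "supp c \<subseteq> B 0 \<Longrightarrow> \<sigma> 0 c + \<tau> 0 c = augmentation c"
    and high_0: "d < k \<Longrightarrow> \<sigma> k c = 0" "d \<le> k \<Longrightarrow> \<tau> k c = 0"
begin

lemma lin_0 [simp]: "\<sigma> k 0 = 0" "\<tau> k 0 = 0"
  using lin[of k 0 0] by auto

lemma lin_diff: "\<sigma> k (x - y) = \<sigma> k x - \<sigma> k y" "\<tau> k (x - y) = \<tau> k x - \<tau> k y"
  using lin[of k "x - y" y] by auto

definition "tot k x = \<sigma> k (x k Plus) + \<tau> k (x k Plus :: chain)"

lemma total_step: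
  assumes x: "x \<in> cl p"
  shows "\<sigma> (Suc k) (x (Suc k) \<alpha>) + \<tau> (Suc k) (x (Suc k) \<alpha>) = \<tau> k (x k Plus) - \<tau> k (x k Minus)"
    and "\<sigma> (Suc k) (x (Suc k) \<alpha>) + \<tau> (Suc k) (x (Suc k) \<alpha>) = \<sigma> k (x k Minus) - \<sigma> k (x k Plus)"
  using bd_\<sigma>[OF pos_supp[OF clD(1)[OF x]], of k \<alpha>] bd_\<tau>[OF pos_supp[OF clD(1)[OF x]], of k \<alpha>]
    clD(3)[OF x, of k \<alpha>] by (simp_all add: lin_diff)

text \<open>The total in degree \<open>k + 1\<close> is the amount by which \<open>\<tau>\<close>
  grows from source to target in degree \<open>k\<close>, so it is bounded by the total in degree
  \<open>k\<close>. As degree 0 has total 1, every total is 0 or 1, and the cell is sent to a cell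
  of the globe.\<close>

lemma total_cases:
  assumes x: "x \<in> cl p"
  shows "\<sigma> k (x k \<alpha>) + \<tau> k (x k \<alpha>) = tot k x \<and> (tot k x = 0 \<or> tot k x = 1)"
proof (induction k arbitrary: \<alpha>)
  case 0
  then show ?case using total_0[OF pos_supp[OF clD(1)[OF x]]] clD(4)[OF x] by (simp add: tot_def)
next
  case (Suc k)
  have "\<sigma> (Suc k) (x (Suc k) \<alpha>) + \<tau> (Suc k) (x (Suc k) \<alpha>) = tot (Suc k) x"
    using total_step(1)[OF x, of k] by (simp add: tot_def)
  moreover have "0 \<le> tot (Suc k) x" using nonneg[OF clD(1)[OF x, of "Suc k" Plus]] by (simp add: tot_def)
  moreover have "tot (Suc k) x \<le> 1"
    using total_step(1)[OF x, of k Plus] Suc[of Plus] nonneg[OF clD(1)[OF x, of k Plus]] nonneg[OF clD(1)[OF x, of k Minus]]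
    by (auto simp: tot_def)
  ultimately show ?case by linarith
qed

lemma total_dec:
  assumes x: "x \<in> cl p" and "j \<le> k" "tot k x = 1"
  shows "tot j x = 1"
  using assms(2,3)
proof (induction k)
  case (Suc k)
  have "tot k x \<noteq> 0"
  proof
    assume "tot k x = 0"
    then have "\<tau> k (x k Plus) = 0"
      using total_cases[OF x, of k Plus] nonneg[OF clD(1)[OF x, of k Plus]] by auto
    then have "tot (Suc k) x \<le> 0"
      using total_step(1)[OF x, of k Plus] nonneg(2)[OF clD(1)[OF x, of k Minus]] by (simp add: tot_def)
    then show False using Suc.prems by simp
  qed
  then have "tot k x = 1" using total_cases[OF x, of k] by auto
  then show ?case using Suc by (cases "j = Suc k") auto
qed simp

text \<open>The drop of \<open>\<sigma>\<close> from source to target is the total one degree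
  higher, while both values lie between 0 and 1.\<close>

lemma label_step:
  assumes x: "x \<in> cl p"
  shows "tot (Suc k) x = 1 \<Longrightarrow> \<sigma> k (x k \<alpha>) = (if \<alpha> = Minus then 1 else 0)"
    and "tot (Suc k) x = 0 \<Longrightarrow> \<sigma> k (x k \<alpha>) = \<sigma> k (x k \<beta>)"
proof -
  have d: "\<sigma> k (x k Minus) - \<sigma> k (x k Plus) = tot (Suc k) x"
    using total_step(2)[OF x, of k Plus] by (simp add: tot_def)
  have "0 \<le> \<sigma> k (x k \<alpha>) \<and> \<sigma> k (x k \<alpha>) \<le> 1" for \<alpha>
    using total_cases[OF x, of k \<alpha>] nonneg[OF clD(1)[OF x, of k \<alpha>]] by auto
  from this[of Minus] this[of Plus] d show "tot (Suc k) x = 1 \<Longrightarrow> \<sigma> k (x k \<alpha>) = (if \<alpha> = Minus then 1 else 0)"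
    "tot (Suc k) x = 0 \<Longrightarrow> \<sigma> k (x k \<alpha>) = \<sigma> k (x k \<beta>)"
    by (cases \<alpha>; cases \<beta>; simp)+
qed

text \<open>The dimension of the cell of the globe of which the image of \<open>x\<close> is a unit;
  \<open>sgn_at\<close> tells its source side from its target side. In dimension \<open>d\<close>
  the globe has a single such cell, so \<open>label\<close> ignores the sign there.\<close>

definition "lev x = (LEAST q. tot (Suc q) x = 0)"

definition "label q \<epsilon> = (if q = d then b else bd C d q \<epsilon> b)"

definition "sgn_at q x = (if \<sigma> q (x q Plus :: chain) = 1 then Minus else Plus)"

definition "val p x = up C (lev x) p (label (lev x) (sgn_at (lev x) x))"

lemma lev:
  assumes x: "x \<in> cl p"
  shows "tot (Suc (lev x)) x = 0" "tot (lev x) x = 1" "lev x \<le> p" "lev x \<le> d"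
proof -
  have "tot (Suc d) x = 0" by (simp add: tot_def high_0)
  then show 1: "tot (Suc (lev x)) x = 0" unfolding lev_def by (rule LeastI)
  show 2: "tot (lev x) x = 1"
  proof (cases "lev x")
    case 0
    then show ?thesis using total_0[OF pos_supp[OF clD(1)[OF x, of 0 Plus]]] clD(4)[OF x] by (simp add: tot_def)
  next
    case (Suc q)
    then have "tot (Suc q) x \<noteq> 0" using not_less_Least[of q "\<lambda>q. tot (Suc q) x = 0"] by (simp add: lev_def)
    then show ?thesis using total_cases[OF x, of "Suc q" Plus] Suc by simp
  qed
  show "lev x \<le> p" using 2 clD(2)[OF x, of "lev x"] by (rule_tac ccontr) (simp add: tot_def)
  show "lev x \<le> d" using 2 by (rule_tac ccontr) (simp add: tot_def high_0)
qed

lemma lev_eq: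
  assumes x: "x \<in> cl p" and "tot q x = 1" "tot (Suc q) x = 0"
  shows "lev x = q"
proof (rule antisym)
  show "lev x \<le> q" unfolding lev_def by (rule Least_le) fact
  show "q \<le> lev x" using total_dec[OF x, of "Suc (lev x)" q] lev(1)[OF x] assms(2) by (rule_tac ccontr) auto
qed

lemma label_cell: "q \<le> d \<Longrightarrow> label q \<epsilon> \<in> cells C q"
  using b C.bd_cell by (auto simp: label_def)

lemma val_cell: "x \<in> cl p \<Longrightarrow> val p x \<in> cells C p"
  unfolding val_def by (intro C.up_cell label_cell lev) auto

lemma total_obd:
  "l \<le> k \<Longrightarrow> x \<in> cl p \<Longrightarrow> tot l (oriental_bd k \<alpha> x) = tot l x"
  "k < l \<Longrightarrow> tot l (oriental_bd k \<alpha> x) = 0"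
  using total_cases[of x p l \<alpha>] by (auto simp: tot_def oriental_bd_def)

text \<open>Taking a boundary at or above the level leaves the cell of the globe unchanged; below
  the level it gives the source or the target of \<open>b\<close>.\<close>

lemma val_bd:
  assumes x: "x \<in> cl p" and k: "k < p"
  shows "val k (oriental_bd k \<alpha> x) = bd C p k \<alpha> (val p x)"
proof -
  let ?q = "lev x" and ?y = "oriental_bd k \<alpha> x"
  note L = lev[OF x]
  have y: "?y \<in> cl k" by (rule obd_cl[OF x])
  have c: "label ?q \<epsilon> \<in> cells C ?q" for \<epsilon> using label_cell L(4) .
  show ?thesis
  proof (cases "?q \<le> k")
    case True
    have "lev ?y = ?q"
    proof (rule lev_eq[OF y])
      show "tot ?q ?y = 1" using total_obd(1)[OF True x] L(2) by simp
      show "tot (Suc ?q) ?y = 0"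
      proof (cases "Suc ?q \<le> k")
        case True
        then show ?thesis using total_obd(1)[OF True x] L(1) by simp
      next
        case False
        then show ?thesis using total_obd(2)[of k "Suc ?q" \<alpha> x] by simp
      qed
    qed
    moreover have "\<sigma> ?q (?y ?q Plus) = \<sigma> ?q (x ?q Plus)"
      using label_step(2)[OF x L(1), of \<alpha> Plus] True by (cases "?q = k") (auto simp: oriental_bd_def)
    ultimately have "val k ?y = up C ?q k (label ?q (sgn_at ?q x))" by (simp add: val_def sgn_at_def)
    then show ?thesis using C.bd_up_above[OF True k c] by (simp add: val_def)
  next
    case False
    then have kq: "k < ?q" by simp
    have "tot (Suc k) x = 1" using total_dec[OF x _ L(2)] kq by simp
    note ls = label_step(1)[OF x this]
    have "tot k x = 1" using total_dec[OF x _ L(2)] kq by simp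
    then have "lev ?y = k" using total_obd(1)[of k k x p] total_obd(2)[of k "Suc k" \<alpha> x] x by (intro lev_eq[OF y]) auto
    moreover have "sgn_at k ?y = \<alpha>" using ls[of \<alpha>] by (cases \<alpha>) (auto simp: sgn_at_def oriental_bd_def)
    ultimately have "val k ?y = bd C d k \<alpha> b" using kq L(4) by (auto simp: val_def label_def)
    moreover have "bd C p k \<alpha> (val p x) = bd C ?q k \<alpha> (label ?q (sgn_at ?q x))"
      unfolding val_def by (rule C.bd_up_below[OF L(3) kq c])
    ultimately show ?thesis using C.globular[of k ?q d b \<alpha>] kq L(4) b by (auto simp: label_def)
  qed
qed

lemma val_unit:
  assumes x: "x \<in> cl p" and "tot (Suc k) x = 0" "k \<le> p"
  shows "val p x = up C k p (val k (oriental_bd k \<alpha> x))"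
proof (cases "k = p")
  case True
  then show ?thesis using obd_id[OF x, of k \<alpha>] by simp
next
  case False
  then have k: "k < p" using assms by simp
  have q: "lev x \<le> k" unfolding lev_def by (rule Least_le) fact
  note L = lev[OF x]
  have c: "label (lev x) \<epsilon> \<in> cells C (lev x)" for \<epsilon> using label_cell L(4) .
  show ?thesis
    unfolding val_bd[OF x k] using C.bd_up_above[OF q k c] C.up_up[OF q _ c, of p] k by (simp add: val_def)
qed

lemma val_cong:
  assumes "\<And>l. \<sigma> l (x l Plus) = \<sigma> l (y l Plus)" "\<And>l. \<tau> l (x l Plus) = \<tau> l (y l Plus)"
  shows "val p x = val p y"
proof -
  have "tot l x = tot l y" for l using assms by (simp add: tot_def)
  then show ?thesis using assms by (simp add: val_def lev_def sgn_at_def)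
qed

lemma total_zero_above:
  assumes x: "x \<in> cl p" and "tot (Suc k) x = 0" "k < l"
  shows "\<sigma> l (x l \<alpha>) = 0" "\<tau> l (x l \<alpha>) = 0"
proof -
  have "tot l x = 0" using total_dec[OF x, of "Suc k" l] total_cases[OF x, of l] assms by auto
  then show "\<sigma> l (x l \<alpha>) = 0" "\<tau> l (x l \<alpha>) = 0"
    using total_cases[OF x, of l \<alpha>] nonneg[OF clD(1)[OF x, of l \<alpha>]] by auto
qed

text \<open>Totals in degree \<open>k + 1\<close> add up under \<open>*\<^sub>k\<close> and never
  exceed 1. So one factor is sent to a unit, and the composite has the value of the other.\<close>

lemma val_kc:
  assumes x: "x \<in> cl p" and y: "y \<in> cl p" and c: "kcomp k x y" and k: "k < p"
  shows "val p (kc k x y) = cmp C p k (val p x) (val p y)"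
proof -
  note z = kc_cl[OF x y c]
  have "tot (Suc k) (kc k x y) = tot (Suc k) x + tot (Suc k) y"
    by (simp add: tot_def kc_simps lin)
  then have "tot (Suc k) x = 0 \<or> tot (Suc k) y = 0"
    using total_cases[OF x, of "Suc k" Plus, THEN conjunct2] total_cases[OF y, of "Suc k" Plus, THEN conjunct2]
      total_cases[OF z, of "Suc k" Plus, THEN conjunct2] by linarith
  then show ?thesis
  proof
    assume 0: "tot (Suc k) x = 0"
    have "val p (kc k x y) = val p y"
    proof (rule val_cong)
      fix l
      have xk: "\<sigma> k (x k Plus) = \<sigma> k (y k Plus)" using label_step(2)[OF x 0, of Plus Minus] c by (simp add: kcomp_iff)
      then have xk': "\<tau> k (x k Plus) = \<tau> k (y k Plus)"
        using total_cases[OF x, of k Plus] total_cases[OF x, of k Minus] c by (simp add: kcomp_iff)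
      consider "l < k" | "l = k" | "k < l" by linarith
      then show "\<sigma> l (kc k x y l Plus) = \<sigma> l (y l Plus)" "\<tau> l (kc k x y l Plus) = \<tau> l (y l Plus)"
        using xk xk' total_zero_above[OF x 0] by (cases; simp add: kc_simps lin)+
    qed
    moreover have "val p x = up C k p (bd C p k Plus (val p y))"
      using val_unit[OF x 0, of Minus] k c val_bd[OF y k, of Plus] by (simp add: kcomp_def)
    ultimately show ?thesis using C.unit_left[OF k val_cell[OF y]] by simp
  next
    assume 0: "tot (Suc k) y = 0"
    have "val p (kc k x y) = val p x"
    proof (rule val_cong)
      fix l
      consider "l < k" | "l = k" | "k < l" by linarith
      then show "\<sigma> l (kc k x y l Plus) = \<sigma> l (x l Plus)" "\<tau> l (kc k x y l Plus) = \<tau> l (x l Plus)"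
        using total_zero_above[OF y 0] c by (cases; simp add: kc_simps lin kcomp_iff)+
    qed
    moreover have "val p y = up C k p (bd C p k Minus (val p x))"
      using val_unit[OF y 0, of Plus] k c val_bd[OF x k, of Minus] by (simp add: kcomp_def)
    ultimately show ?thesis using C.unit_right[OF k val_cell[OF x]] by simp
  qed
qed

lemma val_idn: "x \<in> cl r \<Longrightarrow> r < q \<Longrightarrow> val q x = idn C r q (val r x)"
  using C.up_up[OF lev(3) _ label_cell[OF lev(4)], of x r q] lev[of x r] by (simp add: val_def up_def)

lemma partial_functor_val: "partial_functor B del C p val"
  unfolding partial_functor_def using val_cell val_bd val_kc val_idn by auto

end

text \<open>
  The labels on the horn opposite to the face with vertices \<open>0, \<dots>, e - 1, e + 1, e + 2\<close>: only the
  simplices \<open>0, \<dots>, k - 1, m\<close> get a label, which is a source or a target according to \<open>m\<close>. In dimension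
  \<open>e\<close> the labels of \<open>m = e\<close> and \<open>m = e + 2\<close> agree, so that the missing face has to go backwards.
\<close>

definition initial :: "nat \<Rightarrow> (nat \<Rightarrow> nat) \<Rightarrow> bool" where
  "initial k f \<longleftrightarrow> (\<forall>j<k. f j = j)"

definition is_source :: "nat \<Rightarrow> nat \<Rightarrow> nat \<Rightarrow> bool" where
  "is_source e k v \<longleftrightarrow> (if k < e then even k \<longleftrightarrow> v = k else odd e \<longleftrightarrow> v = Suc e)"

definition source_label :: "nat \<Rightarrow> nat \<Rightarrow> (nat \<Rightarrow> nat) \<Rightarrow> int" where
  "source_label e k f = (if initial k f \<and> (k \<le> e \<and> is_source e k (f k) \<or> k = Suc e \<and> f k = k) then 1 else 0)"

definition target_label :: "nat \<Rightarrow> nat \<Rightarrow> (nat \<Rightarrow> nat) \<Rightarrow> int" where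
  "target_label e k f = (if initial k f \<and> k \<le> e \<and> \<not> is_source e k (f k) then 1 else 0)"

definition weigh :: "((nat \<Rightarrow> nat) \<Rightarrow> int) \<Rightarrow> chain \<Rightarrow> int" where
  "weigh w c = augmentation (frag_extend (\<lambda>f. frag_cmul (w f) (frag_of f)) c)"

lemma weigh_add: "weigh w (a + b) = weigh w a + weigh w b"
  by (simp add: weigh_def frag_extend_add augmentation_add)

lemma weigh_diff: "weigh w (a - b) = weigh w a - weigh w b"
  by (simp add: weigh_def frag_extend_diff augmentation_diff)

lemma augmentation_cmul: "augmentation (frag_cmul a (frag_of (f :: nat \<Rightarrow> nat))) = a"
  by (subst augmentation_superset[of "{f}"]) auto

lemma weigh_frag [simp]: "weigh w (frag_of f) = w f"
  by (simp add: weigh_def augmentation_cmul)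

lemma weigh_eq: "weigh w c = (\<Sum>f\<in>supp c. cf c f * w f)"
proof -
  have s: "augmentation (sum g A) = (\<Sum>f\<in>A. augmentation (g f :: chain))" if "finite A" for g A
    using that by (induction A rule: finite_induct) (auto simp: augmentation_add)
  show ?thesis unfolding weigh_def frag_extend_def
    by (subst s) (simp_all add: augmentation_cmul)
qed

lemma weigh_bdry_frag:
  assumes "f \<in> nd n (Suc k)"
  shows "weigh w (bdry n k (frag_of f)) = (\<Sum>i\<le>Suc k. (-1)^i * w (face k i f))"
proof -
  have "weigh w (\<Sum>i\<in>A. frag_cmul ((-1)^i) (frag_of (face k i f))) = (\<Sum>i\<in>A. (-1)^i * w (face k i f))" if "finite A" for A
    using that
  proof (induction A rule: finite_induct)
    case empty
    then show ?case by (simp add: weigh_def)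
  next
    case (insert i A)
    have "weigh w (frag_cmul ((-1)^i) (frag_of (face k i f))) = (-1)^i * w (face k i f)"
      by (simp add: weigh_def frag_extend_cmul augmentation_cmul)
    with insert show ?case by (simp add: weigh_add)
  qed
  then show ?thesis unfolding bdry_frag[OF assms] by blast
qed

lemma weigh_linear_eqI:
  assumes "supp c \<subseteq> S" "\<And>f. f \<in> S \<Longrightarrow> T (frag_of f) = (T' (frag_of f) :: int)"
    and "\<And>a b. T (a - b) = T a - T b" "\<And>a b. T' (a - b) = T' a - T' b"
  shows "T c = T' (c :: chain)"
  using assms(1)
proof (induction c rule: frag_induction)
  case zero
  then show ?case using assms(3)[of 0 0] assms(4)[of 0 0] by simp
qed (use assms in auto)

lemma horn_simplex_iff: "f \<in> simplices (horn n i) k \<longleftrightarrow> f \<in> ord_maps k n \<and> (\<exists>j\<le>n. j \<noteq> i \<and> j \<notin> f ` {..k})"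
  by (auto simp: horn_def opposite_face_def)

text \<open>Omitting a vertex before position \<open>k\<close> leaves a simplex that is not initial,
  so only the last two faces contribute.\<close>

lemma face_label_sum:
  assumes f: "f \<in> nd n (Suc k)" and w: "\<And>g. \<not> initial k g \<Longrightarrow> w g = 0"
  shows "(\<Sum>i\<le>Suc k. (-1)^i * w (face k i f)) = (-1)^k * (w (face k k f) - w (face k (Suc k) f) :: int)"
proof -
  have "\<not> initial k (face k i f)" if "i < k" for i
    using that nd_ge[OF f, of "Suc i"] by (auto simp: initial_def face_app intro!: exI[of _ i])
  then have "(\<Sum>i<k. (-1)^i * w (face k i f)) = 0" by (intro sum.neutral) (auto simp: w)
  then show ?thesis by (simp add: lessThan_Suc_atMost[symmetric] algebra_simps)
qed

lemma initial_face:
  "initial k (face k k f) \<longleftrightarrow> initial k f" "initial k (face k (Suc k) f) \<longleftrightarrow> initial k f"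
  "face k k f k = f (Suc k)" "face k (Suc k) f k = f k" "initial (Suc k) f \<longleftrightarrow> initial k f \<and> f k = k"
  by (auto simp: initial_def face_app less_Suc_eq)

text \<open>Such a simplex omits only \<open>e\<close> and meets every other vertex, so it is the
  missing face.\<close>

lemma not_in_horn:
  assumes "initial e f" "f e = Suc e" "f (Suc e) = Suc (Suc e)"
  shows "f \<notin> simplices (horn (Suc (Suc e)) e) (Suc e)"
proof
  assume "f \<in> simplices (horn (Suc (Suc e)) e) (Suc e)"
  then obtain j where j: "j \<le> Suc (Suc e)" "j \<noteq> e" "j \<notin> f ` {..Suc e}" by (auto simp: horn_simplex_iff)
  then consider "j < e" | "j = Suc e" | "j = Suc (Suc e)" by linarith
  then show False
  proof cases
    case 1
    then show ?thesis using assms j by (metis atMost_iff image_eqI initial_def le_SucI less_imp_le)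
  next
    case 2
    then show ?thesis using assms j by (metis atMost_iff image_eqI le_SucI le_refl)
  next
    case 3
    then show ?thesis using assms j by (metis atMost_iff image_eqI le_refl)
  qed
qed

text \<open>In the excluded case, which is the missing face, the left side is 1 where the formula
  gives 0: that face would have to run backwards.\<close>

lemma label_arith:
  assumes "k \<le> e" "k \<le> m" "m < m'" "m' \<le> Suc (Suc e)" "\<not> (k = e \<and> m = Suc e \<and> m' = Suc (Suc e))"
  shows "(-1)^k * ((if is_source e k m' then 1 else 0) - (if is_source e k m then 1 else 0)) =
      (if m = k \<and> (k < e \<or> m' = Suc e) then - 1 else 0 :: int)"
proof (cases "k < e")
  case True
  then show ?thesis using assms by (cases "even k") (auto simp: is_source_def)
next
  case False
  then have k: "k = e" using assms(1) by simp
  then consider "m = e" "m' = Suc e" | "m = e" "m' = Suc (Suc e)" using assms by linarith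
  then show ?thesis using k by cases (cases "even e"; simp add: is_source_def)+
qed

lemma label_relation:
  assumes f: "f \<in> basis (Suc (Suc e)) (simplices (horn (Suc (Suc e)) e)) (Suc k)"
  shows "(\<Sum>i\<le>Suc k. (-1)^i * source_label e k (face k i f)) = - (source_label e (Suc k) f + target_label e (Suc k) f)"
    and "(\<Sum>i\<le>Suc k. (-1)^i * target_label e k (face k i f)) = source_label e (Suc k) f + target_label e (Suc k) f"
proof -
  have fn: "f \<in> nd (Suc (Suc e)) (Suc k)" and fh: "f \<in> simplices (horn (Suc (Suc e)) e) (Suc k)" using f by auto
  \<comment> \<open>A nondegenerate simplex of dimension \<open>e + 2\<close> is the identity and
    meets every vertex, so the horn contains none.\<close>
  have "k \<le> e"
  proof (rule ccontr)
    assume "\<not> k \<le> e"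
    then have "k = Suc e" using nd_empty[of "Suc (Suc e)" "Suc k"] fn by (cases "k = Suc e") auto
    obtain j where j: "j \<le> Suc (Suc e)" "j \<notin> f ` {..Suc k}" using fh by (auto simp: horn_simplex_iff)
    have "f i \<le> i" if "i \<le> Suc k" for i
      using that
    proof (induction "Suc k - i" arbitrary: i)
      case 0
      then show ?case using ndD(1)[OF fn, of i] \<open>k = Suc e\<close> by simp
    next
      case (Suc r)
      then show ?case using Suc.hyps(1)[of "Suc i"] ndD(3)[OF fn, of i "Suc i"] by fastforce
    qed
    then have "f j = j" using nd_ge[OF fn, of j] j(1) \<open>k = Suc e\<close> by (simp add: antisym)
    then show False using j \<open>k = Suc e\<close> by (metis atMost_iff image_eqI)
  qed
  have lt: "f k < f (Suc k)" "k \<le> f k" "f (Suc k) \<le> Suc (Suc e)"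
    using ndD(3)[OF fn, of k "Suc k"] nd_ge[OF fn, of k] ndD(1)[OF fn, of "Suc k"] by auto
  have h: "\<not> (k = e \<and> initial e f \<and> f e = Suc e \<and> f (Suc e) = Suc (Suc e))"
    using not_in_horn[of e f] fh by auto
  have s: "(\<Sum>i\<le>Suc k. (-1)^i * source_label e k (face k i f)) = (-1)^k * (source_label e k (face k k f) - source_label e k (face k (Suc k) f))"
    by (rule face_label_sum[OF fn]) (simp add: source_label_def)
  have t: "(\<Sum>i\<le>Suc k. (-1)^i * target_label e k (face k i f)) = (-1)^k * (target_label e k (face k k f) - target_label e k (face k (Suc k) f))"
    by (rule face_label_sum[OF fn]) (simp add: target_label_def)
  \<comment> \<open>The total label that \<open>f\<close> carries in degree \<open>k + 1\<close> if
    it is initial up to \<open>k\<close>; see \<open>tot\<close> below.\<close>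
  define c where "c = (if f k = k \<and> (k < e \<or> f (Suc k) = Suc e) then 1 else 0 :: int)"
  define S where "S v = (if is_source e k v then 1 else 0 :: int)" for v
  have ar: "(-1)^k * (S (f (Suc k)) - S (f k)) = - c" if "initial k f"
  proof -
    have "\<not> (k = e \<and> f k = Suc e \<and> f (Suc k) = Suc (Suc e))" using h that by auto
    from label_arith[OF \<open>k \<le> e\<close> lt(2,1,3) this] show ?thesis unfolding S_def c_def by simp
  qed
  have src: "source_label e k (face k k f) - source_label e k (face k (Suc k) f) = (if initial k f then S (f (Suc k)) - S (f k) else 0)"
    using \<open>k \<le> e\<close> by (simp add: source_label_def initial_face S_def)
  have tgt: "target_label e k (face k k f) - target_label e k (face k (Suc k) f) = (if initial k f then S (f k) - S (f (Suc k)) else 0)"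
    using \<open>k \<le> e\<close> by (simp add: target_label_def initial_face S_def)
  have tot: "source_label e (Suc k) f + target_label e (Suc k) f = (if initial k f then c else 0)"
  proof (cases "initial k f \<and> f k = k")
    case True
    then show ?thesis using \<open>k \<le> e\<close> lt(1)
      by (cases "k < e") (auto simp: source_label_def target_label_def initial_face(5) c_def)
  next
    case False
    then show ?thesis by (auto simp: source_label_def target_label_def initial_face(5) c_def)
  qed
  have "(-1)^k * (S (f k) - S (f (Suc k))) = c" if "initial k f"
    using ar[OF that] by (simp add: algebra_simps)
  with ar show "(\<Sum>i\<le>Suc k. (-1)^i * source_label e k (face k i f)) = - (source_label e (Suc k) f + target_label e (Suc k) f)"
    "(\<Sum>i\<le>Suc k. (-1)^i * target_label e k (face k i f)) = source_label e (Suc k) f + target_label e (Suc k) f"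
    unfolding s t src tgt tot by auto
qed

text \<open>The labelled cell has dimension \<open>e + 1\<close> and sits on the face
  \<open>0, ..., e + 1\<close>, opposite to the last vertex.\<close>

lemma labelling_horn:
  fixes C :: "'a omega_struct"
  assumes C: "omega_category C" and b: "b \<in> cells C (Suc e)"
  defines "Y \<equiv> simplices (horn (Suc (Suc e)) e)"
  shows "labelling (basis (Suc (Suc e)) Y) (bdry (Suc (Suc e))) (simplex_key (Suc (Suc e))) C (Suc e) b
    (\<lambda>k. weigh (source_label e k)) (\<lambda>k. weigh (target_label e k))"
proof -
  let ?N = "Suc (Suc e)"
  interpret steiner_complex "basis ?N Y" "bdry ?N" "simplex_key ?N"
    unfolding Y_def by (rule steiner_complex_basis[OF closed_family_horn])
  interpret C: omega_category C by fact
  show ?thesis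
  proof
    show "0 \<le> weigh (source_label e k) c" if "pos (basis ?N Y k) c" for k c
      unfolding weigh_eq using pos_nonneg[OF that] by (intro sum_nonneg) (simp add: source_label_def)
    show "0 \<le> weigh (target_label e k) c" if "pos (basis ?N Y k) c" for k c
      unfolding weigh_eq using pos_nonneg[OF that] by (intro sum_nonneg) (simp add: target_label_def)
    show "weigh (source_label e k) (bdry ?N k c) = - (weigh (source_label e (Suc k)) c + weigh (target_label e (Suc k)) c)"
      if "supp c \<subseteq> basis ?N Y (Suc k)" for k c
      by (rule weigh_linear_eqI[OF that, where T = "\<lambda>c. weigh (source_label e k) (bdry ?N k c)"])
        (use label_relation(1) in \<open>auto simp: weigh_diff bdry_diff weigh_bdry_frag Y_def simp del: sum.atMost_Suc\<close>)
    show "weigh (target_label e k) (bdry ?N k c) = weigh (source_label e (Suc k)) c + weigh (target_label e (Suc k)) c"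
      if "supp c \<subseteq> basis ?N Y (Suc k)" for k c
      by (rule weigh_linear_eqI[OF that, where T = "\<lambda>c. weigh (target_label e k) (bdry ?N k c)"])
        (use label_relation(2) in \<open>auto simp: weigh_diff bdry_diff weigh_bdry_frag Y_def simp del: sum.atMost_Suc\<close>)
    show "weigh (source_label e 0) c + weigh (target_label e 0) c = augmentation c" if "supp c \<subseteq> basis ?N Y 0" for c
      by (rule weigh_linear_eqI[OF that, where T' = augmentation])
        (auto simp: weigh_diff augmentation_diff source_label_def target_label_def initial_def)
    show "weigh (source_label e k) c = 0" if "Suc e < k" for k c
      unfolding weigh_eq by (rule sum.neutral) (use that in \<open>auto simp: source_label_def\<close>)
    show "weigh (target_label e k) c = 0" if "Suc e \<le> k" for k c
      unfolding weigh_eq by (rule sum.neutral) (use that in \<open>auto simp: target_label_def\<close>)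
  qed (auto simp: weigh_add b)
qed

text \<open>The \<open>k + 1\<close> vertices of \<open>f\<close> together with \<open>i\<close> do
  not exhaust \<open>{..n}\<close>.\<close>

lemma small_in_horn:
  assumes f: "f \<in> nd n k" and k: "Suc k < n"
  shows "f \<in> simplices (horn n i) k"
proof -
  have "card (insert i (f ` {..k})) \<le> Suc (Suc k)"
    by (rule order.trans[OF card_insert_le_m1]) (auto intro: order.trans[OF card_image_le])
  then have "\<not> {..n} \<subseteq> insert i (f ` {..k})"
    using k card_mono[of "insert i (f ` {..k})" "{..n}"] by auto
  then show ?thesis using nd_ord_maps[OF f] by (auto simp: horn_simplex_iff)
qed

lemma face_oid:
  assumes "i \<le> Suc k"
  shows "face k i (oid (Suc k)) \<in> nd (Suc k) k" "j \<le> k \<Longrightarrow> face k i (oid (Suc k)) j = (if j < i then j else Suc j)"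
  using face_nd[OF oid_nd assms] by (auto simp: face_app oid_def)

lemma face_oid_in_horn:
  assumes i: "i \<le> Suc k" and "i \<noteq> e"
  shows "face k i (oid (Suc k)) \<in> simplices (horn (Suc k) e) k"
proof -
  have "i \<notin> face k i (oid (Suc k)) ` {..k}" using face_oid(2)[OF i] by auto
  then show ?thesis using assms nd_ord_maps[OF face_oid(1)[OF i]] by (auto simp: horn_simplex_iff)
qed

lemma face_oid_inj:
  assumes "i \<le> Suc k" "j \<le> Suc k" "face k i (oid (Suc k)) = face k j (oid (Suc k))"
  shows "i = j"
proof -
  have "\<not> i' < j'" if "i' \<le> Suc k" "j' \<le> Suc k" "face k i' (oid (Suc k)) = face k j' (oid (Suc k))" for i' j'
  proof
    assume "i' < j'"
    then show False using fun_cong[OF that(3), of i'] face_oid(2)[OF that(1), of i'] face_oid(2)[OF that(2), of i'] that by simp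
  qed
  then show ?thesis using assms by (metis linorder_neqE_nat)
qed

text \<open>The faces of the top simplex are distinct, so nothing cancels in its boundary: the even
  faces make up the target and the odd ones the source.\<close>

lemma top_boundary:
  fixes k :: nat
  defines "T \<equiv> oid (Suc k)"
  shows "i \<le> Suc k \<Longrightarrow>
      cf (atom (bdry (Suc k)) (Suc k) T k \<alpha>) (face k i T) = (if even i \<longleftrightarrow> \<alpha> = Plus then 1 else 0)"
    and "cf (atom (bdry (Suc k)) (Suc k) T k \<alpha>) f \<noteq> 0 \<Longrightarrow> \<exists>i\<le>Suc k. (even i \<longleftrightarrow> \<alpha> = Plus) \<and> f = face k i T"
proof -
  have T: "T \<in> nd (Suc k) (Suc k)" by (simp add: T_def oid_nd)
  have b: "cf (bdry (Suc k) k (frag_of T)) g = (\<Sum>i\<le>Suc k. (-1)^i * (if g = face k i T then 1 else 0))" for g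
    unfolding bdry_frag[OF T] Poly_Mapping.lookup_sum by simp
  have bi: "cf (bdry (Suc k) k (frag_of T)) (face k i T) = (-1)^i" if i: "i \<le> Suc k" for i
  proof -
    have "(\<Sum>j\<le>Suc k. (-1)^j * (if face k i T = face k j T then 1 else 0)) =
      (\<Sum>j\<le>Suc k. if i = j then (-1)^j else 0 :: int)"
      by (rule sum.cong) (use face_oid_inj[OF i] in \<open>auto simp: T_def\<close>)
    then show ?thesis using b[of "face k i T"] i by (simp del: sum.atMost_Suc)
  qed
  note st = atom_step[of k "Suc k" "bdry (Suc k)" T, OF lessI, unfolded atom_top]
  show "cf (atom (bdry (Suc k)) (Suc k) T k \<alpha>) (face k i T) = (if even i \<longleftrightarrow> \<alpha> = Plus then 1 else 0)"
    if i: "i \<le> Suc k"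
    using st bi[OF i] i by (cases \<alpha>) (auto simp: cf_simps minus_one_power_iff)
  show "\<exists>i\<le>Suc k. (even i \<longleftrightarrow> \<alpha> = Plus) \<and> f = face k i T" if f: "cf (atom (bdry (Suc k)) (Suc k) T k \<alpha>) f \<noteq> 0"
  proof (cases \<alpha>)
    case Plus
    then have "0 < cf (bdry (Suc k) k (frag_of T)) f" using f st by (auto simp: cf_simps max_def split: if_splits)
    then show ?thesis using cf_bdry_frag(1)[OF T] Plus by auto
  next
    case Minus
    then have "cf (bdry (Suc k) k (frag_of T)) f < 0" using f st by (auto simp: cf_simps max_def split: if_splits)
    then show ?thesis using cf_bdry_frag(2)[OF T] Minus by auto
  qed
qed

text \<open>
  The side of the boundary of the top cell that contains the \<open>e\<close>-th face is a composite
  \<open>h *\<^sub>k x0 *\<^sub>k w\<close> in which only \<open>x0\<close> involves that face; the other side does not involve it at all.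
\<close>

lemma horn_boundary:
  fixes e k :: nat
  defines "N \<equiv> Suc (Suc k)"
  defines "B' \<equiv> basis N (simplices (horn N e))" and "de \<equiv> face (Suc k) e (oid N)"
    and "z \<equiv> \<lambda>\<alpha>. oriental_bd (Suc k) \<alpha> (atom (bdry N) N (oid N))"
    and "\<alpha> \<equiv> if even e then Plus else Minus"
  assumes e: "e \<le> N"
  obtains h x0 w where
    "h \<in> cx_cells B' (bdry N) (Suc k)" "w \<in> cx_cells B' (bdry N) (Suc k)"
    "x0 \<in> steiner_complex.whiskered (nd N) (bdry N) (Suc k) de (Suc k)"
    "kcomp k h (kc k x0 w)" "kcomp k x0 w" "z \<alpha> = kc k h (kc k x0 w)" "z (opp \<alpha>) \<in> cx_cells B' (bdry N) (Suc k)"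
    "\<forall>i. i \<le> N \<longrightarrow> i \<noteq> e \<longrightarrow> cf (w (Suc k) Plus) (face (Suc k) i (oid N)) =
      (if (even i \<longleftrightarrow> even e) \<and> simplex_key N (Suc k) (face (Suc k) i (oid N)) < simplex_key N (Suc k) de then 1 else 0)"
    "\<forall>i. i \<le> N \<longrightarrow> i \<noteq> e \<longrightarrow> cf (h (Suc k) Plus) (face (Suc k) i (oid N)) =
      (if (even i \<longleftrightarrow> even e) \<and> \<not> simplex_key N (Suc k) (face (Suc k) i (oid N)) < simplex_key N (Suc k) de then 1 else 0)"
proof -
  interpret N: steiner_complex "nd N" "bdry N" "simplex_key N" by (rule steiner_complex_nd)
  let ?T = "atom (bdry N) N (oid N)" and ?d = "\<lambda>i. face (Suc k) i (oid N)" and ?key = "simplex_key N (Suc k)"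
  have Tc: "?T \<in> ocells N N" by (rule N.at_cl[OF oid_nd])
  have zc: "z \<beta> \<in> ocells N (Suc k)" for \<beta> unfolding z_def by (rule N.obd_cl[OF Tc])
  have zt: "z \<beta> (Suc k) \<gamma> = ?T (Suc k) \<beta>" for \<beta> \<gamma> by (simp add: z_def oriental_bd_def)
  have ev: "even e \<longleftrightarrow> \<alpha> = Plus" by (simp add: \<alpha>_def)
  note tb = top_boundary(1)[of _ "Suc k", folded N_def] and tb' = top_boundary(2)[of "Suc k", folded N_def]
  \<comment> \<open>All simplices of dimension at most \<open>k\<close> lie in the horn, so only the
    top chain decides.\<close>
  have horn: "x \<in> cx_cells B' (bdry N) (Suc k)"
    if x: "x \<in> ocells N (Suc k)" and s: "\<And>f. cf (x (Suc k) Plus) f \<noteq> 0 \<Longrightarrow> \<exists>i\<le>N. i \<noteq> e \<and> f = ?d i" for x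
  proof -
    have "pos (B' l) (x l \<beta>)" for l \<beta>
    proof -
      have "f \<in> B' l" if f: "cf (x l \<beta>) f \<noteq> 0" for f
      proof -
        have fn: "f \<in> nd N l" using N.clD(1)[OF x, of l \<beta>] f by (auto simp: pos_iff)
        consider "l \<le> k" | "l = Suc k" | "Suc k < l" by linarith
        then show ?thesis
        proof cases
          case 1
          then show ?thesis using small_in_horn[OF fn, of e] fn by (simp add: B'_def N_def)
        next
          case 2
          then have "x l \<beta> = x (Suc k) Plus" using N.cl_top[OF x, of l] by simp
          then obtain i where "i \<le> N" "i \<noteq> e" "f = ?d i" using s f by auto
          then show ?thesis using face_oid_in_horn[of i "Suc k" e] fn 2 by (simp add: B'_def N_def)
        next
          case 3
          then show ?thesis using N.clD(2)[OF x] f by simp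
        qed
      qed
      then show ?thesis using N.clD(1)[OF x, of l \<beta>] by (auto simp: pos_iff)
    qed
    then show ?thesis using x by (simp add: cx_cells_def)
  qed
  have zs: "\<exists>i\<le>N. (even i \<longleftrightarrow> \<beta> = Plus) \<and> f = ?d i" if "cf (z \<beta> (Suc k) Plus) f \<noteq> 0" for \<beta> f
    using tb'[of \<beta> f] that by (simp add: zt N_def)
  have other: "z (opp \<alpha>) \<in> cx_cells B' (bdry N) (Suc k)"
  proof (rule horn[OF zc])
    fix f assume "cf (z (opp \<alpha>) (Suc k) Plus) f \<noteq> 0"
    then obtain i where "i \<le> N" "even i \<longleftrightarrow> opp \<alpha> = Plus" "f = ?d i" using zs by blast
    then show "\<exists>i\<le>N. i \<noteq> e \<and> f = ?d i" using ev by (cases \<alpha>) auto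
  qed
  have de: "de \<in> nd N (Suc k)" using face_oid(1)[of e "Suc k"] e by (simp add: de_def N_def)
  \<comment> \<open>Keys are integers, so the threshold \<open>?key de - 1\<close> puts everything
    strictly below the missing face into \<open>w\<close>, and that face becomes the least element
    of the rest, which \<open>take_min\<close> splits off.\<close>
  obtain h' w where s: "h' \<in> ocells N (Suc k)" "w \<in> ocells N (Suc k)" "kcomp k h' w" "z \<alpha> = kc k h' w"
    "\<forall>c \<in> supp (h' (Suc k) Plus). ?key de - 1 < ?key c" "\<forall>c \<in> supp (w (Suc k) Plus). ?key c \<le> ?key de - 1"
    using N.top_split[OF zc[of \<alpha>], of "?key de - 1"] .
  have sum: "cf (h' (Suc k) Plus) f + cf (w (Suc k) Plus) f = cf (?T (Suc k) \<alpha>) f" for f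
    using fun_cong[OF fun_cong[OF s(4)], of "Suc k" Plus] by (simp add: kc_simps zt cf_simps[symmetric])
  have hw: "cf (w (Suc k) Plus) f = (if ?key f < ?key de then cf (?T (Suc k) \<alpha>) f else 0)"
    "cf (h' (Suc k) Plus) f = (if ?key f < ?key de then 0 else cf (?T (Suc k) \<alpha>) f)" for f
  proof -
    have z: "cf (h' (Suc k) Plus) f = 0" if "?key f < ?key de"
      using s(5)[rule_format, of f] that by (cases "f \<in> supp (h' (Suc k) Plus)") (auto simp: in_keys_iff)
    have z': "cf (w (Suc k) Plus) f = 0" if "\<not> ?key f < ?key de"
      using s(6)[rule_format, of f] that by (cases "f \<in> supp (w (Suc k) Plus)") (auto simp: in_keys_iff)
    show "cf (w (Suc k) Plus) f = (if ?key f < ?key de then cf (?T (Suc k) \<alpha>) f else 0)"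
      "cf (h' (Suc k) Plus) f = (if ?key f < ?key de then 0 else cf (?T (Suc k) \<alpha>) f)"
      using sum[of f] z z' by (cases "?key f < ?key de"; simp)+
  qed
  have hd: "cf (h' (Suc k) Plus) de = 1" using hw(2)[of de] tb[of e \<alpha>] ev e by (simp add: de_def N_def)
  then have nz: "h' (Suc k) Plus \<noteq> 0" by auto
  obtain a x0 h where t: "a \<in> nd N (Suc k)" "x0 \<in> N.whiskered (Suc k) a (Suc k)" "h \<in> ocells N (Suc k)" "kcomp k h x0"
    "h' = kc k h x0" "\<forall>c \<in> supp (h (Suc k) Plus). ?key a \<le> ?key c" "h (Suc k) Plus = h' (Suc k) Plus - frag_of a"
    using N.take_min[OF s(1) nz] .
  have "cf (h' (Suc k) Plus) a = cf (h (Suc k) Plus) a + 1" using t(7) by (simp add: cf_simps)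
  then have "cf (h' (Suc k) Plus) a \<noteq> 0" using pos_nonneg[OF N.clD(1)[OF t(3)], of "Suc k" Plus a] by simp
  then have 1: "?key de \<le> ?key a" using hw(2)[of a] by (auto split: if_splits)
  have "a = de"
  proof (rule ccontr)
    assume "a \<noteq> de"
    then have "cf (h (Suc k) Plus) de = 1" using hd t(7) by (simp add: cf_simps)
    then have "?key a \<le> ?key de" using t(6) by (auto simp: in_keys_iff)
    then show False using 1 N.key_inj de t(1) \<open>a \<noteq> de\<close> by (auto simp: inj_on_def)
  qed
  have hval: "cf (h (Suc k) Plus) f = (if ?key f < ?key de \<or> f = de then 0 else cf (?T (Suc k) \<alpha>) f)" for f
    using hw(2)[of f] hd t(7) \<open>a = de\<close> by (auto simp: cf_simps)
  have Ts: "\<exists>i\<le>N. i \<noteq> e \<and> f = ?d i" if "cf (?T (Suc k) \<alpha>) f \<noteq> 0" "f \<noteq> de" for f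
    using tb'[of \<alpha> f] that by (auto simp: N_def de_def)
  have hc: "h \<in> cx_cells B' (bdry N) (Suc k)"
    by (rule horn[OF t(3)]) (use hval Ts in \<open>auto split: if_splits\<close>)
  have wc: "w \<in> cx_cells B' (bdry N) (Suc k)"
    by (rule horn[OF s(2)]) (use hw(1) Ts in \<open>auto split: if_splits\<close>)
  have x0w: "kcomp k x0 w" using s(3) t(4,5) by (simp add: kcomp_kc_left)
  have inj: "?d i \<noteq> de" if "i \<le> N" "i \<noteq> e" for i
    using face_oid_inj[of i "Suc k" e] that e by (auto simp: de_def N_def)
  show ?thesis
  proof (rule that[OF hc wc _ _ x0w _ other]; (intro allI impI)?)
    show "x0 \<in> N.whiskered (Suc k) de (Suc k)" using t(2) \<open>a = de\<close> by simp
    show "kcomp k h (kc k x0 w)" using t(4) x0w by (simp add: kcomp_kc_right)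
    show "z \<alpha> = kc k h (kc k x0 w)" using s(4) t(5) by (simp add: kc_assoc)
    show "cf (w (Suc k) Plus) (?d i) = (if (even i \<longleftrightarrow> even e) \<and> ?key (?d i) < ?key de then 1 else 0)"
      if "i \<le> N" "i \<noteq> e" for i
      using hw(1)[of "?d i"] tb[of i \<alpha>] that ev by (simp add: N_def)
    show "cf (h (Suc k) Plus) (?d i) = (if (even i \<longleftrightarrow> even e) \<and> \<not> ?key (?d i) < ?key de then 1 else 0)"
      if "i \<le> N" "i \<noteq> e" for i
      using hval[of "?d i"] tb[of i \<alpha>] that ev inj[OF that] by (simp add: N_def)
  qed
qed

text \<open>Decides where the face labelled by \<open>b\<close> stands in the composite: before the
  missing face for even \<open>e\<close>, after it for odd \<open>e\<close>. The two faces first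
  differ at the vertex \<open>e\<close>.\<close>

lemma key_last_face:
  defines "d \<equiv> \<lambda>e i. face (Suc e) i (oid (Suc (Suc e)))"
  shows "even e \<Longrightarrow> simplex_key (Suc (Suc e)) (Suc e) (d e (Suc (Suc e))) < simplex_key (Suc (Suc e)) (Suc e) (d e e)"
    and "odd e \<Longrightarrow> simplex_key (Suc (Suc e)) (Suc e) (d e e) < simplex_key (Suc (Suc e)) (Suc e) (d e (Suc (Suc e)))"
proof -
  let ?n = "Suc (Suc e)"
  have app: "j \<le> Suc e \<Longrightarrow> d e i j = (if j < i then j else Suc j)" if "i \<le> ?n" for i j
    unfolding d_def by (rule face_oid(2)[OF that])
  have l: "{j. j \<le> Suc e \<and> d e ?n j \<le> v} = {..v}" if "v \<le> e" for v
    using that app[of ?n] by auto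
  have m: "{j. j \<le> Suc e \<and> d e e j \<le> v} = {..v}" if "v < e" for v
    using that app[of e] by (auto split: if_splits)
  have m': "{j. j \<le> Suc e \<and> d e e j \<le> e} = {..<e}"
    using app[of e] by (auto split: if_splits)
  show "even e \<Longrightarrow> simplex_key ?n (Suc e) (d e ?n) < simplex_key ?n (Suc e) (d e e)"
    "odd e \<Longrightarrow> simplex_key ?n (Suc e) (d e e) < simplex_key ?n (Suc e) (d e ?n)"
    by (rule key_less[of e]; simp add: l m m')+
qed

text \<open>The inverse \<open>b'\<close> is the value on the whiskered missing face. On its side of
  the boundary it is composed with \<open>b\<close> and otherwise with units, and the opposite side
  is a unit; the filler compares the two.\<close>

lemma one_sided_inverse:
  fixes C :: "'a omega_struct"
  assumes C: "omega_category C" and b: "b \<in> cells C (Suc e)"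
    and rlp: "has_rlp (street_nerve C) (horn (Suc (Suc e)) e) (std_simplex (Suc (Suc e)))"
  obtains b' where "composable C (Suc e) e b' b" "composable C (Suc e) e b b'"
    "even e \<Longrightarrow> arr C (Suc e) (idn C e (Suc e) (bd C (Suc e) e Minus b)) (cmp C (Suc e) e b' b) \<or>
      arr C (Suc e) (cmp C (Suc e) e b' b) (idn C e (Suc e) (bd C (Suc e) e Minus b))"
    "odd e \<Longrightarrow> arr C (Suc e) (idn C e (Suc e) (bd C (Suc e) e Plus b)) (cmp C (Suc e) e b b') \<or>
      arr C (Suc e) (cmp C (Suc e) e b b') (idn C e (Suc e) (bd C (Suc e) e Plus b))"
proof -
  let ?N = "Suc (Suc e)"
  let ?Y = "simplices (horn ?N e)"
  let ?d = "\<lambda>i. face (Suc e) i (oid ?N)"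
  interpret C: omega_category C by fact
  interpret N: steiner_complex "nd ?N" "bdry ?N" "simplex_key ?N" by (rule steiner_complex_nd)
  interpret L: labelling "basis ?N ?Y" "bdry ?N" "simplex_key ?N" C "Suc e" b
    "\<lambda>k. weigh (source_label e k)" "\<lambda>k. weigh (target_label e k)"
    by (rule labelling_horn[OF C b])
  obtain G where G: "\<And>p. partial_functor (nd ?N) (bdry ?N) C p G" "\<And>p x. x \<in> L.cl p \<Longrightarrow> G p x = L.val p x"
    using has_rlp_hornD[OF rlp L.partial_functor_val] by blast
  let ?T = "atom (bdry ?N) ?N (oid ?N)"
  let ?z = "\<lambda>\<beta>. oriental_bd (Suc e) \<beta> ?T"
  define \<alpha> where "\<alpha> = (if even e then Plus else Minus)"
  have eN: "e \<le> ?N" by simp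
  obtain h x0 w where s: "h \<in> L.cl (Suc e)" "w \<in> L.cl (Suc e)" "x0 \<in> N.whiskered (Suc e) (?d e) (Suc e)"
    "kcomp e h (kc e x0 w)" "kcomp e x0 w" "?z \<alpha> = kc e h (kc e x0 w)" "?z (opp \<alpha>) \<in> L.cl (Suc e)"
    "\<forall>i. i \<le> ?N \<longrightarrow> i \<noteq> e \<longrightarrow> cf (w (Suc e) Plus) (?d i) =
      (if (even i \<longleftrightarrow> even e) \<and> simplex_key ?N (Suc e) (?d i) < simplex_key ?N (Suc e) (?d e) then 1 else 0)"
    "\<forall>i. i \<le> ?N \<longrightarrow> i \<noteq> e \<longrightarrow> cf (h (Suc e) Plus) (?d i) =
      (if (even i \<longleftrightarrow> even e) \<and> \<not> simplex_key ?N (Suc e) (?d i) < simplex_key ?N (Suc e) (?d e) then 1 else 0)"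
    using horn_boundary[OF eN, folded \<alpha>_def] .
  have Tc: "?T \<in> ocells ?N ?N" by (rule N.at_cl[OF oid_nd])
  \<comment> \<open>In degree \<open>e + 1\<close> the only labelled simplex is the face opposite to
    the last vertex, so the total is its coefficient.\<close>
  have tot: "L.tot (Suc e) x = cf (x (Suc e) Plus) (?d ?N)" if x: "x \<in> L.cl (Suc e)" for x
  proof -
    have lab: "source_label e (Suc e) f + target_label e (Suc e) f = (if f = ?d ?N then 1 else 0)"
      if f: "f \<in> nd ?N (Suc e)" for f
    proof -
      have "initial (Suc e) f \<and> f (Suc e) = Suc e \<longleftrightarrow> f = ?d ?N"
      proof
        assume "f = ?d ?N"
        then show "initial (Suc e) f \<and> f (Suc e) = Suc e" using face_oid(2)[of ?N "Suc e"] by (auto simp: initial_def)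
      next
        assume i: "initial (Suc e) f \<and> f (Suc e) = Suc e"
        show "f = ?d ?N"
        proof (rule ext_le[of "Suc e"])
          fix j assume "j \<le> Suc e"
          then show "f j = ?d ?N j" using i face_oid(2)[of ?N "Suc e" j] by (auto simp: initial_def le_less)
        qed (use ndD(2)[OF f] face_undefined in auto)
      qed
      then show ?thesis by (auto simp: source_label_def target_label_def)
    qed
    have sn: "supp (x (Suc e) Plus) \<subseteq> nd ?N (Suc e)" using L.clD(1)[OF x] pos_supp by blast
    have "L.tot (Suc e) x = (\<Sum>f\<in>supp (x (Suc e) Plus). cf (x (Suc e) Plus) f * (source_label e (Suc e) f + target_label e (Suc e) f))"
      by (simp add: L.tot_def weigh_eq sum.distrib distrib_left)
    also have "\<dots> = (\<Sum>f\<in>supp (x (Suc e) Plus). if f = ?d ?N then cf (x (Suc e) Plus) f else 0)"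
      by (rule sum.cong) (use lab sn in auto)
    also have "\<dots> = cf (x (Suc e) Plus) (?d ?N)" by (simp add: sum.delta in_keys_iff)
    finally show ?thesis .
  qed
  have unit: "L.val (Suc e) x = up C e (Suc e) (bd C (Suc e) e \<beta> (L.val (Suc e) x))"
    if "x \<in> L.cl (Suc e)" "L.tot (Suc e) x = 0" for x \<beta>
    using L.val_unit[OF that, of \<beta>] L.val_bd[OF that(1), of e \<beta>] by simp
  have full: "L.val (Suc e) x = b" if "x \<in> L.cl (Suc e)" "L.tot (Suc e) x = 1" for x
  proof -
    have "L.tot (Suc (Suc e)) x = 0" by (simp add: L.tot_def L.high_0)
    then have "L.lev x = Suc e" using L.lev_eq that by blast
    then show ?thesis by (simp add: L.val_def up_def L.label_def)
  qed
  have hL: "L.tot (Suc e) h = (if even e then 0 else 1)" "L.tot (Suc e) w = (if even e then 1 else 0)"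
    using tot[OF s(1)] tot[OF s(2)] s(8,9)[rule_format, of ?N] key_last_face[of e]
    by (cases "even e"; simp)+
  \<comment> \<open>The number \<open>e + 2\<close> of the labelled face has the parity of
    \<open>e\<close>, so the side without the missing face does not contain it.\<close>
  have oL: "L.tot (Suc e) (?z (opp \<alpha>)) = 0"
    using tot[OF s(7)] top_boundary(1)[of ?N "Suc e" "opp \<alpha>"]
    by (auto simp: oriental_bd_def \<alpha>_def)
  note Gf = partial_functorD[OF G(1) order_refl]
  define Y where "Y = G ?N ?T"
  define x where "x = G (Suc e) (?z \<alpha>)"
  define v where "v = L.val (Suc e) (?z (opp \<alpha>))"
  have Yc: "Y \<in> cells C ?N" unfolding Y_def by (rule Gf(1)[OF Tc])
  have Yb: "bd C ?N (Suc e) \<beta> Y = G (Suc e) (?z \<beta>)" for \<beta> unfolding Y_def using Gf(2)[OF lessI Tc] by simp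
  have Yo: "bd C ?N (Suc e) (opp \<alpha>) Y = v" "bd C ?N (Suc e) \<alpha> Y = x"
    using Yb G(2)[OF s(7)] by (auto simp: v_def x_def)
  define b' where "b' = G (Suc e) x0"
  have x0c: "x0 \<in> ocells ?N (Suc e)" using s(3) N.whiskered_cl by blast
  have sub: "y \<in> L.cl p \<Longrightarrow> y \<in> ocells ?N p" for y p using cx_cells_sub[of "basis ?N ?Y" "nd ?N"] by auto
  have b'c: "b' \<in> cells C (Suc e)" unfolding b'_def by (rule Gf(1)[OF x0c])
  have x: "x = cmp C (Suc e) e (L.val (Suc e) h) (cmp C (Suc e) e b' (L.val (Suc e) w))"
    unfolding x_def s(6) b'_def
    using Gf(3)[OF lessI sub[OF s(1)] N.kc_cl[OF x0c sub[OF s(2)] s(5)] s(4)] Gf(3)[OF lessI x0c sub[OF s(2)] s(5)] G(2) s(1,2) by simp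
  have comp: "composable C (Suc e) e (G (Suc e) y) (G (Suc e) y')"
    if "y \<in> ocells ?N (Suc e)" "y' \<in> ocells ?N (Suc e)" "kcomp e y y'" for y y'
    using that Gf(1) Gf(2)[OF lessI that(1), of Minus] Gf(2)[OF lessI that(2), of Plus]
    by (auto simp: composable_def kcomp_def)
  have c1: "composable C (Suc e) e b' (L.val (Suc e) w)" using comp[OF x0c sub[OF s(2)] s(5)] G(2)[OF s(2)] by (simp add: b'_def)
  have c2: "composable C (Suc e) e (L.val (Suc e) h) (cmp C (Suc e) e b' (L.val (Suc e) w))"
    using comp[OF sub[OF s(1)] N.kc_cl[OF x0c sub[OF s(2)] s(5)] s(4)] G(2)[OF s(1)] G(2)[OF s(2)]
      Gf(3)[OF lessI x0c sub[OF s(2)] s(5)] by (simp add: b'_def)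
  \<comment> \<open>The two boundaries of the unit \<open>v\<close> agree, and by globularity they
    are those of \<open>x\<close>. This makes \<open>b'\<close> run opposite to
    \<open>b\<close>.\<close>
  have bx: "bd C (Suc e) e \<beta> x = bd C (Suc e) e \<gamma> v" for \<beta> \<gamma>
  proof -
    have "bd C (Suc e) e \<beta> x = bd C (Suc e) e \<beta> v"
      using C.globular[of e "Suc e" ?N Y \<beta> \<alpha>] C.globular[of e "Suc e" ?N Y \<beta> "opp \<alpha>"] Yc Yo by simp
    moreover have "bd C (Suc e) e \<beta> v = bd C (Suc e) e \<gamma> v"
    proof -
      have vc: "v \<in> cells C (Suc e)" unfolding v_def by (rule L.val_cell[OF s(7)])
      have "v = up C e (Suc e) (bd C (Suc e) e \<gamma> v)" unfolding v_def by (rule unit[OF s(7) oL])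
      then have "bd C (Suc e) e \<beta> v = bd C (Suc e) e \<beta> (up C e (Suc e) (bd C (Suc e) e \<gamma> v))" by simp
      also have "\<dots> = bd C (Suc e) e \<gamma> v" using C.bd_up_above[of e e "Suc e"] C.bd_cell[OF lessI vc] by simp
      finally show ?thesis .
    qed
    ultimately show ?thesis by simp
  qed
  have v: "v = idn C e (Suc e) (bd C (Suc e) e \<beta> x)" for \<beta>
    using unit[OF s(7) oL, of Plus] bx[of \<beta> Plus] by (simp add: v_def up_def)
  have bb: "bd C (Suc e) e Plus x = bd C (Suc e) e Minus x" using bx[of Plus Plus] bx[of Minus Plus] by simp
  \<comment> \<open>The direction depends on which side is the source, that is, on parity; it is
    left open here.\<close>
  have ar: "arr C (Suc e) v x \<or> arr C (Suc e) x v"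
    unfolding arr_def using Yc Yo by (cases \<alpha>) auto
  show ?thesis
  proof (cases "even e")
    case True
    have w: "L.val (Suc e) w = b" using full[OF s(2)] hL True by simp
    have xb: "x = cmp C (Suc e) e b' b"
      using x w C.unit_left[of e "Suc e" "cmp C (Suc e) e b' b"] unit[OF s(1), of Minus] hL(1) True c2
      by (simp add: composable_def)
    have c: "composable C (Suc e) e b' b" using c1 w by simp
    have "bd C (Suc e) e Minus b = bd C (Suc e) e Minus x" "bd C (Suc e) e Plus b' = bd C (Suc e) e Plus x"
      unfolding xb using C.bd_cmp_source[OF c] C.bd_cmp_target[OF c] by auto
    then show ?thesis
      using that[of b'] c True ar v[of Minus] bb xb b b'c by (auto simp: composable_def)
  next
    case False
    have h: "L.val (Suc e) h = b" using full[OF s(1)] hL False by simp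
    have "cmp C (Suc e) e b' (L.val (Suc e) w) = b'"
      using C.unit_right[of e "Suc e" b'] unit[OF s(2), of Plus] hL(2) False c1
      by (simp add: composable_def)
    then have xb: "x = cmp C (Suc e) e b b'" and c: "composable C (Suc e) e b b'" using x h c2 by auto
    have "bd C (Suc e) e Minus b' = bd C (Suc e) e Minus x" "bd C (Suc e) e Plus b = bd C (Suc e) e Plus x"
      unfolding xb using C.bd_cmp_source[OF c] C.bd_cmp_target[OF c] by auto
    then show ?thesis
      using that[of b'] c False ar v[of Plus] bb xb b b'c by (auto simp: composable_def)
  qed
qed

text \<open>Composability of the one-sided inverse already makes \<open>arr\<close> symmetric, which
  settles the direction left open before. Odd dimensions yield right inverses and are treated in the
  dual.\<close>

lemma has_inverses_if_rlp:
  fixes C :: "'a omega_struct"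
  assumes C: "omega_category C"
    and rlp: "\<And>e. m \<le> e \<Longrightarrow> has_rlp (street_nerve C) (horn (Suc (Suc e)) e) (std_simplex (Suc (Suc e)))"
  shows "has_inverses C m"
proof -
  interpret C: omega_category C by fact
  interpret D: omega_category "dual C" by (rule omega_category_dual[OF C])
  have sym: "arr C q g f" if mq: "m \<le> q" and a: "arr C q f g" for q f g
  proof -
    obtain y where y: "y \<in> cells C (Suc q)" "bd C (Suc q) q Minus y = f" "bd C (Suc q) q Plus y = g"
      using a by (auto simp: arr_def)
    obtain y' where "composable C (Suc q) q y' y" "composable C (Suc q) q y y'"
      using one_sided_inverse[OF C y(1) rlp[OF mq]] by metis
    then show ?thesis using y by (auto simp: arr_def composable_def)
  qed
  show ?thesis unfolding has_inverses_def
  proof (intro allI impI ballI)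
    fix n b assume n: "m \<le> n" and b: "b \<in> cells C (Suc n)"
    have sym': "arr C (Suc n) g f" if "arr C (Suc n) f g" for f g using sym[OF _ that] n by simp
    show "\<exists>b'. composable C (Suc n) n b' b \<and> composable C (Suc n) n b b' \<and>
      arr C (Suc n) (idn C n (Suc n) (bd C (Suc n) n Minus b)) (cmp C (Suc n) n b' b) \<and>
      arr C (Suc n) (idn C n (Suc n) (bd C (Suc n) n Plus b)) (cmp C (Suc n) n b b')"
    proof (cases "even n")
      case True
      have "\<exists>b'. composable C (Suc n) n b' b \<and> composable C (Suc n) n b b' \<and>
        arr C (Suc n) (idn C n (Suc n) (bd C (Suc n) n Minus b)) (cmp C (Suc n) n b' b)"
        if "b \<in> cells C (Suc n)" for b
        using one_sided_inverse[OF C \<open>b \<in> cells C (Suc n)\<close> rlp[OF n]] True sym' by metis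
      then show ?thesis using C.two_sided_inverse[OF sym' _ b] by blast
    next
      case False
      have "\<exists>b'. composable (dual C) (Suc n) n b' b \<and> composable (dual C) (Suc n) n b b' \<and>
        arr (dual C) (Suc n) (idn (dual C) n (Suc n) (bd (dual C) (Suc n) n Minus b)) (cmp (dual C) (Suc n) n b' b)"
        if "b \<in> cells (dual C) (Suc n)" for b
      proof -
        have "b \<in> cells C (Suc n)" using that by simp
        then obtain b' where "composable C (Suc n) n b' b" "composable C (Suc n) n b b'"
          "arr C (Suc n) (cmp C (Suc n) n b b') (idn C n (Suc n) (bd C (Suc n) n Plus b))"
          using one_sided_inverse[OF C _ rlp[OF n]] False sym' by metis
        then show ?thesis unfolding composable_dual arr_dual dual_simps opp.simps by blast
      qed
      moreover have "arr (dual C) (Suc n) g f" if "arr (dual C) (Suc n) f g" for f g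
        using that sym' by simp
      moreover have "b \<in> cells (dual C) (Suc n)" using b by simp
      ultimately obtain b' where "composable (dual C) (Suc n) n b' b" "composable (dual C) (Suc n) n b b'"
        "arr (dual C) (Suc n) (idn (dual C) n (Suc n) (bd (dual C) (Suc n) n Minus b)) (cmp (dual C) (Suc n) n b' b)"
        "arr (dual C) (Suc n) (idn (dual C) n (Suc n) (bd (dual C) (Suc n) n Plus b)) (cmp (dual C) (Suc n) n b b')"
        using D.two_sided_inverse[of n b] by blast
      then show ?thesis unfolding composable_dual arr_dual dual_simps opp.simps using sym' by blast
    qed
  qed
qed

text \<open>The cells of dimension greater than \<open>m\<close> form an invertibility set of their
  own, since all witnesses lie above \<open>m\<close> again.\<close>

lemma weakly_invertible_iff:
  fixes C :: "'a omega_struct"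
  assumes C: "omega_category C"
  shows "(\<forall>n c. m < n \<and> c \<in> cells C n \<longrightarrow> weakly_invertible C n c) \<longleftrightarrow> has_inverses C m"
proof
  interpret C: omega_category C by fact
  assume w: "\<forall>n c. m < n \<and> c \<in> cells C n \<longrightarrow> weakly_invertible C n c"
  show "has_inverses C m"
    unfolding has_inverses_def
  proof (intro allI impI ballI)
    fix n b assume "m \<le> n" "b \<in> cells C (Suc n)"
    then have "weakly_invertible C (n + 1) b" using w by simp
    then obtain E where E: "invertibility_set C E" "(n + 1, b) \<in> E" unfolding weakly_invertible_def by blast
    then obtain b' c c' where "composable C (n + 1) n b' b" "composable C (n + 1) n b b'"
      "cell_from_to C (n + 1) c (idn C n (n + 1) (bd C (n + 1) n Minus b)) (cmp C (n + 1) n b' b)"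
      "cell_from_to C (n + 1) c' (idn C n (n + 1) (bd C (n + 1) n Plus b)) (cmp C (n + 1) n b b')"
      unfolding invertibility_set_def by blast
    then show "\<exists>b'. composable C (Suc n) n b' b \<and> composable C (Suc n) n b b' \<and>
      arr C (Suc n) (idn C n (Suc n) (bd C (Suc n) n Minus b)) (cmp C (Suc n) n b' b) \<and>
      arr C (Suc n) (idn C n (Suc n) (bd C (Suc n) n Plus b)) (cmp C (Suc n) n b b')"
      by (auto simp: cell_from_to_def arr_def)
  qed
next
  assume h: "has_inverses C m"
  let ?E = "{(n, c). m < n \<and> c \<in> cells C n}"
  have "invertibility_set C ?E"
    unfolding invertibility_set_def
  proof (intro conjI allI impI)
    fix n b assume "(n + 1, b) \<in> ?E"
    then have nb: "m \<le> n" "b \<in> cells C (Suc n)" by auto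
    obtain b' where b': "composable C (Suc n) n b' b" "composable C (Suc n) n b b'"
      "arr C (Suc n) (idn C n (Suc n) (bd C (Suc n) n Minus b)) (cmp C (Suc n) n b' b)"
      "arr C (Suc n) (idn C n (Suc n) (bd C (Suc n) n Plus b)) (cmp C (Suc n) n b b')"
      using h nb unfolding has_inverses_def by blast
    moreover have "b' \<in> cells C (Suc n)" using b' by (auto simp: composable_def)
    moreover obtain c c' where "cell_from_to C (n + 1) c (idn C n (n + 1) (bd C (n + 1) n Minus b)) (cmp C (n + 1) n b' b)"
      "cell_from_to C (n + 1) c' (idn C n (n + 1) (bd C (n + 1) n Plus b)) (cmp C (n + 1) n b b')"
      using b'(3,4) by (auto simp: arr_def cell_from_to_def)
    ultimately show "\<exists>b' c c'. (n + 1, b') \<in> ?E \<and> (n + 2, c) \<in> ?E \<and> (n + 2, c') \<in> ?E \<and>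
      composable C (n + 1) n b' b \<and> composable C (n + 1) n b b' \<and>
      cell_from_to C (n + 1) c (idn C n (n + 1) (bd C (n + 1) n Minus b)) (cmp C (n + 1) n b' b) \<and>
      cell_from_to C (n + 1) c' (idn C n (n + 1) (bd C (n + 1) n Plus b)) (cmp C (n + 1) n b b')"
      using nb by (intro exI[of _ b'] exI[of _ c] exI[of _ c']) (auto simp: cell_from_to_def)
  qed auto
  then show "\<forall>n c. m < n \<and> c \<in> cells C n \<longrightarrow> weakly_invertible C n c"
    unfolding weakly_invertible_def by blast
qed

section \<open>Invertibility implies lifting\<close>

context extension
begin

lemma parallel_boundary:
  assumes x: "x \<in> cl (Suc p)"
  shows "parallel C p (G p (oriental_bd p Minus x)) (G p (oriental_bd p Plus x))"
proof -
  have "bd C p l \<beta> (G p (oriental_bd p \<alpha> x)) = G l (oriental_bd l \<beta> x)" if "l < p" for l \<alpha> \<beta>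
    using partial_functorD(2)[OF G order_refl that obd_cl[OF x], of \<beta> \<alpha>] that by simp
  then show ?thesis using partial_functorD(1)[OF G order_refl obd_cl[OF x]] by (simp add: parallel_def)
qed

text \<open>Whiskers of dimension at most \<open>p\<close> are unchanged by the
  \<open>p\<close>-boundary, which therefore acts on the middle factor only.\<close>

lemma bd_whisker_form:
  assumes f: "whisker_form (Suc p) a k u y v" and k: "Suc k \<le> p"
  shows "oriental_bd p \<alpha> (kc k y v) = kc k (oriental_bd p \<alpha> y) v"
    "oriental_bd p \<alpha> (kc k u (kc k y v)) = kc k u (oriental_bd p \<alpha> (kc k y v))"
    "kcomp k (oriental_bd p \<alpha> y) v" "kcomp k u (oriental_bd p \<alpha> (kc k y v))"
proof -
  note F = f[unfolded whisker_form_def]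
  have k': "k < p" using k by simp
  have uv: "oriental_bd p \<alpha> u = u" "oriental_bd p \<alpha> v = v" using F obd_id k by blast+
  show "oriental_bd p \<alpha> (kc k y v) = kc k (oriental_bd p \<alpha> y) v"
    "oriental_bd p \<alpha> (kc k u (kc k y v)) = kc k u (oriental_bd p \<alpha> (kc k y v))"
    using obd_kc(5)[OF k'] uv by simp_all
  show "kcomp k (oriental_bd p \<alpha> y) v" "kcomp k u (oriental_bd p \<alpha> (kc k y v))"
    using F k' by (simp_all add: kcomp_obd_left kcomp_obd_right kcomp_kc_right)
qed

text \<open>With fixed ends the accompanying edges form a positive 1-chain without boundary, which
  is zero by \<open>del0_source\<close>. So an inner horn never calls for the inverse of a
  1-cell.\<close>

lemma whiskered_fixed_ends:
  assumes z: "z \<in> whiskered (Suc p) a (Suc (Suc 0))" and a: "a \<in> B (Suc p)" and p: "0 < p"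
    and ends: "z 0 = at (Suc p) a 0"
  shows "z = at (Suc p) a"
proof -
  let ?a = "at (Suc p) a"
  have "Suc 0 < Suc p" using p by simp
  note r = whiskered_rest[OF z a this]
  let ?Q = "z (Suc 0) Minus - ?a (Suc 0) Minus"
  have "del 0 ?Q = 0"
    using clD(3)[OF whiskered_cl[OF z], of 0 Minus] at_facts(2)[OF a, of 0 Minus] ends by (simp add: del_diff)
  then have "?Q = 0" using del0_source[OF r(2)] by force
  then have "z (Suc 0) \<alpha> = ?a (Suc 0) \<alpha>" for \<alpha> using r(1) by (cases \<alpha>) auto
  then have "z (Suc 0) = ?a (Suc 0)" by auto
  then have "z l = ?a l" for l
    using ends z by (cases l; cases "l - 1") (auto simp: whiskered_def)
  then show ?thesis by auto
qed

text \<open>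
  Whiskering with invertible cells can be undone up to a cell of higher dimension, so that every cell
  with the boundary of the image of \<open>z\<close> comes, up to such a cell, from a value on the atom.
\<close>

lemma lift_whiskered:
  assumes inv: "has_inverses C n" and n: "n = 0 \<or> n = Suc 0 \<and> z 0 = at (Suc p) a 0" and a: "a \<in> B (Suc p)"
    and j: "j \<le> p" and z: "z \<in> whiskered (Suc p) a (Suc j)" and w: "ok z w"
  shows "\<exists>x. ok (at (Suc p) a) x \<and> (\<forall>G'. partial_functor B del C (Suc p) G' \<longrightarrow> (\<forall>q\<le>p. G' q = G q) \<longrightarrow>
    G' (Suc p) (at (Suc p) a) = x \<longrightarrow> arr C (Suc p) (G' (Suc p) z) w)"
  using n j z w
proof (induction j arbitrary: z w)
  case 0
  then have "z = at (Suc p) a" using whiskered_1[OF _ a] by simp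
  then show ?case using 0 C.arr_refl[OF okD(2)[OF 0(4)]] by (intro exI[of _ w]) auto
next
  case (Suc k)
  show ?case
  proof (cases "n \<le> k")
    case False
    \<comment> \<open>Here \<open>n = 1\<close> and \<open>k = 0\<close>: the whiskers are edges,
      and fixed ends exclude them.\<close>
    then have "z = at (Suc p) a" using whiskered_fixed_ends[of z a] Suc.prems a by (cases k) auto
    then show ?thesis using Suc.prems C.arr_refl[OF okD(2)[OF Suc.prems(4)]] by (intro exI[of _ w]) auto
  next
    case True
    have k: "k < p" "Suc k < Suc p" using Suc.prems by auto
    have C: "omega_category C" by unfold_locales
    obtain u y v where f: "whisker_form (Suc p) a k u y v" "z = kc k u (kc k y v)"
      using whisker_form_exists[OF Suc.prems(3) a k(2)] .
    note F = f(1)[unfolded whisker_form_def]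
    note bf = bd_whisker_form[OF f(1) Suc.prems(2)]
    have cl: "u \<in> cl (Suc k)" "v \<in> cl (Suc k)" "u \<in> cl p" "v \<in> cl p" "y \<in> cl (Suc p)" "v \<in> cl (Suc p)" "u \<in> cl (Suc p)"
      using F k cl_mono by (auto simp: whiskered_def)
    have yv: "kc k y v \<in> cl (Suc p)" using kc_cl[OF cl(5,6)] F by blast
    have kk: "kcomp k u (kc k y v)" "kcomp k y v" using whisker_form_step(1)[OF f(1)] F k by auto
    note GD = partial_functorD[OF G order_refl]
    have Gu: "G (Suc k) u \<in> cells C (k + 1)" "G (Suc k) v \<in> cells C (k + 1)"
      using partial_functorD(1)[OF G] Suc.prems(2) cl(1,2) by auto
    have up: "up C (k+1) p (G (Suc k) x) = G p x" if "x \<in> cl (Suc k)" for x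
      using partial_functorD(4)[OF G order_refl _ that] k by (cases "Suc k = p") (auto simp: up_def)
    let ?f = "\<lambda>\<alpha>. G p (oriental_bd p \<alpha> (kc k y v))" and ?g = "\<lambda>\<alpha>. G p (oriental_bd p \<alpha> y)"
    have bz: "G p (oriental_bd p \<alpha> z) = cmp C p k (G p u) (?f \<alpha>)" for \<alpha>
      unfolding f(2) bf(2) using GD(3)[OF k(1) cl(3) obd_cl[OF yv] bf(4)] .
    have bt: "?f \<alpha> = cmp C p k (?g \<alpha>) (G p v)" for \<alpha>
      unfolding bf(1) using GD(3)[OF k(1) obd_cl[OF cl(5)] cl(4) bf(3)] .
    have comp: "composable C p k (G p x) (G p x')" if "x \<in> cl p" "x' \<in> cl p" "kcomp k x x'" for x x'
      using that GD(1) GD(2)[OF k(1) that(1), of Minus] GD(2)[OF k(1) that(2), of Plus] k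
      by (auto simp: composable_def kcomp_def)
    have wb: "w \<in> cells C (Suc p)" "bd C (Suc p) p \<alpha> w = cmp C p k (up C (k+1) p (G (Suc k) u)) (?f \<alpha>)" for \<alpha>
      using Suc.prems(4) bz up[OF cl(1)] by (auto simp: ok_def)
    \<comment> \<open>First the whisker \<open>u\<close> is divided off on the left, then
      \<open>v\<close> on the right; what remains, \<open>x2\<close>, is a candidate value for
      \<open>y\<close>.\<close>
    obtain x1 where x1: "x1 \<in> cells C (Suc p)" "bd C (Suc p) p Minus x1 = ?f Minus" "bd C (Suc p) p Plus x1 = ?f Plus"
      "composable C (Suc p) k (up C (k+1) (Suc p) (G (Suc k) u)) x1"
      "arr C (Suc p) (cmp C (Suc p) k (up C (k+1) (Suc p) (G (Suc k) u)) x1) w"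
      using divide_left[OF C inv True Gu(1) k(1) parallel_boundary[OF yv] _ wb(1,2,2)]
        comp[OF cl(3) obd_cl[OF yv] bf(4)] up[OF cl(1)] by auto
    have xb: "bd C (Suc p) p \<alpha> x1 = cmp C p k (?g \<alpha>) (up C (k+1) p (G (Suc k) v))" for \<alpha>
      using x1(2,3) bt up[OF cl(2)] by (cases \<alpha>) auto
    obtain x2 where x2: "x2 \<in> cells C (Suc p)" "bd C (Suc p) p Minus x2 = ?g Minus" "bd C (Suc p) p Plus x2 = ?g Plus"
      "composable C (Suc p) k x2 (up C (k+1) (Suc p) (G (Suc k) v))"
      "arr C (Suc p) (cmp C (Suc p) k x2 (up C (k+1) (Suc p) (G (Suc k) v))) x1"
      using divide_right[OF C inv True Gu(2) k(1) parallel_boundary[OF cl(5)] _ x1(1) xb xb]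
        comp[OF obd_cl[OF cl(5)] cl(4) bf(3)] up[OF cl(2)] by auto
    have oky: "ok y x2" using x2(1-3) cl(5) unfolding ok_def by (metis sign.exhaust)
    \<comment> \<open>Composition along a positive dimension keeps the vertices, so the condition on
      the ends passes from \<open>z\<close> to \<open>y\<close>.\<close>
    have ny: "n = 0 \<or> n = Suc 0 \<and> y 0 = at (Suc p) a 0"
      using Suc.prems(1) True f(2) kk by (auto simp: kc_simps kcomp_iff)
    obtain x where x: "ok (at (Suc p) a) x" "\<And>G'. partial_functor B del C (Suc p) G' \<Longrightarrow> (\<forall>q\<le>p. G' q = G q) \<Longrightarrow>
      G' (Suc p) (at (Suc p) a) = x \<Longrightarrow> arr C (Suc p) (G' (Suc p) y) x2"
      using Suc.IH[OF ny _ _ oky] Suc.prems(2) F by auto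
    \<comment> \<open>The whiskers are put back: \<open>G'\<close> respects the normal form, and
      whiskering preserves \<open>arr\<close>.\<close>
    have "arr C (Suc p) (G' (Suc p) z) w"
      if G': "partial_functor B del C (Suc p) G'" "\<forall>q\<le>p. G' q = G q" "G' (Suc p) (at (Suc p) a) = x" for G'
    proof -
      note GD' = partial_functorD[OF G'(1) order_refl]
      have up': "G' (Suc p) t = up C (k+1) (Suc p) (G (Suc k) t)" if "t \<in> cl (Suc k)" for t
        using GD'(4)[OF k(2) that] k G'(2) by (simp add: up_def)
      have Gz: "G' (Suc p) z = cmp C (Suc p) k (G' (Suc p) u) (cmp C (Suc p) k (G' (Suc p) y) (G' (Suc p) v))"
        unfolding f(2) using GD'(3)[of k, OF _ cl(7) yv kk(1)] GD'(3)[of k, OF _ cl(5,6) kk(2)] k by simp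
      have comp': "composable C (Suc p) k (G' (Suc p) t) (G' (Suc p) t')"
        if "t \<in> cl (Suc p)" "t' \<in> cl (Suc p)" "kcomp k t t'" for t t'
        using that GD'(1) GD'(2)[of k t Minus] GD'(2)[of k t' Plus] k
        by (auto simp: composable_def kcomp_def)
      have uc: "G' (Suc p) u \<in> cells C (Suc p)" "G' (Suc p) v \<in> cells C (Suc p)" using GD'(1) cl by auto
      have "arr C (Suc p) (cmp C (Suc p) k (G' (Suc p) y) (G' (Suc p) v)) (cmp C (Suc p) k x2 (G' (Suc p) v))"
        by (rule C.arr_cmp[OF C.arr_refl[OF uc(2)] x(2)[OF G'] comp'[OF cl(5,6) kk(2)]])
      then have 1: "arr C (Suc p) (cmp C (Suc p) k (G' (Suc p) y) (G' (Suc p) v)) x1"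
        using x2(5) up'[OF cl(2)] C.arr_trans by simp
      have "composable C (Suc p) k (G' (Suc p) u) (cmp C (Suc p) k (G' (Suc p) y) (G' (Suc p) v))"
        using comp'[OF cl(7) yv kk(1)] GD'(3)[of k, OF _ cl(5,6) kk(2)] k by simp
      then have "arr C (Suc p) (G' (Suc p) z) (cmp C (Suc p) k (G' (Suc p) u) x1)"
        unfolding Gz by (rule C.arr_cmp[OF 1 C.arr_refl[OF uc(1)]])
      then show ?thesis using x1(5) up'[OF cl(1)] C.arr_trans by simp
    qed
    then show ?thesis using x(1) by blast
  qed
qed

end

section \<open>Facets of a simplex and the functor on a horn\<close>

lemma nd_upper:
  assumes "f \<in> nd n k" "j \<le> k"
  shows "f j + (k - j) \<le> n"
  using assms(2)
proof (induction "k - j" arbitrary: j)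
  case 0
  then show ?case using ndD(1)[OF assms(1), of j] by simp
next
  case (Suc r)
  then show ?case using Suc.hyps(1)[of "Suc j"] ndD(3)[OF assms(1), of j "Suc j"] by fastforce
qed

lemma nd_top: "f \<in> nd n n \<Longrightarrow> f = oid n"
  using nd_upper[of f n n] nd_ge[of f n n] ndD(2)[of f n n]
  by (intro ext_le[of n]) (force simp: oid_def)+

text \<open>Counting yields an omitted vertex \<open>j\<close>. As \<open>f l\<close> is
  \<open>l\<close> or \<open>l + 1\<close>, it is the former below \<open>j\<close> and the latter
  from \<open>j\<close> on.\<close>

lemma nd_facet:
  assumes f: "f \<in> nd (Suc k) k"
  obtains j where "j \<le> Suc k" "f = face k j (oid (Suc k))"
proof -
  have "card (f ` {..k}) \<le> Suc k" using card_image_le[of "{..k}" f] by simp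
  then have "\<not> {..Suc k} \<subseteq> f ` {..k}" using card_mono[of "f ` {..k}" "{..Suc k}"] by auto
  then obtain j where j: "j \<le> Suc k" "\<And>l. l \<le> k \<Longrightarrow> f l \<noteq> j" by (metis atMost_iff image_eqI subsetI)
  have b: "l \<le> f l" "f l \<le> Suc l" if "l \<le> k" for l
    using nd_ge[OF f that] nd_upper[OF f that] that by auto
  have up: "f (l + i) = Suc (l + i)" if "f l = Suc l" "l + i \<le> k" for l i
    using that(2)
  proof (induction i)
    case (Suc i)
    then show ?case using ndD(3)[OF f, of "l + i" "Suc (l + i)"] b[of "Suc (l + i)"] by simp
  qed (use that in simp)
  have down: "f i = i" if "f l = l" "i \<le> l" "l \<le> k" for l i
    using that(2)
  proof (induction "l - i" arbitrary: i)
    case (Suc r)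
    then show ?case using Suc.hyps(1)[of "Suc i"] ndD(3)[OF f, of i "Suc i"] b[of i] that(3) by fastforce
  qed (use that in auto)
  have "f = face k j (oid (Suc k))"
  proof (rule ext_le[of k])
    fix l assume l: "l \<le> k"
    show "f l = face k j (oid (Suc k)) l"
    proof (cases "l < j")
      case True
      then have "f l \<noteq> Suc l" using up[of l "j - 1 - l"] j(2)[of "j - 1"] j(1) by force
      then show ?thesis using b[OF l] True l face_oid(2)[OF j(1)] by simp
    next
      case False
      then have "f l \<noteq> l" using down[of l j] j l by auto
      then show ?thesis using b[OF l] False l face_oid(2)[OF j(1)] by simp
    qed
  qed (use ndD(2)[OF f] face_undefined in auto)
  then show ?thesis using that j(1) by blast
qed

lemma missing_not_in_horn:
  "e \<le> Suc k \<Longrightarrow> face k e (oid (Suc k)) \<notin> simplices (horn (Suc k) e) k"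
  "oid k \<notin> simplices (horn k e) k"
proof -
  show "face k e (oid (Suc k)) \<notin> simplices (horn (Suc k) e) k" if e: "e \<le> Suc k"
  proof
    assume "face k e (oid (Suc k)) \<in> simplices (horn (Suc k) e) k"
    then obtain j where j: "j \<le> Suc k" "j \<noteq> e" "j \<notin> face k e (oid (Suc k)) ` {..k}" by (auto simp: horn_simplex_iff)
    let ?l = "if j < e then j else j - 1"
    have "face k e (oid (Suc k)) ?l = j" "?l \<le> k" using face_oid(2)[OF e, of ?l] j e by auto
    then show False using j(3) by force
  qed
  show "oid k \<notin> simplices (horn k e) k" by (auto simp: horn_simplex_iff oid_def)
qed

lemma partial_functor_low:
  assumes "partial_functor B del C p G" "\<And>q. q \<le> p \<Longrightarrow> cx_cells B' del q = cx_cells B del q"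
  shows "partial_functor B' del C p G"
  using assms unfolding partial_functor_def by (simp add: less_imp_le order.strict_trans2)

lemma cx_cells_low:
  assumes "\<And>l. l \<le> q \<Longrightarrow> B' l = B l"
  shows "cx_cells B' del q = cx_cells B del q"
proof -
  have "(\<forall>k \<alpha>. pos (B' k) (x k \<alpha>)) \<longleftrightarrow> (\<forall>k \<alpha>. pos (B k) (x k \<alpha>))" if "\<forall>k \<alpha>. q < k \<longrightarrow> x k \<alpha> = 0" for x :: oriental_cell
    using assms that by (metis linorder_not_le pos_0)
  then show ?thesis unfolding cx_cells_def by blast
qed

text \<open>Without basis elements above dimension \<open>n\<close> every higher cell is a unit, so
  its value is forced.\<close>

lemma (in steiner_complex) partial_functor_total:
  fixes C :: "'a omega_struct"
  assumes C: "omega_category C" and G: "partial_functor B del C n G" and top: "\<And>l. n < l \<Longrightarrow> B l = {}"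
  shows "\<exists>G'. (\<forall>p. partial_functor B del C p G') \<and> (\<forall>q\<le>n. G' q = G q)"
proof -
  interpret C: omega_category C by fact
  define G' where "G' q x = (if q \<le> n then G q x else idn C n q (G n x))" for q x
  have low: "x \<in> cl n" if "x \<in> cl q" for x q
    by (rule cl_lower[OF that]) (use clD(1)[OF that] top in \<open>fastforce simp: pos_iff intro: chain_eqI\<close>)
  have b: "oriental_bd k \<alpha> x = x" if "x \<in> cl q" "n \<le> k" for x q k \<alpha>
    by (rule obd_id[OF low[OF that(1)] that(2)])
  note D = partial_functorD[OF G] and Dn = partial_functorD[OF G order_refl]
  have cell: "G' q x \<in> cells C q" if "x \<in> cl q" for q x
    using D(1)[of q x] Dn(1)[OF low[OF that]] that by (auto simp: G'_def C.idn_cell)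
  have bd: "G' k (oriental_bd k \<alpha> x) = bd C q k \<alpha> (G' q x)" if x: "x \<in> cl q" and k: "k < q" for q k \<alpha> x
  proof (cases "q \<le> n")
    case True
    then show ?thesis using D(2)[OF True k x] k by (simp add: G'_def)
  next
    case False
    consider "k < n" | "k = n" | "n < k" by linarith
    then show ?thesis
      using False b[OF x] Dn(1)[OF low[OF x]] Dn(2)[OF _ low[OF x], of k \<alpha>] k
      by cases (auto simp: G'_def C.bd_idn_below C.bd_idn C.bd_idn_above)
  qed
  have idn: "G' q x = idn C r q (G' r x)" if x: "x \<in> cl r" and r: "r < q" for q r x
  proof -
    consider "q \<le> n" | "r < n" "n < q" | "r = n" "n < q" | "n < r" using r by linarith
    then show ?thesis
    proof cases
      case 1
      then show ?thesis using D(4)[OF 1 r x] r by (simp add: G'_def)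
    next
      case 2
      then show ?thesis
        using Dn(4)[OF 2(1) x] C.idn_idn[OF 2 D(1)[OF less_imp_le[OF 2(1)] x]] by (simp add: G'_def)
    next
      case 3
      then show ?thesis by (simp add: G'_def)
    next
      case 4
      then show ?thesis using C.idn_idn[OF 4 r Dn(1)[OF low[OF x]]] r by (simp add: G'_def)
    qed
  qed
  have cmp: "G' q (kc k x y) = cmp C q k (G' q x) (G' q y)"
    if x: "x \<in> cl q" and y: "y \<in> cl q" and c: "kcomp k x y" and k: "k < q" for q k x y
  proof -
    consider "q \<le> n" | "k < n" "n < q" | "n \<le> k" using k by linarith
    then show ?thesis
    proof cases
      case 1
      then show ?thesis using D(3)[OF 1 k x y c] by (simp add: G'_def)
    next
      case 2
      have "composable C n k (G n x) (G n y)"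
        using Dn(1)[OF low[OF x]] Dn(1)[OF low[OF y]] Dn(2)[OF 2(1) low[OF x], of Minus] Dn(2)[OF 2(1) low[OF y], of Plus] 2 c
        by (auto simp: composable_def kcomp_def)
      then show ?thesis using Dn(3)[OF 2(1) low[OF x] low[OF y] c] C.idn_cmp 2 by (simp add: G'_def)
    next
      case 3
      then have xy: "x = y" using c b[OF x 3] b[OF y 3] by (simp add: kcomp_def)
      have u: "kc k x x = x" using kc_unit_left[OF x, of k] b[OF x 3] by simp
      have xk: "x \<in> cl k" using cl_mono[OF low[OF x] 3] .
      have "cmp C q k (G' q x) (up C k q (bd C q k Minus (G' q x))) = G' q x"
        by (rule C.unit_right[OF k cell[OF x]])
      moreover have "up C k q (bd C q k Minus (G' q x)) = G' q x"
        using bd[OF x k, of Minus] b[OF x 3] idn[OF xk k] k by (simp add: up_def)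
      ultimately show ?thesis using xy u by simp
    qed
  qed
  have "partial_functor B del C p G'" for p
    unfolding partial_functor_def using cell bd idn cmp by blast
  moreover have "G' q = G q" if "q \<le> n" for q using that by (auto simp: G'_def)
  ultimately show ?thesis by blast
qed

text \<open>The second statement says that the values prescribed by \<open>f\<close> one dimension
  higher fit the functor built so far. It stands alone because the facets of the horn are later
  attached together with a value for the missing face.\<close>

lemma functor_on_horn:
  fixes C :: "'a omega_struct"
  assumes C: "omega_category C" and f: "f \<in> simplicial_maps (horn n i) (street_nerve C)"
  defines "B' \<equiv> basis n (simplices (horn n i))"
  shows "\<exists>G. partial_functor B' (bdry n) C q G \<and> (\<forall>q'\<le>q. \<forall>r \<in> B' q'. G q' (atom (bdry n) q' r) = f q' r q' (top_cell q'))"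
    and "partial_functor B' (bdry n) C q G \<Longrightarrow>
      (\<And>q' r. q' \<le> q \<Longrightarrow> r \<in> B' q' \<Longrightarrow> G q' (atom (bdry n) q' r) = f q' r q' (top_cell q')) \<Longrightarrow> r \<in> B' (Suc q) \<Longrightarrow>
      f (Suc q) r (Suc q) (top_cell (Suc q)) \<in> cells C (Suc q) \<and>
      bd C (Suc q) q \<alpha> (f (Suc q) r (Suc q) (top_cell (Suc q))) = G q (oriental_bd q \<alpha> (atom (bdry n) (Suc q) r))"
proof -
  let ?Y = "simplices (horn n i)"
  have Y: "closed_family n ?Y" by (rule closed_family_horn)
  interpret H: steiner_complex B' "bdry n" "simplex_key n" unfolding B'_def by (rule steiner_complex_basis[OF Y])
  note fm = simplicial_mapsD[OF f refl horn_act]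
  have tc: "top_cell q \<in> ocells q q" for q
  proof -
    interpret Q: steiner_complex "nd q" "bdry q" "simplex_key q" by (rule steiner_complex_nd)
    show ?thesis by (rule Q.at_cl[OF oid_nd])
  qed
  have cell: "f q r q (top_cell q) \<in> cells C q" if "r \<in> B' q" for q r
    using partial_functorD(1)[OF fm(2)[of r q q] order_refl tc] that by (auto simp: B'_def)
  have bd: "bd C (Suc q) q \<alpha> (f (Suc q) r (Suc q) (top_cell (Suc q))) = G q (oriental_bd q \<alpha> (atom (bdry n) (Suc q) r))"
    if G: "partial_functor B' (bdry n) C q G" "\<And>q' r. q' \<le> q \<Longrightarrow> r \<in> B' q' \<Longrightarrow> G q' (atom (bdry n) q' r) = f q' r q' (top_cell q')"
      and r: "r \<in> B' (Suc q)" for q G r \<alpha>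
  proof -
    have rY: "r \<in> ?Y (Suc q)" "r \<in> nd n (Suc q)" using r by (auto simp: B'_def)
    interpret Q: steiner_complex "nd (Suc q)" "bdry (Suc q)" "simplex_key (Suc q)" by (rule steiner_complex_nd)
    have "bd C (Suc q) q \<alpha> (f (Suc q) r (Suc q) (top_cell (Suc q))) = f (Suc q) r q (oriental_bd q \<alpha> (top_cell (Suc q)))"
      using partial_functorD(2)[OF fm(2)[OF rY(1), of "Suc q"] order_refl lessI tc] by simp
    also have "\<dots> = G q (push_cell n r (oriental_bd q \<alpha> (top_cell (Suc q))))"
      by (rule simplicial_map_determined[OF Y refl horn_act f G(1)[unfolded B'_def] _ order_refl rY(1) Q.obd_cl[OF tc]])
        (use G(2) in \<open>auto simp: B'_def\<close>)
    also have "\<dots> = G q (oriental_bd q \<alpha> (atom (bdry n) (Suc q) r))"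
      by (simp add: push_cell_obd push_atom[OF rY(2)])
    finally show ?thesis .
  qed
  show "\<exists>G. partial_functor B' (bdry n) C q G \<and> (\<forall>q'\<le>q. \<forall>r \<in> B' q'. G q' (atom (bdry n) q' r) = f q' r q' (top_cell q'))"
  proof (induction q)
    case 0
    obtain G where "partial_functor B' (bdry n) C 0 G" "\<And>a. a \<in> B' 0 \<Longrightarrow> G 0 (H.at 0 a) = f 0 a 0 (top_cell 0)"
      using H.base_partial_functor[of "\<lambda>a. f 0 a 0 (top_cell 0)" C] cell by blast
    then show ?case by auto
  next
    case (Suc q)
    then obtain G where G: "partial_functor B' (bdry n) C q G"
      "\<And>q' r. q' \<le> q \<Longrightarrow> r \<in> B' q' \<Longrightarrow> G q' (H.at q' r) = f q' r q' (top_cell q')" by blast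
    obtain G' where G': "partial_functor B' (bdry n) C (Suc q) G'" "\<And>q'. q' \<le> q \<Longrightarrow> G' q' = G q'"
      "\<And>a. a \<in> B' (Suc q) \<Longrightarrow> G' (Suc q) (H.at (Suc q) a) = f (Suc q) a (Suc q) (top_cell (Suc q))"
      by (rule extend_partial_functor[OF H.steiner_complex_axioms C G(1), of "\<lambda>a. f (Suc q) a (Suc q) (top_cell (Suc q))"])
        (use cell bd[OF G] in auto)
    then show ?case using G(2) by (intro exI[of _ G']) (auto simp: le_Suc_eq)
  qed
  show "partial_functor B' (bdry n) C q G \<Longrightarrow>
      (\<And>q' r. q' \<le> q \<Longrightarrow> r \<in> B' q' \<Longrightarrow> G q' (atom (bdry n) q' r) = f q' r q' (top_cell q')) \<Longrightarrow> r \<in> B' (Suc q) \<Longrightarrow>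
      f (Suc q) r (Suc q) (top_cell (Suc q)) \<in> cells C (Suc q) \<and>
      bd C (Suc q) q \<alpha> (f (Suc q) r (Suc q) (top_cell (Suc q))) = G q (oriental_bd q \<alpha> (atom (bdry n) (Suc q) r))"
    using cell bd by blast
qed

text \<open>For \<open>m = 1\<close>, the conditions \<open>0 < e\<close> and
  \<open>e \<le> p + 1\<close> say that the horn is inner, and \<open>0 < p\<close> says that its
  missing face has dimension at least 2.\<close>

lemma rlp_if_has_inverses:
  fixes C :: "'a omega_struct"
  assumes C: "omega_category C" and inv: "has_inverses C m"
    and e: "e \<le> Suc p" and m: "m = 0 \<or> m = Suc 0 \<and> 0 < e \<and> 0 < p"
  shows "has_rlp (street_nerve C) (horn (Suc (Suc p)) e) (std_simplex (Suc (Suc p)))"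
proof (rule has_rlp_hornI)
  let ?N = "Suc (Suc p)" and ?n = "Suc p"
  let ?Y = "simplices (horn ?N e)"
  fix f assume f: "f \<in> simplicial_maps (horn ?N e) (street_nerve C)"
  define B' where "B' = basis ?N ?Y"
  define \<gamma> where "\<gamma> q r = f q r q (top_cell q)" for q r
  define de where "de = face ?n e (oid ?N)"
  have Y: "closed_family ?N ?Y" by (rule closed_family_horn)
  interpret C: omega_category C by fact
  interpret N: steiner_complex "nd ?N" "bdry ?N" "simplex_key ?N" by (rule steiner_complex_nd)
  interpret H: steiner_complex B' "bdry ?N" "simplex_key ?N" unfolding B'_def by (rule steiner_complex_basis[OF Y])
  obtain G where G: "partial_functor B' (bdry ?N) C ?n G" "\<And>q r. q \<le> ?n \<Longrightarrow> r \<in> B' q \<Longrightarrow> G q (H.at q r) = \<gamma> q r"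
    using functor_on_horn(1)[OF C f, of ?n] unfolding B'_def \<gamma>_def by blast
  have mp: "m \<le> p" using m by auto
  have e': "e \<le> ?N" using e by simp
  have de: "de \<in> nd ?N ?n" unfolding de_def by (rule face_oid(1)[OF e'])
  have low: "B' l = nd ?N l" if "l \<le> p" for l
    using small_in_horn[of _ ?N l e] that by (auto simp: B'_def)
  have sub: "x \<in> H.cl q \<Longrightarrow> x \<in> ocells ?N q" for x q using cx_cells_sub[of B' "nd ?N"] by (auto simp: B'_def)
  have Gp: "partial_functor (nd ?N) (bdry ?N) C p G"
  proof (rule partial_functor_low[OF partial_functor_mono[OF G(1)]])
    show "ocells ?N q = H.cl q" if "q \<le> p" for q
      by (rule cx_cells_low, rule low[symmetric]) (use that in simp)
  qed simp
  interpret X: extension "nd ?N" "bdry ?N" "simplex_key ?N" C p G by unfold_locales fact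
  define z where "z \<beta> = oriental_bd ?n \<beta> (N.at ?N (oid ?N))" for \<beta>
  define \<alpha> where "\<alpha> = (if even e then Plus else Minus)"
  obtain h x0 w where s: "h \<in> H.cl ?n" "w \<in> H.cl ?n" "x0 \<in> N.whiskered ?n de ?n"
    "kcomp p h (kc p x0 w)" "kcomp p x0 w" "z \<alpha> = kc p h (kc p x0 w)" "z (opp \<alpha>) \<in> H.cl ?n"
    by (rule horn_boundary[OF e', folded \<alpha>_def z_def B'_def de_def]) (rule that)
  have Tc: "N.at ?N (oid ?N) \<in> ocells ?N ?N" by (rule N.at_cl[OF oid_nd])
  have zc: "z \<beta> \<in> ocells ?N ?n" for \<beta> unfolding z_def by (rule N.obd_cl[OF Tc])
  have zb: "oriental_bd p \<beta> (z \<delta>) = oriental_bd p \<beta> (z \<delta>')" for \<beta> \<delta> \<delta>' by (simp add: z_def)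
  note GD = partial_functorD[OF G(1) order_refl]
  have Gb: "bd C ?n p \<beta> (G ?n x) = G p (oriental_bd p \<beta> x)" if "x \<in> H.cl ?n" for x \<beta>
    using GD(2)[OF lessI that] by simp
  \<comment> \<open>The value of the side of the boundary that lies in the horn.\<close>
  define t where "t = G ?n (z (opp \<alpha>))"
  have tc: "t \<in> cells C ?n" "G ?n h \<in> cells C ?n" "G ?n w \<in> cells C ?n" unfolding t_def using GD(1) s by auto
  have tb: "bd C ?n p Plus t = bd C ?n p Plus (G ?n h)" "bd C ?n p Minus t = bd C ?n p Minus (G ?n w)"
    unfolding t_def Gb[OF s(7)] Gb[OF s(1)] Gb[OF s(2)] zb[of _ "opp \<alpha>" \<alpha>] s(6)
    using obd_kc(3,4)[OF s(4)] obd_kc(3)[OF s(5)] by auto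
  \<comment> \<open>The composite of \<open>G h\<close>, an unknown and \<open>G w\<close> has to be
    compared with \<open>t\<close>. These factors have codimension one, so they are divided off
    directly; the result \<open>om\<close> is a value for the whiskered missing face.\<close>
  obtain x1 where x1: "composable C ?n p (G ?n h) x1" "bd C ?n p Minus x1 = bd C ?n p Minus t"
    "arr C ?n (cmp C ?n p (G ?n h) x1) t"
    using C.divide_codim1[OF inv mp tc(2,1) tb(1)] by blast
  have x1': "x1 \<in> cells C ?n" "bd C ?n p Minus x1 = bd C ?n p Minus (G ?n w)" using x1 tb(2) by (auto simp: composable_def)
  obtain om where om: "composable C ?n p om (G ?n w)" "bd C ?n p Plus om = bd C ?n p Plus x1"
    "arr C ?n (cmp C ?n p om (G ?n w)) x1"
    using divide_codim1_right[OF C inv mp tc(3) x1'] by blast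
  have x0c: "x0 \<in> ocells ?N ?n" by (rule N.whiskered_cl[OF s(3)])
  have hx0: "kcomp p h x0" using s(4,5) by (simp add: kcomp_kc_right)
  have "bd C ?n p Plus om = G p (oriental_bd p Plus x0)" "bd C ?n p Minus om = G p (oriental_bd p Minus x0)"
    using om(1,2) x1(1) Gb[OF s(1), of Minus] Gb[OF s(2), of Plus] hx0 s(5) by (auto simp: composable_def kcomp_def)
  then have ok: "X.ok x0 om" using x0c om(1) unfolding X.ok_def composable_def by (metis sign.exhaust)
  \<comment> \<open>An inner face has the first and the last vertex of the whole simplex, and
    composition along a positive dimension does not move them.\<close>
  have ends: "x0 0 = N.at ?n de 0" if "0 < p" "0 < e"
  proof
    fix \<beta>
    have "x0 0 \<beta> = z \<alpha> 0 \<beta>" using s(5,6) hx0 that(1) by (simp add: kc_simps kcomp_iff)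
    also have "\<dots> = N.at ?N (oid ?N) 0 \<beta>" by (simp add: z_def oriental_bd_def)
    also have "\<dots> = N.at ?n de 0 \<beta>"
    proof -
      have d: "de 0 = oid ?N 0" "de ?n = oid ?N ?N"
        using face_oid(2)[OF e', of 0] face_oid(2)[OF e', of ?n] that(2) e by (auto simp: de_def oid_def)
      show ?thesis using atom_ends[OF oid_nd, of ?N] atom_ends[OF de] unfolding d by (cases \<beta>) simp_all
    qed
    finally show "x0 0 \<beta> = N.at ?n de 0 \<beta>" .
  qed
  have "m = 0 \<or> m = Suc 0 \<and> x0 0 = N.at ?n de 0" using m ends by auto
  \<comment> \<open>The atom of the missing face needs a value of its own, one that reproduces
    \<open>om\<close> up to a cell after whiskering.\<close>
  from X.lift_whiskered[OF inv this de order_refl s(3) ok] obtain x where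
    x: "X.ok (N.at ?n de) x" "\<And>G'. partial_functor (nd ?N) (bdry ?N) C ?n G' \<Longrightarrow> \<forall>q\<le>p. G' q = G q \<Longrightarrow>
      G' ?n (N.at ?n de) = x \<Longrightarrow> arr C ?n (G' ?n x0) om" by blast
  have facet: "r = de \<or> r \<in> B' ?n" if "r \<in> nd ?N ?n" for r
    using nd_facet[OF that] face_oid_in_horn[of _ ?n e] that unfolding B'_def de_def by (metis IntI)
  have deB: "de \<notin> B' ?n" unfolding de_def B'_def using missing_not_in_horn(1)[OF e'] by blast
  have Gq: "q \<le> p \<Longrightarrow> r \<in> B' q \<Longrightarrow> G q (H.at q r) = \<gamma> q r" for q r using G(2) by simp
  have g: "\<gamma> ?n r \<in> cells C ?n" "bd C ?n p \<beta> (\<gamma> ?n r) = G p (oriental_bd p \<beta> (N.at ?n r))" if "r \<in> B' ?n" for r \<beta>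
    using functor_on_horn(2)[OF C f partial_functor_mono[OF G(1), unfolded B'_def] _ that[unfolded B'_def], of \<beta>] Gq
    unfolding \<gamma>_def B'_def by auto
  define \<gamma>' where "\<gamma>' a = (if a = de then x else \<gamma> ?n a)" for a
  have \<gamma>': "\<gamma>' a \<in> cells C ?n" "bd C ?n p \<beta> (\<gamma>' a) = G p (oriental_bd p \<beta> (N.at ?n a))" if "a \<in> nd ?N ?n" for a \<beta>
    using facet[OF that] g(1)[of a] g(2)[of a \<beta>] x(1) deB by (auto simp: \<gamma>'_def X.ok_def)
  \<comment> \<open>All facets, including the missing one, are attached at once to the functor in
    dimension \<open>p\<close>; agreement with \<open>G\<close> on the horn follows by
    uniqueness.\<close>
  obtain G1 where G1: "partial_functor (nd ?N) (bdry ?N) C ?n G1" "\<And>q. q \<le> p \<Longrightarrow> G1 q = G q"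
    "\<And>a. a \<in> nd ?N ?n \<Longrightarrow> G1 ?n (N.at ?n a) = \<gamma>' a"
    by (rule extend_partial_functor[OF N.steiner_complex_axioms C Gp \<gamma>']) auto
  have G1G: "G1 q y = G q y" if "q \<le> ?n" "y \<in> H.cl q" for q y
  proof (rule H.partial_functor_unique[OF partial_functor_sub[OF G1(1)] G(1) _ that])
    show "B' k \<subseteq> nd ?N k" for k by (auto simp: B'_def)
    show "G1 q (H.at q a) = G q (H.at q a)" if "q \<le> ?n" "a \<in> B' q" for q a
    proof (cases "q \<le> p")
      case False
      then have "q = ?n" using that by simp
      then show ?thesis using G1(3)[of a] G(2)[of ?n a] that deB by (auto simp: B'_def \<gamma>'_def)
    qed (use G1(2) in simp)
  qed
  note G1D = partial_functorD[OF G1(1) order_refl]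
  have comp: "composable C ?n p (G1 ?n y) (G1 ?n y')"
    if "y \<in> ocells ?N ?n" "y' \<in> ocells ?N ?n" "kcomp p y y'" for y y'
    using that G1D(1) G1D(2)[OF lessI that(1), of Minus] G1D(2)[OF lessI that(2), of Plus]
    by (auto simp: composable_def kcomp_def)
  have x0w: "kc p x0 w \<in> ocells ?N ?n" by (rule N.kc_cl[OF x0c sub[OF s(2)] s(5)])
  have hw: "G1 ?n h = G ?n h" "G1 ?n w = G ?n w" "G1 ?n (z (opp \<alpha>)) = t" using G1G s by (auto simp: t_def)
  have e1: "G1 ?n (kc p x0 w) = cmp C ?n p (G1 ?n x0) (G ?n w)"
    using G1D(3)[OF lessI x0c sub[OF s(2)] s(5)] hw by simp
  have e2: "G1 ?n (z \<alpha>) = cmp C ?n p (G ?n h) (G1 ?n (kc p x0 w))"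
    using G1D(3)[OF lessI sub[OF s(1)] x0w s(4)] hw s(6) by simp
  \<comment> \<open>Whiskering this comparison by \<open>w\<close> and then by \<open>h\<close>
    compares the two sides of the boundary of the top simplex.\<close>
  have "arr C ?n (G1 ?n x0) om" by (rule x(2)[OF G1(1)]) (use G1(2,3) de in \<open>auto simp: \<gamma>'_def\<close>)
  then have "arr C ?n (G1 ?n (kc p x0 w)) (cmp C ?n p om (G ?n w))"
    unfolding e1 using comp[OF x0c sub[OF s(2)] s(5)] hw by (intro C.arr_cmp[OF C.arr_refl[OF tc(3)]]) auto
  then have "arr C ?n (G1 ?n (kc p x0 w)) x1" using om(3) C.arr_trans by blast
  then have "arr C ?n (G1 ?n (z \<alpha>)) (cmp C ?n p (G ?n h) x1)"
    unfolding e2 using comp[OF sub[OF s(1)] x0w s(4)] hw by (intro C.arr_cmp[OF _ C.arr_refl[OF tc(2)]]) auto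
  then have "arr C ?n (G1 ?n (z \<alpha>)) (G1 ?n (z (opp \<alpha>)))" using x1(3) C.arr_trans hw by metis
  \<comment> \<open>Whichever side contains the missing face, symmetry provides a cell from source
    to target.\<close>
  moreover from this have "arr C ?n (G1 ?n (z (opp \<alpha>))) (G1 ?n (z \<alpha>))" using C.arr_sym[OF inv _] mp by simp
  ultimately have "arr C ?n (G1 ?n (z Minus)) (G1 ?n (z Plus))" by (cases \<alpha>) auto
  then obtain y where y: "y \<in> cells C ?N" "bd C ?N ?n Minus y = G1 ?n (z Minus)" "bd C ?N ?n Plus y = G1 ?n (z Plus)"
    by (auto simp: arr_def)
  have yb: "bd C ?N ?n \<beta> y = G1 ?n (oriental_bd ?n \<beta> (N.at ?N (oid ?N)))" for \<beta>
    using y by (cases \<beta>) (auto simp: z_def)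
  \<comment> \<open>The identity is the only nondegenerate simplex in the top dimension, and
    \<open>y\<close> becomes its value.\<close>
  obtain G2 where G2: "partial_functor (nd ?N) (bdry ?N) C ?N G2" "\<And>q. q \<le> ?n \<Longrightarrow> G2 q = G1 q"
    by (rule extend_partial_functor[OF N.steiner_complex_axioms C G1(1), of "\<lambda>_. y"]) (use y(1) yb nd_top in auto)
  have top: "nd ?N l = {}" if "?N < l" for l by (rule nd_empty[OF that])
  from N.partial_functor_total[OF C G2(1) top] obtain G3 where
    G3: "\<And>q. partial_functor (nd ?N) (bdry ?N) C q G3" "\<And>q. q \<le> ?N \<Longrightarrow> G3 q = G2 q" by blast
  have "G3 q (N.at q r) = f q r q (top_cell q)" if r: "r \<in> basis ?N ?Y q" for q r
  proof -
    have rB: "r \<in> B' q" "r \<in> nd ?N q" using r by (auto simp: B'_def)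
    have "q \<noteq> ?N" using r missing_not_in_horn(2)[of ?N e] nd_top by auto
    moreover have "q \<le> ?N" using rB(2) top by (cases "q \<le> ?N") auto
    ultimately have q: "q \<le> ?n" by simp
    have "G3 q (N.at q r) = G1 q (N.at q r)" using G3(2)[of q] G2(2)[OF q] q by simp
    also have "\<dots> = \<gamma> q r" using G1G[OF q H.at_cl[OF rB(1)]] G(2)[OF q rB(1)] by simp
    finally show ?thesis by (simp add: \<gamma>_def)
  qed
  then show "\<exists>G. (\<forall>q. partial_functor (nd ?N) (bdry ?N) C q G) \<and>
      (\<forall>q. \<forall>r \<in> basis ?N ?Y q. G q (N.at q r) = f q r q (top_cell q))"
    using G3(1) by blast
qed

theorem mainTheorem1:
  fixes C :: "'a omega_struct"
  assumes "omega_category C"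
  shows
    "((\<forall>n i. 0 < n \<and> i \<le> n \<longrightarrow> has_rlp (street_nerve C) (horn (n + 1) i) (std_simplex (n + 1)))
       \<longleftrightarrow> (\<forall>m c. 1 \<le> m \<and> c \<in> cells C m \<longrightarrow> weakly_invertible C m c)) \<and>
     ((\<forall>n i. 1 < n \<and> 0 < i \<and> i < n \<longrightarrow> has_rlp (street_nerve C) (horn (n + 1) i) (std_simplex (n + 1)))
       \<longleftrightarrow> (\<forall>m c. 1 < m \<and> c \<in> cells C m \<longrightarrow> weakly_invertible C m c))"
proof -
  have 1: "(\<forall>n i. 0 < n \<and> i \<le> n \<longrightarrow> has_rlp (street_nerve C) (horn (n + 1) i) (std_simplex (n + 1))) \<longleftrightarrow> has_inverses C 0"
  proof
    assume rlp: "\<forall>n i. 0 < n \<and> i \<le> n \<longrightarrow> has_rlp (street_nerve C) (horn (n + 1) i) (std_simplex (n + 1))"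
    \<comment> \<open>The horn of index \<open>e\<close> in dimension \<open>n + 1 = e + 2\<close>,
      matching the labelling by an \<open>(e+1)\<close>-cell.\<close>
    have "has_rlp (street_nerve C) (horn (Suc (Suc e)) e) (std_simplex (Suc (Suc e)))" for e
      using rlp[rule_format, of "Suc e" e] by simp
    then show "has_inverses C 0" by (rule has_inverses_if_rlp[OF assms])
  next
    assume inv: "has_inverses C 0"
    show "\<forall>n i. 0 < n \<and> i \<le> n \<longrightarrow> has_rlp (street_nerve C) (horn (n + 1) i) (std_simplex (n + 1))"
    proof (intro allI impI)
      fix n i :: nat assume ni: "0 < n \<and> i \<le> n"
      then obtain p where "n = Suc p" by (cases n) auto
      then show "has_rlp (street_nerve C) (horn (n + 1) i) (std_simplex (n + 1))"
        using rlp_if_has_inverses[OF assms inv, of i p] ni by simp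
    qed
  qed
  have 2: "(\<forall>n i. 1 < n \<and> 0 < i \<and> i < n \<longrightarrow> has_rlp (street_nerve C) (horn (n + 1) i) (std_simplex (n + 1))) \<longleftrightarrow> has_inverses C (Suc 0)"
  proof
    assume rlp: "\<forall>n i. 1 < n \<and> 0 < i \<and> i < n \<longrightarrow> has_rlp (street_nerve C) (horn (n + 1) i) (std_simplex (n + 1))"
    \<comment> \<open>The bound \<open>1 \<le> e\<close> is what places this horn in the range
      \<open>1 < n\<close>, \<open>0 < i < n\<close>.\<close>
    have "has_rlp (street_nerve C) (horn (Suc (Suc e)) e) (std_simplex (Suc (Suc e)))" if "Suc 0 \<le> e" for e
      using rlp[rule_format, of "Suc e" e] that by simp
    then show "has_inverses C (Suc 0)" by (rule has_inverses_if_rlp[OF assms])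
  next
    assume inv: "has_inverses C (Suc 0)"
    show "\<forall>n i. 1 < n \<and> 0 < i \<and> i < n \<longrightarrow> has_rlp (street_nerve C) (horn (n + 1) i) (std_simplex (n + 1))"
    proof (intro allI impI)
      fix n i :: nat assume ni: "1 < n \<and> 0 < i \<and> i < n"
      then obtain p where "n = Suc p" by (cases n) auto
      then show "has_rlp (street_nerve C) (horn (n + 1) i) (std_simplex (n + 1))"
        using rlp_if_has_inverses[OF assms inv, of i p] ni by simp
    qed
  qed
  show ?thesis
    using 1 2 weakly_invertible_iff[OF assms, of 0] weakly_invertible_iff[OF assms, of "Suc 0"]
    by (simp add: Suc_le_eq)
qed

end
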